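(* Let $q$ be a prime power, let $F$ be an algebraic function field (in one variable) with full constant field $\mathbb{F}_q$, let $\mathcal{S}$ be a non-empty proper subset of the set $\mathbb{P}_F$ of places of $F$, and let $H=\bigcap_{P\in\mathcal{S}}\mathcal{O}_P$ be the associated holomorphy ring. Fix an integer $d>1$. Let $\mathcal{E}^+\subseteq H^{d+1}$ be the set of Eisenstein polynomials of degree $d$ with coefficients in $H$, where a polynomial $h_dx^d+\dots+h_0$ is identified with $(h_0,\dots,h_d)\in H^{d+1}$. Then the density $\mathbb{D}(\mathcal{E}^+)$ exists and \[\mathbb{D}(\mathcal{E}^+)=1-\prod_{Q\in \mathcal{S}}\left(1-\frac{(q^{\deg(Q)}-1)^2}{q^{(d+2)\deg(Q)}}\right).\]
   Context: A polynomial $f=\sum_{i=0}^n a_ix^i\in R[x]$ over an integral domain $R$ is Eisenstein if there is a prime ideal $\mathfrak p$ of $R$ with $a_i\in\mathfrak p$ for all $0\le i\le n-1$, $a_0\notin\mathfrak p^2$ and $a_n\notin\mathfrak p$. The nonzero prime ideals of $H$ are exactly $P\cap H$ for $P\in\mathcal{S}$. For a divisor $D$ of $F$, $\mathcal{L}(D)$ is its Riemann–Roch space and $\ell(D)=\dim_{\mathbb{F}_q}\mathcal{L}(D)$. Let $\mathcal{D}$ be the set of positive (effective) divisors of $F$ whose support is disjoint from $\mathcal{S}$; it is a directed set under $D\le D'$ iff $D'-D\ge 0$, and $H=\bigcup_{D\in\mathcal{D}}\mathcal{L}(D)$. For $A\subseteq H^m$ the upper and lower densities are $\overline{\mathbb{D}}(A)=\limsup_{D\in\mathcal{D}}|A\cap\mathcal{L}(D)^m|/q^{m\ell(D)}$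 and $\underline{\mathbb{D}}(A)=\liminf_{D\in\mathcal{D}}|A\cap\mathcal{L}(D)^m|/q^{m\ell(D)}$, with limits in the sense of Moore–Smith convergence over the directed set $\mathcal{D}$; the density $\mathbb{D}(A)$ exists if these coincide, and is then their common value. *)

theory Defs
  imports
    "HOL-Algebra.Finite_Extensions"
    "HOL-Algebra.Generated_Fields"
    "HOL-Algebra.Ideal_Product"
    "HOL-Algebra.QuotRing"
    "HOL-Algebra.UnivPoly"
    "HOL-Library.Extended_Real"
    "HOL-Number_Theory.Prime_Powers"
begin

section \<open>Algebraic function fields in one variable\<close>

definition function_field :: "('a, 'm) ring_scheme \<Rightarrow> 'a set \<Rightarrow> bool"
  where "function_field F K \<longleftrightarrow>
    field F \<and> subfield K F \<and>
    (\<exists>x\<in>carrier F. ring.transcendental F K x \<and>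
       ring.finite_dimension F (generate_field F (insert x K)) (carrier F))"

definition full_constant_field :: "('a, 'm) ring_scheme \<Rightarrow> 'a set \<Rightarrow> bool"
  where "full_constant_field F K \<longleftrightarrow>
    (\<forall>z\<in>carrier F. ring.algebraic F K z \<longrightarrow> z \<in> K)"


section \<open>Places\<close>

definition valuation_ring :: "('a, 'm) ring_scheme \<Rightarrow> 'a set \<Rightarrow> 'a set \<Rightarrow> bool"
  where "valuation_ring F K V \<longleftrightarrow>
    subring V F \<and> K \<subset> V \<and> V \<subset> carrier F \<and>
    (\<forall>z\<in>carrier F - {\<zero>\<^bsub>F\<^esub>}. z \<in> V \<or> inv\<^bsub>F\<^esub> z \<in> V)"

text \<open>A place is the maximal ideal of some valuation ring; it determines that ring.\<close>

definition places :: "('a, 'm) ring_scheme \<Rightarrow> 'a set \<Rightarrow> 'a set set"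
  where "places F K =
    {P. \<exists>V. valuation_ring F K V \<and> maximalideal P (F\<lparr>carrier := V\<rparr>)}"

definition place_ring :: "('a, 'm) ring_scheme \<Rightarrow> 'a set \<Rightarrow> 'a set \<Rightarrow> 'a set"
  where "place_ring F K P =
    (THE V. valuation_ring F K V \<and> maximalideal P (F\<lparr>carrier := V\<rparr>))"

text \<open>The residue field is a vector space over the image of \<open>K\<close> under the residue map,
  which is injective on \<open>K\<close>.\<close>

definition place_degree :: "('a, 'm) ring_scheme \<Rightarrow> 'a set \<Rightarrow> 'a set \<Rightarrow> nat"
  where "place_degree F K P =
    (let V = F\<lparr>carrier := place_ring F K P\<rparr>
     in ring.dim (V Quot P) ((\<lambda>c. P +>\<^bsub>V\<^esub> c) ` K) (carrier (V Quot P)))"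

text \<open>The discrete valuation attached to \<open>P\<close>: \<open>z = u t\<^sup>n\<close> with a unit \<open>u\<close> of the valuation ring
  and a generator \<open>t\<close> of \<open>P\<close>. Only meaningful for \<open>z \<noteq> 0\<close>.\<close>

definition place_val :: "('a, 'm) ring_scheme \<Rightarrow> 'a set \<Rightarrow> 'a set \<Rightarrow> 'a \<Rightarrow> int"
  where "place_val F K P z =
    (let V = F\<lparr>carrier := place_ring F K P\<rparr>
     in THE n. \<exists>t\<in>carrier V. \<exists>u\<in>Units V.
          P = PIdl\<^bsub>V\<^esub> t \<and> z = u \<otimes>\<^bsub>F\<^esub> (t [^]\<^bsub>F\<^esub> n))"


section \<open>Divisors and Riemann--Roch spaces\<close>

text \<open>Divisors are integer-valued functions with finite support contained in the set of places;
  they vanish on all sets that are not places, so the order on functions is the order on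
  divisors.\<close>

definition divisors :: "('a, 'm) ring_scheme \<Rightarrow> 'a set \<Rightarrow> ('a set \<Rightarrow> int) set"
  where "divisors F K = {D. finite {P. D P \<noteq> 0} \<and> {P. D P \<noteq> 0} \<subseteq> places F K}"

definition RR_space :: "('a, 'm) ring_scheme \<Rightarrow> 'a set \<Rightarrow> ('a set \<Rightarrow> int) \<Rightarrow> 'a set"
  where "RR_space F K D =
    {z \<in> carrier F. z \<noteq> \<zero>\<^bsub>F\<^esub> \<longrightarrow> (\<forall>P\<in>places F K. place_val F K P z + D P \<ge> 0)}"

definition RR_dim :: "('a, 'm) ring_scheme \<Rightarrow> 'a set \<Rightarrow> ('a set \<Rightarrow> int) \<Rightarrow> nat"
  where "RR_dim F K D = ring.dim F K (RR_space F K D)"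


section \<open>Holomorphy rings and density\<close>

definition holomorphy_ring :: "('a, 'm) ring_scheme \<Rightarrow> 'a set \<Rightarrow> 'a set set \<Rightarrow> 'a set"
  where "holomorphy_ring F K S = (\<Inter>P\<in>S. place_ring F K P)"

definition eff_divisors ::
    "('a, 'm) ring_scheme \<Rightarrow> 'a set \<Rightarrow> 'a set set \<Rightarrow> ('a set \<Rightarrow> int) set"
  where "eff_divisors F K S =
    {D \<in> divisors F K. (\<forall>P. D P \<ge> 0) \<and> {P. D P \<noteq> 0} \<inter> S = {}}"

text \<open>The filter of tails of a set directed by \<open>\<le>\<close>; \<^const>\<open>Limsup\<close> and \<^const>\<open>Liminf\<close> along it
  are the Moore--Smith upper and lower limits.\<close>

definition tails :: "'d::order set \<Rightarrow> 'd filter"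
  where "tails A = (INF d\<in>A. principal {d'\<in>A. d \<le> d'})"

text \<open>Elements of \<open>X\<^sup>m\<close> are functions on \<open>{..<m}\<close>, extended by \<^const>\<open>undefined\<close>.\<close>

definition density_quotient ::
    "('a, 'm) ring_scheme \<Rightarrow> 'a set \<Rightarrow> nat \<Rightarrow> (nat \<Rightarrow> 'a) set \<Rightarrow> ('a set \<Rightarrow> int) \<Rightarrow> real"
  where "density_quotient F K m A D =
    real (card (A \<inter> ({..<m} \<rightarrow>\<^sub>E RR_space F K D))) / real (card K) ^ (m * RR_dim F K D)"

definition upper_density ::
    "('a, 'm) ring_scheme \<Rightarrow> 'a set \<Rightarrow> 'a set set \<Rightarrow> nat \<Rightarrow> (nat \<Rightarrow> 'a) set \<Rightarrow> ereal"
  where "upper_density F K S m A =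
    Limsup (tails (eff_divisors F K S)) (\<lambda>D. ereal (density_quotient F K m A D))"

definition lower_density ::
    "('a, 'm) ring_scheme \<Rightarrow> 'a set \<Rightarrow> 'a set set \<Rightarrow> nat \<Rightarrow> (nat \<Rightarrow> 'a) set \<Rightarrow> ereal"
  where "lower_density F K S m A =
    Liminf (tails (eff_divisors F K S)) (\<lambda>D. ereal (density_quotient F K m A D))"

definition has_density ::
    "('a, 'm) ring_scheme \<Rightarrow> 'a set \<Rightarrow> 'a set set \<Rightarrow> nat \<Rightarrow> (nat \<Rightarrow> 'a) set \<Rightarrow> real \<Rightarrow> bool"
  where "has_density F K S m A x \<longleftrightarrow>
    upper_density F K S m A = ereal x \<and> lower_density F K S m A = ereal x"


section \<open>Eisenstein polynomials\<close>

definition eisenstein :: "('a, 'm) ring_scheme \<Rightarrow> (nat \<Rightarrow> 'a) \<Rightarrow> bool"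
  where "eisenstein R f \<longleftrightarrow>
    (\<exists>p. primeideal p R \<and>
       (\<forall>i<deg R f. coeff (UP R) f i \<in> p) \<and>
       coeff (UP R) f 0 \<notin> p \<cdot>\<^bsub>R\<^esub> p \<and>
       coeff (UP R) f (deg R f) \<notin> p)"

text \<open>A polynomial of degree \<open>d\<close> is identified with its coefficient tuple \<open>(h\<^sub>0, \<dots>, h\<^sub>d)\<close>.\<close>

definition eisenstein_tuples :: "('a, 'm) ring_scheme \<Rightarrow> nat \<Rightarrow> (nat \<Rightarrow> 'a) set"
  where "eisenstein_tuples R d =
    (\<lambda>f. restrict (coeff (UP R) f) {..<d + 1}) `
      {f \<in> carrier (UP R). deg R f = d \<and> eisenstein R f}"


section \<open>Unordered infinite products\<close>

text \<open>The multiplicative counterpart of \<open>has_sum\<close>: the limit of the finite partial products.\<close>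

definition has_infprod :: "('b \<Rightarrow> real) \<Rightarrow> 'b set \<Rightarrow> real \<Rightarrow> bool"
  where "has_infprod f A x \<longleftrightarrow> (prod f \<longlongrightarrow> x) (finite_subsets_at_top A)"

end

theory Submission
  imports Defs
begin

text \<open>
  The function field theory needed (finiteness of residue fields, finitely many zeros, the
  fundamental inequality, Riemann's inequality) is obtained by counting. Fix a transcendental x and
  the K-span W of a basis of F over K(x); the sums W + xW + ... + x^(l-1) W have exactly |W|^l
  elements. If Z is a set of elements of a ring R containing z that are pairwise incongruent modulo
  zR, the |Z|^l sums of a_i z^i with a_i in Z are distinct and, after clearing denominators, lie in
  such a space of size |W|^(cl + const); letting l grow, |Z| is at most |W|^c. This bounds residue
  degrees and zero divisors. Conversely the same spaces lie in Riemann-Roch spaces of multiples of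
  the pole divisor of x, which forces them to be as large as Riemann's inequality claims.

  Riemann's inequality makes l(D) - deg D eventually constant, hence L(D) surjects onto any finite
  product of local quotients once D is large at one place P0 outside S (strong approximation). So
  the Eisenstein conditions at finitely many places of S are independent, each with its local
  density. The families that are Eisenstein at some remaining place Q have proportion at most
  q^(const) times the sum of q^(-d deg Q), uniformly in D; since d > 1 and there are O(q^n) places
  of degree n, this is the tail of a convergent series, and a squeeze gives the density.
\<close>

section \<open>Transversals and counting sums of powers\<close>

text \<open>Since \<open>K\<close> is finite, dimensions are recorded as cardinalities: the degree
  of a place, degrees of zero divisors and \<open>ell D\<close> all occur as exponents of
  \<open>card K\<close> in indices of additive subgroups. Most linear algebra over K(x) thereby
  becomes the pigeonhole principle. The local factor is a count modulo Q^2. With t = q^deg(Q) there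
  are t^2 classes, of which t - 1 lie in Q but not in Q^2 (for h_0), t lie in Q (for the d - 1
  middle coefficients) and t^2 - t lie outside Q (for h_d). The proportion is (t - 1) t^(d-1) (t^2 -
  t) / t^(2(d+1)) = (t - 1)^2 / t^(d+2). The obstacle is the union over infinitely many places:
  strong approximation says nothing about a place Q whose degree is large compared with deg D. There
  the estimate rests on h_0 being nonzero. A nonzero element of L(D - Q) forces ell(D - Q) <= deg D
  - deg Q + 1, which by Riemann's inequality is at most ell D - deg Q plus a constant independent of
  D and Q.\<close>

lemma nat_power_bound:
  fixes a b C :: nat
  assumes "\<And>l. a ^ l \<le> C * b ^ l"
  shows "a \<le> b"
proof (rule ccontr)
  assume "\<not> a \<le> b"
  then have ab: "b < a" by simp
  show False
  proof (cases "b = 0")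
    case True
    then show False using assms[of 1] ab by simp
  next
    case False
    define r where "r = real a / real b"
    have "r > 1" unfolding r_def using ab False by simp
    then obtain n where n: "real C < r ^ n" using real_arch_pow by blast
    have "real a ^ n \<le> real C * real b ^ n"
      using assms[of n] by (metis of_nat_le_iff of_nat_mult of_nat_power)
    then have "r ^ n \<le> real C" unfolding r_def using False by (simp add: power_divide divide_le_eq)
    with n show False by simp
  qed
qed

lemma nat_linear_bound:
  fixes a b c :: int
  assumes "\<And>k::nat. int k * a \<le> int k * b + c"
  shows "a \<le> b"
proof (rule ccontr)
  assume "\<not> a \<le> b"
  then have "1 \<le> a - b" by simp
  define k where "k = Suc (nat \<bar>c\<bar>)"
  have "int k * 1 \<le> int k * (a - b)" using \<open>1 \<le> a - b\<close> by (intro mult_left_mono) auto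
  moreover have "int k * a \<le> int k * b + c" by (rule assms)
  ultimately have "int k \<le> c" by (simp add: algebra_simps)
  then show False unfolding k_def by simp
qed

section \<open>Indices of additive subgroups by systems of representatives\<close>

context ring
begin

text \<open>Representatives are used instead of cosets because \<open>A\<close> and \<open>B\<close>
  range over bare subsets of one ring: sums, multiples and Horner expansions of representatives then
  stay in that ring.\<close>

definition transversal :: "'a set \<Rightarrow> 'a set \<Rightarrow> 'a set \<Rightarrow> bool"
  where "transversal A B Xs \<longleftrightarrow> Xs \<subseteq> A \<and> (\<forall>a\<in>A. \<exists>!x. x \<in> Xs \<and> a \<ominus> x \<in> B)"

text \<open>\<open>has_idx A B n\<close> says that the index \<open>[A : B]\<close> is finite and equal to \<open>n\<close>.\<close>

definition has_idx :: "'a set \<Rightarrow> 'a set \<Rightarrow> nat \<Rightarrow> bool"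
  where "has_idx A B n \<longleftrightarrow> (\<exists>Xs. finite Xs \<and> card Xs = n \<and> transversal A B Xs)"

definition incongruent :: "'a set \<Rightarrow> 'a set \<Rightarrow> bool"
  where "incongruent Z B \<longleftrightarrow> (\<forall>a\<in>Z. \<forall>b\<in>Z. a \<noteq> b \<longrightarrow> a \<ominus> b \<notin> B)"

definition addsub :: "'a set \<Rightarrow> bool"
  where "addsub B \<longleftrightarrow> B \<subseteq> carrier R \<and> \<zero> \<in> B \<and> (\<forall>a\<in>B. \<forall>b\<in>B. a \<ominus> b \<in> B)"

lemma addsubD:
  assumes "addsub B"
  shows "B \<subseteq> carrier R" "\<zero> \<in> B" "\<And>a b. a \<in> B \<Longrightarrow> b \<in> B \<Longrightarrow> a \<ominus> b \<in> B"
    "\<And>a. a \<in> B \<Longrightarrow> \<ominus> a \<in> B" "\<And>a b. a \<in> B \<Longrightarrow> b \<in> B \<Longrightarrow> a \<oplus> b \<in> B"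
proof -
  show 1: "B \<subseteq> carrier R" "\<zero> \<in> B" and 2: "\<And>a b. a \<in> B \<Longrightarrow> b \<in> B \<Longrightarrow> a \<ominus> b \<in> B"
    using assms by (auto simp: addsub_def)
  show 3: "\<ominus> a \<in> B" if "a \<in> B" for a
    using 2[OF 1(2) that] 1 that by (auto simp: minus_eq)
  show "a \<oplus> b \<in> B" if "a \<in> B" "b \<in> B" for a b
    using 2[OF that(1) 3[OF that(2)]] 1 that
    by (metis minus_eq minus_minus subsetD)
qed

lemma addsubI:
  assumes "B \<subseteq> carrier R" "\<zero> \<in> B" "\<And>a b. a \<in> B \<Longrightarrow> b \<in> B \<Longrightarrow> a \<oplus> b \<in> B"
    "\<And>a. a \<in> B \<Longrightarrow> \<ominus> a \<in> B"
  shows "addsub B"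
  using assms by (auto simp: addsub_def minus_eq)

lemma addsub_subgroup: "addsub B \<longleftrightarrow> subgroup B (add_monoid R)"
proof
  assume "addsub B"
  note D = addsubD[OF this]
  show "subgroup B (add_monoid R)"
    by (rule add.subgroupI) (use D in \<open>auto simp: a_inv_def[symmetric]\<close>)
next
  assume "subgroup B (add_monoid R)"
  then interpret additive_subgroup B R by (rule additive_subgroup.intro)
  show "addsub B" by (rule addsubI) (use a_subset in auto)
qed

lemma diff_swap:
  assumes "addsub B" "a \<in> carrier R" "b \<in> carrier R" "a \<ominus> b \<in> B"
  shows "b \<ominus> a \<in> B"
proof -
  have "b \<ominus> a = \<ominus> (a \<ominus> b)" using assms(2,3) by algebra
  with addsubD(4)[OF assms(1,4)] show ?thesis by simp
qed

lemma diff_trans: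
  assumes "addsub B" "a \<in> carrier R" "b \<in> carrier R" "c \<in> carrier R" "a \<ominus> b \<in> B" "b \<ominus> c \<in> B"
  shows "a \<ominus> c \<in> B"
proof -
  have "a \<ominus> c = (a \<ominus> b) \<oplus> (b \<ominus> c)" using assms(2-4) by algebra
  with addsubD(5)[OF assms(1,5,6)] show ?thesis by simp
qed

lemma transversalD:
  assumes "transversal A B Xs"
  shows "Xs \<subseteq> A" "\<And>a. a \<in> A \<Longrightarrow> \<exists>x\<in>Xs. a \<ominus> x \<in> B"
    "\<And>a x y. a \<in> A \<Longrightarrow> x \<in> Xs \<Longrightarrow> y \<in> Xs \<Longrightarrow> a \<ominus> x \<in> B \<Longrightarrow> a \<ominus> y \<in> B \<Longrightarrow> x = y"
  using assms unfolding transversal_def by blast+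

lemma transversalI:
  assumes "addsub B" "A \<subseteq> carrier R" "Xs \<subseteq> A" "\<And>a. a \<in> A \<Longrightarrow> \<exists>x\<in>Xs. a \<ominus> x \<in> B" "incongruent Xs B"
  shows "transversal A B Xs"
  unfolding transversal_def
proof (intro conjI ballI)
  fix a assume a: "a \<in> A"
  obtain x where x: "x \<in> Xs" "a \<ominus> x \<in> B" using assms(4)[OF a] by blast
  have "y = x" if "y \<in> Xs" "a \<ominus> y \<in> B" for y
  proof (rule ccontr)
    assume "y \<noteq> x"
    have "x \<ominus> y \<in> B"
      using diff_trans[OF assms(1), of x a y] diff_swap[OF assms(1), of a x] a x that assms(2,3) by blast
    with \<open>y \<noteq> x\<close> that(1) x(1) assms(5) show False by (auto simp: incongruent_def)
  qed
  with x show "\<exists>!x. x \<in> Xs \<and> a \<ominus> x \<in> B" by blast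
qed (use assms in auto)

lemma transversal_incongruent:
  assumes "transversal A B Xs" "addsub B" "A \<subseteq> carrier R"
  shows "incongruent Xs B"
  unfolding incongruent_def
proof (intro ballI impI notI)
  fix a b assume ab: "a \<in> Xs" "b \<in> Xs" "a \<noteq> b" "a \<ominus> b \<in> B"
  have "a \<in> A" "a \<in> carrier R" using ab transversalD(1)[OF assms(1)] assms(3) by auto
  moreover have "a \<ominus> a \<in> B" using \<open>a \<in> carrier R\<close> addsubD(2)[OF assms(2)] by (simp add: r_neg minus_eq)
  ultimately show False using transversalD(3)[OF assms(1), of a a b] ab by blast
qed

lemma transversal_exists:
  assumes "addsub B" "A \<subseteq> carrier R"
  shows "\<exists>Xs. transversal A B Xs"
proof -
  \<comment> \<open>The choice depends only on the class of \<open>a\<close>: for congruent elements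
    the predicates under \<open>SOME\<close> coincide, so \<open>c\<close> picks one representative
    per class.\<close>
  define c where "c a = (SOME b. b \<in> A \<and> a \<ominus> b \<in> B)" for a
  have c: "c a \<in> A" "a \<ominus> c a \<in> B" if "a \<in> A" for a
  proof -
    have "a \<in> A \<and> a \<ominus> a \<in> B" using that assms addsubD(2)[OF assms(1)] by (auto simp: r_neg minus_eq)
    then have "c a \<in> A \<and> a \<ominus> c a \<in> B" unfolding c_def by (rule someI)
    then show "c a \<in> A" "a \<ominus> c a \<in> B" by auto
  qed
  have eq: "c a = c b" if "a \<in> A" "b \<in> A" "a \<ominus> b \<in> B" for a b
  proof -
    have "(x \<in> A \<and> a \<ominus> x \<in> B) = (x \<in> A \<and> b \<ominus> x \<in> B)" for x
      using diff_trans[OF assms(1), of a b x] diff_trans[OF assms(1), of b a x] diff_swap[OF assms(1), of a b]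
        that assms(2) by blast
    then show ?thesis unfolding c_def by presburger
  qed
  have "transversal A B (c ` A)"
  proof (rule transversalI[OF assms])
    show "incongruent (c ` A) B"
      unfolding incongruent_def
    proof clarify
      fix a b assume ab: "a \<in> A" "b \<in> A" "c a \<noteq> c b" "c a \<ominus> c b \<in> B"
      have "c (c a) = c (c b)" using eq c ab by simp
      moreover have "c (c a) = c a" "c (c b) = c b" using eq c ab by metis+
      ultimately show False using ab by simp
    qed
  qed (use c in blast)+
  then show ?thesis by blast
qed

lemma incongruent_card_le:
  assumes "has_idx A B n" "addsub B" "A \<subseteq> carrier R" "Z \<subseteq> A" "incongruent Z B"
  shows "finite Z \<and> card Z \<le> n"
proof -
  obtain Xs where Xs: "finite Xs" "card Xs = n" "transversal A B Xs" using assms(1) has_idx_def by auto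
  note T = transversalD[OF Xs(3)]
  define f where "f a = (SOME x. x \<in> Xs \<and> a \<ominus> x \<in> B)" for a
  have f: "f a \<in> Xs \<and> a \<ominus> f a \<in> B" if "a \<in> A" for a
    unfolding f_def by (rule someI_ex) (use T(2)[OF that] in blast)
  have "inj_on f Z"
  proof (rule inj_onI, rule ccontr)
    fix a b assume ab: "a \<in> Z" "b \<in> Z" "f a = f b" "a \<noteq> b"
    have c: "a \<in> carrier R" "b \<in> carrier R" "f a \<in> carrier R" using ab f assms(3,4) T(1) by blast+
    have "a \<ominus> f a \<in> B" "b \<ominus> f a \<in> B" using f[of a] f[of b] ab assms(4) by auto
    then have "a \<ominus> b \<in> B"
      using diff_trans[OF assms(2) c(1,3,2)] diff_swap[OF assms(2) c(2,3)] by blast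
    then show False using assms(5) ab by (auto simp: incongruent_def)
  qed
  moreover have "f ` Z \<subseteq> Xs" using f assms(4) by auto
  ultimately have "finite Z" "card Z \<le> card Xs"
    using Xs(1) by (rule inj_on_finite, rule card_inj_on_le)
  then show ?thesis using Xs(2) by simp
qed

lemma has_idx_unique:
  assumes "has_idx A B n" "has_idx A B m" "addsub B" "A \<subseteq> carrier R"
  shows "n = m"
proof (rule antisym)
  show "n \<le> m"
    using assms(1) incongruent_card_le[OF assms(2,3,4)] transversal_incongruent[OF _ assms(3,4)] transversalD(1)
    unfolding has_idx_def by metis
  show "m \<le> n"
    using assms(2) incongruent_card_le[OF assms(1,3,4)] transversal_incongruent[OF _ assms(3,4)] transversalD(1)
    unfolding has_idx_def by metis
qed

text \<open>Converts every pigeonhole bound below into the existence of a finite index.\<close>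

lemma has_idx_bounded:
  assumes "addsub B" "A \<subseteq> carrier R"
    "\<And>Z. finite Z \<Longrightarrow> Z \<subseteq> A \<Longrightarrow> incongruent Z B \<Longrightarrow> card Z \<le> n"
  shows "\<exists>m\<le>n. has_idx A B m"
proof -
  obtain Xs where Xs: "transversal A B Xs" using transversal_exists[OF assms(1,2)] by blast
  have inc: "incongruent Xs B" and XA: "Xs \<subseteq> A"
    using transversal_incongruent[OF Xs assms(1,2)] transversalD(1)[OF Xs] .
  have fin: "finite Xs"
  proof (rule ccontr)
    assume "infinite Xs"
    then obtain Z where Z: "Z \<subseteq> Xs" "finite Z" "card Z = Suc n"
      using infinite_arbitrarily_large by blast
    have "incongruent Z B" using inc Z(1) unfolding incongruent_def by blast
    then show False using assms(3)[OF Z(2)] Z XA by auto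
  qed
  with Xs inc XA assms(3)[OF fin XA inc] show ?thesis unfolding has_idx_def by blast
qed

lemma has_idx_tower:
  assumes "has_idx A B n" "has_idx B C m" "addsub A" "addsub B" "addsub C" "B \<subseteq> A" "C \<subseteq> B"
  shows "has_idx A C (n * m)"
proof -
  obtain Xs where Xs: "finite Xs" "card Xs = n" "transversal A B Xs" using assms(1) has_idx_def by auto
  obtain Y where Y: "finite Y" "card Y = m" "transversal B C Y" using assms(2) has_idx_def by auto
  note A = addsubD[OF assms(3)] and B = addsubD[OF assms(4)] and C = addsubD[OF assms(5)]
  have XA: "Xs \<subseteq> A" and YB: "Y \<subseteq> B" using transversalD(1) Xs Y by auto
  note iX = transversal_incongruent[OF Xs(3) assms(4) A(1)]
  note iY = transversal_incongruent[OF Y(3) assms(5) B(1)]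
  let ?f = "\<lambda>(x, y). x \<oplus> y"
  have key: "x = x' \<and> y = y'" if "x \<in> Xs" "x' \<in> Xs" "y \<in> Y" "y' \<in> Y" "(x \<oplus> y) \<ominus> (x' \<oplus> y') \<in> C" for x x' y y'
  proof -
    have car: "x \<in> carrier R" "x' \<in> carrier R" "y \<in> carrier R" "y' \<in> carrier R"
      using that XA YB A(1) B(1) by auto
    have "x \<ominus> x' = ((x \<oplus> y) \<ominus> (x' \<oplus> y')) \<oplus> (y' \<ominus> y)" using car by algebra
    moreover have "y' \<ominus> y \<in> B" using that YB B(3) by auto
    ultimately have "x \<ominus> x' \<in> B" using that(5) assms(7) B(5) by auto
    then have x: "x = x'" using iX that by (auto simp: incongruent_def)
    have "y \<ominus> y' = (x \<oplus> y) \<ominus> (x \<oplus> y')" using car by algebra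
    then have "y \<ominus> y' \<in> C" using that(5) x by simp
    then show ?thesis using iY that x by (auto simp: incongruent_def)
  qed
  have inj: "inj_on ?f (Xs \<times> Y)"
  proof (rule inj_onI, clarify)
    fix x y x' y' assume *: "x \<in> Xs" "y \<in> Y" "x' \<in> Xs" "y' \<in> Y" "x \<oplus> y = x' \<oplus> y'"
    have "x' \<oplus> y' \<in> carrier R" using * XA YB A(1) B(1) by (meson a_closed subsetD)
    then have "(x \<oplus> y) \<ominus> (x' \<oplus> y') \<in> C" using *(5) C(2) by (simp add: r_neg minus_eq)
    then show "x = x' \<and> y = y'" using key * by blast
  qed
  have "transversal A C (?f ` (Xs \<times> Y))"
  proof (rule transversalI[OF assms(5) A(1)])
    show "?f ` (Xs \<times> Y) \<subseteq> A" using XA YB A(5) assms(6) by (auto simp: subset_iff)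
    show "\<exists>x\<in>?f ` (Xs \<times> Y). a \<ominus> x \<in> C" if a: "a \<in> A" for a
    proof -
      obtain x where x: "x \<in> Xs" "a \<ominus> x \<in> B" using transversalD(2)[OF Xs(3) a] by blast
      obtain y where y: "y \<in> Y" "(a \<ominus> x) \<ominus> y \<in> C" using transversalD(2)[OF Y(3) x(2)] by blast
      have car: "a \<in> carrier R" "x \<in> carrier R" "y \<in> carrier R" using a x y XA YB A(1) B(1) by auto
      have "a \<ominus> (x \<oplus> y) = (a \<ominus> x) \<ominus> y" using car by algebra
      then show ?thesis using x y by force
    qed
    show "incongruent (?f ` (Xs \<times> Y)) C"
      unfolding incongruent_def
    proof (intro ballI impI notI)
      fix u v assume uv: "u \<in> ?f ` (Xs \<times> Y)" "v \<in> ?f ` (Xs \<times> Y)" "u \<noteq> v" "u \<ominus> v \<in> C"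
      obtain x y where u: "x \<in> Xs" "y \<in> Y" "u = x \<oplus> y" using uv(1) by auto
      obtain x' y' where v: "x' \<in> Xs" "y' \<in> Y" "v = x' \<oplus> y'" using uv(2) by auto
      show False using key[OF u(1) v(1) u(2) v(2)] uv(3,4) u(3) v(3) by simp
    qed
  qed
  moreover have "card (?f ` (Xs \<times> Y)) = n * m"
    by (simp add: card_image[OF inj] card_cartesian_product Xs(2) Y(2))
  moreover have "finite (?f ` (Xs \<times> Y))" using Xs(1) Y(1) by (intro finite_imageI finite_cartesian_product)
  ultimately show ?thesis by (auto simp only: has_idx_def)
qed

text \<open>Lagrange's theorem, from the tower law for
  \<open>{\<zero>} \<subseteq> B \<subseteq> A\<close>: an index over the zero subgroup is a
  cardinality.\<close>

lemma has_idx_card: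
  assumes "has_idx A B n" "addsub A" "addsub B" "B \<subseteq> A" "finite B"
  shows "finite A \<and> card A = n * card B"
proof -
  have z: "addsub {\<zero>}" by (auto simp: addsub_def minus_eq)
  have "incongruent B {\<zero>}"
    using addsubD(1)[OF assms(3)] r_right_minus_eq unfolding incongruent_def by blast
  moreover have "\<exists>x\<in>B. a \<ominus> x \<in> {\<zero>}" if "a \<in> B" for a
    using that addsubD(1)[OF assms(3)] by (intro bexI[of _ a]) (auto simp: minus_eq r_neg)
  ultimately have "transversal B {\<zero>} B"
    by (intro transversalI[OF z addsubD(1)[OF assms(3)]]) auto
  then have "has_idx B {\<zero>} (card B)" using assms(5) has_idx_def by blast
  from has_idx_tower[OF assms(1) this assms(2,3) z assms(4)] 
  obtain Xs where Xs: "finite Xs" "card Xs = n * card B" "transversal A {\<zero>} Xs"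
    using addsubD(2)[OF assms(3)] has_idx_def by auto
  have "A \<subseteq> Xs"
  proof
    fix a assume a: "a \<in> A"
    obtain x where x: "x \<in> Xs" "a \<ominus> x = \<zero>" using transversalD(2)[OF Xs(3) a] by auto
    have "a \<in> carrier R" "x \<in> carrier R" using a x transversalD(1)[OF Xs(3)] addsubD(1)[OF assms(2)] by auto
    then show "a \<in> Xs" using x by (simp add: r_right_minus_eq)
  qed
  then have "A = Xs" using transversalD(1)[OF Xs(3)] by auto
  then show ?thesis using Xs by auto
qed

text \<open>A normal form function. It turns congruence modulo \<open>B\<close> into equality of
  values, so that tuples of residue classes can be handled as tuples of representatives.\<close>

lemma transversal_rep:
  assumes "transversal A B C" "addsub B" "A \<subseteq> carrier R"
  shows "\<exists>r. (\<forall>a\<in>A. r a \<in> C \<and> a \<ominus> r a \<in> B) \<and> (\<forall>a\<in>A. \<forall>c\<in>A. r a = r c \<longleftrightarrow> a \<ominus> c \<in> B) \<and> (\<forall>c\<in>C. r c = c)"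
proof -
  note T = transversalD[OF assms(1)]
  have ex: "\<forall>a\<in>A. \<exists>c. c \<in> C \<and> a \<ominus> c \<in> B" using T(2) by blast
  obtain r where r: "\<forall>a\<in>A. r a \<in> C \<and> a \<ominus> r a \<in> B" using bchoice[OF ex] by blast
  have eq: "r a = r c \<longleftrightarrow> a \<ominus> c \<in> B" if ac: "a \<in> A" "c \<in> A" for a c
  proof -
    have ra: "r a \<in> C" "a \<ominus> r a \<in> B" and rc: "r c \<in> C" "c \<ominus> r c \<in> B" using r ac by blast+
    have R: "a \<in> carrier R" "c \<in> carrier R" "r a \<in> carrier R" "r c \<in> carrier R"
      using ac ra rc T(1) assms(3) by blast+
    show ?thesis
    proof
      assume "r a = r c"
      then show "a \<ominus> c \<in> B" using diff_trans[OF assms(2) R(1,4,2)] ra(2) diff_swap[OF assms(2) R(2,4) rc(2)] by simp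
    next
      assume "a \<ominus> c \<in> B"
      from diff_trans[OF assms(2) R(1,2,4) this rc(2)] show "r a = r c" using T(3)[OF ac(1) ra(1) rc(1) ra(2)] by simp
    qed
  qed
  have "r c = c" if c: "c \<in> C" for c
  proof -
    have cA: "c \<in> A" "c \<in> carrier R" using c T(1) assms(3) by blast+
    have "c \<ominus> c \<in> B" using addsubD(2)[OF assms(2)] cA by (simp add: minus_eq r_neg)
    then show ?thesis using T(3)[OF cA(1) _ c] r cA(1) by blast
  qed
  then show ?thesis using r eq by blast
qed

text \<open>\<open>horner A y n\<close> is the set of all \<open>\<Sum>i<n. a\<^sub>i y\<^sup>i\<close> with \<open>a\<^sub>i \<in> A\<close>.\<close>

primrec horner :: "'a set \<Rightarrow> 'a \<Rightarrow> nat \<Rightarrow> 'a set"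
  where "horner A y 0 = {\<zero>}"
  | "horner A y (Suc n) = (\<lambda>(a, s). a \<oplus> y \<otimes> s) ` (A \<times> horner A y n)"

lemma horner_closed: "A \<subseteq> carrier R \<Longrightarrow> y \<in> carrier R \<Longrightarrow> horner A y n \<subseteq> carrier R"
  by (induction n) auto

lemma horner_finite: "finite A \<Longrightarrow> finite (horner A y n)"
  by (induction n) auto

lemma horner_add:
  assumes "A \<subseteq> carrier R" "y \<in> carrier R" "\<And>a b. a \<in> A \<Longrightarrow> b \<in> A \<Longrightarrow> a \<oplus> b \<in> A"
    "s \<in> horner A y n" "t \<in> horner A y n"
  shows "s \<oplus> t \<in> horner A y n"
  using assms(4,5)
proof (induction n arbitrary: s t)
  case (Suc n)
  obtain a s' where s: "a \<in> A" "s' \<in> horner A y n" "s = a \<oplus> y \<otimes> s'" using Suc.prems by auto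
  obtain b t' where t: "b \<in> A" "t' \<in> horner A y n" "t = b \<oplus> y \<otimes> t'" using Suc.prems by auto
  have c: "a \<in> carrier R" "b \<in> carrier R" "s' \<in> carrier R" "t' \<in> carrier R"
    using s t horner_closed[OF assms(1,2)] assms(1) by blast+
  have "s \<oplus> t = (a \<oplus> b) \<oplus> y \<otimes> (s' \<oplus> t')" unfolding s t using c assms(2) by (simp add: r_distr a_ac)
  then show ?case using Suc.IH[OF s(2) t(2)] assms(3)[OF s(1) t(1)] by force
qed simp

lemma horner_Suc_mono:
  assumes "A \<subseteq> carrier R" "y \<in> carrier R" "\<zero> \<in> A"
  shows "horner A y n \<subseteq> horner A y (Suc n)"
proof (induction n)
  case 0
  have "\<zero> = \<zero> \<oplus> y \<otimes> \<zero>" using assms by simp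
  then show ?case using assms(3) by force
next
  case (Suc n)
  then show ?case by (force intro: image_eqI)
qed

lemma horner_mono:
  assumes "A \<subseteq> carrier R" "y \<in> carrier R" "\<zero> \<in> A" "m \<le> n"
  shows "horner A y m \<subseteq> horner A y n"
  using assms(4) horner_Suc_mono[OF assms(1-3)] by (rule lift_Suc_mono_le[rotated]) 

lemma horner_shift:
  assumes "A \<subseteq> carrier R" "y \<in> carrier R" "\<zero> \<in> A" "s \<in> horner A y n"
  shows "y \<otimes> s \<in> horner A y (Suc n)"
proof -
  have "y \<otimes> s = \<zero> \<oplus> y \<otimes> s" using assms horner_closed[OF assms(1,2)] by (simp add: subset_iff)
  then show ?thesis using assms(3,4) by (auto intro!: image_eqI)
qed

lemma horner_base:
  assumes "A \<subseteq> carrier R" "y \<in> carrier R" "\<zero> \<in> A" "a \<in> A"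
  shows "a \<in> horner A y (Suc n)"
proof -
  have "a \<in> horner A y 1" using assms by (auto intro!: image_eqI[of _ _ "(a, \<zero>)"])
  then show ?thesis using horner_mono[OF assms(1-3), of 1 "Suc n"] by auto
qed

lemma subfield_card_ge2:
  assumes "subfield K R" "finite K"
  shows "2 \<le> card K"
proof -
  have "\<one> \<noteq> \<zero>" using subfieldE(6)[OF assms(1)] by simp
  then have "card {\<zero>, \<one>} = 2" by simp
  moreover have "{\<zero>, \<one>} \<subseteq> K" using subringE[OF subfieldE(1)[OF assms(1)]] by auto
  ultimately show ?thesis using card_mono[OF assms(2)] by metis
qed

lemma horner_smult:
  assumes "A \<subseteq> carrier R" "y \<in> carrier R" "c \<in> carrier R" "\<And>u. u \<in> carrier R \<Longrightarrow> c \<otimes> (y \<otimes> u) = y \<otimes> (c \<otimes> u)"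
    "\<And>a. a \<in> A \<Longrightarrow> c \<otimes> a \<in> A" "s \<in> horner A y n"
  shows "c \<otimes> s \<in> horner A y n"
  using assms(6)
proof (induction n arbitrary: s)
  case 0
  then show ?case using assms(3) by simp
next
  case (Suc n)
  obtain a s' where s: "a \<in> A" "s' \<in> horner A y n" "s = a \<oplus> y \<otimes> s'" using Suc.prems by auto
  have c: "a \<in> carrier R" "s' \<in> carrier R" using s assms(1) horner_closed[OF assms(1,2)] by auto
  have "c \<otimes> s = c \<otimes> a \<oplus> y \<otimes> (c \<otimes> s')" unfolding s using c assms(2,3,4) by (simp add: r_distr)
  then show ?case using assms(5)[OF s(1)] Suc.IH[OF s(2)] by (auto intro!: image_eqI)
qed

section \<open>Finite vector spaces over a finite field\<close>

lemma dimension_card: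
  assumes "subfield K R" "finite K" "dimension n K E"
  shows "finite E \<and> card E = card K ^ n"
  using assms(3)
proof (induction n arbitrary: E)
  case 0
  show ?case using dimension_zero[OF assms(1) 0] by simp
next
  case (Suc n)
  obtain v E' where E: "v \<in> carrier R" "dimension n K E'" "v \<notin> E'" "E = line_extension K v E'"
    using dimension_backwards[OF assms(1) Suc.prems] by blast
  note IH = Suc.IH[OF E(2)] and sp = space_subgroup_props[OF assms(1) E(2)]
  note sr = subringE[OF subfieldE(1)[OF assms(1)]]
  have img: "E = (\<lambda>(k, e). k \<otimes> v \<oplus> e) ` (K \<times> E')"
    unfolding E(4) by (auto simp: line_extension_mem_iff) blast
  have "inj_on (\<lambda>(k, e). k \<otimes> v \<oplus> e) (K \<times> E')"
  proof (rule inj_onI, clarify)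
    fix k e k' e' assume *: "k \<in> K" "e \<in> E'" "k' \<in> K" "e' \<in> E'" "k \<otimes> v \<oplus> e = k' \<otimes> v \<oplus> e'"
    have c: "k \<in> carrier R" "k' \<in> carrier R" "e \<in> carrier R" "e' \<in> carrier R" using * sr(1) sp(1) by auto
    have "(k \<ominus> k') \<otimes> v = (k \<otimes> v \<oplus> e) \<ominus> e \<ominus> k' \<otimes> v" using c E(1) by algebra
    also have "\<dots> = e' \<ominus> e" unfolding *(5) using c E(1) by algebra
    finally have "(k \<ominus> k') \<otimes> v \<in> E'" using sp(3,4) * by (simp add: minus_eq)
    then have "k \<ominus> k' = \<zero>"
      using sp(6)[of "k \<ominus> k'" v] E(1,3) sr(5,7) * by (auto simp: minus_eq)
    then have k: "k = k'" using c by simp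
    then show "k = k' \<and> e = e'" using *(5) c E(1) by simp
  qed
  then have "card E = card K * card E'" unfolding img by (simp add: card_image card_cartesian_product)
  then show ?case using IH assms(2) unfolding img by auto
qed

text \<open>Independent vectors are adjoined inside \<open>E\<close> until it is exhausted. The
  process stops, because a subspace of dimension \<open>card E\<close> would have at least 2^(card
  E) elements, more than \<open>E\<close> has.\<close>

lemma finite_subspace_dim:
  assumes "subfield K R" "finite K" "addsub E" "finite E" "\<And>k v. k \<in> K \<Longrightarrow> v \<in> E \<Longrightarrow> k \<otimes> v \<in> E"
  shows "dimension (dim K E) K E" "card E = card K ^ dim K E"
proof -
  note E = addsubD[OF assms(3)]
  have step: "(\<exists>m. dimension m K E) \<or> (\<exists>E'\<subseteq>E. dimension n K E')" for n
  proof (induction n)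
    case 0
    show ?case using E(2) by (intro disjI2 exI[of _ "{\<zero>}"]) auto
  next
    case (Suc n)
    then show ?case
    proof (elim disjE exE conjE)
      fix E' assume E': "E' \<subseteq> E" "dimension n K E'"
      show ?thesis
      proof (cases "E' = E")
        case False
        then obtain v where v: "v \<in> E" "v \<notin> E'" using E' by auto
        have "dimension (Suc n) K (line_extension K v E')" using Suc_dim v E' E(1) by auto
        moreover have "line_extension K v E' \<subseteq> E"
          using v E' assms(5) E(5) by (auto simp: line_extension_mem_iff subset_iff)
        ultimately show ?thesis by blast
      qed (use E' in auto)
    qed auto
  qed
  have "\<exists>m. dimension m K E"
  proof (rule ccontr)
    assume "\<not> ?thesis"
    then obtain E' where E': "E' \<subseteq> E" "dimension (card E) K E'" using step[of "card E"] by auto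
    have "card K ^ card E \<le> card E"
      using dimension_card[OF assms(1,2) E'(2)] card_mono[OF assms(4) E'(1)] by simp
    moreover have "card E < 2 ^ card E" by simp
    moreover have "(2::nat) ^ card E \<le> card K ^ card E"
      using subfield_card_ge2[OF assms(1,2)] by (rule power_mono) simp
    ultimately show False by linarith
  qed
  then have "finite_dimension K E" by (simp add: finite_dimension_def)
  from finite_dimensionE[OF assms(1) this] show d: "dimension (dim K E) K E" by (simp add: over_def)
  show "card E = card K ^ dim K E" using dimension_card[OF assms(1,2) d] by simp
qed

end

context cring
begin

lemma horner_addsub:
  assumes "addsub A" "y \<in> carrier R"
  shows "addsub (horner A y n)"
proof (rule addsubI)
  note A = addsubD[OF assms(1)]
  show "horner A y n \<subseteq> carrier R" by (rule horner_closed[OF A(1) assms(2)])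
  show "\<zero> \<in> horner A y n" using horner_mono[OF A(1) assms(2) A(2), of 0 n] by auto
  show "a \<oplus> b \<in> horner A y n" if "a \<in> horner A y n" "b \<in> horner A y n" for a b
    using horner_add[OF A(1) assms(2) A(5)] that by blast
  show "\<ominus> a \<in> horner A y n" if "a \<in> horner A y n" for a
  proof -
    have "(\<ominus> \<one>) \<otimes> a \<in> horner A y n"
    proof (rule horner_smult[OF A(1) assms(2) _ _ _ that])
      show "\<ominus> \<one> \<otimes> b \<in> A" if "b \<in> A" for b
        using A(4)[OF that] A(1) that by (auto simp: l_minus subset_iff)
    qed (use assms(2) in \<open>auto simp: l_minus r_minus\<close>)
    then show ?thesis using that horner_closed[OF A(1) assms(2)] by (auto simp: l_minus subset_iff)
  qed
qed

lemma horner_mult: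
  assumes "addsub C" "addsub A" "y \<in> carrier R" "\<And>c a. c \<in> C \<Longrightarrow> a \<in> A \<Longrightarrow> c \<otimes> a \<in> A"
    "e \<in> horner C y s" "m \<in> horner A y l"
  shows "e \<otimes> m \<in> horner A y (l + s)"
  using assms(5)
proof (induction s arbitrary: e)
  case 0
  then show ?case using addsubD(2)[OF horner_addsub[OF assms(2,3)]] assms(6)
    addsubD(1)[OF horner_addsub[OF assms(2,3)]] by (auto simp: subset_iff)
next
  case (Suc s)
  note A = addsubD[OF assms(2)] and C = addsubD[OF assms(1)]
  note H = addsubD[OF horner_addsub[OF assms(2,3)]]
  obtain k e' where e: "k \<in> C" "e' \<in> horner C y s" "e = k \<oplus> y \<otimes> e'" using Suc.prems by auto
  have c: "k \<in> carrier R" "e' \<in> carrier R" "m \<in> carrier R"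
    using e C(1) horner_closed[OF C(1) assms(3)] H(1) assms(6) by blast+
  have "e \<otimes> m = k \<otimes> m \<oplus> y \<otimes> (e' \<otimes> m)" unfolding e using c assms(3) by (simp add: l_distr m_assoc)
  moreover have "k \<otimes> m \<in> horner A y l"
    by (rule horner_smult[OF A(1) assms(3) c(1) _ _ assms(6)]) (use assms(3,4) e(1) c in \<open>auto simp: m_lcomm\<close>)
  then have "k \<otimes> m \<in> horner A y (l + Suc s)"
    using horner_mono[OF A(1) assms(3) A(2), of l "l + Suc s"] by auto
  moreover have "y \<otimes> (e' \<otimes> m) \<in> horner A y (l + Suc s)"
    using horner_shift[OF A(1) assms(3) A(2) Suc.IH[OF e(2)]] by simp
  ultimately show ?case using H(5) by metis
qed

lemma mult_addsub:
  assumes "addsub B" "z \<in> carrier R"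
  shows "addsub ((\<otimes>) z ` B)"
proof (rule addsubI)
  note B = addsubD[OF assms(1)]
  show "(\<otimes>) z ` B \<subseteq> carrier R" using assms B(1) by auto
  show "\<zero> \<in> (\<otimes>) z ` B" using B(2) assms(2) by (auto intro!: image_eqI[of _ _ \<zero>])
  show "\<ominus> a \<in> (\<otimes>) z ` B" if a: "a \<in> (\<otimes>) z ` B" for a
  proof -
    obtain b where b: "b \<in> B" "a = z \<otimes> b" using a by auto
    have "\<ominus> a = z \<otimes> (\<ominus> b)" using b assms B(1) by (simp add: r_minus subset_iff)
    then show ?thesis using B(4)[OF b(1)] by simp
  qed
  show "a \<oplus> a' \<in> (\<otimes>) z ` B" if a: "a \<in> (\<otimes>) z ` B" "a' \<in> (\<otimes>) z ` B" for a a'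
  proof -
    obtain b b' where b: "b \<in> B" "a = z \<otimes> b" "b' \<in> B" "a' = z \<otimes> b'" using a by auto
    have "a \<oplus> a' = z \<otimes> (b \<oplus> b')" using b assms B(1) by (simp add: r_distr subset_iff)
    then show ?thesis using B(5)[OF b(1,3)] by simp
  qed
qed

text \<open>The recursion of \<open>horner\<close> splits off the constant term. This lemma and the
  next give access to the coefficient of the highest power, which the descent in
  \<open>valuation_ring_exists\<close> eliminates.\<close>

lemma horner_top_intro:
  assumes "addsub A" "y \<in> carrier R" "c \<in> A" "t \<in> horner A y n"
  shows "c \<otimes> y [^] n \<oplus> t \<in> horner A y (Suc n)"
  using assms(4)
proof (induction n arbitrary: t)
  case 0
  then show ?case using assms addsubD[OF assms(1)] by (auto simp: subset_iff intro!: image_eqI[of _ _ "(c, \<zero>)"])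
next
  case (Suc n)
  note A = addsubD[OF assms(1)]
  obtain a t' where t: "a \<in> A" "t' \<in> horner A y n" "t = a \<oplus> y \<otimes> t'" using Suc.prems by auto
  have c: "a \<in> carrier R" "t' \<in> carrier R" "c \<in> carrier R" "y [^] n \<in> carrier R"
    using t A(1) assms(2,3) horner_closed[OF A(1) assms(2), of n] by auto
  have "c \<otimes> y [^] Suc n \<oplus> t = a \<oplus> y \<otimes> (c \<otimes> y [^] n \<oplus> t')"
    unfolding t(3) nat_pow_Suc using c assms(2) by algebra
  moreover have "(a, c \<otimes> y [^] n \<oplus> t') \<in> A \<times> horner A y (Suc n)" using t(1) Suc.IH[OF t(2)] by blast
  ultimately show ?case by (subst horner.simps(2)) (force intro: rev_image_eqI)
qed

lemma horner_top_elim: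
  assumes "addsub A" "y \<in> carrier R" "s \<in> horner A y (Suc n)"
  shows "\<exists>c\<in>A. \<exists>t\<in>horner A y n. s = c \<otimes> y [^] n \<oplus> t"
  using assms(3)
proof (induction n arbitrary: s)
  case 0
  then show ?case using assms addsubD[OF assms(1)] by (auto simp: subset_iff)
next
  case (Suc n)
  note A = addsubD[OF assms(1)]
  obtain a s' where s: "a \<in> A" "s' \<in> horner A y (Suc n)" "s = a \<oplus> y \<otimes> s'"
    using Suc.prems by (auto simp only: horner.simps(2)[of A y "Suc n"])
  obtain c t where ct: "c \<in> A" "t \<in> horner A y n" "s' = c \<otimes> y [^] n \<oplus> t" using Suc.IH[OF s(2)] by blast
  have c: "a \<in> carrier R" "t \<in> carrier R" "c \<in> carrier R" "y [^] n \<in> carrier R"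
    using s ct A(1) assms(2,3) horner_closed[OF A(1) assms(2), of n] by auto
  have "s = c \<otimes> y [^] Suc n \<oplus> (a \<oplus> y \<otimes> t)"
    unfolding s(3) ct(3) nat_pow_Suc using c assms(2) by algebra
  moreover have "a \<oplus> y \<otimes> t \<in> horner A y (Suc n)" using s(1) ct(2) by auto
  ultimately show ?case using ct(1) by blast
qed

end

section \<open>Function fields\<close>

context field
begin

text \<open>Digits are recovered one at a time: the last hypothesis identifies the lowest digit, and
  cancelling \<open>y\<close> leaves a shorter expansion. It is applied to residues modulo zR and to
  the space \<open>W\<close> in powers of x.\<close>

lemma horner_card_eq:
  assumes "finite A" "A \<subseteq> carrier R" "y \<in> carrier R" "y \<noteq> \<zero>"
    "\<And>l a a' s s'. a \<in> A \<Longrightarrow> a' \<in> A \<Longrightarrow> s \<in> horner A y l \<Longrightarrow> s' \<in> horner A y l \<Longrightarrow> a \<ominus> a' = y \<otimes> (s' \<ominus> s) \<Longrightarrow> a = a'"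
  shows "card (horner A y l) = card A ^ l"
proof (induction l)
  case (Suc l)
  have "inj_on (\<lambda>(a, s). a \<oplus> y \<otimes> s) (A \<times> horner A y l)"
  proof (rule inj_onI, clarify)
    fix a s a' s' assume *: "a \<in> A" "s \<in> horner A y l" "a' \<in> A" "s' \<in> horner A y l" "a \<oplus> y \<otimes> s = a' \<oplus> y \<otimes> s'"
    have c: "a \<in> carrier R" "a' \<in> carrier R" "s \<in> carrier R" "s' \<in> carrier R"
      using * assms(2) horner_closed[OF assms(2,3)] by auto
    have "a \<ominus> a' = (a \<oplus> y \<otimes> s) \<ominus> y \<otimes> s \<ominus> a'" using c assms(3) by algebra
    also have "\<dots> = y \<otimes> (s' \<ominus> s)" unfolding *(5) using c assms(3) by algebra
    finally have a: "a = a'" using assms(5) * by blast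
    then have "y \<otimes> s = y \<otimes> s'" using *(5) c assms(3) by simp
    then show "a = a' \<and> s = s'" using a c assms(3,4) m_lcancel by simp
  qed
  then have "card (horner A y (Suc l)) = card (A \<times> horner A y l)"
    unfolding horner.simps by (rule card_image)
  then show ?case using Suc by (simp add: card_cartesian_product)
qed simp

lemma horner_eval:
  assumes "K \<subseteq> carrier R" "y \<in> carrier R" "p \<in> horner K y n"
  shows "\<exists>qs. set qs \<subseteq> K \<and> eval qs y = p"
  using assms(3)
proof (induction n arbitrary: p)
  case 0
  then show ?case by (intro exI[of _ "[]"]) auto
next
  case (Suc n)
  obtain a s where p: "a \<in> K" "s \<in> horner K y n" "p = a \<oplus> y \<otimes> s" using Suc.prems by auto
  obtain qs where qs: "set qs \<subseteq> K" "eval qs y = s" using Suc.IH[OF p(2)] by auto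
  have c: "a \<in> carrier R" "s \<in> carrier R" using p assms(1) horner_closed[OF assms(1,2)] by auto
  have "eval (qs @ [a]) y = s \<otimes> y \<oplus> a" using eval_append_aux[of qs a y] qs assms c by auto
  then show ?case using qs p c assms(2) by (intro exI[of _ "qs @ [a]"]) (auto simp: m_comm a_comm)
qed

text \<open>The equation makes \<open>y\<close> a root of the polynomial X p(X) - k. Only the zero
  polynomial vanishes at a transcendental element, so the constant term is zero.\<close>

lemma transcendental_horner:
  assumes "subring K R" "y \<in> carrier R" "transcendental K y" "k \<in> K" "p \<in> horner K y n" "k = y \<otimes> p"
  shows "k = \<zero>"
proof -
  have KR: "K \<subseteq> carrier R" using subringE(1)[OF assms(1)] .
  obtain qs where qs: "set qs \<subseteq> K" "eval qs y = p" using horner_eval[OF KR assms(2,5)] by auto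
  have c: "k \<in> carrier R" "p \<in> carrier R" using assms KR horner_closed[OF KR assms(2)] by auto
  let ?l = "qs @ [\<ominus> k]"
  have lK: "set ?l \<subseteq> K" using qs(1) subringE(5)[OF assms(1)] assms(4) by auto
  have "eval ?l y = p \<otimes> y \<oplus> \<ominus> k" using eval_append_aux[of qs "\<ominus> k" y] qs assms(2) KR c by auto
  also have "\<dots> = \<zero>" using assms(2,6) c by (simp add: m_comm r_neg)
  finally have "eval (normalize ?l) y = \<zero>" using eval_normalize[of ?l y] lK KR assms(2) by auto
  moreover have "normalize ?l \<in> carrier (K[X])"
    using normalize_gives_polynomial[OF lK] univ_poly_carrier by blast
  ultimately have "normalize ?l = []" using eval_transcendental[of K y] assms(3) by (simp add: over_def)
  \<comment> \<open>\<open>normalize\<close> only strips leading zeros, so an empty result means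
    that all coefficients are zero.\<close>
  then have "?l = replicate (length ?l) \<zero>" using normalize_def'(1)[of ?l] by auto
  then have "set ?l \<subseteq> {\<zero>}" by (metis set_replicate_conv_if empty_subsetI subset_refl)
  then have "\<ominus> k = \<zero>" by simp
  then show ?thesis using c by (metis minus_minus minus_zero)
qed

lemma generate_field_fraction:
  assumes "subring P R" "H \<subseteq> P" "h \<in> generate_field R H"
  shows "\<exists>a\<in>P. \<exists>b\<in>P. b \<noteq> \<zero> \<and> h \<otimes> b = a"
proof -
  note P = subringE[OF assms(1)]
  have HR: "H \<subseteq> carrier R" using assms(2) P(1) by auto
  show ?thesis
    using assms(3)
  proof (induction rule: generate_field.induct)
    case one
    show ?case by (intro bexI[of _ \<one>]) (use P in auto)
  next
    case (incl h)
    then show ?case by (intro bexI[of _ h] bexI[of _ \<one>]) (use P assms(2) in auto)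
  next
    case (a_inv h)
    then obtain a b where ab: "a \<in> P" "b \<in> P" "b \<noteq> \<zero>" "h \<otimes> b = a" by auto
    have "h \<in> carrier R" using generate_field_in_carrier[OF HR a_inv(1)] .
    then have "(\<ominus> h) \<otimes> b = \<ominus> a" using ab P(1) by (auto simp: l_minus subset_iff)
    then show ?case using ab P(5) by blast
  next
    case (m_inv h)
    then obtain a b where ab: "a \<in> P" "b \<in> P" "b \<noteq> \<zero>" "h \<otimes> b = a" by auto
    have h: "h \<in> carrier R" using generate_field_in_carrier[OF HR m_inv(1)] .
    have u: "h \<in> Units R" using h m_inv(2) field_Units by auto
    have c: "a \<in> carrier R" "b \<in> carrier R" using ab P(1) by auto
    have "inv h \<otimes> a = b" using u ab(4) h c by (metis Units_inv_closed Units_l_inv l_one m_assoc)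
    moreover have "a \<noteq> \<zero>" using ab(3,4) h c m_inv(2) integral by blast
    ultimately show ?case using ab by blast
  next
    case (eng_add h1 h2)
    obtain a b where ab: "a \<in> P" "b \<in> P" "b \<noteq> \<zero>" "h1 \<otimes> b = a" using eng_add by auto
    obtain a' b' where ab': "a' \<in> P" "b' \<in> P" "b' \<noteq> \<zero>" "h2 \<otimes> b' = a'" using eng_add by auto
    have h: "h1 \<in> carrier R" "h2 \<in> carrier R" using generate_field_in_carrier[OF HR] eng_add by auto
    have c: "a \<in> carrier R" "b \<in> carrier R" "a' \<in> carrier R" "b' \<in> carrier R" using ab ab' P(1) by auto
    have "(h1 \<oplus> h2) \<otimes> (b \<otimes> b') = (h1 \<otimes> b) \<otimes> b' \<oplus> (h2 \<otimes> b') \<otimes> b" using h c by algebra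
    then have "(h1 \<oplus> h2) \<otimes> (b \<otimes> b') = a \<otimes> b' \<oplus> a' \<otimes> b" using ab ab' by simp
    moreover have "a \<otimes> b' \<oplus> a' \<otimes> b \<in> P" "b \<otimes> b' \<in> P" using ab ab' P by auto
    moreover have "b \<otimes> b' \<noteq> \<zero>" using c ab ab' integral by blast
    ultimately show ?case by blast
  next
    case (eng_mult h1 h2)
    obtain a b where ab: "a \<in> P" "b \<in> P" "b \<noteq> \<zero>" "h1 \<otimes> b = a" using eng_mult by auto
    obtain a' b' where ab': "a' \<in> P" "b' \<in> P" "b' \<noteq> \<zero>" "h2 \<otimes> b' = a'" using eng_mult by auto
    have h: "h1 \<in> carrier R" "h2 \<in> carrier R" using generate_field_in_carrier[OF HR] eng_mult by auto
    have c: "a \<in> carrier R" "b \<in> carrier R" "a' \<in> carrier R" "b' \<in> carrier R" using ab ab' P(1) by auto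
    have "(h1 \<otimes> h2) \<otimes> (b \<otimes> b') = (h1 \<otimes> b) \<otimes> (h2 \<otimes> b')" using h c by algebra
    then have "(h1 \<otimes> h2) \<otimes> (b \<otimes> b') = a \<otimes> a'" using ab ab' by simp
    moreover have "a \<otimes> a' \<in> P" "b \<otimes> b' \<in> P" using ab ab' P by auto
    moreover have "b \<otimes> b' \<noteq> \<zero>" using c ab ab' integral by blast
    ultimately show ?case by blast
  qed
qed

text \<open>For \<open>A = K\<close> this is the ring K[y]; for a K-space \<open>A\<close> it is the
  K[y]-module generated by \<open>A\<close>.\<close>

definition polys :: "'a set \<Rightarrow> 'a \<Rightarrow> 'a set"
  where "polys A y = (\<Union>n. horner A y n)"

lemma polys_two:
  assumes "A \<subseteq> carrier R" "y \<in> carrier R" "\<zero> \<in> A" "a \<in> polys A y" "b \<in> polys A y"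
  shows "\<exists>n. a \<in> horner A y n \<and> b \<in> horner A y n"
proof -
  obtain n m where "a \<in> horner A y n" "b \<in> horner A y m" using assms by (auto simp: polys_def)
  then have "a \<in> horner A y (max n m)" "b \<in> horner A y (max n m)"
    using horner_mono[OF assms(1-3), of n "max n m"] horner_mono[OF assms(1-3), of m "max n m"] by auto
  then show ?thesis by blast
qed

lemma polys_addsub:
  assumes "addsub A" "y \<in> carrier R"
  shows "addsub (polys A y)"
proof (rule addsubI)
  note A = addsubD[OF assms(1)] and H = addsubD[OF horner_addsub[OF assms]]
  show "polys A y \<subseteq> carrier R" "\<zero> \<in> polys A y" using H(1,2) by (auto simp: polys_def)
  show "a \<oplus> b \<in> polys A y" if "a \<in> polys A y" "b \<in> polys A y" for a b
    using polys_two[OF A(1) assms(2) A(2) that] H(5) by (auto simp: polys_def)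
  show "\<ominus> a \<in> polys A y" if "a \<in> polys A y" for a using that H(4) by (auto simp: polys_def)
qed

lemma polys_mult:
  assumes "addsub C" "addsub A" "y \<in> carrier R" "\<And>c a. c \<in> C \<Longrightarrow> a \<in> A \<Longrightarrow> c \<otimes> a \<in> A"
    "e \<in> polys C y" "m \<in> polys A y"
  shows "e \<otimes> m \<in> polys A y"
  using horner_mult[OF assms(1-4)] assms(5,6) unfolding polys_def by blast

lemma polys_base:
  assumes "A \<subseteq> carrier R" "y \<in> carrier R" "\<zero> \<in> A"
  shows "A \<subseteq> polys A y"
  using horner_base[OF assms, of _ 0] unfolding polys_def by blast

lemma addsub_subring: "subring B R \<Longrightarrow> addsub B"
  using addsub_subgroup subring.axioms(1) by blast

lemma polys_subring:
  assumes "subring K R" "y \<in> carrier R"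
  shows "subring (polys K y) R" "K \<subseteq> polys K y" "y \<in> polys K y"
proof -
  note K = subringE[OF assms(1)] and A = addsub_subring[OF assms(1)]
  note P = addsubD[OF polys_addsub[OF A assms(2)]]
  show KP: "K \<subseteq> polys K y" by (rule polys_base[OF K(1) assms(2) K(2)])
  show "subring (polys K y) R"
  proof (rule subringI)
    show "a \<otimes> b \<in> polys K y" if "a \<in> polys K y" "b \<in> polys K y" for a b
      using polys_mult[OF A A assms(2) K(6) that] .
  qed (use P K(3) KP in auto)
  have "y \<otimes> \<one> \<in> horner K y (Suc 1)"
    by (rule horner_shift[OF K(1) assms(2) K(2)]) (simp only: One_nat_def horner_base[OF K(1) assms(2) K(2,3)])
  then show "y \<in> polys K y" using assms(2) unfolding polys_def by (auto simp del: horner.simps)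
qed

end

text \<open>
  \<open>W\<close> stands for the \<open>K\<close>-span of a basis of \<open>F\<close> over \<open>K(x)\<close>. The cardinality condition encodes that the
  basis is linearly independent over \<open>K(x)\<close>, the last one that it spans.
\<close>

locale function_field_basis = field F for F :: "('a, 'm) ring_scheme" (structure) +
  fixes K :: "'a set" and x :: 'a and W :: "'a set"
  assumes K: "subfield K F" and finK: "finite K"
    and full: "\<And>z. z \<in> carrier F \<Longrightarrow> z \<notin> K \<Longrightarrow> transcendental K z"
    and x: "x \<in> carrier F" "transcendental K x"
    and W: "addsub W" "finite W" "\<And>k w. k \<in> K \<Longrightarrow> w \<in> W \<Longrightarrow> k \<otimes> w \<in> W"
    and W_card: "\<And>l. card (horner W x l) = card W ^ l"
    and W_frac: "\<And>z. z \<in> carrier F \<Longrightarrow> \<exists>e\<in>polys K x. e \<noteq> \<zero> \<and> e \<otimes> z \<in> polys W x"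

context field
begin

lemma combine_zeros: "set ks \<subseteq> {\<zero>} \<Longrightarrow> set us \<subseteq> carrier R \<Longrightarrow> combine ks us = \<zero>"
proof (induction ks us rule: combine.induct)
  case (1 k ks u us)
  then show ?case by simp
qed simp_all

text \<open>The denominators of the K(y)-coordinates are cleared one after the other, their product
  being the common denominator. This supplies the condition \<open>W_frac\<close> of the
  locale.\<close>

lemma span_fraction:
  assumes "subfield K R" "y \<in> carrier R" "set us \<subseteq> W" "addsub W" "\<And>k w. k \<in> K \<Longrightarrow> w \<in> W \<Longrightarrow> k \<otimes> w \<in> W"
    "set ks \<subseteq> generate_field R (insert y K)"
  shows "\<exists>e\<in>polys K y. e \<noteq> \<zero> \<and> e \<otimes> combine ks us \<in> polys W y"
  using assms(3,6)
proof (induction ks us rule: combine.induct)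
  case (1 k ks u us)
  have sr: "subring K R" using assms(1) by (rule subfieldE(1))
  note P = subringE[OF polys_subring(1)[OF sr assms(2)]] and KP = polys_subring(2,3)[OF sr assms(2)]
  note A = addsub_subring[OF sr] and W = addsubD[OF assms(4)]
  note PW = addsubD[OF polys_addsub[OF assms(4,2)]]
  obtain e where e: "e \<in> polys K y" "e \<noteq> \<zero>" "e \<otimes> combine ks us \<in> polys W y" using 1 by auto
  obtain a b where ab: "a \<in> polys K y" "b \<in> polys K y" "b \<noteq> \<zero>" "k \<otimes> b = a"
    using generate_field_fraction[OF polys_subring(1)[OF sr assms(2)], of "insert y K" k] KP 1(3) by auto
  have gR: "generate_field R (insert y K) \<subseteq> carrier R"
    using generate_field_incl[of "insert y K"] assms(2) subringE(1)[OF sr] by blast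
  have c: "a \<in> carrier R" "b \<in> carrier R" "e \<in> carrier R" "k \<in> carrier R" "u \<in> carrier R" "combine ks us \<in> carrier R"
    using ab e P(1) 1(2,3) gR W(1) by auto
  have "(e \<otimes> b) \<otimes> combine (k # ks) (u # us) = (e \<otimes> a) \<otimes> u \<oplus> b \<otimes> (e \<otimes> combine ks us)"
    unfolding combine.simps ab(4)[symmetric] using c by algebra
  moreover have "u \<in> polys W y"
    using polys_base[OF W(1) assms(2) W(2)] 1(2) by auto
  then have "(e \<otimes> a) \<otimes> u \<in> polys W y"
    using polys_mult[OF A assms(4,2,5)] P(6)[OF e(1) ab(1)] by blast
  moreover have "b \<otimes> (e \<otimes> combine ks us) \<in> polys W y"
    using polys_mult[OF A assms(4,2,5)] ab(2) e(3) by blast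
  ultimately have "(e \<otimes> b) \<otimes> combine (k # ks) (u # us) \<in> polys W y" using PW(5) by simp
  moreover have "e \<otimes> b \<noteq> \<zero>" using c e ab integral by blast
  ultimately show ?case using P(6)[OF e(1) ab(2)] by blast
next
  case ("2_1" us)
  have sr: "subring K R" using assms(1) by (rule subfieldE(1))
  note P = subringE[OF polys_subring(1)[OF sr assms(2)]]
  show ?case using P(3) addsubD(2)[OF polys_addsub[OF assms(4,2)]] by (intro bexI[of _ \<one>]) auto
next
  case ("2_2" ks)
  have sr: "subring K R" using assms(1) by (rule subfieldE(1))
  note P = subringE[OF polys_subring(1)[OF sr assms(2)]]
  show ?case using P(3) addsubD(2)[OF polys_addsub[OF assms(4,2)]] by (intro bexI[of _ \<one>]) auto
qed

text \<open>Elements of W[y] have coordinates in K[y] with respect to \<open>us\<close>, so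
  independence of \<open>us\<close> over K(y) can be used to compare them.\<close>

lemma horner_combine:
  assumes "subring K R" "y \<in> carrier R" "set us \<subseteq> carrier R"
    "\<And>w. w \<in> W \<Longrightarrow> \<exists>ks. set ks \<subseteq> K \<and> length ks = length us \<and> w = combine ks us"
    "s \<in> horner W y n"
  shows "\<exists>ps. set ps \<subseteq> polys K y \<and> length ps = length us \<and> s = combine ps us"
  using assms(5)
proof (induction n arbitrary: s)
  case 0
  show ?case
    using 0 combine_replicate[OF assms(3)] subringE(2)[OF polys_subring(1)[OF assms(1,2)]]
    by (intro exI[of _ "replicate (length us) \<zero>"]) auto
next
  case (Suc n)
  note P = subringE[OF polys_subring(1)[OF assms(1,2)]] and KP = polys_subring(2,3)[OF assms(1,2)]
  obtain w s' where s: "w \<in> W" "s' \<in> horner W y n" "s = w \<oplus> y \<otimes> s'" using Suc.prems by auto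
  obtain ks where ks: "set ks \<subseteq> K" "length ks = length us" "w = combine ks us" using assms(4)[OF s(1)] by auto
  obtain ps where ps: "set ps \<subseteq> polys K y" "length ps = length us" "s' = combine ps us"
    using Suc.IH[OF s(2)] by auto
  let ?ys = "map ((\<otimes>) y) ps"
  have ys: "set ?ys \<subseteq> polys K y" using ps(1) KP(2) P(6) by auto
  have psR: "set ps \<subseteq> carrier R" and ksR: "set ks \<subseteq> carrier R" and ysR: "set ?ys \<subseteq> carrier R"
    using ps(1) ks(1) P(1) KP ys by blast+
  have "s = combine (map2 (\<oplus>) ks ?ys) us"
    unfolding s ks(3) ps(3) combine_r_distr[OF psR assms(3,2)]
    by (rule combine_add) (use ks ps ksR ysR assms(3) in auto)
  moreover have "set (map2 (\<oplus>) ks ?ys) \<subseteq> polys K y"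
  proof
    fix c assume "c \<in> set (map2 (\<oplus>) ks ?ys)"
    then obtain a b where ab: "(a, b) \<in> set (zip ks ?ys)" "c = a \<oplus> b" by auto
    have "a \<in> polys K y" "b \<in> polys K y"
      using set_zip_leftD[OF ab(1)] set_zip_rightD[OF ab(1)] ks(1) KP(1) ys by blast+
    then show "c \<in> polys K y" using P(7) ab(2) by simp
  qed
  ultimately show ?case using ks(2) ps(2) by (intro exI[of _ "map2 (\<oplus>) ks ?ys"]) auto
qed

lemma function_field_basis_exists:
  assumes "subfield K R" "finite K" "\<And>z. z \<in> carrier R \<Longrightarrow> algebraic K z \<Longrightarrow> z \<in> K"
    "y \<in> carrier R" "transcendental K y" "finite_dimension (generate_field R (insert y K)) (carrier R)"
  shows "\<exists>W. function_field_basis R K y W"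
proof -
  have sr: "subring K R" using assms(1) by (rule subfieldE(1))
  have KR: "K \<subseteq> carrier R" using subringE(1)[OF sr] .
  let ?G = "generate_field R (insert y K)"
  have G: "subfield ?G R" using generate_field_is_subfield[of "insert y K"] assms(4) KR by auto
  obtain n where "dimension n ?G (carrier R)" using assms(6) finite_dimension_def by auto
  from exists_base[OF G this] obtain us where us: "set us \<subseteq> carrier R" "independent ?G us" "Span ?G us = carrier R"
    by auto
  define W where "W = Span K us"
  note P = subringE[OF polys_subring(1)[OF sr assms(4)]] and KP = polys_subring(2,3)[OF sr assms(4)]
  have PG: "horner K y m \<subseteq> ?G" for m
  proof (induction m)
    case 0
    then show ?case using subringE(2)[OF subfieldE(1)[OF G]] by auto
  next
    case (Suc m)
    then show ?case using subringE(6,7)[OF subfieldE(1)[OF G]] generate_field.incl[of _ "insert y K" R]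
      by (auto simp: subset_iff)
  qed
  have PG': "polys K y \<subseteq> ?G" using PG by (auto simp: polys_def)
  have Wmem: "\<exists>ks. set ks \<subseteq> K \<and> length ks = length us \<and> w = combine ks us" if "w \<in> W" for w
    using that Span_mem_iff_length_version[OF assms(1) us(1)] unfolding W_def by blast
  have WR: "addsub W" unfolding W_def addsub_subgroup by (rule Span_is_add_subgroup[OF assms(1) us(1)])
  have Wsm: "k \<otimes> w \<in> W" if "k \<in> K" "w \<in> W" for k w
    using that Span_smult_closed[OF assms(1) us(1)] unfolding W_def by blast
  have usW: "set us \<subseteq> W" unfolding W_def by (rule Span_base_incl[OF assms(1) us(1)])
  have Wfin: "finite W"
  proof -
    have "W \<subseteq> (\<lambda>ks. combine ks us) ` {ks. set ks \<subseteq> K \<and> length ks = length us}" using Wmem by blast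
    then show ?thesis using finite_lists_length_eq[OF assms(2)] finite_surj by blast
  qed
  have y0: "y \<noteq> \<zero>"
  proof
    assume "y = \<zero>"
    have "\<one> \<in> horner K y 1" using horner_base[OF KR assms(4), of \<one> 0] subringE[OF sr] by simp
    have "y \<in> K" using \<open>y = \<zero>\<close> subringE(2)[OF sr] by simp
    \<comment> \<open>The list \<open>[\<one>, \<zero>]\<close> is the polynomial X, which would
      vanish at \<open>y\<close>.\<close>
    have "\<one> = \<zero>" 
      using eval_transcendental[of K y "[\<one>, \<zero>]"] assms(4,5) \<open>y = \<zero>\<close> subringE[OF sr]
      by (auto simp: over_def univ_poly_def polynomial_def)
    then show False using one_not_zero by simp
  qed
  \<comment> \<open>Coordinates over K(y) are unique, so each constant coordinate of
    \<open>w\<close> equals \<open>y\<close> times a polynomial in \<open>y\<close> and is zero by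
    transcendence. This is the uniqueness of the lowest digit needed for the cardinality
    condition.\<close>
  have zero: "w = \<zero>" if w: "w \<in> W" "s \<in> horner W y l" "w = y \<otimes> s" for w s l
  proof -
    obtain ks where ks: "set ks \<subseteq> K" "length ks = length us" "w = combine ks us" using Wmem[OF w(1)] by auto
    obtain ps where ps: "set ps \<subseteq> polys K y" "length ps = length us" "s = combine ps us"
      using horner_combine[OF sr assms(4) us(1) Wmem w(2)] by auto
    let ?ys = "map ((\<otimes>) y) ps"
    have ys: "set ?ys \<subseteq> polys K y" using ps(1) KP(2) P(6) by auto
    have wy: "w = combine ?ys us" unfolding w(3) ps(3)
      by (rule combine_r_distr) (use ps us P(1) assms(4) in auto)
    have "w \<in> Span ?G us" using us(3) addsubD(1)[OF WR] w(1) by auto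
    from unique_decomposition[OF G us(2) this] have "ks = ?ys"
      using ks wy ys KP(1) PG' ps(2) by (metis length_map subset_trans)
    have "set ks \<subseteq> {\<zero>}"
    proof
      fix k assume k: "k \<in> set ks"
      then obtain p where p: "p \<in> polys K y" "k = y \<otimes> p" using \<open>ks = ?ys\<close> ps(1) by auto
      then obtain m where "p \<in> horner K y m" by (auto simp: polys_def)
      then show "k \<in> {\<zero>}" using transcendental_horner[OF sr assms(4,5)] p(2) k ks(1) by blast
    qed
    then show ?thesis using ks(3) combine_zeros us(1) by simp
  qed
  have card: "card (horner W y l) = card W ^ l" for l
  proof (rule horner_card_eq[OF Wfin addsubD(1)[OF WR] assms(4) y0])
    fix l a a' s s'
    assume *: "a \<in> W" "a' \<in> W" "s \<in> horner W y l" "s' \<in> horner W y l" "a \<ominus> a' = y \<otimes> (s' \<ominus> s)"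
    have "a \<ominus> a' = \<zero>"
      using zero[OF addsubD(3)[OF WR *(1,2)] addsubD(3)[OF horner_addsub[OF WR assms(4)] *(4,3)] *(5)] .
    then show "a = a'" using * addsubD(1)[OF WR] by (auto simp: subset_iff)
  qed
  have "function_field_basis R K y W"
  proof (intro function_field_basis.intro function_field_basis_axioms.intro field_axioms)
    show "\<exists>e\<in>polys K y. e \<noteq> \<zero> \<and> e \<otimes> z \<in> polys W y" if "z \<in> carrier R" for z
    proof -
      have "z \<in> Span ?G us" unfolding us(3) by (rule that)
      then obtain ks where "set ks \<subseteq> ?G" "z = combine ks us"
        unfolding Span_mem_iff_length_version[OF G us(1)] by blast
      then show ?thesis using span_fraction[OF assms(1,4) usW WR Wsm] by blast
    qed
  qed (use assms WR Wfin Wsm card in auto)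
  then show ?thesis by blast
qed

end

context function_field_basis
begin

lemma Ksub: "subring K F" by (rule subfieldE(1)[OF K])

lemma inv_closed [simp]: "a \<in> carrier F \<Longrightarrow> a \<noteq> \<zero> \<Longrightarrow> inv a \<in> carrier F"
  using field_Units by auto

lemma inv_nz [simp]: "a \<in> carrier F \<Longrightarrow> a \<noteq> \<zero> \<Longrightarrow> inv a \<noteq> \<zero>"
  using field_Units Units_inv_Units by auto

lemma inv_r [simp]: "a \<in> carrier F \<Longrightarrow> a \<noteq> \<zero> \<Longrightarrow> a \<otimes> inv a = \<one>"
  using field_Units Units_r_inv by auto

lemma inv_l [simp]: "a \<in> carrier F \<Longrightarrow> a \<noteq> \<zero> \<Longrightarrow> inv a \<otimes> a = \<one>"
  using field_Units Units_l_inv by auto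

lemma inv_inv' [simp]: "a \<in> carrier F \<Longrightarrow> a \<noteq> \<zero> \<Longrightarrow> inv (inv a) = a"
  using field_Units Units_inv_inv by auto

lemma mult_nz [simp]: "a \<in> carrier F \<Longrightarrow> b \<in> carrier F \<Longrightarrow> a \<otimes> b = \<zero> \<longleftrightarrow> a = \<zero> \<or> b = \<zero>"
  using integral integral_iff by blast

lemma inv_mult_l [simp]: "a \<in> carrier F \<Longrightarrow> a \<noteq> \<zero> \<Longrightarrow> b \<in> carrier F \<Longrightarrow> inv a \<otimes> (a \<otimes> b) = b"
  by (metis inv_closed inv_l l_one m_assoc)

lemma inv_mult_r [simp]: "a \<in> carrier F \<Longrightarrow> a \<noteq> \<zero> \<Longrightarrow> b \<in> carrier F \<Longrightarrow> a \<otimes> (inv a \<otimes> b) = b"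
  by (metis inv_closed inv_r l_one m_assoc)

lemma inv_mult_dist: "a \<in> carrier F \<Longrightarrow> a \<noteq> \<zero> \<Longrightarrow> b \<in> carrier F \<Longrightarrow> b \<noteq> \<zero> \<Longrightarrow> inv (a \<otimes> b) = inv a \<otimes> inv b"
  by (rule comm_inv_char) (auto simp: m_ac)

lemma pow_nz [simp]: "a \<in> carrier F \<Longrightarrow> a \<noteq> \<zero> \<Longrightarrow> a [^] (n::nat) \<noteq> \<zero>"
  by (induction n) auto

section \<open>Common denominators and the counting bound\<close>

lemma common_denominator:
  assumes "finite Z" "Z \<subseteq> carrier F"
  shows "\<exists>e\<in>polys K x. e \<noteq> \<zero> \<and> (\<exists>c. \<forall>a\<in>Z. e \<otimes> a \<in> horner W x c)"
  using assms
proof (induction Z)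
  case empty
  show ?case using subringE(3)[OF polys_subring(1)[OF Ksub x(1)]] by (intro bexI[of _ \<one>]) auto
next
  case (insert z Z)
  note A = addsub_subring[OF Ksub] and W1 = addsubD[OF W(1)] and HW = addsubD[OF horner_addsub[OF W(1) x(1)]]
  note P = subringE[OF polys_subring(1)[OF Ksub x(1)]]
  obtain e c where e: "e \<in> polys K x" "e \<noteq> \<zero>" "\<And>a. a \<in> Z \<Longrightarrow> e \<otimes> a \<in> horner W x c" using insert by auto
  obtain e' c' where e': "e' \<in> polys K x" "e' \<noteq> \<zero>" "e' \<otimes> z \<in> horner W x c'"
    using W_frac[of z] insert.prems by (auto simp: polys_def[of W])
  obtain s s' where s: "e \<in> horner K x s" "e' \<in> horner K x s'" using e e' by (auto simp: polys_def)
  have c: "e \<in> carrier F" "e' \<in> carrier F" "z \<in> carrier F" using e e' P(1) insert.prems by auto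
  let ?m = "max (c + s') (c' + s)"
  have "(e \<otimes> e') \<otimes> a \<in> horner W x ?m" if a: "a \<in> insert z Z" for a
  proof (cases "a = z")
    case True
    have "e \<otimes> (e' \<otimes> z) \<in> horner W x (c' + s)" by (rule horner_mult[OF A W(1) x(1) W(3) s(1) e'(3)])
    then show ?thesis using c horner_mono[OF W1(1) x(1) W1(2), of "c' + s" ?m] True by (auto simp: m_assoc)
  next
    case False
    have aZ: "a \<in> Z" "a \<in> carrier F" using False a insert.prems by auto
    have "e' \<otimes> (e \<otimes> a) \<in> horner W x (c + s')" by (rule horner_mult[OF A W(1) x(1) W(3) s(2) e(3)[OF aZ(1)]])
    moreover have "e' \<otimes> (e \<otimes> a) = (e \<otimes> e') \<otimes> a" using c aZ by (simp add: m_ac)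
    ultimately show ?thesis using horner_mono[OF W1(1) x(1) W1(2), of "c + s'" ?m] by auto
  qed
  moreover have "e \<otimes> e' \<noteq> \<zero>" using c e e' by simp
  ultimately show ?case using P(6)[OF e(1) e'(1)] by blast
qed

text \<open>\<open>e\<close> is a common denominator for multiplication by \<open>z\<close> on \<open>W[x]\<close>, of degree at most \<open>c\<close>.\<close>

definition multiplier :: "'a \<Rightarrow> 'a \<Rightarrow> nat \<Rightarrow> bool"
  where "multiplier z e c \<longleftrightarrow> e \<in> carrier F \<and> e \<noteq> \<zero> \<and>
    (\<forall>l. \<forall>m\<in>horner W x l. e \<otimes> m \<in> horner W x (l + c) \<and> e \<otimes> z \<otimes> m \<in> horner W x (l + c))"

lemma multiplier_bound:
  assumes "multiplier z e c" "z \<noteq> \<zero>" "subring R F" "z \<in> R" "Z \<subseteq> R" "finite Z" "incongruent Z ((\<otimes>) z ` R)"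
  shows "card Z \<le> card W ^ c"
proof -
  note R = subringE[OF assms(3)] and W1 = addsubD[OF W(1)] and HW = addsubD[OF horner_addsub[OF W(1) x(1)]]
  have z: "z \<in> carrier F" using assms R(1) by auto
  have ZF: "Z \<subseteq> carrier F" using assms R(1) by auto
  have e: "e \<in> carrier F" "e \<noteq> \<zero>" and
    em: "\<And>l m. m \<in> horner W x l \<Longrightarrow> e \<otimes> m \<in> horner W x (l + c)" and
    ezm: "\<And>l m. m \<in> horner W x l \<Longrightarrow> e \<otimes> z \<otimes> m \<in> horner W x (l + c)"
    using assms(1) by (auto simp: multiplier_def)
  have hR: "horner Z z l \<subseteq> R" for l
  proof (induction l)
    case (Suc l)
    then show ?case using assms(4,5) R(6,7) by (auto simp: subset_iff)
  qed (use R in auto)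
  have card: "card (horner Z z l) = card Z ^ l" for l
  proof (rule horner_card_eq[OF assms(6) ZF z assms(2)])
    fix l a a' s s' assume *: "a \<in> Z" "a' \<in> Z" "s \<in> horner Z z l" "s' \<in> horner Z z l" "a \<ominus> a' = z \<otimes> (s' \<ominus> s)"
    have "s' \<ominus> s \<in> R" using * hR addsubD(3)[OF addsub_subring[OF assms(3)]] by blast
    then have "a \<ominus> a' \<in> (\<otimes>) z ` R" using *(5) by auto
    then show "a = a'" using assms(7) * unfolding incongruent_def by blast
  qed
  obtain e' c' where e': "e' \<in> polys K x" "e' \<noteq> \<zero>" "\<And>a. a \<in> Z \<Longrightarrow> e' \<otimes> a \<in> horner W x c'"
    using common_denominator[OF assms(6) ZF] by blast
  have e'F: "e' \<in> carrier F" using e' subringE(1)[OF polys_subring(1)[OF Ksub x(1)]] by auto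
  have epow: "e [^] (j::nat) \<otimes> m \<in> horner W x (l + j * c)" if "m \<in> horner W x l" for j l m
  proof (induction j)
    case 0
    then show ?case using that HW(1) by (auto simp: subset_iff)
  next
    case (Suc j)
    have "e [^] Suc j \<otimes> m = e \<otimes> (e [^] j \<otimes> m)" using e that HW(1)[of l] by (auto simp: m_ac subset_iff)
    then show ?case using em[OF Suc] by (simp add: ac_simps)
  qed
  \<comment> \<open>Each power of \<open>z\<close> consumes one factor \<open>e\<close> and costs
    \<open>c\<close> further powers of x, so the length grows with slope \<open>c\<close>. The
    denominators of \<open>Z\<close> itself only contribute the constant \<open>c'\<close>.\<close>
  have sub: "e [^] l \<otimes> e' \<otimes> s \<in> horner W x (c' + l * c)" if "s \<in> horner Z z l" for l s
    using that
  proof (induction l arbitrary: s)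
    case 0
    then show ?case using e e'F HW(2) by auto
  next
    case (Suc l)
    obtain a s' where s: "a \<in> Z" "s' \<in> horner Z z l" "s = a \<oplus> z \<otimes> s'" using Suc.prems by auto
    have cr: "a \<in> carrier F" "s' \<in> carrier F" using s ZF horner_closed[OF ZF z, of l] by auto
    have "e [^] Suc l \<otimes> e' \<otimes> s = e [^] Suc l \<otimes> (e' \<otimes> a) \<oplus> e \<otimes> z \<otimes> (e [^] l \<otimes> e' \<otimes> s')"
    proof -
      have "e [^] l \<in> carrier F" using e by simp
      then show ?thesis unfolding s(3) nat_pow_Suc using cr e e'F z by algebra
    qed
    moreover have "e [^] Suc l \<otimes> (e' \<otimes> a) \<in> horner W x (c' + Suc l * c)" using epow[OF e'(3)[OF s(1)]] .
    moreover have "e \<otimes> z \<otimes> (e [^] l \<otimes> e' \<otimes> s') \<in> horner W x (c' + Suc l * c)"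
      using ezm[OF Suc.IH[OF s(2)]] by (simp add: ac_simps)
    ultimately show ?case using HW(5) by metis
  qed
  have "card Z ^ l \<le> card W ^ c' * (card W ^ c) ^ l" for l
  proof -
    have u: "e [^] l \<otimes> e' \<in> carrier F" "e [^] l \<otimes> e' \<noteq> \<zero>"
      using e e' e'F by auto
    have "inj_on (\<lambda>s. e [^] l \<otimes> e' \<otimes> s) (horner Z z l)"
      using u horner_closed[OF ZF z, of l] m_lcancel[of "e [^] l \<otimes> e'"] by (intro inj_onI) (auto simp: subset_iff)
    then have "card (horner Z z l) \<le> card (horner W x (c' + l * c))"
      by (rule card_inj_on_le) (use sub horner_finite[OF W(2)] in auto)
    also have "\<dots> = card W ^ c' * (card W ^ c) ^ l" using W_card by (simp add: power_add power_mult[symmetric] mult.commute)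
    finally show ?thesis using card by simp
  qed
  then show ?thesis by (rule nat_power_bound)
qed

lemma multiplier_exists:
  assumes "z \<in> carrier F"
  shows "\<exists>e c. multiplier z e c"
proof -
  note A = addsub_subring[OF Ksub] and W1 = addsubD[OF W(1)] and HW = addsubD[OF horner_addsub[OF W(1) x(1)]]
  obtain e c where e: "e \<in> polys K x" "e \<noteq> \<zero>" "\<And>w. w \<in> (\<otimes>) z ` W \<Longrightarrow> e \<otimes> w \<in> horner W x c"
    using common_denominator[of "(\<otimes>) z ` W"] W1(1) assms W(2) by blast
  have eF: "e \<in> carrier F" using e subringE(1)[OF polys_subring(1)[OF Ksub x(1)]] by auto
  obtain s where s: "e \<in> horner K x s" using e by (auto simp: polys_def)
  have ez: "e \<otimes> z \<otimes> m \<in> horner W x (l + c)" if "m \<in> horner W x l" for l m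
    using that
  proof (induction l arbitrary: m)
    case 0
    then show ?case using eF assms HW(2) by auto
  next
    case (Suc l)
    obtain w m' where m: "w \<in> W" "m' \<in> horner W x l" "m = w \<oplus> x \<otimes> m'" using Suc.prems by auto
    have cr: "w \<in> carrier F" "m' \<in> carrier F" using m W1(1) HW(1)[of l] by auto
    have "e \<otimes> z \<otimes> m = e \<otimes> (z \<otimes> w) \<oplus> x \<otimes> (e \<otimes> z \<otimes> m')"
      unfolding m(3) using cr eF assms x(1) by algebra
    moreover have "e \<otimes> (z \<otimes> w) \<in> horner W x (Suc l + c)"
      using e(3)[of "z \<otimes> w"] m(1) horner_mono[OF W1(1) x(1) W1(2), of c "Suc l + c"] by auto
    moreover have "x \<otimes> (e \<otimes> z \<otimes> m') \<in> horner W x (Suc l + c)"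
      using horner_shift[OF W1(1) x(1) W1(2) Suc.IH[OF m(2)]] by simp
    ultimately show ?case using HW(5) by metis
  qed
  have "multiplier z e (c + s)"
    unfolding multiplier_def
  proof (intro conjI allI ballI)
    fix l m assume m: "m \<in> horner W x l"
    show "e \<otimes> m \<in> horner W x (l + (c + s))"
      using horner_mult[OF A W(1) x(1) W(3) s m] horner_mono[OF W1(1) x(1) W1(2), of "l + s" "l + (c + s)"] by auto
    show "e \<otimes> z \<otimes> m \<in> horner W x (l + (c + s))"
      using ez[OF m] horner_mono[OF W1(1) x(1) W1(2), of "l + c" "l + (c + s)"] by auto
  qed (use e eF in auto)
  then show ?thesis by blast
qed

text \<open>For x = 0 the set \<open>horner W x 2\<close> would collapse into \<open>W\<close>, so
  \<open>card W ^ 2 \<le> card W\<close> and \<open>W\<close> would be trivial; then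
  \<open>W_frac\<close> fails at one.\<close>

lemma x_nz: "x \<noteq> \<zero>"
proof
  assume "x = \<zero>"
  have W1: "\<zero> \<in> W" using addsubD(2)[OF W(1)] .
  have "horner W x 2 \<subseteq> W"
    using addsubD(1)[OF W(1)] horner_closed[OF addsubD(1)[OF W(1)] x(1)] W1
    by (auto simp: \<open>x = \<zero>\<close> numeral_2_eq_2 subset_iff)
  then have "card W ^ 2 \<le> card W" using card_mono[OF W(2)] W_card by metis
  moreover have "card W > 0" using W1 W(2) by (auto simp: card_gt_0_iff)
  ultimately have "card W = 1" by (simp add: power2_eq_square)
  then have "W = {\<zero>}" using W1 by (auto simp: card_Suc_eq card_1_singleton_iff)
  then have "horner W x n = {\<zero>}" for n using x(1) by (induction n) auto
  then have P: "polys W x = {\<zero>}" by (auto simp: polys_def)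
  obtain e where "e \<in> polys K x" "e \<noteq> \<zero>" "e \<otimes> \<one> \<in> {\<zero>}" using W_frac[of \<one>] P by auto
  moreover have "e \<in> carrier F" using \<open>e \<in> polys K x\<close> subringE(1)[OF polys_subring(1)[OF Ksub x(1)]] by auto
  ultimately show False by simp
qed

text \<open>The cost is only 1. With the fundamental inequality this bounds the pole divisor of x by
  \<open>card W\<close>.\<close>

lemma multiplier_inv_x: "multiplier (inv x) x 1"
  unfolding multiplier_def
  using horner_shift[OF addsubD(1)[OF W(1)] x(1) addsubD(2)[OF W(1)]] x(1) x_nz
    horner_Suc_mono[OF addsubD(1)[OF W(1)] x(1) addsubD(2)[OF W(1)]]
    horner_closed[OF addsubD(1)[OF W(1)] x(1)]
  by (auto simp del: horner.simps simp: subset_iff)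

text \<open>A polynomial in x preserves W[x], so the denominator is one and the cost is the degree.
  This is what makes the zero divisor of x^(2M) - x^M small enough in
  \<open>clearable_single\<close>.\<close>

lemma multiplier_x_pow_diff:
  assumes "i \<le> (j::nat)"
  shows "multiplier (x [^] j \<ominus> x [^] i) \<one> j"
  unfolding multiplier_def
proof (intro conjI allI ballI)
  note W1 = addsubD[OF W(1)] and HW = addsubD[OF horner_addsub[OF W(1) x(1)]]
  fix l m assume m: "m \<in> horner W x l"
  have mF: "m \<in> carrier F" using m HW(1) by auto
  show "\<one> \<otimes> m \<in> horner W x (l + j)" using m mF horner_mono[OF W1(1) x(1) W1(2), of l "l + j"] by auto
  have xp: "x [^] (k::nat) \<otimes> m \<in> horner W x (l + k)" for k
  proof (induction k)
    case 0
    then show ?case using m mF by simp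
  next
    case (Suc k)
    have "x [^] Suc k \<otimes> m = x \<otimes> (x [^] k \<otimes> m)" using x(1) mF by (simp add: m_ac)
    then show ?case using horner_shift[OF W1(1) x(1) W1(2) Suc] by simp
  qed
  have "\<one> \<otimes> (x [^] j \<ominus> x [^] i) \<otimes> m = x [^] j \<otimes> m \<ominus> x [^] i \<otimes> m"
  proof -
    have "x [^] j \<in> carrier F" "x [^] i \<in> carrier F" using x(1) by auto
    then show ?thesis using mF by algebra
  qed
  moreover have "x [^] i \<otimes> m \<in> horner W x (l + j)"
    using xp[of i] horner_mono[OF W1(1) x(1) W1(2), of "l + i" "l + j"] assms by auto
  ultimately show "\<one> \<otimes> (x [^] j \<ominus> x [^] i) \<otimes> m \<in> horner W x (l + j)" using HW(3) xp[of j] by metis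
qed auto

lemma x_pow_diff_nz:
  assumes "i < (j::nat)"
  shows "x [^] j \<ominus> x [^] i \<noteq> \<zero>"
proof
  assume "x [^] j \<ominus> x [^] i = \<zero>"
  then have eq: "x [^] j = x [^] i" using x(1) by (simp add: r_right_minus_eq)
  obtain k where k: "j = i + Suc k" using assms less_iff_Suc_add by auto
  have "x [^] i \<otimes> x [^] Suc k = x [^] (i + Suc k)" by (rule nat_pow_mult[OF x(1)])
  also have "\<dots> = x [^] i \<otimes> \<one>" using eq x(1) unfolding k by simp
  finally have "x [^] i \<otimes> x [^] Suc k = x [^] i \<otimes> \<one>" .
  then have "x [^] Suc k = \<one>" using x(1) x_nz m_lcancel[of "x [^] i" "x [^] Suc k" \<one>] by auto
  then have 1: "\<one> = x \<otimes> x [^] k" using x(1) by (simp add: m_comm)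
  have "x [^] k \<in> polys K x"
    using polys_subring(3)[OF Ksub x(1)] subringE[OF polys_subring(1)[OF Ksub x(1)]] by (induction k) auto
  then obtain n where "x [^] k \<in> horner K x n" by (auto simp: polys_def)
  from transcendental_horner[OF Ksub x subringE(3)[OF Ksub] this 1] show False by simp
qed

text \<open>A ring maximal among those containing \<open>z\<close> but not its inverse is a valuation ring.\<close>

lemma valuation_ring_exists:
  assumes z: "z \<in> carrier F" "z \<notin> K"
  shows "\<exists>V. valuation_ring F K V \<and> z \<in> V \<and> inv z \<notin> V"
proof -
  have z0: "z \<noteq> \<zero>" using z(2) subringE(2)[OF Ksub] by auto
  define \<A> where "\<A> = {V. subring V F \<and> K \<subseteq> V \<and> z \<in> V \<and> inv z \<notin> V}"
  \<comment> \<open>Start of the Zorn argument: an equation 1 = z p(z) is impossible because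
    \<open>z\<close>, lying outside the full constant field, is transcendental.\<close>
  have "polys K z \<in> \<A>"
  proof -
    have "inv z \<notin> polys K z"
    proof
      assume "inv z \<in> polys K z"
      then obtain n where "inv z \<in> horner K z n" by (auto simp: polys_def)
      from transcendental_horner[OF Ksub z(1) full[OF z] subringE(3)[OF Ksub] this] z z0 show False by simp
    qed
    then show ?thesis unfolding \<A>_def using polys_subring[OF Ksub z(1)] by auto
  qed
  moreover have "\<Union>\<C> \<in> \<A>" if "\<C> \<noteq> {}" "subset.chain \<A> \<C>" for \<C>
  proof -
    have mem: "V \<in> \<A>" if "V \<in> \<C>" for V using that \<open>subset.chain \<A> \<C>\<close> by (auto simp: subset.chain_def)
    have tot: "V \<subseteq> V' \<or> V' \<subseteq> V" if "V \<in> \<C>" "V' \<in> \<C>" for V V' using that \<open>subset.chain \<A> \<C>\<close> by (auto simp: subset.chain_def)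
    have two: "\<exists>V\<in>\<C>. a \<in> V \<and> b \<in> V" if "a \<in> \<Union>\<C>" "b \<in> \<Union>\<C>" for a b using that tot by blast
    have sr: "subring V F" if "V \<in> \<C>" for V using mem[OF that] by (simp add: \<A>_def)
    obtain V0 where V0: "V0 \<in> \<C>" using \<open>\<C> \<noteq> {}\<close> by blast
    have "subring (\<Union>\<C>) F"
    proof (rule subringI)
      show "\<Union>\<C> \<subseteq> carrier F" using subringE(1)[OF sr] by blast
      show "\<one> \<in> \<Union>\<C>" using subringE(3)[OF sr[OF V0]] V0 by blast
      show "\<ominus> h \<in> \<Union>\<C>" if "h \<in> \<Union>\<C>" for h using that subringE(5)[OF sr] by blast
      show "a \<otimes> b \<in> \<Union>\<C>" if "a \<in> \<Union>\<C>" "b \<in> \<Union>\<C>" for a b using two[OF that] subringE(6)[OF sr] by blast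
      show "a \<oplus> b \<in> \<Union>\<C>" if "a \<in> \<Union>\<C>" "b \<in> \<Union>\<C>" for a b using two[OF that] subringE(7)[OF sr] by blast
    qed
    then show ?thesis unfolding \<A>_def using mem V0 unfolding \<A>_def by blast
  qed
  ultimately obtain V where V: "V \<in> \<A>" and max: "\<And>V'. V' \<in> \<A> \<Longrightarrow> V \<subseteq> V' \<Longrightarrow> V' = V"
    using subset_Zorn_nonempty[of \<A>] by blast
  have srV: "subring V F" and KV: "K \<subseteq> V" and zV: "z \<in> V" and izV: "inv z \<notin> V" using V by (auto simp: \<A>_def)
  note R = subringE[OF srV] and AV = addsub_subring[OF srV]
  \<comment> \<open>Maximality of \<open>V\<close>: adjoining any new element produces the inverse
    of \<open>z\<close>.\<close>
  have big: "inv z \<in> polys V y" if "y \<in> carrier F" "y \<notin> V" for y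
  proof (rule ccontr)
    assume "inv z \<notin> polys V y"
    then have "polys V y \<in> \<A>" using polys_subring[OF srV that(1)] KV zV by (auto simp: \<A>_def)
    from max[OF this polys_subring(2)[OF srV that(1)]] polys_subring(3)[OF srV that(1)] that(2) show False by simp
  qed
  \<comment> \<open>Elements u = 1 - za are units of \<open>V\<close>. Otherwise 1/z is a polynomial
    in 1/u over \<open>V\<close>, so u^n/z lies in \<open>V\<close>; as u^n = 1 - zb with b in
    \<open>V\<close>, also 1/z = u^n/z + b would lie in \<open>V\<close>.\<close>
  have unit: "\<one> \<ominus> z \<otimes> a \<noteq> \<zero> \<and> inv (\<one> \<ominus> z \<otimes> a) \<in> V" if a: "a \<in> V" for a
  proof -
    let ?u = "\<one> \<ominus> z \<otimes> a"
    have aF: "a \<in> carrier F" using a R(1) by auto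
    have uV: "?u \<in> V" using addsubD(3)[OF AV] R(3,6) zV a by auto
    have uF: "?u \<in> carrier F" using uV R(1) by auto
    have u0: "?u \<noteq> \<zero>"
    proof
      assume "?u = \<zero>"
      then have "z \<otimes> a = \<one>" using z(1) aF by simp
      then have "inv z = a" using z(1) aF by (metis comm_inv_char)
      then show False using a izV by simp
    qed
    have "inv ?u \<in> V"
    proof (rule ccontr)
      assume "inv ?u \<notin> V"
      then have "inv z \<in> polys V (inv ?u)" using big uF u0 by auto
      then obtain n where n: "inv z \<in> horner V (inv ?u) n" by (auto simp: polys_def)
      have *: "?u [^] n \<otimes> s \<in> V" if "s \<in> horner V (inv ?u) n" for s n
        using that
      proof (induction n arbitrary: s)
        case 0
        then show ?case using R(2) by auto
      next
        case (Suc n)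
        obtain b s' where s: "b \<in> V" "s' \<in> horner V (inv ?u) n" "s = b \<oplus> inv ?u \<otimes> s'" using Suc.prems by auto
        have bF: "b \<in> carrier F" "s' \<in> carrier F"
          using s R(1) horner_closed[OF R(1), of "inv ?u"] uF u0 by auto
        have "?u [^] Suc n \<otimes> s = ?u [^] Suc n \<otimes> b \<oplus> ?u [^] n \<otimes> s'"
          unfolding s(3) using bF uF u0 by (simp add: r_distr m_assoc)
        moreover have "?u [^] Suc n \<in> V" using uV R(3,6) by (induction n) auto
        ultimately show ?case using Suc.IH[OF s(2)] R(6,7) s(1) by metis
      qed
      have r: "?u [^] n \<otimes> inv z \<in> V" using *[OF n] .
      have "\<exists>b\<in>V. ?u [^] n = \<one> \<ominus> z \<otimes> b" for n :: nat
      proof (induction n)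
        case 0
        show ?case using R(2) z(1) by (intro bexI[of _ \<zero>]) (auto simp: minus_eq)
      next
        case (Suc n)
        then obtain b where b: "b \<in> V" "?u [^] n = \<one> \<ominus> z \<otimes> b" by auto
        have bF: "b \<in> carrier F" using b R(1) by auto
        have "?u [^] Suc n = \<one> \<ominus> z \<otimes> (b \<oplus> (\<one> \<ominus> z \<otimes> b) \<otimes> a)"
          unfolding nat_pow_Suc b(2) using bF aF z(1) by algebra
        moreover have "b \<oplus> (\<one> \<ominus> z \<otimes> b) \<otimes> a \<in> V" using b a zV R addsubD(3)[OF AV] by auto
        ultimately show ?case by blast
      qed
      then obtain b where b: "b \<in> V" "?u [^] n = \<one> \<ominus> z \<otimes> b" by auto
      have bF: "b \<in> carrier F" using b R(1) by auto
      have "?u [^] n \<otimes> inv z = inv z \<ominus> (z \<otimes> inv z) \<otimes> b"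
        unfolding b(2) using bF z(1) inv_closed[OF z(1) z0] by algebra
      then have "inv z = ?u [^] n \<otimes> inv z \<oplus> b"
        using bF z z0 inv_closed[OF z(1) z0] by (simp add: minus_eq a_assoc l_neg)
      then show False using r b(1) R(7) izV by metis
    qed
    then show ?thesis using u0 by simp
  qed
  \<comment> \<open>Chevalley's argument: if neither y nor 1/y lies in \<open>V\<close>, then
    multiplying expansions of 1/z by \<open>z\<close> writes one as a polynomial in y and as a
    polynomial in 1/y, with coefficients in J = zV.\<close>
  define J where "J = (\<otimes>) z ` V"
  have AJ: "addsub J"
    unfolding J_def by (rule mult_addsub[OF addsub_subring[OF srV] z(1)])
  note J = addsubD[OF AJ]
  have VJ: "v \<otimes> a \<in> J" if "v \<in> V" "a \<in> J" for v a
  proof -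
    obtain a' where a': "a' \<in> V" "a = z \<otimes> a'" using \<open>a \<in> J\<close> J_def by auto
    have "v \<otimes> a = z \<otimes> (v \<otimes> a')" unfolding a'(2) using a'(1) that(1) z(1) R(1) by (simp add: m_lcomm subset_iff)
    then show ?thesis using R(6)[OF that(1) a'(1)] J_def by auto
  qed
  have one: "\<exists>n. \<one> \<in> horner J y n" if y: "y \<in> carrier F" "y \<notin> V" for y
  proof -
    obtain n where n: "inv z \<in> horner V y n" using big[OF y] by (auto simp: polys_def)
    have "z \<otimes> s \<in> horner J y n" if "s \<in> horner V y n" for s n
      using that
    proof (induction n arbitrary: s)
      case 0
      then show ?case using z(1) by auto
    next
      case (Suc n)
      obtain b s' where s: "b \<in> V" "s' \<in> horner V y n" "s = b \<oplus> y \<otimes> s'" using Suc.prems by auto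
      have bF: "b \<in> carrier F" "s' \<in> carrier F" using s R(1) horner_closed[OF R(1) y(1)] by auto
      have "z \<otimes> s = z \<otimes> b \<oplus> y \<otimes> (z \<otimes> s')" unfolding s(3) using bF y(1) z(1) by (simp add: r_distr m_lcomm)
      then show ?case using Suc.IH[OF s(2)] s(1) by (auto simp: J_def intro!: image_eqI)
    qed
    from this[OF n] show ?thesis using z(1) z0 by auto
  qed
  \<comment> \<open>Multiplying the expansion in 1/y by y^k, where k = n - 1, gives (1 - c) y^k = t
    with c in \<open>J\<close> and t of length k. Since 1 - c is a unit, the top term of the
    expansion in y can be replaced by shorter terms.\<close>
  have desc: "\<exists>n'<n. \<one> \<in> horner J y n'"
    if y: "y \<in> carrier F" "y \<noteq> \<zero>" and m: "\<one> \<in> horner J (inv y) m" and n: "\<one> \<in> horner J y n" and mn: "m \<le> n" for y m n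
  proof -
    have iy: "inv y \<in> carrier F" using y by simp
    have *: "\<exists>c\<in>J. \<exists>t\<in>horner J y n. y [^] n \<otimes> s = c \<otimes> y [^] n \<oplus> t"
      if "s \<in> horner J (inv y) m" "m \<le> Suc n" for s m n
      using that
    proof (induction m arbitrary: s n)
      case 0
      then show ?case using J(2) y addsubD(2)[OF horner_addsub[OF AJ y(1)]] by (intro bexI[OF _ J(2)] bexI[of _ \<zero> "horner J y n"]) auto
    next
      case (Suc m)
      obtain a s' where s: "a \<in> J" "s' \<in> horner J (inv y) m" "s = a \<oplus> inv y \<otimes> s'" using Suc.prems by auto
      have aF: "a \<in> carrier F" "s' \<in> carrier F" using s J(1) horner_closed[OF J(1) iy] by auto
      show ?case
      proof (cases n)
        case 0
        then have "s' = \<zero>" using Suc.prems s(2) by simp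
        then show ?thesis using s y aF 0 by (intro bexI[OF _ s(1)]) auto
      next
        case (Suc k)
        have "m \<le> Suc k" using Suc.prems(2) Suc by simp
        from Suc.IH[OF s(2) this] obtain c t where ct: "c \<in> J" "t \<in> horner J y k" "y [^] k \<otimes> s' = c \<otimes> y [^] k \<oplus> t" by blast
        have "y [^] n \<otimes> s = a \<otimes> y [^] n \<oplus> y [^] k \<otimes> s'"
          unfolding s(3) Suc using aF y by (simp add: r_distr m_ac)
        moreover have "y [^] k \<otimes> s' \<in> horner J y n" unfolding ct(3) Suc by (rule horner_top_intro[OF AJ y(1) ct(1,2)])
        ultimately show ?thesis using s(1) by blast
      qed
    qed
    have "n \<noteq> 0" using n one_not_zero by (cases n) simp_all
    then obtain k where k: "n = Suc k" by (cases n) auto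
    obtain c t where ct: "c \<in> J" "t \<in> horner J y k" "y [^] k \<otimes> \<one> = c \<otimes> y [^] k \<oplus> t" using *[OF m, of k] mn k by auto
    obtain c' t' where ct': "c' \<in> J" "t' \<in> horner J y k" "\<one> = c' \<otimes> y [^] k \<oplus> t'"
      using horner_top_elim[OF AJ y(1), of \<one> k] n[unfolded k] by blast
    note HJ = addsubD[OF horner_addsub[OF AJ y(1)]]
    obtain a where a: "a \<in> V" "c = z \<otimes> a" using ct(1) by (auto simp: J_def)
    let ?u = "\<one> \<ominus> z \<otimes> a"
    have cF: "c \<in> carrier F" "t \<in> carrier F" "a \<in> carrier F" "y [^] k \<in> carrier F" "c' \<in> carrier F"
      using ct(1) a(1) J(1) R(1) y ct'(1) HJ(1)[of k] ct(2) by auto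
    have "?u \<otimes> y [^] k = y [^] k \<otimes> \<one> \<ominus> c \<otimes> y [^] k" unfolding a(2) using cF z(1) by algebra
    also have "\<dots> = t" unfolding ct(3) using cF by algebra
    finally have ut: "?u \<otimes> y [^] k = t" .
    have uF: "?u \<in> carrier F" "?u \<noteq> \<zero>" "inv ?u \<in> V" using unit[OF a(1)] cF z(1) by auto
    have yk: "y [^] k = inv ?u \<otimes> t" unfolding ut[symmetric] using uF cF by simp
    have sm: "v \<otimes> m \<in> horner J y k" if "v \<in> V" "m \<in> horner J y k" for v m
      by (rule horner_smult[OF J(1) y(1) _ _ VJ[OF that(1)] that(2)])
        (use that R(1) y in \<open>auto simp: m_lcomm subset_iff\<close>)
    have JV: "J \<subseteq> V" using zV R(6) by (auto simp: J_def)
    have "y [^] k \<in> horner J y k" unfolding yk using sm[OF uF(3) ct(2)] .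
    then have "c' \<otimes> y [^] k \<in> horner J y k" using sm ct'(1) JV by auto
    then have "\<one> \<in> horner J y k" using HJ(5)[OF _ ct'(2)] ct'(3) by metis
    then show ?thesis using k by blast
  qed
  have "y \<in> V \<or> inv y \<in> V" if y: "y \<in> carrier F" "y \<noteq> \<zero>" for y
  proof (rule ccontr)
    assume "\<not> ?thesis"
    then have yV: "y \<notin> V" "inv y \<notin> V" by auto
    \<comment> \<open>Both lengths are taken minimal; the longer expansion can be shortened by the
      shorter one, a contradiction.\<close>
    define n where "n = (LEAST n. \<one> \<in> horner J y n)"
    define m where "m = (LEAST n. \<one> \<in> horner J (inv y) n)"
    have n: "\<one> \<in> horner J y n" and n': "\<And>k. k < n \<Longrightarrow> \<one> \<notin> horner J y k"
      unfolding n_def using one[OF y(1) yV(1)] by (auto intro: LeastI_ex dest: not_less_Least)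
    have m: "\<one> \<in> horner J (inv y) m" and m': "\<And>k. k < m \<Longrightarrow> \<one> \<notin> horner J (inv y) k"
      unfolding m_def using one[OF _ yV(2)] y by (auto intro: LeastI_ex dest: not_less_Least)
    show False
    proof (cases "m \<le> n")
      case True
      from desc[OF y m n this] n' show False by blast
    next
      case False
      have "\<one> \<in> horner J (inv (inv y)) n" using n y by simp
      from desc[OF _ _ this m] m' False y show False by auto
    qed
  qed
  then have "valuation_ring F K V"
    unfolding valuation_ring_def using srV KV zV z(2) izV R(1) inv_closed[OF z(1) z0] by blast
  then show ?thesis using zV izV by blast
qed


section \<open>Valuations\<close>

text \<open>The inverse of zero is unspecified, hence the separate clause.\<close>

definition nonunits :: "'a set \<Rightarrow> 'a set"
  where "nonunits V = {z \<in> V. z = \<zero> \<or> inv z \<notin> V}"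

lemma vringD:
  assumes "valuation_ring F K V"
  shows "subring V F" "K \<subseteq> V" "V \<subseteq> carrier F" "V \<noteq> carrier F"
    "\<And>z. z \<in> carrier F \<Longrightarrow> z \<noteq> \<zero> \<Longrightarrow> z \<in> V \<or> inv z \<in> V"
  using assms by (auto simp: valuation_ring_def)

lemma vring_mult: "valuation_ring F K V \<Longrightarrow> a \<in> V \<Longrightarrow> b \<in> V \<Longrightarrow> a \<otimes> b \<in> V"
  using subringE(6)[OF vringD(1)] .

lemma vring_carrier [intro]: "valuation_ring F K V \<Longrightarrow> a \<in> V \<Longrightarrow> a \<in> carrier F"
  using vringD(3) by auto

lemma one_vring: "valuation_ring F K V \<Longrightarrow> \<one> \<in> V" and zero_vring: "valuation_ring F K V \<Longrightarrow> \<zero> \<in> V"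
  using subringE(2,3)[OF vringD(1)] by auto

lemma nonunits_mult:
  assumes V: "valuation_ring F K V" "a \<in> V" "b \<in> nonunits V"
  shows "a \<otimes> b \<in> nonunits V"
proof (cases "a = \<zero> \<or> b = \<zero>")
  case True
  then show ?thesis using assms vringD(3)[OF V(1)] zero_vring[OF V(1)] by (auto simp: nonunits_def)
next
  case False
  have c: "a \<in> carrier F" "b \<in> carrier F" "b \<in> V" "inv b \<notin> V" using assms False by (auto simp: nonunits_def)
  have "inv (a \<otimes> b) \<notin> V"
  proof
    assume "inv (a \<otimes> b) \<in> V"
    then have "a \<otimes> inv (a \<otimes> b) \<in> V" using vring_mult[OF V(1)] V(2) by blast
    moreover have "a \<otimes> inv (a \<otimes> b) = inv b" using c False by (simp add: inv_mult_dist)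
    ultimately show False using c by simp
  qed
  then show ?thesis using vring_mult[OF V(1,2)] c by (auto simp: nonunits_def)
qed

lemma nonunits_addsub:
  assumes V: "valuation_ring F K V"
  shows "addsub (nonunits V)"
proof (rule addsubI)
  note R = subringE[OF vringD(1)[OF V]]
  show "nonunits V \<subseteq> carrier F" "\<zero> \<in> nonunits V" using vring_carrier[OF V] R(2) by (auto simp: nonunits_def)
  show "\<ominus> a \<in> nonunits V" if "a \<in> nonunits V" for a
  proof -
    have "(\<ominus> \<one>) \<otimes> a \<in> nonunits V" using nonunits_mult[OF V _ that] R(3,5) by blast
    then show ?thesis using that vring_carrier[OF V] by (simp add: nonunits_def l_minus)
  qed
  \<comment> \<open>If a/b is integral then a + b = (a/b + 1) b is a multiple of a nonunit. A
    valuation ring contains a/b or b/a, so this covers all nonzero pairs.\<close>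
  have key: "a \<oplus> b \<in> nonunits V"
    if ab: "a \<in> nonunits V" "b \<in> nonunits V" "b \<noteq> \<zero>" "a \<otimes> inv b \<in> V" for a b
  proof -
    have c: "a \<in> carrier F" "b \<in> carrier F" using ab vring_carrier[OF V] by (auto simp: nonunits_def)
    have "a \<oplus> b = (a \<otimes> inv b \<oplus> \<one>) \<otimes> b" using c ab(3) by (simp add: l_distr m_assoc)
    then show ?thesis using nonunits_mult[OF V _ ab(2)] R(3,7) ab(4) by metis
  qed
  show "a \<oplus> b \<in> nonunits V" if ab: "a \<in> nonunits V" "b \<in> nonunits V" for a b
  proof -
    have c: "a \<in> carrier F" "b \<in> carrier F" using ab vring_carrier[OF V] by (auto simp: nonunits_def)
    consider "a = \<zero>" | "b = \<zero>" | "a \<noteq> \<zero>" "b \<noteq> \<zero>" by blast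
    then show ?thesis
    proof cases
      case 3
      have "a \<otimes> inv b \<in> V \<or> inv (a \<otimes> inv b) \<in> V" using vringD(5)[OF V, of "a \<otimes> inv b"] 3 c by auto
      moreover have "inv (a \<otimes> inv b) = b \<otimes> inv a" using 3 c by (simp add: inv_mult_dist m_comm)
      ultimately show ?thesis using key[OF ab] key[OF ab(2,1)] 3 c by (auto simp: a_comm)
    qed (use c ab in auto)
  qed
qed

lemma vring_ring:
  assumes "valuation_ring F K V"
  shows "domain (F\<lparr>carrier := V\<rparr>)" "cring (F\<lparr>carrier := V\<rparr>)" "ring (F\<lparr>carrier := V\<rparr>)"
  using subring_is_domain[OF vringD(1)[OF assms]]
  by (auto simp: domain_def cring_def)

lemma nonunits_ideal:
  assumes V: "valuation_ring F K V"
  shows "ideal (nonunits V) (F\<lparr>carrier := V\<rparr>)"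
proof (rule idealI)
  note A = addsubD[OF nonunits_addsub[OF V]]
  interpret V: domain "F\<lparr>carrier := V\<rparr>" by (rule vring_ring(1)[OF V])
  show "ring (F\<lparr>carrier := V\<rparr>)" by (rule vring_ring(3)[OF V])
  have "V.addsub (nonunits V)"
  proof (rule V.addsubI)
    show "nonunits V \<subseteq> carrier (F\<lparr>carrier := V\<rparr>)" by (auto simp: nonunits_def)
    show "\<ominus>\<^bsub>F\<lparr>carrier := V\<rparr>\<^esub> a \<in> nonunits V" if a: "a \<in> nonunits V" for a
    proof -
      have aV: "a \<in> V" "\<ominus> a \<in> V" using a A(4)[OF a] by (auto simp: nonunits_def)
      have "a \<in> carrier F" using aV vring_carrier[OF V] by auto
      then have "\<ominus>\<^bsub>F\<lparr>carrier := V\<rparr>\<^esub> a = \<ominus> a" using aV by (intro V.minus_equality) (auto simp: l_neg)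
      then show ?thesis using A(4)[OF a] by simp
    qed
  qed (use A in auto)
  then show "subgroup (nonunits V) (add_monoid (F\<lparr>carrier := V\<rparr>))" by (simp only: V.addsub_subgroup)
  show "b \<otimes>\<^bsub>F\<lparr>carrier := V\<rparr>\<^esub> a \<in> nonunits V" if "a \<in> nonunits V" "b \<in> carrier (F\<lparr>carrier := V\<rparr>)" for a b
    using nonunits_mult[OF V] that by auto
  then show "a \<otimes>\<^bsub>F\<lparr>carrier := V\<rparr>\<^esub> b \<in> nonunits V" if "a \<in> nonunits V" "b \<in> carrier (F\<lparr>carrier := V\<rparr>)" for a b
    using that vring_carrier[OF V] by (simp add: nonunits_def m_comm)
qed

lemma ideal_unit:
  assumes V: "valuation_ring F K V" and J: "ideal J (F\<lparr>carrier := V\<rparr>)" and z: "z \<in> J" "z \<notin> nonunits V"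
  shows "J = V"
proof -
  interpret J: ideal J "F\<lparr>carrier := V\<rparr>" by (rule J)
  have JV: "J \<subseteq> V" using J.a_subset by simp
  have zV: "z \<in> V" "z \<noteq> \<zero>" "inv z \<in> V" using z JV by (auto simp: nonunits_def)
  have "inv z \<otimes>\<^bsub>F\<lparr>carrier := V\<rparr>\<^esub> z \<in> J" using J.I_l_closed[OF z(1)] zV by simp
  then have "\<one>\<^bsub>F\<lparr>carrier := V\<rparr>\<^esub> \<in> J" using zV vring_carrier[OF V] by simp
  then show ?thesis using J.one_imp_carrier by simp
qed

lemma maximalideal_nonunits:
  assumes V: "valuation_ring F K V"
  shows "maximalideal P (F\<lparr>carrier := V\<rparr>) \<longleftrightarrow> P = nonunits V"
proof
  assume "maximalideal P (F\<lparr>carrier := V\<rparr>)"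
  then interpret P: maximalideal P "F\<lparr>carrier := V\<rparr>" .
  have "P \<subseteq> nonunits V" using ideal_unit[OF V P.is_ideal] P.I_notcarr by auto
  moreover have "\<one> \<notin> nonunits V" using one_vring[OF V] by (simp add: nonunits_def)
  then have "nonunits V \<noteq> V" using one_vring[OF V] by blast
  ultimately show "P = nonunits V"
    using P.I_maximal[OF nonunits_ideal[OF V]] by (auto simp: nonunits_def)
next
  assume P: "P = nonunits V"
  show "maximalideal P (F\<lparr>carrier := V\<rparr>)"
    unfolding P
  proof (rule maximalidealI[OF nonunits_ideal[OF V]])
    have "\<one> \<notin> nonunits V" using one_vring[OF V] by (simp add: nonunits_def)
    then show "carrier (F\<lparr>carrier := V\<rparr>) \<noteq> nonunits V" using one_vring[OF V] by auto
    fix J assume J: "ideal J (F\<lparr>carrier := V\<rparr>)" "nonunits V \<subseteq> J"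
    show "J = nonunits V \<or> J = carrier (F\<lparr>carrier := V\<rparr>)"
      using ideal_unit[OF V J(1)] J(2) by auto
  qed
qed

text \<open>An element lies outside \<open>V\<close> exactly when its inverse is a nonzero nonunit.
  Hence the maximal ideal determines the ring, and the \<open>THE\<close> in
  \<open>place_ring\<close> is well defined.\<close>

lemma vring_from_nonunits:
  assumes V: "valuation_ring F K V"
  shows "V = {z \<in> carrier F. z = \<zero> \<or> inv z \<notin> nonunits V}"
proof (rule subset_antisym; rule subsetI)
  fix z assume z: "z \<in> V"
  then show "z \<in> {z \<in> carrier F. z = \<zero> \<or> inv z \<notin> nonunits V}"
    using vring_carrier[OF V z] by (auto simp: nonunits_def)
next
  fix z assume z: "z \<in> {z \<in> carrier F. z = \<zero> \<or> inv z \<notin> nonunits V}"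
  show "z \<in> V"
  proof (rule ccontr)
    assume "z \<notin> V"
    then have z0: "z \<noteq> \<zero>" using zero_vring[OF V] by auto
    then have "inv z \<in> V" "inv (inv z) = z" using z vringD(5)[OF V, of z] \<open>z \<notin> V\<close> by auto
    then show False using z z0 \<open>z \<notin> V\<close> by (simp add: nonunits_def)
  qed
qed

lemma place_ring_nonunits:
  assumes V: "valuation_ring F K V"
  shows "place_ring F K (nonunits V) = V" "nonunits V \<in> places F K"
proof -
  show "place_ring F K (nonunits V) = V"
    unfolding place_ring_def
    by (rule the_equality) (use V maximalideal_nonunits vring_from_nonunits in metis)+
  show "nonunits V \<in> places F K" unfolding places_def using V maximalideal_nonunits[OF V] by blast
qed

abbreviation OP :: "'a set \<Rightarrow> 'a set"
  where "OP \<equiv> place_ring F K"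

lemma placeD:
  assumes "P \<in> places F K"
  shows "valuation_ring F K (OP P)" "P = nonunits (OP P)"
proof -
  obtain V where V: "valuation_ring F K V" "P = nonunits V"
    using assms maximalideal_nonunits by (auto simp: places_def)
  show "valuation_ring F K (OP P)" "P = nonunits (OP P)"
    using V place_ring_nonunits[OF V(1)] by auto
qed

section \<open>Finite indices and discreteness of valuation rings\<close>

lemma has_idx_mult:
  assumes "has_idx A B n" "addsub A" "addsub B" "B \<subseteq> A" "z \<in> carrier F" "z \<noteq> \<zero>"
  shows "has_idx ((\<otimes>) z ` A) ((\<otimes>) z ` B) n"
proof -
  obtain T where T: "finite T" "card T = n" "transversal A B T" using assms(1) has_idx_def by auto
  note A = addsubD[OF assms(2)] and B = addsubD[OF assms(3)] and t = transversalD[OF T(3)]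
  have inj: "inj_on ((\<otimes>) z) (carrier F)" using m_lcancel assms by (intro inj_onI) auto
  have diff: "z \<otimes> a \<ominus> z \<otimes> b = z \<otimes> (a \<ominus> b)" if "a \<in> A" "b \<in> A" for a b
  proof -
    have "a \<in> carrier F" "b \<in> carrier F" using that A(1) by auto
    then show ?thesis using assms(5) by algebra
  qed
  have mem: "z \<otimes> a \<in> (\<otimes>) z ` B \<longleftrightarrow> a \<in> B" if "a \<in> carrier F" for a
    using inj that B(1) by (auto simp: inj_on_def subset_iff)
  have "transversal ((\<otimes>) z ` A) ((\<otimes>) z ` B) ((\<otimes>) z ` T)"
  proof (rule transversalI[OF mult_addsub[OF assms(3,5)]])
    show "(\<otimes>) z ` A \<subseteq> carrier F" "(\<otimes>) z ` T \<subseteq> (\<otimes>) z ` A" using A(1) assms(5) t(1) by auto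
    show "\<exists>y\<in>(\<otimes>) z ` T. a \<ominus> y \<in> (\<otimes>) z ` B" if a: "a \<in> (\<otimes>) z ` A" for a
    proof -
      obtain b where b: "b \<in> A" "a = z \<otimes> b" using a by auto
      obtain u where u: "u \<in> T" "b \<ominus> u \<in> B" using t(2)[OF b(1)] by blast
      then have "a \<ominus> z \<otimes> u \<in> (\<otimes>) z ` B" using b diff[of b u] t(1) by auto
      then show ?thesis using u by blast
    qed
    show "incongruent ((\<otimes>) z ` T) ((\<otimes>) z ` B)"
      unfolding incongruent_def
    proof (intro ballI impI notI)
      fix a' b' assume ab': "a' \<in> (\<otimes>) z ` T" "b' \<in> (\<otimes>) z ` T" "a' \<noteq> b'" "a' \<ominus> b' \<in> (\<otimes>) z ` B"
      obtain a b where ab: "a \<in> T" "b \<in> T" "a' = z \<otimes> a" "b' = z \<otimes> b" using ab' by auto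
      have "a \<noteq> b" using ab ab' by auto
      have "z \<otimes> a \<ominus> z \<otimes> b \<in> (\<otimes>) z ` B" using ab ab' by simp
      then have "a \<ominus> b \<in> B" using diff[of a b] mem[of "a \<ominus> b"] ab t(1) A(1) by (auto simp: subset_iff)
      then show False using transversal_incongruent[OF T(3) assms(3) A(1)] ab \<open>a \<noteq> b\<close> by (auto simp: incongruent_def)
    qed
  qed
  moreover have "card ((\<otimes>) z ` T) = n"
    using T(2) card_image[OF inj_on_subset[OF inj, of T]] t(1) A(1) by auto
  ultimately show ?thesis using T(1) has_idx_def by blast
qed

text \<open>The counting bound holds in every subring of the field. For valuation rings this
  finiteness is what forces discreteness.\<close>

lemma principal_idx:
  assumes "subring V F" "z \<in> V" "z \<noteq> \<zero>"
  shows "\<exists>n. has_idx V ((\<otimes>) z ` V) n"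
proof -
  have z: "z \<in> carrier F" and VF: "V \<subseteq> carrier F" using assms subringE(1) by auto
  obtain e c where "multiplier z e c" using multiplier_exists[OF z] by auto
  from multiplier_bound[OF this assms(3,1,2)]
  show ?thesis using has_idx_bounded[OF mult_addsub[OF addsub_subring[OF assms(1)] z] VF] by blast
qed

lemma has_idx_pos:
  assumes "has_idx A B n" "addsub A" "addsub B"
  shows "n \<ge> 1"
  using incongruent_card_le[OF assms(1,3) addsubD(1)[OF assms(2)], of "{\<zero>}"] addsubD(2)[OF assms(2)]
  by (auto simp: incongruent_def)

lemma has_idx_ge2:
  assumes "has_idx A B n" "addsub A" "addsub B" "a \<in> A" "a \<notin> B"
  shows "n \<ge> 2"
proof -
  have aF: "a \<in> carrier F" using assms addsubD(1) by auto
  have a0: "a \<noteq> \<zero>" using assms addsubD(2) by auto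
  have "\<ominus> a \<notin> B" using addsubD(4)[OF assms(3), of "\<ominus> a"] assms(5) aF by auto
  then have "incongruent {\<zero>, a} B" using assms(5) aF by (auto simp: incongruent_def minus_eq)
  from incongruent_card_le[OF assms(1,3) addsubD(1)[OF assms(2)] _ this]
  show ?thesis using addsubD(2)[OF assms(2)] assms(4) a0 by auto
qed

text \<open>Take a nonzero nonunit \<open>t\<close> with minimal index [V : tV]. A nonunit
  \<open>s\<close> outside tV would be a proper divisor of \<open>t\<close>, so that sV strictly
  contains tV and its index is at most half as large.\<close>

lemma uniformizer_exists:
  assumes V: "valuation_ring F K V"
  shows "\<exists>t\<in>V. t \<noteq> \<zero> \<and> nonunits V = (\<otimes>) t ` V"
proof -
  note R = subringE[OF vringD(1)[OF V]] and AV = addsub_subring[OF vringD(1)[OF V]]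
  define f where "f t = (SOME n. has_idx V ((\<otimes>) t ` V) n)" for t
  have f: "has_idx V ((\<otimes>) t ` V) (f t)" if "t \<in> V" "t \<noteq> \<zero>" for t
    unfolding f_def using principal_idx[OF vringD(1)[OF V] that] by (rule someI_ex)
  obtain z where z: "z \<in> carrier F" "z \<notin> V" using vringD(3,4)[OF V] by auto
  have z0: "z \<noteq> \<zero>" using z zero_vring[OF V] by auto
  have "inv z \<in> nonunits V \<and> inv z \<noteq> \<zero>" using z z0 vringD(5)[OF V z(1)] by (auto simp: nonunits_def)
  then have ex: "\<exists>t. t \<in> nonunits V \<and> t \<noteq> \<zero>" by blast
  define t where "t = (ARG_MIN f t. t \<in> nonunits V \<and> t \<noteq> \<zero>)"
  have t: "t \<in> nonunits V" "t \<noteq> \<zero>" and min: "\<And>s. s \<in> nonunits V \<Longrightarrow> s \<noteq> \<zero> \<Longrightarrow> f t \<le> f s"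
    using arg_min_nat_lemma[of "\<lambda>t. t \<in> nonunits V \<and> t \<noteq> \<zero>" _ f] ex unfolding t_def by blast+
  have tV: "t \<in> V" using t by (simp add: nonunits_def)
  have sub: "(\<otimes>) t ` V \<subseteq> nonunits V" using nonunits_mult[OF V _ t(1)] vring_carrier[OF V] tV by (auto simp: m_comm)
  have "nonunits V \<subseteq> (\<otimes>) t ` V"
  proof (rule subsetI, rule ccontr)
    fix s assume s: "s \<in> nonunits V" "s \<notin> (\<otimes>) t ` V"
    have s0: "s \<noteq> \<zero>" using s addsubD(2)[OF mult_addsub[OF AV]] tV vring_carrier[OF V] by auto
    have sV: "s \<in> V" using s by (simp add: nonunits_def)
    have c: "s \<in> carrier F" "t \<in> carrier F" using sV tV vring_carrier[OF V] by auto
    have "s \<otimes> inv t \<notin> V"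
    proof
      assume *: "s \<otimes> inv t \<in> V"
      have "t \<otimes> (s \<otimes> inv t) = s" using c t(2) by (simp add: m_lcomm)
      then show False using s(2) * by (metis imageI)
    qed
    moreover have "inv (s \<otimes> inv t) = t \<otimes> inv s" using c t(2) s0 by (simp add: inv_mult_dist m_comm)
    ultimately have ts: "t \<otimes> inv s \<in> V" using vringD(5)[OF V, of "s \<otimes> inv t"] c t(2) s0 by auto
    have tsV: "(\<otimes>) t ` V \<subseteq> (\<otimes>) s ` V"
    proof clarify
      fix v assume v: "v \<in> V"
      have "s \<otimes> (t \<otimes> inv s \<otimes> v) = (s \<otimes> inv s) \<otimes> (t \<otimes> v)"
        using c inv_closed[OF c(1) s0] vring_carrier[OF V v] by algebra
      then have "t \<otimes> v = s \<otimes> (t \<otimes> inv s \<otimes> v)" using c s0 vring_carrier[OF V v] by simp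
      then show "t \<otimes> v \<in> (\<otimes>) s ` V" using R(6)[OF ts v] by blast
    qed
    have sVV: "(\<otimes>) s ` V \<subseteq> V" using R(6)[OF sV] by auto
    note As = mult_addsub[OF AV c(1)] and At = mult_addsub[OF AV c(2)]
    have "\<exists>k\<le>f t. has_idx ((\<otimes>) s ` V) ((\<otimes>) t ` V) k"
    proof (rule has_idx_bounded[OF At addsubD(1)[OF As]])
      fix Z assume Z: "Z \<subseteq> (\<otimes>) s ` V" "incongruent Z ((\<otimes>) t ` V)"
      have "Z \<subseteq> V" using Z(1) sVV by (rule subset_trans)
      from incongruent_card_le[OF f[OF tV t(2)] At addsubD(1)[OF AV] this Z(2)] show "card Z \<le> f t" by simp
    qed
    then obtain k where k: "has_idx ((\<otimes>) s ` V) ((\<otimes>) t ` V) k" by auto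
    have "has_idx V ((\<otimes>) t ` V) (f s * k)" using has_idx_tower[OF f[OF sV s0] k AV As At sVV tsV] .
    then have "f t = f s * k" using has_idx_unique[OF f[OF tV t(2)] _ At addsubD(1)[OF AV]] by blast
    moreover have "s \<in> (\<otimes>) s ` V" using R(3) c by (auto intro!: image_eqI[of _ _ \<one>])
    then have "k \<ge> 2" using has_idx_ge2[OF k As At _ s(2)] by blast
    moreover have "f s \<ge> 1" using has_idx_pos[OF f[OF sV s0] AV As] .
    ultimately have "f t \<ge> f s * 2" by simp
    then show False using min[OF s(1) s0] \<open>f s \<ge> 1\<close> by linarith
  qed
  then show ?thesis using sub t(2) tV by blast
qed


declare pow_nat [simp del]

definition uniformizer :: "'a set \<Rightarrow> 'a \<Rightarrow> bool"
  where "uniformizer V t \<longleftrightarrow> t \<in> V \<and> t \<noteq> \<zero> \<and> nonunits V = (\<otimes>) t ` V"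

definition units :: "'a set \<Rightarrow> 'a set"
  where "units V = {u \<in> V. u \<noteq> \<zero> \<and> inv u \<in> V}"

lemma units_closed:
  assumes V: "valuation_ring F K V"
  shows "\<one> \<in> units V" "\<And>u w. u \<in> units V \<Longrightarrow> w \<in> units V \<Longrightarrow> u \<otimes> w \<in> units V"
    "\<And>u. u \<in> units V \<Longrightarrow> inv u \<in> units V" "units V \<subseteq> carrier F" "\<And>u. u \<in> units V \<Longrightarrow> u \<noteq> \<zero>" "units V \<subseteq> V"
    "\<And>u (n::nat). u \<in> units V \<Longrightarrow> u [^] n \<in> units V"
proof -
  show 1: "\<one> \<in> units V" using one_vring[OF V] by (simp add: units_def)
  show 2: "u \<otimes> w \<in> units V" if "u \<in> units V" "w \<in> units V" for u w
    using that vring_mult[OF V] vring_carrier[OF V] by (auto simp: units_def inv_mult_dist)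
  show "inv u \<in> units V" if "u \<in> units V" for u
    using that vring_carrier[OF V] by (auto simp: units_def)
  show "units V \<subseteq> carrier F" "units V \<subseteq> V" "\<And>u. u \<in> units V \<Longrightarrow> u \<noteq> \<zero>"
    using vring_carrier[OF V] by (auto simp: units_def)
  show "u [^] n \<in> units V" if "u \<in> units V" for u and n :: nat
    using that 1 2 by (induction n) auto
qed

lemma units_nonunits: "valuation_ring F K V \<Longrightarrow> u \<in> V \<Longrightarrow> u \<in> units V \<longleftrightarrow> u \<notin> nonunits V"
  by (auto simp: units_def nonunits_def)

lemma uniformizer_carrier: "valuation_ring F K V \<Longrightarrow> uniformizer V t \<Longrightarrow> t \<in> carrier F"
  using vring_carrier by (auto simp: uniformizer_def)

text \<open>Dividing a nonunit by \<open>t\<close> divides the index of its principal ideal by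
  [V : tV], which is at least 2; this gives the induction.\<close>

lemma rep_exists:
  assumes V: "valuation_ring F K V" and t: "uniformizer V t"
    and "has_idx V ((\<otimes>) z ` V) n" "z \<in> V" "z \<noteq> \<zero>"
  shows "\<exists>u\<in>units V. \<exists>k::nat. z = u \<otimes> t [^] k"
  using assms(3-)
proof (induction n arbitrary: z rule: less_induct)
  case (less n z)
  note AV = addsub_subring[OF vringD(1)[OF V]]
  have tF: "t \<in> carrier F" "t \<in> V" "t \<noteq> \<zero>" and tV: "nonunits V = (\<otimes>) t ` V"
    using t uniformizer_carrier[OF V t] by (auto simp: uniformizer_def)
  have zF: "z \<in> carrier F" using less.prems vring_carrier[OF V] by auto
  show ?case
  proof (cases "z \<in> units V")
    case True
    then show ?thesis using zF by (intro bexI[OF _ True] exI[of _ 0]) auto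
  next
    case False
    then have "z \<in> nonunits V" using less.prems units_nonunits[OF V] by auto
    then obtain z' where z': "z' \<in> V" "z = t \<otimes> z'" using tV by auto
    have z'F: "z' \<in> carrier F" "z' \<noteq> \<zero>" using z' less.prems vring_carrier[OF V] tF by auto
    obtain k where k: "has_idx V ((\<otimes>) z' ` V) k" using principal_idx[OF vringD(1)[OF V] z'(1) z'F(2)] by auto
    obtain m where m: "has_idx V ((\<otimes>) t ` V) m" using principal_idx[OF vringD(1)[OF V] tF(2,3)] by auto
    note A1 = mult_addsub[OF AV z'F(1)] and A2 = mult_addsub[OF AV tF(1)]
    have sub: "(\<otimes>) z' ` V \<subseteq> V" "(\<otimes>) t ` V \<subseteq> V" using vring_mult[OF V] z' tF by auto
    have "has_idx ((\<otimes>) t ` V) ((\<otimes>) t ` ((\<otimes>) z' ` V)) k"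
      by (rule has_idx_mult[OF k AV A1 sub(1) tF(1,3)])
    moreover have eq: "(\<otimes>) t ` ((\<otimes>) z' ` V) = (\<otimes>) z ` V"
      unfolding image_image z'(2) using z'F tF vring_carrier[OF V] by (intro image_cong) (auto simp: m_assoc)
    ultimately have "has_idx ((\<otimes>) t ` V) ((\<otimes>) z ` V) k" by simp
    from has_idx_tower[OF m this AV A2 mult_addsub[OF AV zF] sub(2)]
    have "has_idx V ((\<otimes>) z ` V) (m * k)" using eq sub(1) by (metis image_mono)
    then have n: "n = m * k"
      using has_idx_unique[OF less.prems(1) _ mult_addsub[OF AV zF] addsubD(1)[OF AV]] by blast
    have "\<one> \<notin> (\<otimes>) t ` V" unfolding tV[symmetric] using one_vring[OF V] by (simp add: nonunits_def)
    then have "m \<ge> 2" using has_idx_ge2[OF m AV A2 one_vring[OF V]] by blast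
    moreover have "k \<ge> 1" using has_idx_pos[OF k AV A1] .
    ultimately have "k < n" using n by (cases m) auto
    from less.IH[OF this k z'(1) z'F(2)] obtain u j where u: "u \<in> units V" "z' = u \<otimes> t [^] (j::nat)" by auto
    have "u \<in> carrier F" using u units_closed(4)[OF V] by auto
    then have "z = u \<otimes> t [^] Suc j" unfolding z'(2) u(2) using tF by (simp add: m_ac)
    then show ?thesis using u(1) by blast
  qed
qed

lemma uniformizer_pow:
  assumes V: "valuation_ring F K V" and t: "uniformizer V t"
  shows "t [^] (Suc k) \<in> nonunits V"
proof -
  have "t [^] k \<in> V" using t one_vring[OF V] vring_mult[OF V] by (induction k) (auto simp: uniformizer_def)
  moreover have "t \<in> nonunits V"
    using t one_vring[OF V] uniformizer_carrier[OF V t] by (auto simp: uniformizer_def intro!: image_eqI[of _ _ \<one>])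
  ultimately show ?thesis using nonunits_mult[OF V] by simp
qed

lemma rep_unique:
  assumes V: "valuation_ring F K V" and t: "uniformizer V t"
    and "u \<in> units V" "w \<in> units V" "u \<otimes> t [^] (b::nat) = w \<otimes> t [^] (d::nat)"
  shows "b = d"
proof -
  have tF: "t \<in> carrier F" "t \<noteq> \<zero>" using t uniformizer_carrier[OF V t] by (auto simp: uniformizer_def)
  have *: False if "u \<in> units V" "w \<in> units V" "u \<otimes> t [^] b = w \<otimes> t [^] d" "b < d" for u w and b d :: nat
  proof -
    obtain k where k: "d = b + Suc k" using \<open>b < d\<close> less_iff_Suc_add by auto
    have c: "u \<in> carrier F" "w \<in> carrier F" using that units_closed(4)[OF V] by auto
    have "t [^] d = t [^] Suc k \<otimes> t [^] b" unfolding k by (simp only: nat_pow_mult[OF tF(1)] add.commute)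
    then have "u \<otimes> t [^] b = (w \<otimes> t [^] Suc k) \<otimes> t [^] b" using that(3) c tF by (simp add: m_assoc)
    then have "t [^] b \<otimes> u = t [^] b \<otimes> (w \<otimes> t [^] Suc k)" using c tF by (simp only: m_comm nat_pow_closed m_closed)
    moreover have "w \<otimes> t [^] Suc k \<in> carrier F" "t [^] b \<noteq> \<zero>" using c tF by auto
    ultimately have "u = w \<otimes> t [^] Suc k" using c tF m_lcancel[of "t [^] b"] by blast
    then have "u \<in> nonunits V" using nonunits_mult[OF V _ uniformizer_pow[OF V t]] that(2) units_closed(6)[OF V] by auto
    then show False using that(1) units_nonunits[OF V] units_closed(6)[OF V] by blast
  qed
  show ?thesis using *[OF assms(3-5)] *[OF assms(4,3) assms(5)[symmetric]] by (meson linorder_neqE_nat)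
qed

text \<open>\<open>z = u t\<^sup>n\<close> for a unit \<open>u\<close>; the power is split so that no negative exponent occurs.\<close>

definition vrep :: "'a set \<Rightarrow> 'a \<Rightarrow> 'a \<Rightarrow> int \<Rightarrow> bool"
  where "vrep V t z n \<longleftrightarrow> (\<exists>u\<in>units V. \<exists>a b::nat. z \<otimes> t [^] a = u \<otimes> t [^] b \<and> n = int b - int a)"

lemma vrepI: "u \<in> units V \<Longrightarrow> z \<otimes> t [^] (a::nat) = u \<otimes> t [^] (b::nat) \<Longrightarrow> n = int b - int a \<Longrightarrow> vrep V t z n"
  unfolding vrep_def by blast

lemma vrep_exists:
  assumes V: "valuation_ring F K V" and t: "uniformizer V t" and z: "z \<in> carrier F" "z \<noteq> \<zero>"
  shows "\<exists>n. vrep V t z n \<and> (z \<in> V \<longrightarrow> 0 \<le> n)"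
proof -
  have *: "\<exists>u\<in>units V. \<exists>k::nat. z = u \<otimes> t [^] k" if "z \<in> V" "z \<noteq> \<zero>" for z
    using principal_idx[OF vringD(1)[OF V] that] rep_exists[OF V t _ that] by blast
  have tF: "t \<in> carrier F" "t \<noteq> \<zero>" using t uniformizer_carrier[OF V t] by (auto simp: uniformizer_def)
  show ?thesis
  proof (cases "z \<in> V")
    case True
    then obtain u and k :: nat where u: "u \<in> units V" "z = u \<otimes> t [^] k" using * z by blast
    then have "z \<otimes> t [^] (0::nat) = u \<otimes> t [^] k" using units_closed(4)[OF V] tF z by auto
    then have "vrep V t z (int k)" by (rule vrepI[OF u(1)]) simp
    then show ?thesis by auto
  next
    case False
    then have "inv z \<in> V" using vringD(5)[OF V z] by auto
    then obtain u and k :: nat where u: "u \<in> units V" "inv z = u \<otimes> t [^] k" using * z by (metis inv_nz)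
    have c: "u \<in> carrier F" "u \<noteq> \<zero>" using u units_closed(4,5)[OF V] by auto
    have "z \<otimes> t [^] k = inv u \<otimes> ((u \<otimes> t [^] k) \<otimes> z)" using c tF z by (simp add: m_assoc m_comm[of z "t [^] k"])
    also have "\<dots> = inv u \<otimes> t [^] (0::nat)" unfolding u(2)[symmetric] using c z by simp
    finally have "vrep V t z (0 - int k)" by (rule vrepI[OF units_closed(3)[OF V u(1)]]) simp
    then show ?thesis using False by blast
  qed
qed

text \<open>Two uniformizers differ by a unit. Independence of the uniformizer is needed because the
  description in \<open>place_val\<close> quantifies over all generators of the ideal.\<close>

lemma vrep_unique:
  assumes V: "valuation_ring F K V" and t: "uniformizer V t" "uniformizer V s" and z: "z \<in> carrier F"
    and "vrep V t z n" "vrep V s z m"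
  shows "n = m"
proof -
  have tF: "t \<in> carrier F" "t \<noteq> \<zero>" "s \<in> carrier F" "s \<noteq> \<zero>"
    using t uniformizer_carrier[OF V] by (auto simp: uniformizer_def)
  have "t \<in> (\<otimes>) t ` V" "s \<in> (\<otimes>) s ` V" using tF one_vring[OF V] by (auto intro!: image_eqI[of _ _ \<one>])
  then have "s \<in> (\<otimes>) t ` V" "t \<in> (\<otimes>) s ` V" using t by (auto simp: uniformizer_def)
  then obtain w w' where w: "w \<in> V" "s = t \<otimes> w" "w' \<in> V" "t = s \<otimes> w'" by auto
  have wF: "w \<in> carrier F" "w' \<in> carrier F" using w vring_carrier[OF V] by auto
  have "t \<otimes> (w \<otimes> w') = t \<otimes> \<one>" using w(4)[unfolded w(2)] wF tF by (simp add: m_assoc)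
  then have ww: "w \<otimes> w' = \<one>" using m_lcancel[of t "w \<otimes> w'" \<one>] tF wF by auto
  then have "w \<noteq> \<zero>" using wF by auto
  moreover have "inv w = w'" using ww wF by (metis comm_inv_char)
  ultimately have wu: "w \<in> units V" using w by (simp add: units_def)
  obtain u a b where u: "u \<in> units V" "z \<otimes> t [^] a = u \<otimes> t [^] (b::nat)" "n = int b - int (a::nat)"
    using assms(5) by (auto simp: vrep_def)
  obtain u' c d where u': "u' \<in> units V" "z \<otimes> s [^] c = u' \<otimes> s [^] (d::nat)" "m = int d - int (c::nat)"
    using assms(6) by (auto simp: vrep_def)
  have uF: "u \<in> carrier F" "u' \<in> carrier F" using u u' units_closed(4)[OF V] by auto
  have sp: "s [^] k = w [^] k \<otimes> t [^] k" for k :: nat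
    unfolding w(2) using tF wF by (simp add: nat_pow_distrib m_comm)
  have "(u \<otimes> w [^] c) \<otimes> t [^] (b + c) = (u \<otimes> t [^] b) \<otimes> (w [^] c \<otimes> t [^] c)"
    using uF wF tF by (simp add: nat_pow_mult[symmetric] m_ac)
  also have "\<dots> = (z \<otimes> s [^] c) \<otimes> t [^] a" unfolding u(2)[symmetric] sp[symmetric] using z tF by (simp add: m_ac)
  also have "\<dots> = (u' \<otimes> s [^] d) \<otimes> t [^] a" by (simp only: u'(2))
  also have "\<dots> = (u' \<otimes> w [^] d) \<otimes> t [^] (d + a)"
    unfolding sp using uF wF tF by (simp add: nat_pow_mult[symmetric] m_ac)
  finally have "b + c = d + a"
    using rep_unique[OF V t(1)] units_closed(2,7)[OF V] u(1) u'(1) wu by blast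
  then show ?thesis using u(3) u'(3) by linarith
qed

lemma vrep_mult:
  assumes V: "valuation_ring F K V" and t: "uniformizer V t" and z: "z \<in> carrier F" "w \<in> carrier F"
    and "vrep V t z n" "vrep V t w m"
  shows "vrep V t (z \<otimes> w) (n + m)"
proof -
  obtain u a b where u: "u \<in> units V" "z \<otimes> t [^] a = u \<otimes> t [^] (b::nat)" "n = int b - int (a::nat)"
    using assms(5) by (auto simp: vrep_def)
  obtain u' c d where u': "u' \<in> units V" "w \<otimes> t [^] c = u' \<otimes> t [^] (d::nat)" "m = int d - int (c::nat)"
    using assms(6) by (auto simp: vrep_def)
  have F: "u \<in> carrier F" "u' \<in> carrier F" "t \<in> carrier F"
    using u u' units_closed(4)[OF V] uniformizer_carrier[OF V t] by auto
  have "(z \<otimes> w) \<otimes> t [^] (a + c) = (z \<otimes> t [^] a) \<otimes> (w \<otimes> t [^] c)"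
    using F z by (simp add: nat_pow_mult[symmetric] m_ac)
  also have "\<dots> = (u \<otimes> u') \<otimes> t [^] (b + d)"
    unfolding u(2) u'(2) using F by (simp add: nat_pow_mult[symmetric] m_ac)
  finally show ?thesis
    by (rule vrepI[OF units_closed(2)[OF V u(1) u'(1)]]) (use u(3) u'(3) in simp)
qed

lemma vrep_nonneg:
  assumes V: "valuation_ring F K V" and t: "uniformizer V t" and z: "z \<in> carrier F" "z \<noteq> \<zero>"
    and "vrep V t z n"
  shows "z \<in> V \<longleftrightarrow> 0 \<le> n" "z \<in> nonunits V \<longleftrightarrow> 1 \<le> n"
proof -
  have *: "0 \<le> n" if "z \<in> V" "vrep V t z n" "z \<in> carrier F" "z \<noteq> \<zero>" for z n
    using vrep_exists[OF V t that(3,4)] vrep_unique[OF V t t that(3,2)] that(1) by blast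
  have one: "vrep V t \<one> 0" unfolding vrep_def using units_closed(1)[OF V] by (intro bexI exI[of _ 0]) auto
  have iv: "vrep V t (inv z) (- n)"
  proof -
    obtain m where m: "vrep V t (inv z) m" using vrep_exists[OF V t, of "inv z"] z by auto
    have "vrep V t \<one> (n + m)" using vrep_mult[OF V t z(1) _ assms(5) m] z by simp
    then have "n + m = 0" using vrep_unique[OF V t t _ _ one] by auto
    then have "m = - n" by simp
    then show ?thesis using m by simp
  qed
  show zV: "z \<in> V \<longleftrightarrow> 0 \<le> n"
  proof
    assume "0 \<le> n"
    show "z \<in> V"
    proof (rule ccontr)
      assume "z \<notin> V"
      then have iV: "inv z \<in> V" using vringD(5)[OF V z] by auto
      then have "0 \<le> - n" using *[OF iV iv] z by auto
      then have n0: "n = 0" using \<open>0 \<le> n\<close> by simp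
      obtain u a b where u: "u \<in> units V" "z \<otimes> t [^] a = u \<otimes> t [^] (b::nat)" "n = int b - int (a::nat)"
        using assms(5) by (auto simp: vrep_def)
      have F: "u \<in> carrier F" "t \<in> carrier F" "t \<noteq> \<zero>"
        using u units_closed(4)[OF V] uniformizer_carrier[OF V t] t by (auto simp: uniformizer_def)
      have "t [^] b \<otimes> z = t [^] b \<otimes> u" using u n0 F z by (simp add: m_comm)
      then have "z = u" using m_lcancel[of "t [^] b" z u] F z by auto
      then show False using u(1) units_closed(6)[OF V] \<open>z \<notin> V\<close> by auto
    qed
  qed (use * assms z in auto)
  have iV: "inv z \<in> V \<longleftrightarrow> 0 \<le> - n"
  proof
    assume "0 \<le> - n"
    show "inv z \<in> V"
    proof (rule ccontr)
      assume "inv z \<notin> V"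
      then have zV': "z \<in> V" using vringD(5)[OF V z] by auto
      then have "n = 0" using zV \<open>0 \<le> - n\<close> by simp
      then obtain u a b where u: "u \<in> units V" "z \<otimes> t [^] a = u \<otimes> t [^] (b::nat)" "int b - int (a::nat) = 0"
        using assms(5) by (auto simp: vrep_def)
      have F: "u \<in> carrier F" "t \<in> carrier F" "t \<noteq> \<zero>"
        using u units_closed(4)[OF V] uniformizer_carrier[OF V t] t by (auto simp: uniformizer_def)
      have "t [^] b \<otimes> z = t [^] b \<otimes> u" using u F z by (simp add: m_comm)
      then have "z = u" using m_lcancel[of "t [^] b" z u] F z by auto
      then show False using u(1) \<open>inv z \<notin> V\<close> by (auto simp: units_def)
    qed
  qed (use *[OF _ iv] z in auto)
  show "z \<in> nonunits V \<longleftrightarrow> 1 \<le> n"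
    using zV iV z by (auto simp: nonunits_def)
qed

lemma Units_vring:
  assumes V: "valuation_ring F K V"
  shows "Units (F\<lparr>carrier := V\<rparr>) = units V"
proof (intro subset_antisym subsetI)
  fix u assume "u \<in> Units (F\<lparr>carrier := V\<rparr>)"
  then obtain w where w: "u \<in> V" "w \<in> V" "w \<otimes> u = \<one>" "u \<otimes> w = \<one>" by (auto simp: Units_def)
  then have c: "u \<in> carrier F" "w \<in> carrier F" using vring_carrier[OF V] by auto
  then have "u \<noteq> \<zero>" "inv u = w" using w comm_inv_char by auto
  then show "u \<in> units V" using w by (simp add: units_def)
next
  fix u assume "u \<in> units V"
  then show "u \<in> Units (F\<lparr>carrier := V\<rparr>)" using vring_carrier[OF V] by (auto simp: units_def Units_def intro!: bexI[of _ "inv u"])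
qed

text \<open>Bridge from the \<open>THE\<close> and the integer powers of \<open>place_val\<close> to
  \<open>vrep\<close>; the integer exponent is unfolded by sign.\<close>

lemma place_val_vrep:
  assumes V: "valuation_ring F K V" and t: "uniformizer V t" and z: "z \<in> carrier F" "z \<noteq> \<zero>"
    and n: "vrep V t z n"
  shows "place_val F K (nonunits V) z = n"
proof -
  have PI: "nonunits V = PIdl\<^bsub>F\<lparr>carrier := V\<rparr>\<^esub> s \<longleftrightarrow> nonunits V = (\<otimes>) s ` V" if "s \<in> V" for s
  proof -
    have "PIdl\<^bsub>F\<lparr>carrier := V\<rparr>\<^esub> s = (\<otimes>) s ` V"
      unfolding cgenideal_def using that vring_carrier[OF V] by (auto simp: m_comm)
    then show ?thesis by simp
  qed
  \<comment> \<open>\<open>place_val\<close> asks only for a generator of the ideal. A generator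
    zero is excluded because the ideal is not zero, so its generators are exactly the
    uniformizers.\<close>
  have nz: "nonunits V \<noteq> {\<zero>}" 
    using t uniformizer_pow[OF V t, of 0] uniformizer_carrier[OF V t] by (auto simp: uniformizer_def)
  have unif: "uniformizer V s \<longleftrightarrow> s \<in> V \<and> nonunits V = PIdl\<^bsub>F\<lparr>carrier := V\<rparr>\<^esub> s" for s
  proof -
    have "(\<otimes>) \<zero> ` V = {\<zero>}" using vring_carrier[OF V] one_vring[OF V] by (auto intro!: image_eqI[of _ _ \<one>])
    then show ?thesis using PI[of s] nz unfolding uniformizer_def by metis
  qed
  have eq: "(\<exists>u\<in>units V. z = u \<otimes> s [^] m) \<longleftrightarrow> vrep V s z m" if s: "uniformizer V s" for s and m :: int
  proof
    have sF: "s \<in> carrier F" "s \<noteq> \<zero>" using s uniformizer_carrier[OF V s] by (auto simp: uniformizer_def)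
    show "vrep V s z m" if "\<exists>u\<in>units V. z = u \<otimes> s [^] m"
    proof -
      obtain u where u: "u \<in> units V" "z = u \<otimes> s [^] m" using \<open>\<exists>u\<in>units V. _\<close> by blast
      have uF: "u \<in> carrier F" using u units_closed(4)[OF V] by auto
      show ?thesis
      proof (cases "m < 0")
        case True
        then have "z \<otimes> s [^] nat (- m) = u \<otimes> s [^] (0::nat)"
          unfolding u(2) int_pow_def2 using uF sF by (simp add: m_assoc)
        then show ?thesis by (rule vrepI[OF u(1)]) (use True in auto)
      next
        case False
        then have "z \<otimes> s [^] (0::nat) = u \<otimes> s [^] nat m"
          unfolding u(2) int_pow_def2 using uF sF by simp
        then show ?thesis by (rule vrepI[OF u(1)]) (use False in auto)
      qed
    qed
    show "\<exists>u\<in>units V. z = u \<otimes> s [^] m" if "vrep V s z m"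
    proof -
      obtain u a b where u: "u \<in> units V" "z \<otimes> s [^] a = u \<otimes> s [^] (b::nat)" "m = int b - int (a::nat)"
        using \<open>vrep V s z m\<close> by (auto simp: vrep_def)
      have uF: "u \<in> carrier F" using u units_closed(4)[OF V] by auto
      have "z = u \<otimes> s [^] m"
      proof (cases "m < 0")
        case True
        then have a: "a = nat (- m) + b" using u(3) by auto
        have "s [^] b \<otimes> (z \<otimes> s [^] nat (- m)) = s [^] b \<otimes> u"
          using u(2) uF sF z unfolding a by (simp add: nat_pow_mult[symmetric] m_ac)
        then have "z \<otimes> s [^] nat (- m) = u" using m_lcancel[of "s [^] b" "z \<otimes> s [^] nat (- m)" u] uF sF z by auto
        then have "u \<otimes> inv (s [^] nat (- m)) = z" using uF sF z by (auto simp: m_assoc)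
        then show ?thesis unfolding int_pow_def2 using True by simp
      next
        case False
        then have b: "b = nat m + a" using u(3) by auto
        have "s [^] a \<otimes> z = s [^] a \<otimes> (u \<otimes> s [^] nat m)"
          using u(2) uF sF z unfolding b by (simp add: nat_pow_mult[symmetric] m_ac)
        then have "z = u \<otimes> s [^] nat m" using m_lcancel[of "s [^] a" z "u \<otimes> s [^] nat m"] uF sF z by auto
        then show ?thesis unfolding int_pow_def2 using False by simp
      qed
      then show ?thesis using u(1) by blast
    qed
  qed
  have "(\<exists>s\<in>V. \<exists>u\<in>units V. nonunits V = PIdl\<^bsub>F\<lparr>carrier := V\<rparr>\<^esub> s \<and> z = u \<otimes> (s [^] m)) \<longleftrightarrow> m = n" for m :: int
  proof
    assume "\<exists>s\<in>V. \<exists>u\<in>units V. nonunits V = PIdl\<^bsub>F\<lparr>carrier := V\<rparr>\<^esub> s \<and> z = u \<otimes> (s [^] m)"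
    then obtain s where s: "uniformizer V s" "\<exists>u\<in>units V. z = u \<otimes> (s [^] m)" using unif by blast
    then show "m = n" using vrep_unique[OF V t s(1) z(1) n] eq[OF s(1)] by blast
  next
    assume "m = n"
    then show "\<exists>s\<in>V. \<exists>u\<in>units V. nonunits V = PIdl\<^bsub>F\<lparr>carrier := V\<rparr>\<^esub> s \<and> z = u \<otimes> (s [^] m)"
      using eq[OF t] n t unif by blast
  qed
  then show ?thesis
    unfolding place_val_def Let_def place_ring_nonunits(1)[OF V] Units_vring[OF V] by simp
qed

abbreviation v :: "'a set \<Rightarrow> 'a \<Rightarrow> int"
  where "v \<equiv> place_val F K"

lemma v_vrep:
  assumes "P \<in> places F K" "uniformizer (OP P) t" "z \<in> carrier F" "z \<noteq> \<zero>"
  shows "vrep (OP P) t z (v P z)"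
proof -
  obtain n where "vrep (OP P) t z n" using vrep_exists[OF placeD(1)[OF assms(1)] assms(2-4)] by blast
  moreover from place_val_vrep[OF placeD(1)[OF assms(1)] assms(2-4) this] have "v P z = n"
    using placeD(2)[OF assms(1)] by simp
  ultimately show ?thesis by simp
qed

lemma unif_ex: "P \<in> places F K \<Longrightarrow> \<exists>t. uniformizer (OP P) t"
  using uniformizer_exists[OF placeD(1)] unfolding uniformizer_def by blast

lemma v_mult:
  assumes "P \<in> places F K" "z \<in> carrier F" "z \<noteq> \<zero>" "w \<in> carrier F" "w \<noteq> \<zero>"
  shows "v P (z \<otimes> w) = v P z + v P w"
proof -
  obtain t where t: "uniformizer (OP P) t" using unif_ex[OF assms(1)] by auto
  note V = placeD(1)[OF assms(1)]
  show ?thesis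
    using vrep_unique[OF V t t _ v_vrep[OF assms(1) t, of "z \<otimes> w"] vrep_mult[OF V t assms(2,4) v_vrep[OF assms(1) t assms(2,3)] v_vrep[OF assms(1) t assms(4,5)]]]
      assms by simp
qed

lemma v_OP:
  assumes "P \<in> places F K" "z \<in> carrier F" "z \<noteq> \<zero>"
  shows "z \<in> OP P \<longleftrightarrow> 0 \<le> v P z" "z \<in> P \<longleftrightarrow> 1 \<le> v P z"
proof -
  obtain t where t: "uniformizer (OP P) t" using unif_ex[OF assms(1)] by auto
  note * = vrep_nonneg[OF placeD(1)[OF assms(1)] t assms(2,3) v_vrep[OF assms(1) t assms(2,3)]]
  show "z \<in> OP P \<longleftrightarrow> 0 \<le> v P z" by (rule *(1))
  show "z \<in> P \<longleftrightarrow> 1 \<le> v P z" using *(2) placeD(2)[OF assms(1)] by simp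
qed

lemma v_one: 
  assumes "P \<in> places F K"
  shows "v P \<one> = 0"
  using v_mult[OF assms, of \<one> \<one>] by simp

lemma v_inv: "P \<in> places F K \<Longrightarrow> z \<in> carrier F \<Longrightarrow> z \<noteq> \<zero> \<Longrightarrow> v P (inv z) = - v P z"
  using v_mult[of P z "inv z"] v_one[of P] by simp

lemma v_pow: "P \<in> places F K \<Longrightarrow> z \<in> carrier F \<Longrightarrow> z \<noteq> \<zero> \<Longrightarrow> v P (z [^] (n::nat)) = int n * v P z"
  by (induction n) (auto simp: v_one v_mult algebra_simps)

lemma v_value:
  assumes "P \<in> places F K"
  shows "\<exists>s\<in>carrier F. s \<noteq> \<zero> \<and> v P s = n"
proof -
  obtain t where t: "uniformizer (OP P) t" using unif_ex[OF assms(1)] by auto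
  note V = placeD(1)[OF assms(1)]
  have tF: "t \<in> carrier F" "t \<noteq> \<zero>" using t uniformizer_carrier[OF V t] by (auto simp: uniformizer_def)
  have "vrep (OP P) t t 1" unfolding vrep_def using units_closed(1)[OF V] tF
    by (intro bexI[of _ \<one>] exI[of _ 0] exI[of _ 1]) auto
  then have t1: "v P t = 1" using vrep_unique[OF V t t tF(1) v_vrep[OF assms t tF]] by blast
  show ?thesis
  proof (cases "0 \<le> n")
    case True
    then show ?thesis using v_pow[OF assms tF, of "nat n"] t1 tF by (intro bexI[of _ "t [^] nat n"]) auto
  next
    case False
    then show ?thesis using v_pow[OF assms tF, of "nat (- n)"] v_inv[OF assms, of "t [^] nat (- n)"] t1 tF
      by (intro bexI[of _ "inv (t [^] nat (- n))"]) auto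
  qed
qed

text \<open>The fractional ideal \<open>P\<^sup>n\<close> of the valuation ring at \<open>P\<close>.\<close>

definition FI :: "'a set \<Rightarrow> int \<Rightarrow> 'a set"
  where "FI P n = {z \<in> carrier F. z = \<zero> \<or> n \<le> v P z}"

lemma FI_0: "P \<in> places F K \<Longrightarrow> FI P 0 = OP P"
  using v_OP(1)[of P] vring_carrier[OF placeD(1)[of P]] zero_vring[OF placeD(1)[of P]] by (auto simp: FI_def)

lemma FI_1: "P \<in> places F K \<Longrightarrow> FI P 1 = P"
proof -
  assume P: "P \<in> places F K"
  have "\<zero> \<in> P" "P \<subseteq> carrier F"
    using addsubD(1,2)[OF nonunits_addsub[OF placeD(1)[OF P]]] placeD(2)[OF P] by auto
  then show ?thesis using v_OP(2)[OF P] by (auto simp: FI_def)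
qed

lemma FI_mono: "m \<le> n \<Longrightarrow> FI P n \<subseteq> FI P m"
  by (auto simp: FI_def)

lemma FI_mult:
  assumes "P \<in> places F K" "z \<in> FI P m" "w \<in> FI P n"
  shows "z \<otimes> w \<in> FI P (m + n)"
proof (cases "z = \<zero> \<or> w = \<zero>")
  case True
  then show ?thesis using assms by (auto simp: FI_def)
next
  case False
  then show ?thesis using assms v_mult[OF assms(1), of z w] by (auto simp: FI_def)
qed

lemma FI_scale:
  assumes "P \<in> places F K" "z \<in> carrier F" "z \<noteq> \<zero>"
  shows "(\<otimes>) z ` FI P n = FI P (n + v P z)"
proof (rule subset_antisym; rule subsetI)
  fix w assume "w \<in> (\<otimes>) z ` FI P n"
  then obtain y where y: "y \<in> FI P n" "w = z \<otimes> y" by auto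
  have "z \<in> FI P (v P z)" using assms by (auto simp: FI_def)
  from FI_mult[OF assms(1) this y(1)] show "w \<in> FI P (n + v P z)" using y(2) by (simp add: add.commute)
next
  fix w assume w: "w \<in> FI P (n + v P z)"
  have "inv z \<in> FI P (- v P z)" using assms v_inv[OF assms] by (auto simp: FI_def)
  from FI_mult[OF assms(1) this w] have "inv z \<otimes> w \<in> FI P n" by simp
  moreover have "w = z \<otimes> (inv z \<otimes> w)" using assms w by (auto simp: FI_def)
  ultimately show "w \<in> (\<otimes>) z ` FI P n" by blast
qed

lemma FI_addsub:
  assumes "P \<in> places F K"
  shows "addsub (FI P n)"
proof -
  obtain s where s: "s \<in> carrier F" "s \<noteq> \<zero>" "v P s = n" using v_value[OF assms] by blast
  have "addsub (OP P)" using addsub_subring vringD(1)[OF placeD(1)[OF assms]] by blast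
  from mult_addsub[OF this s(1)] show ?thesis using FI_scale[OF assms s(1,2), of 0] FI_0[OF assms] s(3) by simp
qed

lemma FI_K: "P \<in> places F K \<Longrightarrow> K \<subseteq> FI P 0"
  using FI_0 vringD(2)[OF placeD(1)] by auto

lemma v_K:
  assumes "P \<in> places F K" "k \<in> K" "k \<noteq> \<zero>"
  shows "v P k = 0"
proof -
  have kF: "k \<in> carrier F" using assms subringE(1)[OF Ksub] by auto
  have ik: "inv k \<in> K" using subfield_m_inv(1)[OF K, of k] assms by auto
  have "0 \<le> v P k" using FI_K[OF assms(1)] assms by (auto simp: FI_def)
  moreover have "0 \<le> v P (inv k)" using FI_K[OF assms(1)] ik kF assms(3) inv_nz[of k] by (auto simp: FI_def)
  ultimately show ?thesis using v_inv[OF assms(1) kF assms(3)] by simp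
qed


section \<open>Approximation and the fundamental inequality\<close>

abbreviation pdeg :: "'a set \<Rightarrow> nat"
  where "pdeg \<equiv> place_degree F K"

lemma vring_minus:
  assumes V: "valuation_ring F K V" and "a \<in> V" "b \<in> V"
  shows "a \<ominus>\<^bsub>F\<lparr>carrier := V\<rparr>\<^esub> b = a \<ominus> b"
proof -
  interpret V: domain "F\<lparr>carrier := V\<rparr>" by (rule vring_ring(1)[OF V])
  have m: "\<ominus> b \<in> V" using subringE(5)[OF vringD(1)[OF V]] assms by auto
  have "b \<in> carrier F" using vring_carrier[OF V assms(3)] .
  then have "\<ominus>\<^bsub>F\<lparr>carrier := V\<rparr>\<^esub> b = \<ominus> b" using m assms by (intro V.minus_equality) (auto simp: l_neg)
  then show ?thesis by (simp add: a_minus_def)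
qed

text \<open>The degree is defined as a dimension over the image of \<open>K\<close>; here it becomes
  the exponent of an index. The index is finite because the ideal is principal, and it is at least 2
  because one is not in the ideal.\<close>

lemma residue_idx:
  assumes P: "P \<in> places F K"
  shows "has_idx (OP P) P (card K ^ pdeg P)" "1 \<le> pdeg P"
proof -
  define V where "V = OP P"
  note V = placeD(1)[OF P, folded V_def] and PV = placeD(2)[OF P, folded V_def]
  let ?R = "F\<lparr>carrier := V\<rparr>"
  interpret V: domain ?R by (rule vring_ring(1)[OF V])
  interpret I: ideal P ?R using nonunits_ideal[OF V] PV by simp
  let ?Q = "?R Quot P"
  interpret Q: ring ?Q by (rule I.quotient_is_ring)
  interpret H: ring_hom_ring ?R ?Q "(+>\<^bsub>?R\<^esub>) P" by (rule I.rcos_ring_hom_ring)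
  note AV = addsub_subring[OF vringD(1)[OF V]] and AP = nonunits_addsub[OF V, folded PV]
  obtain t where t: "t \<in> V" "t \<noteq> \<zero>" "P = (\<otimes>) t ` V" using uniformizer_exists[OF V] PV by auto
  obtain n where n: "has_idx V P n" using principal_idx[OF vringD(1)[OF V] t(1,2)] t(3) by auto
  then obtain T where T: "finite T" "card T = n" "transversal V P T" by (auto simp: has_idx_def)
  note tT = transversalD[OF T(3)]
  have eq: "P +>\<^bsub>?R\<^esub> a = P +>\<^bsub>?R\<^esub> b \<longleftrightarrow> a \<ominus> b \<in> P" if "a \<in> V" "b \<in> V" for a b
    using V.quotient_eq_iff_same_a_r_cos[OF I.is_ideal, of a b] vring_minus[OF V that] that by simp
  have car: "carrier ?Q = (\<lambda>a. P +>\<^bsub>?R\<^esub> a) ` V"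
    by (auto simp: FactRing_def A_RCOSETS_def')
  have "bij_betw (\<lambda>a. P +>\<^bsub>?R\<^esub> a) T (carrier ?Q)"
    unfolding bij_betw_def
  proof
    show "inj_on (\<lambda>a. P +>\<^bsub>?R\<^esub> a) T"
    proof (rule inj_onI)
      fix a b assume ab: "a \<in> T" "b \<in> T" "P +>\<^bsub>?R\<^esub> a = P +>\<^bsub>?R\<^esub> b"
      have "a \<in> V" "b \<in> V" using ab tT(1) by auto
      then have "a \<ominus> b \<in> P" using eq ab(3) by blast
      then show "a = b" using transversal_incongruent[OF T(3) AP addsubD(1)[OF AV]] ab by (auto simp: incongruent_def)
    qed
    show "(\<lambda>a. P +>\<^bsub>?R\<^esub> a) ` T = carrier ?Q"
    proof
      show "(\<lambda>a. P +>\<^bsub>?R\<^esub> a) ` T \<subseteq> carrier ?Q" unfolding car using tT(1) by auto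
      show "carrier ?Q \<subseteq> (\<lambda>a. P +>\<^bsub>?R\<^esub> a) ` T"
      proof
        fix c assume "c \<in> carrier ?Q"
        then obtain a where a: "a \<in> V" "c = P +>\<^bsub>?R\<^esub> a" unfolding car by auto
        obtain u where u: "u \<in> T" "a \<ominus> u \<in> P" using tT(2)[OF a(1)] by blast
        have "u \<in> V" using u(1) tT(1) by auto
        then have "c = P +>\<^bsub>?R\<^esub> u" using eq[OF a(1)] u(2) a(2) by blast
        then show "c \<in> (\<lambda>a. P +>\<^bsub>?R\<^esub> a) ` T" using u(1) by blast
      qed
    qed
  qed
  then have cardQ: "finite (carrier ?Q)" "card (carrier ?Q) = n"
    using T(1,2) bij_betw_finite[of _ T] bij_betw_same_card[of _ T] by metis+
  have one: "\<one>\<^bsub>?Q\<^esub> \<noteq> \<zero>\<^bsub>?Q\<^esub>"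
  proof
    assume "\<one>\<^bsub>?Q\<^esub> = \<zero>\<^bsub>?Q\<^esub>"
    then have "P +>\<^bsub>?R\<^esub> \<one> = P" by (simp add: FactRing_def)
    then have "\<one> \<in> P" using I.a_rcos_self[OF V.one_closed] by simp
    then show False using PV one_vring[OF V] by (simp add: nonunits_def)
  qed
  have KV: "subfield K ?R"
  proof -
    have "field (F\<lparr>carrier := K\<rparr>)" using subfield_iff(2)[OF K] .
    then show ?thesis using V.subfield_iff(1)[of K] vringD(2)[OF V] by auto
  qed
  note inj = H.img_is_subfield(1)[OF KV one] and sf = H.img_is_subfield(2)[OF KV one]
  have "card (carrier ?Q) = card ((+>\<^bsub>?R\<^esub>) P ` K) ^ Q.dim ((+>\<^bsub>?R\<^esub>) P ` K) (carrier ?Q)"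
  proof (rule Q.finite_subspace_dim(2)[OF sf])
    show "Q.addsub (carrier ?Q)" by (rule Q.addsubI) auto
    show "k \<otimes>\<^bsub>?Q\<^esub> w \<in> carrier ?Q" if "k \<in> (+>\<^bsub>?R\<^esub>) P ` K" "w \<in> carrier ?Q" for k w
      using that subringE(1)[OF subfieldE(1)[OF sf]] by blast
  qed (use finK cardQ in auto)
  moreover have "Q.dim ((+>\<^bsub>?R\<^esub>) P ` K) (carrier ?Q) = pdeg P"
    by (simp add: place_degree_def Let_def V_def)
  moreover have "card ((+>\<^bsub>?R\<^esub>) P ` K) = card K" by (rule card_image[OF inj])
  ultimately have nq: "n = card K ^ pdeg P" using cardQ by simp
  then show "has_idx (OP P) P (card K ^ pdeg P)" using n by (simp add: V_def)
  have "\<one> \<notin> P" using PV one_vring[OF V] by (simp add: nonunits_def)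
  then have "n \<ge> 2" using has_idx_ge2[OF n AV AP one_vring[OF V]] by blast
  then show "1 \<le> pdeg P" using nq by (cases "pdeg P") auto
qed

lemma FI_idx1:
  assumes P: "P \<in> places F K"
  shows "has_idx (FI P n) (FI P (n + 1)) (card K ^ pdeg P)"
proof -
  obtain s where s: "s \<in> carrier F" "s \<noteq> \<zero>" "v P s = n" using v_value[OF P] by blast
  have "has_idx (FI P 0) (FI P 1) (card K ^ pdeg P)" using residue_idx(1)[OF P] FI_0[OF P] FI_1[OF P] by simp
  from has_idx_mult[OF this FI_addsub[OF P] FI_addsub[OF P] FI_mono s(1,2)]
  show ?thesis using FI_scale[OF P s(1,2)] s(3) by (simp add: add.commute)
qed

lemma FI_idx:
  assumes P: "P \<in> places F K"
  shows "has_idx (FI P n) (FI P (n + int k)) (card K ^ (k * pdeg P))"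
proof (induction k)
  case 0
  have "transversal (FI P n) (FI P n) {\<zero>}"
    by (rule transversalI[OF FI_addsub[OF P] addsubD(1)[OF FI_addsub[OF P]]])
      (use addsubD(1,2)[OF FI_addsub[OF P, of n]] in \<open>auto simp: incongruent_def minus_eq subset_iff\<close>)
  then show ?case unfolding has_idx_def by (intro exI[of _ "{\<zero>}"]) auto
next
  case (Suc k)
  have 1: "has_idx (FI P (n + int k)) (FI P (n + int (Suc k))) (card K ^ pdeg P)"
    using FI_idx1[OF P, of "n + int k"] by (simp add: algebra_simps)
  have "has_idx (FI P n) (FI P (n + int (Suc k))) (card K ^ (k * pdeg P) * card K ^ pdeg P)"
    by (rule has_idx_tower[OF Suc 1 FI_addsub[OF P] FI_addsub[OF P] FI_addsub[OF P] FI_mono FI_mono]) auto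
  then show ?case by (simp add: power_add mult.commute)
qed

lemma one_notin_place:
  assumes P: "P \<in> places F K"
  shows "\<one> \<notin> P"
proof -
  have "\<one> \<notin> nonunits (OP P)" using one_vring[OF placeD(1)[OF P]] by (simp add: nonunits_def)
  then show ?thesis by (subst placeD(2)[OF P])
qed

lemma place_facts:
  assumes P: "P \<in> places F K"
  shows "addsub P" "P \<subseteq> OP P" "\<And>a b. a \<in> OP P \<Longrightarrow> b \<in> P \<Longrightarrow> a \<otimes> b \<in> P" "subring (OP P) F"
    "\<And>a. a \<in> OP P \<Longrightarrow> a \<notin> P \<Longrightarrow> a \<noteq> \<zero> \<and> inv a \<in> OP P"
proof -
  note V = placeD(1)[OF P] and PV = placeD(2)[OF P]
  show "addsub P" using nonunits_addsub[OF V] PV by simp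
  show "P \<subseteq> OP P" by (subst PV) (auto simp: nonunits_def)
  show "a \<otimes> b \<in> P" if "a \<in> OP P" "b \<in> P" for a b using nonunits_mult[OF V that(1)] that(2) PV by simp
  show "subring (OP P) F" using vringD(1)[OF V] .
  show "a \<noteq> \<zero> \<and> inv a \<in> OP P" if "a \<in> OP P" "a \<notin> P" for a
    using that by (subst (asm) PV) (auto simp: nonunits_def)
qed

section \<open>Weak approximation\<close>

lemma OP_pow:
  assumes "P \<in> places F K" "a \<in> OP P"
  shows "a [^] (n::nat) \<in> OP P"
proof (induction n)
  case 0
  show ?case using one_vring[OF placeD(1)[OF assms(1)]] by simp
next
  case (Suc n)
  show ?case unfolding nat_pow_Suc by (rule vring_mult[OF placeD(1)[OF assms(1)] Suc assms(2)])
qed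

lemma pow_cong_one:
  assumes "subring R F" "addsub B" "B \<subseteq> R" "\<And>a b. a \<in> R \<Longrightarrow> b \<in> B \<Longrightarrow> a \<otimes> b \<in> B"
    "a \<in> R" "a \<ominus> \<one> \<in> B"
  shows "a [^] (k::nat) \<ominus> \<one> \<in> B" "a [^] k \<in> R"
proof -
  note R = subringE[OF assms(1)]
  have aF: "a \<in> carrier F" using assms R by auto
  show pw: "a [^] k \<in> R" for k :: nat using assms(5) R by (induction k) auto
  show "a [^] k \<ominus> \<one> \<in> B"
  proof (induction k)
    case 0
    then show ?case using addsubD(2)[OF assms(2)] by (simp add: minus_eq r_neg)
  next
    case (Suc k)
    have "a [^] k \<in> carrier F" using aF by simp
    then have "a [^] Suc k \<ominus> \<one> = a [^] k \<otimes> (a \<ominus> \<one>) \<oplus> (a [^] k \<ominus> \<one>)" unfolding nat_pow_Suc using aF by algebra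
    then show ?case using Suc addsubD(5)[OF assms(2)] assms(4)[OF pw assms(6)] by simp
  qed
qed

text \<open>By pigeonhole two of the powers y^0, ..., y^N agree modulo \<open>P\<close>, where N is
  the size of the residue field. So a nonzero residue has order at most N, which divides N!. The
  extra factor \<open>k\<close> allows exponents for several places to be multiplied
  together.\<close>

lemma residue_exponent:
  assumes P: "P \<in> places F K"
  shows "\<exists>M\<ge>1::nat. \<forall>k::nat. k \<ge> 1 \<longrightarrow> (\<forall>y\<in>OP P. y [^] (M * k) \<in> P \<or> y [^] (M * k) \<ominus> \<one> \<in> P)"
proof -
  note PF = place_facts[OF P]
  note R = subringE[OF PF(4)]
  define N where "N = card K ^ pdeg P"
  have "y [^] (fact N * k) \<in> P \<or> y [^] (fact N * k) \<ominus> \<one> \<in> P" if k: "k \<ge> 1" and y: "y \<in> OP P" for k :: nat and y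
  proof (cases "y \<in> P")
    case True
    obtain j where j: "fact N * k = Suc j" using k by (metis Suc_pred' fact_gt_zero mult_pos_pos less_le_trans zero_less_one)
    have "y [^] j \<in> OP P" by (rule OP_pow[OF P y])
    then show ?thesis unfolding j using PF(3)[OF _ True] by simp
  next
    case False
    have yF: "y \<in> carrier F" "y \<noteq> \<zero>" "inv y \<in> OP P" using y R(1) PF(5)[OF y False] by auto
    have pw: "y [^] i \<in> OP P" for i :: nat by (rule OP_pow[OF P y])
    have ipw: "inv (y [^] i) \<in> OP P" for i :: nat
    proof (induction i)
      case (Suc i)
      then show ?case using R(6)[OF Suc yF(3)] yF by (simp add: inv_mult_dist)
    qed (use R in auto)
    have "\<exists>i j. i < j \<and> j \<le> N \<and> y [^] j \<ominus> y [^] i \<in> P"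
    proof (rule ccontr)
      assume *: "\<not> ?thesis"
      have ne: "y [^] i \<ominus> y [^] j \<notin> P" if "i \<le> N" "j \<le> N" "i \<noteq> j" for i j
      proof -
        have "y [^] j \<ominus> y [^] i \<notin> P \<or> y [^] i \<ominus> y [^] j \<notin> P" using * that by (metis linorder_neqE_nat)
        then show ?thesis using diff_swap[OF PF(1), of "y [^] i" "y [^] j"] diff_swap[OF PF(1), of "y [^] j" "y [^] i"] yF by auto
      qed
      have "inj_on (\<lambda>i. y [^] i) {..N}"
      proof (rule inj_onI, rule ccontr)
        fix i j assume ij: "i \<in> {..N}" "j \<in> {..N}" "y [^] i = y [^] j" "i \<noteq> j"
        have "y [^] i \<ominus> y [^] j = \<zero>" using ij(3) yF by (simp add: r_neg minus_eq)
        then show False using ne[of i j] ij addsubD(2)[OF PF(1)] by auto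
      qed
      then have "card ((\<lambda>i. y [^] i) ` {..N}) = Suc N" by (simp add: card_image)
      moreover have "incongruent ((\<lambda>i. y [^] i) ` {..N}) P"
        unfolding incongruent_def using ne by (auto simp: image_iff)
      ultimately show False
        using incongruent_card_le[OF residue_idx(1)[OF P] PF(1) R(1), of "(\<lambda>i. y [^] i) ` {..N}"] pw
        unfolding N_def by auto
    qed
    then obtain i j where ij: "i < j" "j \<le> N" "y [^] j \<ominus> y [^] i \<in> P" by blast
    define m where "m = j - i"
    have m: "j = i + m" "m \<ge> 1" using ij(1) by (auto simp: m_def)
    have ym: "y [^] m \<ominus> \<one> \<in> P"
    proof -
      have c: "y [^] i \<in> carrier F" "y [^] m \<in> carrier F" "y [^] i \<noteq> \<zero>" using yF by auto
      have "y [^] j = y [^] i \<otimes> y [^] m" unfolding m(1) by (rule nat_pow_mult[OF yF(1), symmetric])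
      then have "y [^] j \<ominus> y [^] i = y [^] i \<otimes> y [^] m \<ominus> y [^] i" by (rule arg_cong)
      also have "\<dots> = y [^] i \<otimes> (y [^] m \<ominus> \<one>)" using c(1,2) by algebra
      finally have "inv (y [^] i) \<otimes> (y [^] j \<ominus> y [^] i) = inv (y [^] i) \<otimes> (y [^] i \<otimes> (y [^] m \<ominus> \<one>))"
        by (rule arg_cong)
      also have "\<dots> = y [^] m \<ominus> \<one>" by (rule inv_mult_l[OF c(1,3)]) (use c in auto)
      finally show ?thesis using PF(3)[OF ipw ij(3)] by metis
    qed
    have "m dvd fact N" using m ij by (intro dvd_fact) auto
    then obtain l where l: "fact N = m * l" by auto
    have "y [^] (fact N * k) = (y [^] m) [^] (l * k)" using yF by (simp add: nat_pow_pow l mult.assoc)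
    moreover have "(y [^] m) [^] (l * k) \<ominus> \<one> \<in> P"
      using pow_cong_one(1)[OF PF(4,1,2,3) pw ym] .
    ultimately show ?thesis by simp
  qed
  then show ?thesis by (intro exI[of _ "fact N"]) auto
qed

lemma residue_exponents:
  assumes "finite T" "T \<subseteq> places F K"
  shows "\<exists>M\<ge>1::nat. \<forall>P\<in>T. \<forall>y\<in>OP P. y [^] M \<in> P \<or> y [^] M \<ominus> \<one> \<in> P"
proof -
  have "\<exists>M\<ge>1::nat. \<forall>k\<ge>1. \<forall>P\<in>T. \<forall>y\<in>OP P. y [^] (M * k) \<in> P \<or> y [^] (M * k) \<ominus> \<one> \<in> P"
    using assms
  proof (induction T)
    case (insert P T)
    have "T \<subseteq> places F K" using insert.prems by simp
    from insert.IH[OF this] obtain M :: nat where M1: "M \<ge> 1"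
      "\<forall>k\<ge>1. \<forall>P\<in>T. \<forall>y\<in>OP P. y [^] (M * k) \<in> P \<or> y [^] (M * k) \<ominus> \<one> \<in> P"
      by (elim exE conjE)
    have M: "M \<ge> 1" "\<And>k P y. k \<ge> 1 \<Longrightarrow> P \<in> T \<Longrightarrow> y \<in> OP P \<Longrightarrow> y [^] (M * k) \<in> P \<or> y [^] (M * k) \<ominus> \<one> \<in> P"
      using M1 by simp_all
    have "P \<in> places F K" using insert.prems by simp
    from residue_exponent[OF this] obtain N :: nat where N1: "N \<ge> 1"
      "\<forall>k. k \<ge> 1 \<longrightarrow> (\<forall>y\<in>OP P. y [^] (N * k) \<in> P \<or> y [^] (N * k) \<ominus> \<one> \<in> P)"
      by (elim exE conjE)
    have N: "N \<ge> 1" "\<And>k y. k \<ge> 1 \<Longrightarrow> y \<in> OP P \<Longrightarrow> y [^] (N * k) \<in> P \<or> y [^] (N * k) \<ominus> \<one> \<in> P"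
      using N1 by simp_all
    have "y [^] (M * N * k) \<in> Q \<or> y [^] (M * N * k) \<ominus> \<one> \<in> Q" if "k \<ge> 1" "Q \<in> insert P T" "y \<in> OP Q" for k Q y
    proof (cases "Q = P")
      case True
      have "M * k \<ge> 1" using M(1) that(1) by simp
      then have "y [^] (N * (M * k)) \<in> P \<or> y [^] (N * (M * k)) \<ominus> \<one> \<in> P" using N(2) that True by blast
      moreover have "M * N * k = N * (M * k)" by simp
      ultimately show ?thesis using True by (simp only:)
    next
      case False
      have "N * k \<ge> 1" using N(1) that(1) by simp
      moreover have "M * N * k = M * (N * k)" by simp
      ultimately show ?thesis using M(2)[of "N * k" Q y] that False by (simp only: insert_iff) blast
    qed
    then show ?case using M(1) N(1) by (intro exI[of _ "M * N"]) auto
  qed auto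
  then obtain M :: nat where M: "M \<ge> 1"
    "\<forall>k\<ge>1. \<forall>P\<in>T. \<forall>y\<in>OP P. y [^] (M * k) \<in> P \<or> y [^] (M * k) \<ominus> \<one> \<in> P"
    by (elim exE conjE)
  then show ?thesis using M(2)[rule_format, of 1] by (intro exI[of _ M]) simp
qed

text \<open>
  If every residue at the places of \<open>T\<close> has \<open>M\<close>-th power 0 or 1, then \<open>1 / (1 - s + s\<^sup>2)\<close> with \<open>s = y\<^sup>M\<close> is
  congruent to 1 where \<open>y\<close> is integral and vanishes at the poles of \<open>y\<close>.
\<close>

lemma indicator_element:
  assumes T: "finite T" "T \<subseteq> places F K" and y: "y \<in> carrier F"
  shows "\<exists>e\<in>carrier F. \<forall>P\<in>T. e \<in> OP P \<and> (if y \<in> OP P then e \<ominus> \<one> \<in> P else e \<in> P)"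
proof -
  from residue_exponents[OF T] obtain M :: nat where M1: "M \<ge> 1"
    "\<forall>P\<in>T. \<forall>y\<in>OP P. y [^] M \<in> P \<or> y [^] M \<ominus> \<one> \<in> P"
    by (elim exE conjE)
  have M: "M \<ge> 1" "\<And>P z. P \<in> T \<Longrightarrow> z \<in> OP P \<Longrightarrow> z [^] M \<in> P \<or> z [^] M \<ominus> \<one> \<in> P"
    using M1 by simp_all
  define D where "D s = \<one> \<ominus> s \<oplus> s \<otimes> s" for s
  \<comment> \<open>D s = 1 - s(1 - s), and s(1 - s) lies in \<open>P\<close> when s is 0 or 1
    modulo \<open>P\<close>. So D s is a unit congruent to one, and so is its inverse.\<close>
  have unit: "D s \<noteq> \<zero> \<and> inv (D s) \<in> OP P \<and> inv (D s) \<ominus> \<one> \<in> P"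
    if P: "P \<in> T" and s: "s \<in> OP P" "s \<in> P \<or> s \<ominus> \<one> \<in> P" for P s
  proof -
    have PP: "P \<in> places F K" using P T by auto
    note PF = place_facts[OF PP]
    note R = subringE[OF PF(4)]
    have sF: "s \<in> carrier F" using s R by auto
    have ss: "s \<otimes> (\<one> \<ominus> s) \<in> P"
      using s(2)
    proof
      assume "s \<in> P"
      moreover have "\<one> \<ominus> s \<in> OP P" by (rule addsubD(3)[OF addsub_subring[OF PF(4)] R(3) s(1)])
      ultimately have "(\<one> \<ominus> s) \<otimes> s \<in> P" by (intro PF(3))
      then show ?thesis using sF by (simp add: m_comm)
    next
      assume "s \<ominus> \<one> \<in> P"
      then have "\<one> \<ominus> s \<in> P" using diff_swap[OF PF(1) sF] by auto
      then show ?thesis by (rule PF(3)[OF s(1)])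
    qed
    have D: "D s = \<one> \<ominus> s \<otimes> (\<one> \<ominus> s)" unfolding D_def using sF by algebra
    have DV: "D s \<in> OP P" unfolding D using addsubD(3)[OF addsub_subring[OF PF(4)] R(3)] ss PF(2) by auto
    have DF: "D s \<in> carrier F" using DV R by auto
    have "D s \<notin> P"
    proof
      assume "D s \<in> P"
      then have "D s \<oplus> s \<otimes> (\<one> \<ominus> s) \<in> P" using addsubD(5)[OF PF(1)] ss by blast
      moreover have "D s \<oplus> s \<otimes> (\<one> \<ominus> s) = \<one>" unfolding D_def using sF by algebra
      ultimately show False using one_notin_place[OF PP] by simp
    qed
    then have u: "D s \<noteq> \<zero>" "inv (D s) \<in> OP P" using PF(5)[OF DV] by auto
    have "s \<otimes> (\<one> \<ominus> s) = \<one> \<ominus> D s" unfolding D_def using sF by algebra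
    then have "inv (D s) \<otimes> (s \<otimes> (\<one> \<ominus> s)) = inv (D s) \<otimes> (\<one> \<ominus> D s)" by (rule arg_cong)
    also have "\<dots> = inv (D s) \<ominus> \<one>" using DF u(1) inv_closed[OF DF u(1)] by (simp add: minus_eq r_distr r_minus)
    finally have "inv (D s) \<ominus> \<one> \<in> P" using PF(3)[OF u(2) ss] by simp
    then show ?thesis using u by blast
  qed
  define s where "s = y [^] M"
  have sF: "s \<in> carrier F" unfolding s_def using y by simp
  have key: "D s \<noteq> \<zero> \<and> inv (D s) \<in> OP P \<and> (if y \<in> OP P then inv (D s) \<ominus> \<one> \<in> P else inv (D s) \<in> P)" if P: "P \<in> T" for P
  proof (cases "y \<in> OP P")
    case True
    have PP: "P \<in> places F K" using P T by auto
    have "s \<in> OP P" unfolding s_def by (rule OP_pow[OF PP True])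
    then show ?thesis using unit[OF P, of s] M(2)[OF P True] True s_def by auto
  next
    case False
    have PP: "P \<in> places F K" using P T by auto
    note PF = place_facts[OF PP] and V = placeD(1)[OF PP]
    note R = subringE[OF PF(4)]
    have y0: "y \<noteq> \<zero>" using False R(2) by auto
    have s0: "s \<noteq> \<zero>" unfolding s_def using y y0 by simp
    have "v P y < 0" using v_OP(1)[OF PP y y0] False by auto
    then have "v P s < 0" unfolding s_def using v_pow[OF PP y y0, of M] M(1) by (simp add: mult_less_0_iff)
    then have w: "inv s \<in> P" using v_OP(2)[OF PP, of "inv s"] v_inv[OF PP sF s0] sF s0 by auto
    have wV: "inv s \<in> OP P" using w PF(2) by auto
    have wF: "inv s \<in> carrier F" using sF s0 by simp
    note u = unit[OF P wV disjI1[OF w]]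
    have DF: "D (inv s) \<in> carrier F" "D s \<in> carrier F" unfolding D_def using wF sF by auto
    \<comment> \<open>At a pole of \<open>y\<close> the identity D(s) = s^2 D(1/s) reduces to 1/s,
      which lies in \<open>P\<close>. Hence 1/D(s) is 1/s^2 times a unit and vanishes at
      \<open>P\<close>.\<close>
    have "s \<otimes> s \<otimes> D (inv s) = s \<otimes> s \<ominus> s \<otimes> (s \<otimes> inv s) \<oplus> (s \<otimes> inv s) \<otimes> (s \<otimes> inv s)"
      unfolding D_def using sF wF by algebra
    also have "\<dots> = D s" unfolding D_def using sF s0 by (simp, algebra)
    finally have Ds: "D s = s \<otimes> s \<otimes> D (inv s)" by simp
    then have "D s \<noteq> \<zero>" using sF s0 DF u by simp
    moreover have "inv (D s) = inv s \<otimes> inv s \<otimes> inv (D (inv s))" unfolding Ds using sF s0 DF u by (simp add: inv_mult_dist)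
    moreover have "inv s \<otimes> inv s \<otimes> inv (D (inv s)) \<in> P"
      using PF(3)[of "inv (D (inv s))" "inv s \<otimes> inv s"] PF(3)[OF wV w] u wF DF by (simp add: m_comm)
    ultimately show ?thesis using False PF(2) by auto
  qed
  show ?thesis
  proof (cases "T = {}")
    case False
    then obtain P where "P \<in> T" by blast
    then have "D s \<noteq> \<zero>" using key by auto
    moreover have "D s \<in> carrier F" unfolding D_def using sF by auto
    ultimately show ?thesis using key by (intro bexI[of _ "inv (D s)"]) auto
  qed (auto intro: one_closed)
qed

text \<open>A discrete valuation ring is a maximal proper subring: if \<open>OP Q\<close> contained
  \<open>OP P\<close> properly, powers of an element with a pole at \<open>P\<close> would absorb
  the poles of any field element, and \<open>OP Q\<close> would be the whole field.\<close>

lemma places_incomparable: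
  assumes P: "P \<in> places F K" "Q \<in> places F K" "P \<noteq> Q"
  shows "\<exists>y\<in>OP P. y \<notin> OP Q"
proof (rule ccontr)
  assume "\<not> ?thesis"
  then have sub: "OP P \<subseteq> OP Q" by auto
  have "OP P \<noteq> OP Q" using placeD(2)[OF P(1)] placeD(2)[OF P(2)] P(3) by metis
  then obtain z where z: "z \<in> OP Q" "z \<notin> OP P" using sub by blast
  note RP = subringE[OF place_facts(4)[OF P(1)]] and RQ = subringE[OF place_facts(4)[OF P(2)]]
  have zF: "z \<in> carrier F" "z \<noteq> \<zero>" using z RQ RP(2) by auto
  have vz: "v P z < 0" using v_OP(1)[OF P(1) zF] z by auto
  have "w \<in> OP Q" if w: "w \<in> carrier F" for w
  proof (cases "w = \<zero>")
    case False
    define n where "n = nat \<bar>v P w\<bar>"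
    have "v P (w \<otimes> inv (z [^] n)) = v P w - int n * v P z"
      using v_mult[OF P(1) w False, of "inv (z [^] n)"] v_inv[OF P(1), of "z [^] n"] v_pow[OF P(1) zF] zF by simp
    moreover have "int n * v P z \<le> int n * (- 1)" using vz by (intro mult_left_mono) auto
    ultimately have "0 \<le> v P (w \<otimes> inv (z [^] n))" unfolding n_def by simp
    then have "w \<otimes> inv (z [^] n) \<in> OP Q" using v_OP(1)[OF P(1), of "w \<otimes> inv (z [^] n)"] w False zF sub by auto
    moreover have "z [^] n \<in> OP Q" by (rule OP_pow[OF P(2) z(1)])
    ultimately have "(w \<otimes> inv (z [^] n)) \<otimes> z [^] n \<in> OP Q" using RQ(6) by blast
    then show ?thesis using w zF by (simp add: m_assoc)
  qed (use RQ in auto)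
  then show False using vringD(3,4)[OF placeD(1)[OF P(2)]] by blast
qed

text \<open>For each other place \<open>Q\<close> an element integral at \<open>P\<close> but not at
  \<open>Q\<close> yields an indicator of the pair. The product of these indicators is 1 modulo
  \<open>P\<close> and vanishes at all the other places, to first order; a polynomial in it raises
  the order to \<open>s\<close>.\<close>

lemma separating_element:
  assumes T: "finite T" "T \<subseteq> places F K" and P: "P \<in> T"
  shows "\<exists>e\<in>carrier F. e \<ominus> \<one> \<in> FI P (int s) \<and> (\<forall>Q\<in>T - {P}. e \<in> FI Q (int s))"
proof -
  have PP: "P \<in> places F K" using P T by auto
  have "\<exists>e\<in>carrier F. (\<forall>Q\<in>T. e \<in> OP Q) \<and> e \<ominus> \<one> \<in> P \<and> (\<forall>Q\<in>T'. e \<in> Q)" if "finite T'" "T' \<subseteq> T - {P}" for T'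
    using that
  proof (induction T')
    case empty
    show ?case
    proof (intro bexI[of _ \<one>] conjI)
      show "\<forall>Q\<in>T. \<one> \<in> OP Q" using T one_vring[OF placeD(1)] by blast
      show "\<one> \<ominus> \<one> \<in> P" using addsubD(2)[OF place_facts(1)[OF PP]] by (simp add: minus_eq r_neg)
    qed auto
  next
    case (insert Q T')
    obtain e where e: "e \<in> carrier F" "\<And>Q. Q \<in> T \<Longrightarrow> e \<in> OP Q" "e \<ominus> \<one> \<in> P" "\<And>Q. Q \<in> T' \<Longrightarrow> e \<in> Q"
      using insert by auto
    have Q: "Q \<in> places F K" "Q \<in> T" "P \<noteq> Q" using insert.prems T by auto
    obtain y where y: "y \<in> OP P" "y \<notin> OP Q" using places_incomparable[OF PP Q(1,3)] by blast
    have yF: "y \<in> carrier F" using y vring_carrier[OF placeD(1)[OF PP]] by auto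
    obtain e' where e': "e' \<in> carrier F" "\<And>Q. Q \<in> T \<Longrightarrow> e' \<in> OP Q \<and> (if y \<in> OP Q then e' \<ominus> \<one> \<in> Q else e' \<in> Q)"
      using indicator_element[OF T yF] by blast
    have "e \<otimes> e' \<ominus> \<one> = e \<otimes> (e' \<ominus> \<one>) \<oplus> (e \<ominus> \<one>)" using e(1) e'(1) by algebra
    then have 1: "e \<otimes> e' \<ominus> \<one> \<in> P"
      using place_facts(3)[OF PP e(2)[OF P], of "e' \<ominus> \<one>"] e'(2)[OF P] y(1) addsubD(5)[OF place_facts(1)[OF PP]] e(3) by auto
    have 2: "e \<otimes> e' \<in> R" if "R \<in> insert Q T'" for R
    proof (cases "R = Q")
      case True
      then show ?thesis using place_facts(3)[OF Q(1) e(2)[OF Q(2)]] e'(2)[OF Q(2)] y(2) by auto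
    next
      case False
      then have R: "R \<in> T'" "R \<in> T" "R \<in> places F K" using that insert.prems T by auto
      then have "e' \<otimes> e \<in> R" using place_facts(3)[OF R(3)] e'(2)[OF R(2)] e(4)[OF R(1)] by auto
      then show ?thesis using e e' by (simp add: m_comm)
    qed
    have 3: "e \<otimes> e' \<in> OP R" if "R \<in> T" for R
      using subringE(6)[OF place_facts(4)] e(2)[OF that] e'(2)[OF that] T that by blast
    show ?case using 1 2 3 e e' by (intro bexI[of _ "e \<otimes> e'"]) auto
  qed
  from this[of "T - {P}"] T obtain e where e: "e \<in> carrier F" "\<And>Q. Q \<in> T \<Longrightarrow> e \<in> OP Q" "e \<ominus> \<one> \<in> P" "\<And>Q. Q \<in> T - {P} \<Longrightarrow> e \<in> Q"
    by auto
  have FIpow: "a [^] n \<in> FI Q (int n)" if "Q \<in> places F K" "a \<in> Q" for Q a and n :: nat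
  proof (induction n)
    case 0
    then show ?case using FI_0[OF that(1)] one_vring[OF placeD(1)[OF that(1)]] by simp
  next
    case (Suc n)
    have "a \<in> FI Q 1" using FI_1[OF that(1)] that(2) by simp
    from FI_mult[OF that(1) Suc this] show ?case by (simp add: add.commute)
  qed
  \<comment> \<open>If e is 1 modulo \<open>P\<close>, then 1 - e^s lies in \<open>P\<close>, so its
    s-th power lies in P^s. If e lies in Q, then 1 - e^s is 1 modulo Q^s, hence so is its s-th
    power. Both congruences thus reach order \<open>s\<close>.\<close>
  let ?f = "\<one> \<ominus> (\<one> \<ominus> e [^] s) [^] s"
  have eF: "e [^] s \<in> carrier F" "(\<one> \<ominus> e [^] s) [^] s \<in> carrier F" using e(1) by auto
  have "\<one> \<ominus> e [^] s \<in> P"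
    using pow_cong_one(1)[OF place_facts(4,1,2,3)[OF PP] e(2)[OF P] e(3)]
      diff_swap[OF place_facts(1)[OF PP] eF(1) one_closed] by auto
  from FIpow[OF PP this, of s] have "\<ominus> ((\<one> \<ominus> e [^] s) [^] s) \<in> FI P (int s)"
    using addsubD(4)[OF FI_addsub[OF PP]] by blast
  moreover have "?f \<ominus> \<one> = \<ominus> ((\<one> \<ominus> e [^] s) [^] s)" using eF by algebra
  ultimately have "?f \<ominus> \<one> \<in> FI P (int s)" by simp
  moreover have "?f \<in> FI Q (int s)" if "Q \<in> T - {P}" for Q
  proof -
    have Q: "Q \<in> places F K" "Q \<in> T" using that T by auto
    note FA = FI_addsub[OF Q(1), of "int s"]
    have sub: "FI Q (int s) \<subseteq> OP Q" using FI_mono[of 0 "int s" Q] FI_0[OF Q(1)] by auto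
    have mul: "a \<otimes> b \<in> FI Q (int s)" if "a \<in> OP Q" "b \<in> FI Q (int s)" for a b
      using FI_mult[OF Q(1), of a 0 b "int s"] that FI_0[OF Q(1)] by auto
    have es: "e [^] s \<in> FI Q (int s)" using FIpow[OF Q(1) e(4)[OF that]] .
    have "(\<one> \<ominus> e [^] s) \<ominus> \<one> = \<ominus> (e [^] s)" using eF by algebra
    then have 1: "(\<one> \<ominus> e [^] s) \<ominus> \<one> \<in> FI Q (int s)" using addsubD(4)[OF FA es] by simp
    have "\<one> \<ominus> e [^] s \<in> OP Q"
      using addsubD(3)[OF addsub_subring[OF place_facts(4)[OF Q(1)]]] one_vring[OF placeD(1)[OF Q(1)]] es sub by blast
    from pow_cong_one(1)[OF place_facts(4)[OF Q(1)] FA sub mul this 1]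
    show ?thesis using diff_swap[OF FA eF(2) one_closed] by blast
  qed
  moreover have "?f \<in> carrier F" using eF by auto
  ultimately show ?thesis by blast
qed

lemma weak_approximation:
  assumes T: "finite T" "T \<subseteq> places F K" and a: "\<And>P. P \<in> T \<Longrightarrow> a P \<in> carrier F"
  shows "\<exists>z\<in>carrier F. \<forall>P\<in>T. z \<ominus> a P \<in> FI P n"
proof -
  have "\<exists>z\<in>carrier F. (\<forall>P\<in>T'. z \<ominus> a P \<in> FI P n) \<and> (\<forall>P\<in>T - T'. z \<in> FI P n)" if "finite T'" "T' \<subseteq> T" for T'
    using that
  proof (induction T')
    case empty
    show ?case by (intro bexI[of _ \<zero>]) (auto simp: FI_def)
  next
    case (insert P T')
    obtain z where z: "z \<in> carrier F" "\<And>P. P \<in> T' \<Longrightarrow> z \<ominus> a P \<in> FI P n" "\<And>P. P \<in> T - T' \<Longrightarrow> z \<in> FI P n"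
      using insert by auto
    have P: "P \<in> T" "P \<in> places F K" using insert.prems T by auto
    have aF: "a P \<in> carrier F" using a[OF P(1)] .
    \<comment> \<open>A bound for the pole orders of \<open>a P\<close> at all places of
      \<open>T\<close>. A separating element of order n + c absorbs them and still leaves order
      n.\<close>
    define c where "c = (\<Sum>Q\<in>T. \<bar>v Q (a P)\<bar>)"
    have c: "a P \<in> FI Q (- c)" if "Q \<in> T" for Q
    proof -
      have "\<bar>v Q (a P)\<bar> \<le> c" unfolding c_def using that T(1) by (intro member_le_sum) auto
      then show ?thesis using aF by (auto simp: FI_def)
    qed
    obtain e where e: "e \<in> carrier F" "e \<ominus> \<one> \<in> FI P (int (nat (n + c)))" "\<And>Q. Q \<in> T - {P} \<Longrightarrow> e \<in> FI Q (int (nat (n + c)))"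
      using separating_element[OF T P(1), of "nat (n + c)"] by auto
    have le: "n \<le> - c + int (nat (n + c))" by simp
    have ae: "a P \<otimes> e \<in> FI Q n" if "Q \<in> T - {P}" for Q
      using FI_mult[OF _ c e(3)[OF that]] FI_mono[OF le, of Q] that T by blast
    have "a P \<otimes> (e \<ominus> \<one>) \<in> FI P n"
      using FI_mult[OF P(2) c[OF P(1)] e(2)] FI_mono[OF le, of P] by blast
    moreover have "a P \<otimes> e \<ominus> a P = a P \<otimes> (e \<ominus> \<one>)" using aF e(1) by algebra
    ultimately have aeP: "a P \<otimes> e \<ominus> a P \<in> FI P n" by simp
    let ?z = "z \<oplus> a P \<otimes> e"
    have zF: "?z \<in> carrier F" using z e aF by auto
    have "?z \<ominus> a Q \<in> FI Q n" if Q: "Q \<in> insert P T'" for Q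
    proof (cases "Q = P")
      case True
      have "P \<notin> T'" using insert by auto
      then have "z \<in> FI P n" using z(3) P by auto
      moreover have "?z \<ominus> a P = z \<oplus> (a P \<otimes> e \<ominus> a P)" using z(1) e(1) aF by algebra
      ultimately show ?thesis using True addsubD(5)[OF FI_addsub[OF P(2)]] aeP by simp
    next
      case False
      then have QT: "Q \<in> T'" "Q \<in> T - {P}" "Q \<in> places F K" using Q insert.prems T by auto
      have "a Q \<in> carrier F" using a QT by auto
      then have "?z \<ominus> a Q = (z \<ominus> a Q) \<oplus> a P \<otimes> e" using z(1) e(1) aF by algebra
      then show ?thesis using addsubD(5)[OF FI_addsub[OF QT(3)] z(2)[OF QT(1)] ae[OF QT(2)]] by simp
    qed
    moreover have "?z \<in> FI Q n" if Q: "Q \<in> T - insert P T'" for Q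
    proof -
      have "Q \<in> places F K" using Q T by auto
      then show ?thesis using addsubD(5)[OF FI_addsub z(3) ae] Q by auto
    qed
    ultimately show ?case using zF by blast
  qed
  from this[OF T(1)] show ?thesis by auto
qed

text \<open>In the ring \<open>R\<close> of elements integral on \<open>T\<close>, weak
  approximation realizes every tuple of residues modulo the powers P^(v_P(z)). Different tuples are
  incongruent modulo zR, so \<open>multiplier_bound\<close> limits their number.\<close>

lemma fundamental_inequality:
  assumes z: "z \<in> carrier F" "z \<noteq> \<zero>" "multiplier z e c"
    and T: "finite T" "T \<subseteq> places F K" "\<And>P. P \<in> T \<Longrightarrow> 0 \<le> v P z"
  shows "card K ^ (\<Sum>P\<in>T. nat (v P z) * pdeg P) \<le> card W ^ c"
proof -
  define R where "R = carrier F \<inter> (\<Inter>P\<in>T. OP P)"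
  have srP: "subring (OP P) F" if "P \<in> T" for P using place_facts(4) T that by auto
  have R: "subring R F"
    by (rule subringI) (use subringE[OF srP] in \<open>auto simp: R_def\<close>)
  have zR: "z \<in> R" unfolding R_def using z v_OP(1)[OF _ z(1,2)] T by auto
  have "\<forall>P\<in>T. \<exists>C. finite C \<and> card C = card K ^ (nat (v P z) * pdeg P) \<and> transversal (OP P) (FI P (v P z)) C"
  proof
    fix P assume P: "P \<in> T"
    then have PP: "P \<in> places F K" using T by auto
    have "has_idx (FI P 0) (FI P (0 + int (nat (v P z)))) (card K ^ (nat (v P z) * pdeg P))" by (rule FI_idx[OF PP])
    then show "\<exists>C. finite C \<and> card C = card K ^ (nat (v P z) * pdeg P) \<and> transversal (OP P) (FI P (v P z)) C"
      using FI_0[OF PP] T(3)[OF P] by (simp add: has_idx_def)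
  qed
  then obtain C where C: "\<And>P. P \<in> T \<Longrightarrow> finite (C P) \<and> card (C P) = card K ^ (nat (v P z) * pdeg P) \<and> transversal (OP P) (FI P (v P z)) (C P)"
    by metis
  have CV: "C P \<subseteq> OP P" if "P \<in> T" for P using C[OF that] transversalD(1) by blast
  \<comment> \<open>All summands are nonnegative, so this single exponent dominates every
    \<open>v P z\<close> and one order of approximation serves all places.\<close>
  define n where "n = (\<Sum>P\<in>T. v P z)"
  have vn: "v P z \<le> n" if "P \<in> T" for P unfolding n_def using that T by (intro member_le_sum) auto
  have "\<forall>f\<in>PiE T C. \<exists>y\<in>carrier F. \<forall>P\<in>T. y \<ominus> f P \<in> FI P n"
  proof
    fix f assume f: "f \<in> PiE T C"
    have "f P \<in> carrier F" if "P \<in> T" for P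
      using f that CV[OF that] subringE(1)[OF srP[OF that]] by (auto dest: PiE_mem)
    then show "\<exists>y\<in>carrier F. \<forall>P\<in>T. y \<ominus> f P \<in> FI P n" by (rule weak_approximation[OF T(1,2)])
  qed
  then obtain g where g: "\<And>f. f \<in> PiE T C \<Longrightarrow> g f \<in> carrier F \<and> (\<forall>P\<in>T. g f \<ominus> f P \<in> FI P n)" by metis
  have gR: "g f \<in> R" if f: "f \<in> PiE T C" for f
  proof -
    have "g f \<in> OP P" if P: "P \<in> T" for P
    proof -
      have PP: "P \<in> places F K" using P T by auto
      have fP: "f P \<in> OP P" using f P CV by (auto dest: PiE_mem)
      have "FI P n \<subseteq> FI P 0" using vn[OF P] T(3)[OF P] by (intro FI_mono) linarith
      then have "g f \<ominus> f P \<in> OP P" using g[OF f] P FI_0[OF PP] by auto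
      then have "(g f \<ominus> f P) \<oplus> f P \<in> OP P" using subringE(7)[OF srP[OF P]] fP by auto
      moreover have "(g f \<ominus> f P) \<oplus> f P = g f"
      proof -
        have "g f \<in> carrier F" "f P \<in> carrier F" using g[OF f] fP subringE(1)[OF srP[OF P]] by auto
        then show ?thesis by algebra
      qed
      ultimately show ?thesis by simp
    qed
    then show ?thesis using g[OF f] by (simp add: R_def)
  qed
  have key: "f = f'" if f: "f \<in> PiE T C" "f' \<in> PiE T C" and d: "g f \<ominus> g f' \<in> (\<otimes>) z ` R" for f f'
  proof (rule PiE_ext[OF f])
    fix P assume P: "P \<in> T"
    then have PP: "P \<in> places F K" using T by auto
    have fP: "f P \<in> C P" "f' P \<in> C P" using f P by (auto dest: PiE_mem)
    then have fF: "f P \<in> OP P" "f' P \<in> OP P" using CV[OF P] by auto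
    then have fF': "f P \<in> carrier F" "f' P \<in> carrier F" using subringE(1)[OF srP[OF P]] by auto
    note FA = FI_addsub[OF PP, of "v P z"]
    have "(\<otimes>) z ` R \<subseteq> (\<otimes>) z ` FI P 0" using FI_0[OF PP] P unfolding R_def by blast
    then have 1: "g f \<ominus> g f' \<in> FI P (v P z)" using d FI_scale[OF PP z(1,2), of 0] by auto
    have 2: "g f \<ominus> f P \<in> FI P (v P z)" "g f' \<ominus> f' P \<in> FI P (v P z)"
      using g f P FI_mono[OF vn[OF P], of P] by blast+
    have gF: "g f \<in> carrier F" "g f' \<in> carrier F" using g f by auto
    have "f P \<ominus> f' P = (g f \<ominus> g f') \<ominus> (g f \<ominus> f P) \<oplus> (g f' \<ominus> f' P)" using gF fF' by algebra
    then have "f P \<ominus> f' P \<in> FI P (v P z)" using addsubD(3,5)[OF FA] 1 2 by metis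
    then show "f P = f' P"
      using transversal_incongruent[of "OP P" "FI P (v P z)" "C P"] C[OF P] FA subringE(1)[OF srP[OF P]] fP
      unfolding incongruent_def by blast
  qed
  have zero: "\<zero> \<in> (\<otimes>) z ` R" using subringE(2)[OF R] z by (auto intro!: image_eqI[of _ _ \<zero>])
  have inj: "inj_on g (PiE T C)"
  proof (rule inj_onI)
    fix f f' assume f: "f \<in> PiE T C" "f' \<in> PiE T C" "g f = g f'"
    have "g f \<ominus> g f' = \<zero>" using f g by (simp add: r_neg minus_eq)
    then show "f = f'" using key f zero by metis
  qed
  have fin: "finite (PiE T C)" using T C by (intro finite_PiE) auto
  have "incongruent (g ` PiE T C) ((\<otimes>) z ` R)"
    unfolding incongruent_def
  proof (intro ballI impI notI)
    fix a b assume ab: "a \<in> g ` PiE T C" "b \<in> g ` PiE T C" "a \<noteq> b" "a \<ominus> b \<in> (\<otimes>) z ` R"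
    then obtain f f' where f: "f \<in> PiE T C" "a = g f" "f' \<in> PiE T C" "b = g f'" by blast
    then have "f = f'" using key ab(4) by blast
    then show False using ab(3) f by simp
  qed
  from multiplier_bound[OF z(3,2) R zR _ _ this] have "card (g ` PiE T C) \<le> card W ^ c"
    using gR fin by auto
  moreover have "card (g ` PiE T C) = (\<Prod>P\<in>T. card (C P))"
    using card_image[OF inj] card_PiE[OF T(1)] by simp
  moreover have "(\<Prod>P\<in>T. card (C P)) = card K ^ (\<Sum>P\<in>T. nat (v P z) * pdeg P)"
    using C by (simp add: power_sum)
  ultimately show ?thesis by simp
qed

text \<open>Every zero contributes at least 1 to the exponent. A set of \<open>card W ^ c\<close>
  zeros would therefore violate the fundamental inequality, as an exponent is smaller than the power
  of q it belongs to.\<close>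

lemma finite_zeros:
  assumes z: "z \<in> carrier F" "z \<noteq> \<zero>"
  shows "finite {P \<in> places F K. 0 < v P z}"
proof (rule ccontr)
  obtain e c where ec: "multiplier z e c" using multiplier_exists[OF z(1)] by auto
  assume "infinite {P \<in> places F K. 0 < v P z}"
  then obtain T where T: "T \<subseteq> {P \<in> places F K. 0 < v P z}" "finite T" "card T = card W ^ c"
    using infinite_arbitrarily_large by blast
  have "card T \<le> (\<Sum>P\<in>T. nat (v P z) * pdeg P)"
  proof -
    have "1 \<le> nat (v P z) * pdeg P" if "P \<in> T" for P
    proof -
      have P: "P \<in> places F K" "0 < v P z" using T(1) that by auto
      then have "1 \<le> nat (v P z)" "1 \<le> pdeg P" using residue_idx(2) by auto
      then show ?thesis using mult_le_mono by fastforce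
    qed
    then have "(\<Sum>P\<in>T. 1) \<le> (\<Sum>P\<in>T. nat (v P z) * pdeg P)" by (rule sum_mono)
    then show ?thesis by simp
  qed
  moreover have "card K ^ (\<Sum>P\<in>T. nat (v P z) * pdeg P) \<le> card W ^ c"
    by (rule fundamental_inequality[OF z ec T(2)]) (use T(1) in auto)
  moreover have "(\<Sum>P\<in>T. nat (v P z) * pdeg P) < card K ^ (\<Sum>P\<in>T. nat (v P z) * pdeg P)"
    using subfield_card_ge2[OF K finK] by (intro power_gt_expt) auto
  ultimately show False using T(3) by linarith
qed

lemma finite_support:
  assumes z: "z \<in> carrier F" "z \<noteq> \<zero>"
  shows "finite {P \<in> places F K. v P z \<noteq> 0}"
proof -
  have "{P \<in> places F K. v P z \<noteq> 0} \<subseteq> {P \<in> places F K. 0 < v P z} \<union> {P \<in> places F K. 0 < v P (inv z)}"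
    using v_inv[OF _ z] by auto
  then show ?thesis using finite_zeros[OF z] finite_zeros[of "inv z"] z finite_subset by auto
qed


section \<open>Divisors and Riemann-Roch spaces\<close>

abbreviation q :: nat
  where "q \<equiv> card K"

lemma q_ge2: "2 \<le> q"
  by (rule subfield_card_ge2[OF K finK])

abbreviation Div :: "('a set \<Rightarrow> int) set"
  where "Div \<equiv> divisors F K"

definition degD :: "('a set \<Rightarrow> int) \<Rightarrow> int"
  where "degD D = (\<Sum>P | D P \<noteq> 0. D P * int (pdeg P))"

lemma DivI:
  assumes "finite A" "A \<subseteq> places F K" "\<And>P. P \<notin> A \<Longrightarrow> D P = 0"
  shows "D \<in> Div"
proof -
  have "{P. D P \<noteq> 0} \<subseteq> A" using assms(3) by auto
  then show ?thesis using assms(1,2) finite_subset by (auto simp: divisors_def)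
qed

lemma DivD:
  assumes "D \<in> Div"
  shows "finite {P. D P \<noteq> 0}" "{P. D P \<noteq> 0} \<subseteq> places F K" "\<And>P. P \<notin> places F K \<Longrightarrow> D P = 0"
  using assms by (auto simp: divisors_def)

lemma degD_superset:
  assumes "finite A" "{P. D P \<noteq> 0} \<subseteq> A"
  shows "degD D = (\<Sum>P\<in>A. D P * int (pdeg P))"
  unfolding degD_def by (rule sum.mono_neutral_left) (use assms in auto)

lemma Div_add:
  assumes "D \<in> Div" "E \<in> Div"
  shows "(\<lambda>P. D P + E P) \<in> Div" "degD (\<lambda>P. D P + E P) = degD D + degD E"
proof -
  let ?A = "{P. D P \<noteq> 0} \<union> {P. E P \<noteq> 0}"
  have A: "finite ?A" "?A \<subseteq> places F K" using DivD[OF assms(1)] DivD[OF assms(2)] by auto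
  show "(\<lambda>P. D P + E P) \<in> Div" by (rule DivI[OF A]) auto
  have "degD (\<lambda>P. D P + E P) = (\<Sum>P\<in>?A. (D P + E P) * int (pdeg P))"
    by (rule degD_superset) (use A in auto)
  also have "\<dots> = (\<Sum>P\<in>?A. D P * int (pdeg P)) + (\<Sum>P\<in>?A. E P * int (pdeg P))"
    by (simp add: distrib_right sum.distrib)
  also have "\<dots> = degD D + degD E" using degD_superset[of ?A D] degD_superset[of ?A E] A by auto
  finally show "degD (\<lambda>P. D P + E P) = degD D + degD E" .
qed

lemma Div_scale:
  assumes "D \<in> Div"
  shows "(\<lambda>P. k * D P) \<in> Div" "degD (\<lambda>P. k * D P) = k * degD D"
proof -
  let ?A = "{P. D P \<noteq> 0}"
  show "(\<lambda>P. k * D P) \<in> Div" by (rule DivI[of ?A]) (use DivD[OF assms] in auto)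
  have "degD (\<lambda>P. k * D P) = (\<Sum>P\<in>?A. (k * D P) * int (pdeg P))"
    by (rule degD_superset) (use DivD[OF assms] in auto)
  then show "degD (\<lambda>P. k * D P) = k * degD D"
    by (simp add: degD_def sum_distrib_left mult.assoc)
qed

lemma Div_diff:
  assumes "D \<in> Div" "E \<in> Div"
  shows "(\<lambda>P. D P - E P) \<in> Div" "degD (\<lambda>P. D P - E P) = degD D - degD E"
  using Div_add[OF assms(1) Div_scale(1)[OF assms(2), of "-1"]] Div_scale(2)[OF assms(2), of "-1"] by simp_all

lemma Div_zero: "(\<lambda>P. 0) \<in> Div" "degD (\<lambda>P. 0) = 0"
  by (auto simp: divisors_def degD_def)

lemma Div_single:
  assumes "P \<in> places F K"
  shows "(\<lambda>Q. if Q = P then n else 0) \<in> Div" "degD (\<lambda>Q. if Q = P then n else 0) = n * int (pdeg P)"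
proof -
  show "(\<lambda>Q. if Q = P then n else 0) \<in> Div" by (rule DivI[of "{P}"]) (use assms in auto)
  show "degD (\<lambda>Q. if Q = P then n else 0) = n * int (pdeg P)"
    by (subst degD_superset[of "{P}"]) auto
qed

lemma Div_max:
  assumes "D \<in> Div"
  shows "(\<lambda>P. max 0 (D P)) \<in> Div"
  by (rule DivI[of "{P. D P \<noteq> 0}"]) (use DivD[OF assms] in auto)

lemma degD_nonneg:
  assumes "\<And>P. 0 \<le> D P"
  shows "0 \<le> degD D"
  unfolding degD_def by (intro sum_nonneg) (use assms in auto)

lemma degD_mono:
  assumes "D \<in> Div" "E \<in> Div" "\<And>P. D P \<le> E P"
  shows "degD D \<le> degD E"
  using degD_nonneg[of "\<lambda>P. E P - D P"] Div_diff(2)[OF assms(2,1)] assms(3) by simp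

text \<open>Cut off outside the places, where \<open>place_val\<close> has no meaning, so that the
  function is a divisor.\<close>

definition prdiv :: "'a \<Rightarrow> 'a set \<Rightarrow> int"
  where "prdiv z = (\<lambda>P. if P \<in> places F K then v P z else 0)"

lemma prdiv_Div: "z \<in> carrier F \<Longrightarrow> z \<noteq> \<zero> \<Longrightarrow> prdiv z \<in> Div"
  by (rule DivI[OF finite_support]) (auto simp: prdiv_def)

lemma prdiv_mult: "z \<in> carrier F \<Longrightarrow> z \<noteq> \<zero> \<Longrightarrow> w \<in> carrier F \<Longrightarrow> w \<noteq> \<zero> \<Longrightarrow> prdiv (z \<otimes> w) = (\<lambda>P. prdiv z P + prdiv w P)"
  by (auto simp: prdiv_def v_mult)

lemma prdiv_inv: "z \<in> carrier F \<Longrightarrow> z \<noteq> \<zero> \<Longrightarrow> prdiv (inv z) = (\<lambda>P. - prdiv z P)"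
  by (auto simp: prdiv_def v_inv)

lemma prdiv_pow: "z \<in> carrier F \<Longrightarrow> z \<noteq> \<zero> \<Longrightarrow> prdiv (z [^] (k::nat)) = (\<lambda>P. int k * prdiv z P)"
  by (auto simp: prdiv_def v_pow)

section \<open>Riemann-Roch spaces and local quotients\<close>

abbreviation LL :: "('a set \<Rightarrow> int) \<Rightarrow> 'a set"
  where "LL \<equiv> RR_space F K"

abbreviation ell :: "('a set \<Rightarrow> int) \<Rightarrow> nat"
  where "ell \<equiv> RR_dim F K"

lemma LL_FI: "LL D = {z \<in> carrier F. \<forall>P\<in>places F K. z \<in> FI P (- D P)}"
  by (auto simp: RR_space_def FI_def)

lemma LL_addsub: "addsub (LL D)"
proof (rule addsubI)
  note A = addsubD[OF FI_addsub]
  show "LL D \<subseteq> carrier F" "\<zero> \<in> LL D" by (auto simp: RR_space_def)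
  show "a \<oplus> b \<in> LL D" if "a \<in> LL D" "b \<in> LL D" for a b using that A(5) by (auto simp: LL_FI)
  show "\<ominus> a \<in> LL D" if "a \<in> LL D" for a using that A(4) by (auto simp: LL_FI)
qed

lemma LL_K:
  assumes "k \<in> K" "z \<in> LL D"
  shows "k \<otimes> z \<in> LL D"
proof -
  have "k \<otimes> z \<in> FI P (- D P)" if P: "P \<in> places F K" for P
  proof -
    have "k \<in> FI P 0" "z \<in> FI P (- D P)" using FI_K[OF P] assms P by (auto simp: LL_FI)
    from FI_mult[OF P this] show ?thesis by simp
  qed
  then show ?thesis using assms subringE(1)[OF Ksub] by (auto simp: LL_FI)
qed

lemma LL_mono: "(\<And>P. D P \<le> E P) \<Longrightarrow> LL D \<subseteq> LL E"
  unfolding RR_space_def by (smt (verit) Collect_mono mem_Collect_eq)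

lemma LL_scale:
  assumes "z \<in> carrier F" "z \<noteq> \<zero>"
  shows "(\<otimes>) z ` LL D = LL (\<lambda>P. D P - prdiv z P)"
proof (rule subset_antisym; rule subsetI)
  have *: "z \<otimes> w \<in> LL (\<lambda>P. D P - prdiv z P)" if "z \<in> carrier F" "z \<noteq> \<zero>" "w \<in> LL D" for z w D
  proof -
    have "z \<otimes> w \<in> FI P (- (D P - prdiv z P))" if P: "P \<in> places F K" for P
    proof -
      have "z \<in> FI P (v P z)" using \<open>z \<in> carrier F\<close> by (auto simp: FI_def)
      moreover have "w \<in> FI P (- D P)" using \<open>w \<in> LL D\<close> P by (auto simp: LL_FI)
      ultimately show ?thesis using FI_mult[OF P, of z "v P z" w "- D P"] P by (simp add: prdiv_def)
    qed
    then show ?thesis using that by (auto simp: LL_FI)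
  qed
  fix w
  show "w \<in> LL (\<lambda>P. D P - prdiv z P)" if "w \<in> (\<otimes>) z ` LL D" using * assms that by auto
  show "w \<in> (\<otimes>) z ` LL D" if w: "w \<in> LL (\<lambda>P. D P - prdiv z P)"
  proof -
    have "inv z \<otimes> w \<in> LL D" using *[OF _ _ w, of "inv z"] assms by (simp add: prdiv_inv)
    moreover have "w = z \<otimes> (inv z \<otimes> w)" using assms w by (auto simp: LL_FI)
    ultimately show ?thesis by blast
  qed
qed

text \<open>A nonconstant z has a pole: some valuation ring contains 1/z but not z. This is where
  the constant field being full enters the dimension formulas.\<close>

lemma LL_zero: "LL (\<lambda>P. 0) = K"
proof
  show "K \<subseteq> LL (\<lambda>P. 0)" using v_K subringE(1)[OF Ksub] by (auto simp: RR_space_def)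
  show "LL (\<lambda>P. 0) \<subseteq> K"
  proof (rule subsetI, rule ccontr)
    fix z assume z: "z \<in> LL (\<lambda>P. 0)" "z \<notin> K"
    then have zF: "z \<in> carrier F" "z \<noteq> \<zero>" using subringE(2)[OF Ksub] by (auto simp: RR_space_def)
    have "inv z \<notin> K"
    proof
      assume "inv z \<in> K"
      then have "inv (inv z) \<in> K" using subfield_m_inv(1)[OF K, of "inv z"] zF by auto
      then show False using zF z by simp
    qed
    then obtain V where V: "valuation_ring F K V" "inv z \<in> V" "inv (inv z) \<notin> V"
      using valuation_ring_exists[of "inv z"] zF by auto
    have "z \<notin> OP (nonunits V)" "nonunits V \<in> places F K" using place_ring_nonunits[OF V(1)] V(3) zF by auto
    then show False using z(1) v_OP(1)[of "nonunits V" z] zF by (auto simp: RR_space_def)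
  qed
qed

lemma degree_difference:
  assumes "D \<in> Div" "E \<in> Div" "\<And>P. D P \<le> E P"
  shows "(\<Sum>P | D P \<noteq> E P. nat (E P - D P) * pdeg P) = nat (degD E - degD D)"
proof -
  have D: "(\<lambda>P. E P - D P) \<in> Div" using Div_diff(1)[OF assms(2,1)] .
  have "degD E - degD D = degD (\<lambda>P. E P - D P)" using Div_diff(2)[OF assms(2,1)] by simp
  also have "\<dots> = (\<Sum>P | D P \<noteq> E P. (E P - D P) * int (pdeg P))"
  proof (rule degD_superset)
    have "{P. E P - D P \<noteq> 0} = {P. D P \<noteq> E P}" by auto
    then show "finite {P. D P \<noteq> E P}" "{P. E P - D P \<noteq> 0} \<subseteq> {P. D P \<noteq> E P}" using DivD(1)[OF D] by simp_all
  qed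
  also have "\<dots> = (\<Sum>P | D P \<noteq> E P. int (nat (E P - D P) * pdeg P))"
    using assms(3) by (intro sum.cong) auto
  also have "\<dots> = int (\<Sum>P | D P \<noteq> E P. nat (E P - D P) * pdeg P)" by simp
  finally have "degD E - degD D = int (\<Sum>P | D P \<noteq> E P. nat (E P - D P) * pdeg P)" .
  then show ?thesis by (simp only: nat_int)
qed

text \<open>\<open>C\<close> stands for the product of the quotients P^(-E(P)) / P^(-D(P)) over the
  places where the divisors differ, and \<open>\<rho>\<close> for simultaneous reduction. It acts on
  tuples \<open>a\<close>; a global element is the constant tuple.\<close>

lemma local_representatives:
  assumes D: "D \<in> Div" "E \<in> Div" "\<And>P. D P \<le> E P"
  obtains C :: "('a set \<Rightarrow> 'a) set" and \<rho> :: "('a set \<Rightarrow> 'a) \<Rightarrow> 'a set \<Rightarrow> 'a"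
  where "finite C" "card C = q ^ nat (degD E - degD D)"
    "\<forall>a. (\<forall>P. P \<in> places F K \<longrightarrow> D P \<noteq> E P \<longrightarrow> a P \<in> FI P (- E P)) \<longrightarrow> \<rho> a \<in> C"
    "\<forall>a b. (\<forall>P. P \<in> places F K \<longrightarrow> D P \<noteq> E P \<longrightarrow> a P \<in> FI P (- E P) \<and> b P \<in> FI P (- E P)) \<longrightarrow>
       \<rho> a = \<rho> b \<longleftrightarrow> (\<forall>P. D P \<noteq> E P \<longrightarrow> a P \<ominus> b P \<in> FI P (- D P))"
proof -
  define T where "T = {P. D P \<noteq> E P}"
  have "{P. E P - D P \<noteq> 0} = T" unfolding T_def by auto
  then have T: "finite T" "T \<subseteq> places F K" using DivD(1,2)[OF Div_diff(1)[OF D(2,1)]] by simp_all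
  have ex: "\<forall>P\<in>T. \<exists>C. finite C \<and> card C = q ^ (nat (E P - D P) * pdeg P) \<and> transversal (FI P (- E P)) (FI P (- D P)) C"
  proof
    fix P assume P: "P \<in> T"
    have "- E P + int (nat (E P - D P)) = - D P" using D(3)[of P] by simp
    then show "\<exists>C. finite C \<and> card C = q ^ (nat (E P - D P) * pdeg P) \<and> transversal (FI P (- E P)) (FI P (- D P)) C"
      using FI_idx[of P "- E P" "nat (E P - D P)"] P T(2) by (auto simp: has_idx_def)
  qed
  obtain C where C: "\<And>P. P \<in> T \<Longrightarrow> finite (C P)" "\<And>P. P \<in> T \<Longrightarrow> card (C P) = q ^ (nat (E P - D P) * pdeg P)"
    "\<And>P. P \<in> T \<Longrightarrow> transversal (FI P (- E P)) (FI P (- D P)) (C P)"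
    using bchoice[OF ex] by blast
  have reps: "\<forall>P\<in>T. \<exists>r. (\<forall>a\<in>FI P (- E P). r a \<in> C P) \<and>
    (\<forall>a\<in>FI P (- E P). \<forall>b\<in>FI P (- E P). r a = r b \<longleftrightarrow> a \<ominus> b \<in> FI P (- D P))"
  proof
    fix P assume P: "P \<in> T"
    then have A: "addsub (FI P (- D P))" "addsub (FI P (- E P))" using FI_addsub T(2) by blast+
    show "\<exists>r. (\<forall>a\<in>FI P (- E P). r a \<in> C P) \<and>
      (\<forall>a\<in>FI P (- E P). \<forall>b\<in>FI P (- E P). r a = r b \<longleftrightarrow> a \<ominus> b \<in> FI P (- D P))"
      using transversal_rep[OF C(3)[OF P] A(1) addsubD(1)[OF A(2)]] by blast
  qed
  obtain r where r: "\<And>P a. P \<in> T \<Longrightarrow> a \<in> FI P (- E P) \<Longrightarrow> r P a \<in> C P"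
    and req: "\<And>P a b. P \<in> T \<Longrightarrow> a \<in> FI P (- E P) \<Longrightarrow> b \<in> FI P (- E P) \<Longrightarrow> r P a = r P b \<longleftrightarrow> a \<ominus> b \<in> FI P (- D P)"
    using bchoice[OF reps] by blast
  define \<rho> where "\<rho> a = (\<lambda>P\<in>T. r P (a P))" for a
  show thesis
  proof (rule that[of "PiE T C" \<rho>])
    show "finite (PiE T C)" using T(1) C(1) by (rule finite_PiE)
    have "card (PiE T C) = (\<Prod>P\<in>T. q ^ (nat (E P - D P) * pdeg P))" unfolding card_PiE[OF T(1)] using C(2) by (intro prod.cong) auto
    also have "\<dots> = q ^ (\<Sum>P\<in>T. nat (E P - D P) * pdeg P)" by (simp add: power_sum)
    finally show "card (PiE T C) = q ^ nat (degD E - degD D)" using degree_difference[OF D] by (simp add: T_def)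
    show "\<forall>a. (\<forall>P. P \<in> places F K \<longrightarrow> D P \<noteq> E P \<longrightarrow> a P \<in> FI P (- E P)) \<longrightarrow> \<rho> a \<in> PiE T C"
      unfolding \<rho>_def using r T(2) by (auto simp: T_def)
    show "\<forall>a b. (\<forall>P. P \<in> places F K \<longrightarrow> D P \<noteq> E P \<longrightarrow> a P \<in> FI P (- E P) \<and> b P \<in> FI P (- E P)) \<longrightarrow>
       \<rho> a = \<rho> b \<longleftrightarrow> (\<forall>P. D P \<noteq> E P \<longrightarrow> a P \<ominus> b P \<in> FI P (- D P))"
    proof (intro allI impI)
      fix a b assume ab: "\<forall>P. P \<in> places F K \<longrightarrow> D P \<noteq> E P \<longrightarrow> a P \<in> FI P (- E P) \<and> b P \<in> FI P (- E P)"
      have "\<rho> a = \<rho> b \<longleftrightarrow> (\<forall>P\<in>T. r P (a P) = r P (b P))"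
        unfolding \<rho>_def by (auto simp: fun_eq_iff restrict_def)
      also have "\<dots> \<longleftrightarrow> (\<forall>P\<in>T. a P \<ominus> b P \<in> FI P (- D P))"
      proof (rule ball_cong[OF refl])
        fix P assume P: "P \<in> T"
        then have "a P \<in> FI P (- E P) \<and> b P \<in> FI P (- E P)" using ab T(2) by (auto simp: T_def)
        then show "r P (a P) = r P (b P) \<longleftrightarrow> a P \<ominus> b P \<in> FI P (- D P)" using req[OF P] by blast
      qed
      finally show "\<rho> a = \<rho> b \<longleftrightarrow> (\<forall>P. D P \<noteq> E P \<longrightarrow> a P \<ominus> b P \<in> FI P (- D P))" by (simp add: T_def)
    qed
  qed
qed

lemma LL_diff_mem:
  assumes "\<And>P. D P \<le> E P" "z \<in> LL E" "w \<in> LL E"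
  shows "z \<ominus> w \<in> LL D \<longleftrightarrow> (\<forall>P\<in>places F K. D P \<noteq> E P \<longrightarrow> z \<ominus> w \<in> FI P (- D P))"
proof -
  have "z \<ominus> w \<in> LL E" using addsubD(3)[OF LL_addsub] assms by blast
  then have *: "z \<ominus> w \<in> carrier F" "\<And>P. P \<in> places F K \<Longrightarrow> z \<ominus> w \<in> FI P (- E P)" by (auto simp: LL_FI)
  show ?thesis
  proof
    assume R: "\<forall>P\<in>places F K. D P \<noteq> E P \<longrightarrow> z \<ominus> w \<in> FI P (- D P)"
    have "z \<ominus> w \<in> FI P (- D P)" if "P \<in> places F K" for P
      using *(2)[OF that] R that by (cases "D P = E P") auto
    then show "z \<ominus> w \<in> LL D" using *(1) by (simp add: LL_FI)
  qed (simp add: LL_FI)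
qed

text \<open>Simultaneous reduction embeds L(E)/L(D) into the product of the local quotients, of size
  q^(deg E - deg D).\<close>

lemma LL_idx:
  assumes D: "D \<in> Div" "E \<in> Div" "\<And>P. D P \<le> E P"
  shows "\<exists>n \<le> q ^ nat (degD E - degD D). has_idx (LL E) (LL D) n"
proof -
  obtain C :: "('a set \<Rightarrow> 'a) set" and \<rho> :: "('a set \<Rightarrow> 'a) \<Rightarrow> 'a set \<Rightarrow> 'a" where C: "finite C" "card C = q ^ nat (degD E - degD D)"
    and \<rho>0: "\<forall>a. (\<forall>P. P \<in> places F K \<longrightarrow> D P \<noteq> E P \<longrightarrow> a P \<in> FI P (- E P)) \<longrightarrow> \<rho> a \<in> C"
    "\<forall>a b. (\<forall>P. P \<in> places F K \<longrightarrow> D P \<noteq> E P \<longrightarrow> a P \<in> FI P (- E P) \<and> b P \<in> FI P (- E P)) \<longrightarrow>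
       \<rho> a = \<rho> b \<longleftrightarrow> (\<forall>P. D P \<noteq> E P \<longrightarrow> a P \<ominus> b P \<in> FI P (- D P))"
    by (rule local_representatives[OF D])
  note \<rho> = \<rho>0[rule_format]
  have Lp: "z \<in> FI P (- E P)" if "z \<in> LL E" "P \<in> places F K" for z P using that by (auto simp: LL_FI)
  show ?thesis
  proof (rule has_idx_bounded[OF LL_addsub addsubD(1)[OF LL_addsub]])
    fix Z assume Z: "finite Z" "Z \<subseteq> LL E" "incongruent Z (LL D)"
    have "inj_on (\<lambda>z. \<rho> (\<lambda>P. z)) Z"
    proof (rule inj_onI, rule ccontr)
      fix z w assume zw: "z \<in> Z" "w \<in> Z" "\<rho> (\<lambda>P. z) = \<rho> (\<lambda>P. w)" "z \<noteq> w"
      have L: "z \<in> LL E" "w \<in> LL E" using zw Z by auto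
      have "\<forall>P. D P \<noteq> E P \<longrightarrow> z \<ominus> w \<in> FI P (- D P)" using \<rho>(2)[of "\<lambda>P. z" "\<lambda>P. w"] zw(3) Lp L by auto
      then have "z \<ominus> w \<in> LL D" using LL_diff_mem[OF D(3) L] by auto
      then show False using Z(3) zw by (auto simp: incongruent_def)
    qed
    moreover have "(\<lambda>z. \<rho> (\<lambda>P. z)) ` Z \<subseteq> C" using \<rho>(1) Lp Z(2) by auto
    ultimately show "card Z \<le> q ^ nat (degD E - degD D)" using card_inj_on_le C by metis
  qed
qed

text \<open>An injection between finite sets of equal size is onto. If the index is as large as
  possible, every tuple of local classes is therefore attained.\<close>

lemma LL_surj:
  assumes D: "D \<in> Div" "E \<in> Div" "\<And>P. D P \<le> E P"
    and idx: "has_idx (LL E) (LL D) (q ^ nat (degD E - degD D))"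
    and a: "\<And>P. P \<in> places F K \<Longrightarrow> D P \<noteq> E P \<Longrightarrow> a P \<in> FI P (- E P)"
  shows "\<exists>z\<in>LL E. \<forall>P. D P \<noteq> E P \<longrightarrow> z \<ominus> a P \<in> FI P (- D P)"
proof -
  obtain C :: "('a set \<Rightarrow> 'a) set" and \<rho> :: "('a set \<Rightarrow> 'a) \<Rightarrow> 'a set \<Rightarrow> 'a" where C: "finite C" "card C = q ^ nat (degD E - degD D)"
    and \<rho>0: "\<forall>a. (\<forall>P. P \<in> places F K \<longrightarrow> D P \<noteq> E P \<longrightarrow> a P \<in> FI P (- E P)) \<longrightarrow> \<rho> a \<in> C"
    "\<forall>a b. (\<forall>P. P \<in> places F K \<longrightarrow> D P \<noteq> E P \<longrightarrow> a P \<in> FI P (- E P) \<and> b P \<in> FI P (- E P)) \<longrightarrow>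
       \<rho> a = \<rho> b \<longleftrightarrow> (\<forall>P. D P \<noteq> E P \<longrightarrow> a P \<ominus> b P \<in> FI P (- D P))"
    by (rule local_representatives[OF D])
  note \<rho> = \<rho>0[rule_format]
  have Lp: "z \<in> FI P (- E P)" if "z \<in> LL E" "P \<in> places F K" for z P using that by (auto simp: LL_FI)
  obtain Z where Z: "finite Z" "card Z = q ^ nat (degD E - degD D)" "transversal (LL E) (LL D) Z"
    using idx by (auto simp: has_idx_def)
  have ZL: "Z \<subseteq> LL E" using transversalD(1)[OF Z(3)] .
  have inc: "incongruent Z (LL D)" using transversal_incongruent[OF Z(3) LL_addsub addsubD(1)[OF LL_addsub]] .
  have "inj_on (\<lambda>z. \<rho> (\<lambda>P. z)) Z"
  proof (rule inj_onI, rule ccontr)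
    fix z w assume zw: "z \<in> Z" "w \<in> Z" "\<rho> (\<lambda>P. z) = \<rho> (\<lambda>P. w)" "z \<noteq> w"
    have L: "z \<in> LL E" "w \<in> LL E" using zw ZL by auto
    have "\<forall>P. D P \<noteq> E P \<longrightarrow> z \<ominus> w \<in> FI P (- D P)" using \<rho>(2)[of "\<lambda>P. z" "\<lambda>P. w"] zw(3) Lp L by auto
    then have "z \<ominus> w \<in> LL D" using LL_diff_mem[OF D(3) L] by auto
    then show False using inc zw by (auto simp: incongruent_def)
  qed
  then have "card ((\<lambda>z. \<rho> (\<lambda>P. z)) ` Z) = card C" using Z(2) C(2) by (simp add: card_image)
  moreover have "(\<lambda>z. \<rho> (\<lambda>P. z)) ` Z \<subseteq> C" using \<rho>(1) Lp ZL by auto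
  ultimately have "(\<lambda>z. \<rho> (\<lambda>P. z)) ` Z = C" using C(1) card_subset_eq by blast
  moreover have "\<rho> a \<in> C" by (rule \<rho>(1)) (rule a)
  ultimately have "\<rho> a \<in> (\<lambda>z. \<rho> (\<lambda>P. z)) ` Z" by simp
  then obtain z where z: "z \<in> Z" "\<rho> (\<lambda>P. z) = \<rho> a" by auto
  have "\<forall>P. D P \<noteq> E P \<longrightarrow> z \<ominus> a P \<in> FI P (- D P)" using \<rho>(2)[of "\<lambda>P. z" a] z(2) Lp a z(1) ZL by auto
  then show ?thesis using z(1) ZL by blast
qed

lemma LL_finite:
  assumes "D \<in> Div"
  shows "finite (LL D)"
proof -
  let ?E = "\<lambda>P. max 0 (D P)"
  have E: "?E \<in> Div" using Div_max[OF assms] .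
  obtain n where n: "has_idx (LL ?E) (LL (\<lambda>P. 0)) n" using LL_idx[OF Div_zero(1) E] by auto
  have "finite (LL ?E)"
    using has_idx_card[OF n LL_addsub LL_addsub LL_mono] finK LL_zero by auto
  moreover have "LL D \<subseteq> LL ?E" by (rule LL_mono) auto
  ultimately show ?thesis using finite_subset by blast
qed

lemma card_LL:
  assumes "D \<in> Div"
  shows "card (LL D) = q ^ ell D"
  unfolding RR_dim_def
  by (rule finite_subspace_dim(2)[OF K finK LL_addsub LL_finite[OF assms] LL_K])

lemma q_pow_le: "q ^ a \<le> q ^ b \<longleftrightarrow> a \<le> b"
  using q_ge2 by (intro power_increasing_iff) auto

text \<open>The second inequality says that deg - ell is monotone, which is how it enters strong
  approximation.\<close>

lemma ell_mono:
  assumes D: "D \<in> Div" "E \<in> Div" "\<And>P. D P \<le> E P"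
  shows "ell D \<le> ell E" "int (ell E) \<le> int (ell D) + (degD E - degD D)"
proof -
  obtain n where n: "n \<le> q ^ nat (degD E - degD D)" "has_idx (LL E) (LL D) n" using LL_idx[OF D] by auto
  have sub: "LL D \<subseteq> LL E" by (rule LL_mono[OF D(3)])
  show "ell D \<le> ell E" using card_mono[OF LL_finite[OF D(2)] sub] card_LL D q_pow_le by auto
  have "card (LL E) = n * card (LL D)" using has_idx_card[OF n(2) LL_addsub LL_addsub sub LL_finite[OF D(1)]] by simp
  then have "q ^ ell E \<le> q ^ (nat (degD E - degD D) + ell D)" using n(1) card_LL D by (simp add: power_add)
  then have "ell E \<le> nat (degD E - degD D) + ell D" by (simp only: q_pow_le)
  moreover have "0 \<le> degD E - degD D" using degD_mono[OF D] by simp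
  ultimately show "int (ell E) \<le> int (ell D) + (degD E - degD D)" by linarith
qed

lemma LL_idx_eq:
  assumes D: "D \<in> Div" "E \<in> Div" "\<And>P. D P \<le> E P" and eq: "int (ell E) = int (ell D) + (degD E - degD D)"
  shows "has_idx (LL E) (LL D) (q ^ nat (degD E - degD D))"
proof -
  obtain n where n: "n \<le> q ^ nat (degD E - degD D)" "has_idx (LL E) (LL D) n" using LL_idx[OF D] by auto
  have sub: "LL D \<subseteq> LL E" by (rule LL_mono[OF D(3)])
  have "card (LL E) = n * card (LL D)" using has_idx_card[OF n(2) LL_addsub LL_addsub sub LL_finite[OF D(1)]] by simp
  then have "q ^ ell E = n * q ^ ell D" using card_LL D by simp
  moreover have "ell E = nat (degD E - degD D) + ell D" using eq degD_mono[OF D] by linarith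
  ultimately have "q ^ nat (degD E - degD D) * q ^ ell D = n * q ^ ell D" by (simp add: power_add)
  moreover have "q ^ ell D > 0" using q_ge2 by simp
  ultimately have "n = q ^ nat (degD E - degD D)" by (metis mult_cancel2 less_irrefl)
  then show ?thesis using n(2) by simp
qed

lemma ell_zero: "ell (\<lambda>P. 0) = 1"
proof -
  have "q ^ ell (\<lambda>P. 0) = q ^ 1" using card_LL[OF Div_zero(1)] LL_zero by simp
  then show ?thesis using q_ge2 by (subst (asm) power_inject_exp) auto
qed

lemma ell_eff:
  assumes "D \<in> Div" "\<And>P. 0 \<le> D P"
  shows "int (ell D) \<le> degD D + 1"
  using ell_mono(2)[OF Div_zero(1) assms] ell_zero Div_zero(2) by simp

lemma ell_prdiv:
  assumes "z \<in> carrier F" "z \<noteq> \<zero>" "D \<in> Div"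
  shows "ell (\<lambda>P. D P - prdiv z P) = ell D"
proof -
  have D': "(\<lambda>P. D P - prdiv z P) \<in> Div" using Div_diff(1)[OF assms(3) prdiv_Div[OF assms(1,2)]] .
  have "inj_on ((\<otimes>) z) (LL D)"
    using m_lcancel assms addsubD(1)[OF LL_addsub, of D] by (intro inj_onI) auto
  then have "card (LL (\<lambda>P. D P - prdiv z P)) = card (LL D)" using LL_scale[OF assms(1,2)] card_image by metis
  then have "q ^ ell (\<lambda>P. D P - prdiv z P) = q ^ ell D" using card_LL D' assms(3) by simp
  then show ?thesis using q_ge2 by (subst (asm) power_inject_exp) auto
qed


section \<open>Riemann's inequality and strong approximation\<close>

text \<open>The divisor of zeros; the divisor of poles is \<open>zdiv (inv z)\<close>.\<close>

definition zdiv :: "'a \<Rightarrow> 'a set \<Rightarrow> int"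
  where "zdiv z = (\<lambda>P. max 0 (prdiv z P))"

lemma zdiv_Div: "z \<in> carrier F \<Longrightarrow> z \<noteq> \<zero> \<Longrightarrow> zdiv z \<in> Div"
  unfolding zdiv_def by (rule Div_max[OF prdiv_Div])

lemma zdiv_nonneg: "0 \<le> zdiv z P"
  by (simp add: zdiv_def)

lemma zdiv_degree:
  assumes z: "z \<in> carrier F" "z \<noteq> \<zero>" "multiplier z e c"
  shows "q ^ nat (degD (zdiv z)) \<le> card W ^ c"
proof -
  let ?T = "{P \<in> places F K. 0 < v P z}"
  have T: "finite ?T" by (rule finite_zeros[OF z(1,2)])
  have "degD (zdiv z) = (\<Sum>P\<in>?T. zdiv z P * int (pdeg P))"
    by (rule degD_superset[OF T]) (auto simp: zdiv_def prdiv_def max_def split: if_splits)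
  also have "\<dots> = (\<Sum>P\<in>?T. int (nat (v P z) * pdeg P))"
    by (rule sum.cong) (auto simp: zdiv_def prdiv_def)
  also have "\<dots> = int (\<Sum>P\<in>?T. nat (v P z) * pdeg P)" by simp
  finally have "nat (degD (zdiv z)) = (\<Sum>P\<in>?T. nat (v P z) * pdeg P)" by (simp only: nat_int)
  then show ?thesis using fundamental_inequality[OF z T] by auto
qed

text \<open>The divisor of poles of x. Its degree \<open>b\<close> satisfies
  \<open>card W = q ^ nat b\<close> by \<open>riemann_B\<close>, the classical equality of the
  degree of the pole divisor with the degree of the field over K(x).\<close>

definition B :: "'a set \<Rightarrow> int"
  where "B = zdiv (inv x)"

lemma B_Div: "B \<in> Div" and B_nonneg: "0 \<le> B P"
  using zdiv_Div[of "inv x"] x(1) x_nz zdiv_nonneg by (auto simp: B_def)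

lemma B_val: "P \<in> places F K \<Longrightarrow> B P = max 0 (- v P x)"
  using x(1) x_nz by (simp add: B_def zdiv_def prdiv_def v_inv)

definition b :: int
  where "b = degD B"

lemma b_nonneg: "0 \<le> b"
  unfolding b_def by (rule degD_nonneg) (rule B_nonneg)

lemma W_upper: "q ^ nat b \<le> card W"
  using zdiv_degree[OF _ _ multiplier_inv_x] x(1) x_nz by (simp add: b_def B_def)

lemma bounding_divisor:
  assumes "finite S" "S \<subseteq> carrier F"
  shows "\<exists>C\<in>Div. (\<forall>P. 0 \<le> C P) \<and> S \<subseteq> LL C"
  using assms
proof (induction S)
  case empty
  show ?case using Div_zero by auto
next
  case (insert w S)
  then obtain C where C: "C \<in> Div" "\<And>P. 0 \<le> C P" "S \<subseteq> LL C" by auto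
  show ?case
  proof (cases "w = \<zero>")
    case True
    then have "insert w S \<subseteq> LL C" using C addsubD(2)[OF LL_addsub] by auto
    then show ?thesis using C by blast
  next
    case False
    have w: "w \<in> carrier F" using insert by auto
    let ?C = "\<lambda>P. C P + zdiv (inv w) P"
    have "?C \<in> Div" using Div_add(1)[OF C(1) zdiv_Div] w False by auto
    moreover have "LL C \<subseteq> LL ?C" by (rule LL_mono) (simp add: zdiv_nonneg)
    moreover have "w \<in> LL ?C"
      using w False C(2) by (auto simp: RR_space_def zdiv_def prdiv_def v_inv add_increasing2 max_def)
    moreover have "0 \<le> ?C P" for P using C(2) zdiv_nonneg by simp
    ultimately show ?thesis using C(3) by (intro bexI[of _ ?C]) auto
  qed
qed

lemma growth_in_LL:
  assumes C: "C \<in> Div" "\<And>P. 0 \<le> C P" "W \<subseteq> LL C"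
  shows "horner W x l \<subseteq> LL (\<lambda>P. C P + int l * B P)"
proof (induction l)
  case 0
  then show ?case using addsubD(2)[OF LL_addsub] by auto
next
  case (Suc l)
  show ?case
  proof
    fix m assume "m \<in> horner W x (Suc l)"
    then obtain w m' where m: "w \<in> W" "m' \<in> horner W x l" "m = w \<oplus> x \<otimes> m'" by auto
    have "LL C \<subseteq> LL (\<lambda>P. C P + int (Suc l) * B P)" by (rule LL_mono) (simp add: B_nonneg)
    then have "w \<in> LL (\<lambda>P. C P + int (Suc l) * B P)" using m(1) C(3) by auto
    moreover have "x \<otimes> m' \<in> (\<otimes>) x ` LL (\<lambda>P. C P + int l * B P)" using Suc m(2) by blast
    then have "x \<otimes> m' \<in> LL (\<lambda>P. (C P + int l * B P) - prdiv x P)"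
      by (simp only: LL_scale[OF x(1) x_nz])
    moreover have "LL (\<lambda>P. (C P + int l * B P) - prdiv x P) \<subseteq> LL (\<lambda>P. C P + int (Suc l) * B P)"
    proof (rule LL_mono)
      fix P
      have "- prdiv x P \<le> B P" using B_val[of P] B_nonneg[of P] by (auto simp: prdiv_def)
      then show "C P + int l * B P - prdiv x P \<le> C P + int (Suc l) * B P" by (simp add: distrib_right)
    qed
    ultimately show "m \<in> LL (\<lambda>P. C P + int (Suc l) * B P)" unfolding m(3) using addsubD(5)[OF LL_addsub] by blast
  qed
qed

text \<open>The \<open>card W ^ l\<close> elements of \<open>horner W x l\<close> lie in L(C + lB),
  of dimension at most deg C + lb + 1. Growing l gives \<open>card W \<le> q ^ nat b\<close>, and
  \<open>W_upper\<close> is the converse. With equality known, the same inclusion reads lb <= ell(C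
  + lB), and removing C costs at most deg C.\<close>

lemma riemann_B: "card W = q ^ nat b" "\<exists>\<gamma>\<ge>0. \<forall>l. int l * b - \<gamma> \<le> int (ell (\<lambda>P. int l * B P))"
proof -
  obtain C where C: "C \<in> Div" "\<And>P. 0 \<le> C P" "W \<subseteq> LL C"
    using bounding_divisor[OF W(2) addsubD(1)[OF W(1)]] by auto
  have lB: "(\<lambda>P. int l * B P) \<in> Div" "degD (\<lambda>P. int l * B P) = int l * b" for l
    using Div_scale[OF B_Div] by (auto simp: b_def)
  have D: "(\<lambda>P. C P + int l * B P) \<in> Div" "degD (\<lambda>P. C P + int l * B P) = degD C + int l * b" for l
    using Div_add[OF C(1) lB(1)] lB(2) by auto
  have le: "card W ^ l \<le> q ^ ell (\<lambda>P. C P + int l * B P)" for l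
    using card_mono[OF LL_finite[OF D(1)] growth_in_LL[OF C]] W_card card_LL[OF D(1)] by metis
  have "card W ^ l \<le> q ^ nat (degD C + 1) * (q ^ nat b) ^ l" for l
  proof -
    have "int (ell (\<lambda>P. C P + int l * B P)) \<le> degD C + int l * b + 1"
      using ell_eff[OF D(1)] C(2) B_nonneg D(2) by simp
    then have "ell (\<lambda>P. C P + int l * B P) \<le> nat (degD C + 1) + nat b * l"
    proof -
      assume *: "int (ell (\<lambda>P. C P + int l * B P)) \<le> degD C + int l * b + 1"
      have "int (nat (degD C + 1) + nat b * l) = degD C + 1 + b * int l"
        using degD_nonneg[of C] C(2) b_nonneg by simp
      then show ?thesis using * by (simp only: mult.commute flip: of_nat_le_iff)
    qed
    then have "q ^ ell (\<lambda>P. C P + int l * B P) \<le> q ^ (nat (degD C + 1) + nat b * l)" by (simp only: q_pow_le)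
    then show ?thesis using le[of l] by (simp add: power_add power_mult)
  qed
  then have "card W \<le> q ^ nat b" by (rule nat_power_bound)
  then show W: "card W = q ^ nat b" using W_upper by simp
  have "int l * b - degD C \<le> int (ell (\<lambda>P. int l * B P))" for l
  proof -
    have "q ^ (nat b * l) \<le> q ^ ell (\<lambda>P. C P + int l * B P)" using le[of l] by (simp add: W power_mult)
    then have "nat b * l \<le> ell (\<lambda>P. C P + int l * B P)" by (simp only: q_pow_le)
    then have "b * int l \<le> int (ell (\<lambda>P. C P + int l * B P))"
      using b_nonneg by (metis int_nat_eq of_nat_le_iff of_nat_mult)
    moreover have "int (ell (\<lambda>P. C P + int l * B P)) \<le> int (ell (\<lambda>P. int l * B P)) + degD C"
      using ell_mono(2)[OF lB(1) D(1), of l l] C(2) D(2) lB(2) by simp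
    ultimately show ?thesis by (simp add: mult.commute)
  qed
  then show "\<exists>\<gamma>\<ge>0. \<forall>l. int l * b - \<gamma> \<le> int (ell (\<lambda>P. int l * B P))"
    using degD_nonneg[of C] C(2) by blast
qed

section \<open>Riemann's inequality for all divisors\<close>

lemma eff_induct:
  assumes A: "A \<in> Div" "\<And>P. 0 \<le> A P"
    and zero: "R (\<lambda>P. 0)"
    and step: "\<And>A P. P \<in> places F K \<Longrightarrow> R A \<Longrightarrow> R (\<lambda>Q. A Q + (if Q = P then 1 else 0))"
  shows "R A"
  using A
proof (induction "nat (degD A)" arbitrary: A rule: less_induct)
  case less
  show ?case
  proof (cases "\<forall>P. A P = 0")
    case True
    then have "A = (\<lambda>P. 0)" by auto
    then show ?thesis using zero by simp
  next
    case False
    then obtain P where P: "A P \<noteq> 0" by auto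
    then have PP: "P \<in> places F K" using DivD(3)[OF less.prems(1)] by blast
    let ?A = "\<lambda>Q. A Q - (if Q = P then 1 else 0)"
    have A: "?A \<in> Div" "degD ?A = degD A - int (pdeg P)"
      using Div_diff[OF less.prems(1) Div_single(1)[OF PP, of 1]] Div_single(2)[OF PP, of 1] by auto
    have nn: "0 \<le> ?A Q" for Q using less.prems(2)[of Q] less.prems(2)[of P] P by auto
    have "nat (degD ?A) < nat (degD A)"
      using degD_nonneg[of ?A] nn A(2) residue_idx(2)[OF PP] by simp
    from less.hyps[OF this A(1) nn] have "R ?A" .
    from step[OF PP this] show ?thesis by simp
  qed
qed

text \<open>
  For such \<open>A\<close> one has \<open>ell A = ell (A - prdiv y) \<ge> ell (A - Z + m B)\<close>, and \<open>A - Z + m B\<close> has degree at least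
  that of \<open>A\<close> and lies below \<open>(m + s) B\<close>, where Riemann's inequality is already known. The condition is
  additive in \<open>A\<close>, so it suffices to verify it for single places.
\<close>

definition clearable :: "('a set \<Rightarrow> int) \<Rightarrow> bool"
  where "clearable A \<longleftrightarrow> (\<exists>y\<in>carrier F. \<exists>Z\<in>Div. \<exists>m s::nat. y \<noteq> \<zero> \<and>
    (\<forall>P. prdiv y P \<le> Z P - int m * B P) \<and> degD Z \<le> int m * b \<and> (\<forall>P. A P \<le> Z P + int s * B P))"

lemma clearableI:
  assumes "y \<in> carrier F" "Z \<in> Div" "y \<noteq> \<zero>" "\<And>P. prdiv y P \<le> Z P - int m * B P" "degD Z \<le> int m * b"
    "\<And>P. A P \<le> Z P + int s * B P"
  shows "clearable A"
  using assms unfolding clearable_def by blast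

lemma clearable_add:
  assumes "clearable A" "clearable A'"
  shows "clearable (\<lambda>P. A P + A' P)"
proof -
  obtain y Z m s where y: "y \<in> carrier F" "Z \<in> Div" "y \<noteq> \<zero>" "\<And>P. prdiv y P \<le> Z P - int m * B P"
    "degD Z \<le> int m * b" "\<And>P. A P \<le> Z P + int s * B P"
    using assms(1) unfolding clearable_def by blast
  obtain y' Z' m' s' where y': "y' \<in> carrier F" "Z' \<in> Div" "y' \<noteq> \<zero>" "\<And>P. prdiv y' P \<le> Z' P - int m' * B P"
    "degD Z' \<le> int m' * b" "\<And>P. A' P \<le> Z' P + int s' * B P"
    using assms(2) unfolding clearable_def by blast
  show ?thesis
  proof (rule clearableI[of "y \<otimes> y'" "\<lambda>P. Z P + Z' P" "m + m'" _ "s + s'"])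
    show "prdiv (y \<otimes> y') P \<le> Z P + Z' P - int (m + m') * B P" for P
      using y(4)[of P] y'(4)[of P] prdiv_mult[OF y(1,3) y'(1,3)] by (simp add: algebra_simps)
    show "degD (\<lambda>P. Z P + Z' P) \<le> int (m + m') * b"
      using y(5) y'(5) Div_add(2)[OF y(2) y'(2)] by (simp add: algebra_simps)
    show "A P + A' P \<le> Z P + Z' P + int (s + s') * B P" for P
      using y(6)[of P] y'(6)[of P] by (simp add: algebra_simps)
  qed (use y y' Div_add(1) in auto)
qed

lemma v_diff_le:
  assumes P: "P \<in> places F K" and "a \<in> carrier F" "a \<noteq> \<zero>" "c \<in> carrier F" "c \<noteq> \<zero>" "v P a < v P c"
  shows "a \<ominus> c \<noteq> \<zero> \<and> v P (a \<ominus> c) \<le> v P a"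
proof -
  note A = FI_addsub[OF P]
  have c: "c \<in> FI P (v P a + 1)" using assms by (auto simp: FI_def)
  have "a \<notin> FI P (v P a + 1)" using assms by (auto simp: FI_def)
  moreover have "a = (a \<ominus> c) \<oplus> c" using assms(2,4) by algebra
  ultimately have "a \<ominus> c \<notin> FI P (v P a + 1)" using addsubD(5)[OF A _ c] by metis
  then show ?thesis using assms(2,4) by (auto simp: FI_def)
qed

text \<open>A pole of x is covered by one copy of \<open>B\<close>. At any other place a suitable
  polynomial y in x vanishes, and its divisor of zeros serves as \<open>Z\<close>: the poles of y
  are controlled by \<open>B\<close>, and the cost of its multiplier bounds the degree of
  \<open>Z\<close>.\<close>

lemma clearable_single:
  assumes P: "P \<in> places F K"
  shows "clearable (\<lambda>Q. if Q = P then 1 else 0)"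
proof (cases "v P x < 0")
  case True
  have o: "prdiv \<one> Q = 0" for Q using v_one by (simp add: prdiv_def)
  show ?thesis
  proof (rule clearableI[of \<one> "\<lambda>P. 0" 0 _ 1])
    show "(if Q = P then 1 else 0) \<le> 0 + int 1 * B Q" for Q
      using B_nonneg[of Q] B_val[OF P] True by auto
  qed (use o Div_zero in auto)
next
  case False
  have xP: "x \<in> OP P" using v_OP(1)[OF P x(1) x_nz] False by simp
  obtain M :: nat where M: "M \<ge> 1" "x [^] M \<in> P \<or> x [^] M \<ominus> \<one> \<in> P"
  proof -
    from residue_exponent[OF P] obtain M :: nat where M: "M \<ge> 1"
      "\<forall>k::nat. k \<ge> 1 \<longrightarrow> (\<forall>y\<in>OP P. y [^] (M * k) \<in> P \<or> y [^] (M * k) \<ominus> \<one> \<in> P)"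
      by (elim exE conjE)
    then show thesis using that[OF M(1)] M(2)[rule_format, of 1 x] xP by simp
  qed
  \<comment> \<open>x^(2M) - x^M = x^M (x^M - 1) lies in \<open>P\<close> whichever of the two
    residues x^M has, so zeros of x need no separate treatment.\<close>
  let ?y = "x [^] (M + M) \<ominus> x [^] M"
  have yF: "?y \<in> carrier F" "?y \<noteq> \<zero>" using x(1) x_pow_diff_nz[of M "M + M"] M(1) by auto
  have xM: "x [^] M \<in> carrier F" "x [^] M \<in> OP P" using x(1) OP_pow[OF P xP] by auto
  have y: "?y = x [^] M \<otimes> (x [^] M \<ominus> \<one>)"
  proof -
    have "x [^] (M + M) = x [^] M \<otimes> x [^] M" by (rule nat_pow_mult[OF x(1), symmetric])
    then show ?thesis using xM(1) by (simp add: minus_eq r_distr r_minus)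
  qed
  have xM1: "x [^] M \<ominus> \<one> \<in> OP P" "x [^] M \<ominus> \<one> \<in> carrier F"
    using addsubD(3)[OF addsub_subring[OF place_facts(4)[OF P]] xM(2)] one_vring[OF placeD(1)[OF P]] xM(1) by auto
  have "?y \<in> P" 
    using M(2)
  proof
    assume "x [^] M \<in> P"
    from place_facts(3)[OF P xM1(1) this] show ?thesis unfolding y using xM xM1 by (simp add: m_comm)
  next
    assume "x [^] M \<ominus> \<one> \<in> P"
    from place_facts(3)[OF P xM(2) this] show ?thesis unfolding y .
  qed
  then have vy: "1 \<le> v P ?y" using v_OP(2)[OF P yF] by simp
  show ?thesis
  proof (rule clearableI[of ?y "zdiv ?y" "M + M" _ 0])
    show "zdiv ?y \<in> Div" by (rule zdiv_Div[OF yF])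
    show "prdiv ?y Q \<le> zdiv ?y Q - int (M + M) * B Q" for Q
    proof (cases "Q \<in> places F K \<and> v Q x < 0")
      case True
      then have Q: "Q \<in> places F K" "v Q x < 0" by auto
      have "int (M + M) * v Q x < int M * v Q x" using Q(2) M(1) by (intro mult_strict_right_mono_neg) auto
      then have "v Q (x [^] (M + M)) < v Q (x [^] M)" using v_pow[OF Q(1) x(1) x_nz] by simp
      then have "v Q ?y \<le> v Q (x [^] (M + M))" using v_diff_le[OF Q(1)] x(1) x_nz by simp
      also have "\<dots> = int (M + M) * v Q x" by (rule v_pow[OF Q(1) x(1) x_nz])
      also have "v Q x = - B Q" using B_val[OF Q(1)] Q(2) by simp
      finally have "v Q ?y \<le> - (int (M + M) * B Q)" by simp
      then show ?thesis using Q(1) zdiv_nonneg[of ?y Q] by (simp add: prdiv_def)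
    next
      case False
      then have "B Q = 0" using B_val[of Q] DivD(3)[OF B_Div, of Q] by (cases "Q \<in> places F K") auto
      then show ?thesis by (simp add: zdiv_def)
    qed
    \<comment> \<open>The cost is the degree 2M, and \<open>card W\<close> is q^b; so the zeros of
      \<open>?y\<close> have degree at most 2Mb, exactly the bound that \<open>clearable\<close>
      asks for with m = 2M.\<close>
    have "q ^ nat (degD (zdiv ?y)) \<le> q ^ (nat b * (M + M))"
      using zdiv_degree[OF yF multiplier_x_pow_diff] by (simp add: riemann_B(1) power_mult)
    then have "nat (degD (zdiv ?y)) \<le> nat b * (M + M)" by (simp only: q_pow_le)
    then show "degD (zdiv ?y) \<le> int (M + M) * b"
      using b_nonneg by (metis int_nat_eq mult.commute nat_le_eq_zle nat_mult_distrib nat_int of_nat_0_le_iff zero_le_mult_iff)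
    show "(if Q = P then 1 else 0) \<le> zdiv ?y Q + int 0 * B Q" for Q
      using vy P by (simp add: zdiv_def prdiv_def)
  qed (use yF in auto)
qed

lemma clearable_eff:
  assumes "A \<in> Div" "\<And>P. 0 \<le> A P"
  shows "clearable A"
  using assms
proof (rule eff_induct)
  have o: "prdiv \<one> Q = 0" for Q using v_one by (simp add: prdiv_def)
  show "clearable (\<lambda>P. 0)"
    by (rule clearableI[of \<one> "\<lambda>P. 0" 0 _ 0]) (use o Div_zero in auto)
  show "clearable (\<lambda>Q. A Q + (if Q = P then 1 else 0))" if "P \<in> places F K" "clearable A" for A P
    using clearable_add[OF that(2) clearable_single[OF that(1)]] .
qed

lemma riemann_eff: "\<exists>\<gamma>\<ge>0. \<forall>A\<in>Div. (\<forall>P. 0 \<le> A P) \<longrightarrow> degD A - \<gamma> \<le> int (ell A)"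
proof -
  obtain \<gamma> where g: "\<gamma> \<ge> 0" "\<And>l. int l * b - \<gamma> \<le> int (ell (\<lambda>P. int l * B P))" using riemann_B(2) by blast
  have "degD A - \<gamma> \<le> int (ell A)" if A: "A \<in> Div" "\<forall>P. 0 \<le> A P" for A
  proof -
    obtain y Z m s where y: "y \<in> carrier F" "Z \<in> Div" "y \<noteq> \<zero>" "\<And>P. prdiv y P \<le> Z P - int m * B P"
      "degD Z \<le> int m * b" "\<And>P. A P \<le> Z P + int s * B P"
      using clearable_eff[OF A(1)] A(2) unfolding clearable_def by blast
    have lB: "(\<lambda>P. int l * B P) \<in> Div" "degD (\<lambda>P. int l * B P) = int l * b" for l
      using Div_scale[OF B_Div] by (auto simp: b_def)
    let ?D = "\<lambda>P. A P - (Z P - int m * B P)"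
    have ZB: "(\<lambda>P. Z P - int m * B P) \<in> Div" "degD (\<lambda>P. Z P - int m * B P) = degD Z - int m * b"
      using Div_diff[OF y(2) lB(1)] lB(2) by auto
    have D: "?D \<in> Div" "degD ?D = degD A - (degD Z - int m * b)"
      using Div_diff[OF A(1) ZB(1)] ZB(2) by auto
    have Ay: "(\<lambda>P. A P - prdiv y P) \<in> Div" using Div_diff(1)[OF A(1) prdiv_Div[OF y(1,3)]] .
    have "ell ?D \<le> ell (\<lambda>P. A P - prdiv y P)" by (rule ell_mono(1)[OF D(1) Ay]) (use y(4) in \<open>simp add: algebra_simps\<close>)
    also have "\<dots> = ell A" by (rule ell_prdiv[OF y(1,3) A(1)])
    finally have 1: "ell ?D \<le> ell A" .
    have "int (ell (\<lambda>P. int (m + s) * B P)) \<le> int (ell ?D) + (degD (\<lambda>P. int (m + s) * B P) - degD ?D)"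
    proof (rule ell_mono(2)[OF D(1) lB(1)])
      show "?D P \<le> int (m + s) * B P" for P using y(6)[of P] by (simp add: algebra_simps)
    qed
    then have "int (m + s) * b - \<gamma> \<le> int (ell ?D) + (int (m + s) * b - degD ?D)"
      using g(2)[of "m + s"] unfolding lB(2) by linarith
    then have "degD ?D - \<gamma> \<le> int (ell ?D)" by simp
    moreover have "degD A \<le> degD ?D" using D(2) y(5) by simp
    ultimately show ?thesis using 1 by linarith
  qed
  then show ?thesis using g(1) by blast
qed

text \<open>Multiplication by z^k carries L of k times the zeros onto L of k times the poles. On
  effective divisors ell equals the degree up to a constant, so the linear growth in k forces zeros
  and poles to have equal degree.\<close>

lemma degD_prdiv:
  assumes "z \<in> carrier F" "z \<noteq> \<zero>"
  shows "degD (prdiv z) = 0"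
proof -
  obtain \<gamma> where g: "\<gamma> \<ge> 0" "\<And>A. A \<in> Div \<Longrightarrow> (\<And>P. 0 \<le> A P) \<Longrightarrow> degD A - \<gamma> \<le> int (ell A)"
    using riemann_eff by blast
  have *: "degD (zdiv z) \<le> degD (zdiv (inv z))" if z: "z \<in> carrier F" "z \<noteq> \<zero>" for z
  proof (rule nat_linear_bound[of _ _ "\<gamma> + 1"])
    fix k :: nat
    have 1: "(\<lambda>P. int k * zdiv z P) \<in> Div" "degD (\<lambda>P. int k * zdiv z P) = int k * degD (zdiv z)"
      using Div_scale[OF zdiv_Div[OF z]] by auto
    have 2: "(\<lambda>P. int k * zdiv (inv z) P) \<in> Div" "degD (\<lambda>P. int k * zdiv (inv z) P) = int k * degD (zdiv (inv z))"
      using Div_scale[OF zdiv_Div[of "inv z"]] z by auto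
    have "(\<lambda>P. int k * zdiv z P - prdiv (z [^] k) P) = (\<lambda>P. int k * zdiv (inv z) P)"
      using z by (auto simp: prdiv_pow prdiv_inv zdiv_def max_def algebra_simps)
    then have "ell (\<lambda>P. int k * zdiv (inv z) P) = ell (\<lambda>P. int k * zdiv z P)"
      using ell_prdiv[OF _ _ 1(1), of "z [^] k"] z by simp
    moreover have "int k * degD (zdiv z) - \<gamma> \<le> int (ell (\<lambda>P. int k * zdiv z P))"
      using g(2)[OF 1(1)] zdiv_nonneg 1(2) by simp
    moreover have "int (ell (\<lambda>P. int k * zdiv (inv z) P)) \<le> int k * degD (zdiv (inv z)) + 1"
      using ell_eff[OF 2(1)] zdiv_nonneg 2(2) by simp
    ultimately show "int k * degD (zdiv z) \<le> int k * degD (zdiv (inv z)) + (\<gamma> + 1)" by simp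
  qed
  have iz: "inv z \<in> carrier F" "inv z \<noteq> \<zero>" using assms by auto
  have "degD (zdiv z) = degD (zdiv (inv z))" using *[OF assms] *[OF iz] assms by simp
  moreover have "prdiv z = (\<lambda>P. zdiv z P - zdiv (inv z) P)" using assms by (auto simp: zdiv_def prdiv_inv max_def)
  ultimately show ?thesis using Div_diff(2)[OF zdiv_Div[OF assms] zdiv_Div[OF iz]] by simp
qed

lemma riemann: "\<exists>\<gamma>\<ge>0. \<forall>D\<in>Div. degD D - \<gamma> \<le> int (ell D)"
proof -
  obtain \<gamma> where g: "\<gamma> \<ge> 0" "\<And>A. A \<in> Div \<Longrightarrow> (\<And>P. 0 \<le> A P) \<Longrightarrow> degD A - \<gamma> \<le> int (ell A)"
    using riemann_eff by blast
  have "degD D - \<gamma> \<le> int (ell D)" if D: "D \<in> Div" for D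
    using g(2)[OF Div_max[OF D]] ell_mono(2)[OF D Div_max[OF D]] by simp
  then show ?thesis using g(1) by blast
qed

text \<open>A nonzero z in L(D) makes D + (z) effective, and this divisor has the same degree and
  the same \<open>ell\<close> as D.\<close>

lemma LL_nonzero_deg:
  assumes "D \<in> Div" "z \<in> LL D" "z \<noteq> \<zero>"
  shows "0 \<le> degD D" "int (ell D) \<le> degD D + 1"
proof -
  have z: "z \<in> carrier F" using assms by (auto simp: RR_space_def)
  have iz: "inv z \<in> carrier F" "inv z \<noteq> \<zero>" using z assms by auto
  let ?E = "\<lambda>P. D P - prdiv (inv z) P"
  have E: "?E \<in> Div" "degD ?E = degD D"
    using Div_diff[OF assms(1) prdiv_Div[OF iz]] degD_prdiv[OF iz] by auto
  have nn: "0 \<le> ?E P" for P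
    using assms z DivD(3)[OF assms(1), of P] unfolding prdiv_inv[OF z assms(3)]
    by (auto simp: prdiv_def RR_space_def add.commute)
  show "0 \<le> degD D" using degD_nonneg[of ?E] nn E(2) by simp
  show "int (ell D) \<le> degD D + 1" using ell_eff[OF E(1) nn] E(2) ell_prdiv[OF iz assms(1)] by simp
qed

lemma LL_nontrivial:
  assumes "D \<in> Div" "0 < ell D"
  shows "\<exists>z\<in>LL D. z \<noteq> \<zero>"
proof (rule ccontr)
  assume "\<not> ?thesis"
  then have "LL D \<subseteq> {\<zero>}" by auto
  then have "card (LL D) \<le> 1" using card_mono[of "{\<zero>}"] by auto
  moreover have "q ^ 1 \<le> q ^ ell D" using assms(2) by (simp only: q_pow_le)
  ultimately show False using card_LL[OF assms(1)] q_ge2 by simp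
qed

text \<open>\<open>deg D - ell D\<close> is monotone and bounded, hence constant above some multiple of \<open>P0\<close>.\<close>

lemma strong_approximation_dim:
  assumes P0: "P0 \<in> places F K" and A: "A \<in> Div" "\<And>P. 0 \<le> A P"
  shows "\<exists>n0::nat. \<forall>D\<in>Div. (\<forall>P. (if P = P0 then int n0 else 0) \<le> D P) \<longrightarrow>
    int (ell D) = int (ell (\<lambda>P. D P - A P)) + degD A"
proof -
  obtain \<gamma> where g: "\<gamma> \<ge> 0" "\<And>D. D \<in> Div \<Longrightarrow> degD D - \<gamma> \<le> int (ell D)" using riemann by blast
  define r where "r D = degD D - int (ell D)" for D
  have r_mono: "r D \<le> r E" if "D \<in> Div" "E \<in> Div" "\<And>P. D P \<le> E P" for D E
    using ell_mono(2)[OF that] by (simp add: r_def)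
  have r_le: "r D \<le> \<gamma>" if "D \<in> Div" for D using g(2)[OF that] by (simp add: r_def)
  \<comment> \<open>A natural number valued defect, so that a minimum exists; it is attained where
    \<open>r\<close> is maximal.\<close>
  define N where "N D = nat (\<gamma> - r D)" for D
  obtain M where M: "M \<in> Div" "\<And>D. D \<in> Div \<Longrightarrow> N M \<le> N D"
    using arg_min_nat_lemma[of "\<lambda>D. D \<in> Div" "\<lambda>P. 0" N] Div_zero(1) by blast
  have max: "r D \<le> r M" if "D \<in> Div" for D
    using M(2)[OF that] r_le[OF that] r_le[OF M(1)] by (simp add: N_def)
  \<comment> \<open>Chosen so that n0 P0 - A - M has degree at least \<open>\<gamma>\<close> + 1,
    hence a nonzero section \<open>z\<close>.\<close>
  define n0 where "n0 = nat (degD A + degD M + \<gamma> + 1)"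
  let ?P = "\<lambda>P. if P = P0 then int n0 else 0"
  let ?E = "\<lambda>P. ?P P - A P"
  have P: "?P \<in> Div" "degD ?P = int n0 * int (pdeg P0)" using Div_single[OF P0] by auto
  have E: "?E \<in> Div" "degD ?E = degD ?P - degD A" using Div_diff[OF P(1) A(1)] by auto
  have EM: "(\<lambda>P. ?E P - M P) \<in> Div" "degD (\<lambda>P. ?E P - M P) = degD ?P - degD A - degD M"
    using Div_diff[OF E(1) M(1)] E(2) by auto
  have "int n0 * 1 \<le> int n0 * int (pdeg P0)" using residue_idx(2)[OF P0] by (intro mult_left_mono) auto
  moreover have "degD A + degD M + \<gamma> + 1 \<le> int n0" by (simp add: n0_def)
  ultimately have "degD (\<lambda>P. ?E P - M P) \<ge> \<gamma> + 1" using EM(2) P(2) by linarith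
  then have "0 < ell (\<lambda>P. ?E P - M P)" using g(2)[OF EM(1)] by linarith
  then obtain z where z: "z \<in> LL (\<lambda>P. ?E P - M P)" "z \<noteq> \<zero>" using LL_nontrivial[OF EM(1)] by blast
  have zF: "z \<in> carrier F" using z by (auto simp: RR_space_def)
  have iz: "inv z \<in> carrier F" "inv z \<noteq> \<zero>" using zF z by auto
  \<comment> \<open>Adding the principal divisor of \<open>z\<close> lifts \<open>?E\<close> above
    \<open>M\<close> without changing \<open>r\<close>. So \<open>r\<close> is already maximal at
    \<open>?E\<close>, and by monotonicity at every divisor above it.\<close>
  let ?G = "\<lambda>P. ?E P - prdiv (inv z) P"
  have G: "?G \<in> Div" "degD ?G = degD ?E"
    using Div_diff[OF E(1) prdiv_Div[OF iz]] degD_prdiv[OF iz] by auto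
  have "M P \<le> ?G P" for P
  proof (cases "P \<in> places F K")
    case True
    then have "0 \<le> v P z + (?E P - M P)" using z by (auto simp: RR_space_def)
    then show ?thesis using True prdiv_inv[OF zF z(2)] by (simp add: prdiv_def)
  next
    case False
    then show ?thesis using DivD(3)[OF M(1)] DivD(3)[OF G(1)] by simp
  qed
  from r_mono[OF M(1) G(1) this] have "r M \<le> r ?E" using G(2) ell_prdiv[OF iz E(1)] by (simp add: r_def)
  then have rE: "r ?E = r M" using max[OF E(1)] by simp
  have "int (ell D) = int (ell (\<lambda>P. D P - A P)) + degD A" if D: "D \<in> Div" "\<forall>P. ?P P \<le> D P" for D
  proof -
    have DA: "(\<lambda>P. D P - A P) \<in> Div" "degD (\<lambda>P. D P - A P) = degD D - degD A" using Div_diff[OF D(1) A(1)] by auto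
    have "r ?E \<le> r (\<lambda>P. D P - A P)" by (rule r_mono[OF E(1) DA(1)]) (use D(2) in auto)
    then have 1: "r (\<lambda>P. D P - A P) = r M" using rE max[OF DA(1)] by simp
    have "r (\<lambda>P. D P - A P) \<le> r D" by (rule r_mono[OF DA(1) D(1)]) (use A(2) in auto)
    then have "r D = r M" using 1 max[OF D(1)] by simp
    then show ?thesis using 1 DA(2) by (simp add: r_def)
  qed
  then show ?thesis by blast
qed

text \<open>Where \<open>A\<close> lives, \<open>D\<close> vanishes, so the local quotients are
  OP(P) / P^(A(P)). That \<open>ell\<close> drops by exactly \<open>degD A\<close> means that
  L(D)/L(D - A) has the full size of their product, and then \<open>LL_surj\<close> applies.\<close>

lemma strong_approximation:
  assumes P0: "P0 \<in> places F K" and A: "A \<in> Div" "\<And>P. 0 \<le> A P" "A P0 = 0"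
  shows "\<exists>n0::nat. \<forall>D\<in>Div. (\<forall>P. (if P = P0 then int n0 else 0) \<le> D P) \<longrightarrow> (\<forall>P. A P \<noteq> 0 \<longrightarrow> D P = 0) \<longrightarrow>
    has_idx (LL D) (LL (\<lambda>P. D P - A P)) (q ^ nat (degD A)) \<and>
    (\<forall>a. (\<forall>P. A P \<noteq> 0 \<longrightarrow> a P \<in> OP P) \<longrightarrow> (\<exists>z\<in>LL D. \<forall>P. A P \<noteq> 0 \<longrightarrow> z \<ominus> a P \<in> FI P (A P)))"
proof -
  obtain n0 :: nat where n0: "\<And>D. D \<in> Div \<Longrightarrow> (\<forall>P. (if P = P0 then int n0 else 0) \<le> D P) \<Longrightarrow>
    int (ell D) = int (ell (\<lambda>P. D P - A P)) + degD A"
    using strong_approximation_dim[OF P0 A(1,2)] by blast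
  show ?thesis
  proof (intro exI[of _ n0] ballI impI)
    fix D assume D: "D \<in> Div" "\<forall>P. (if P = P0 then int n0 else 0) \<le> D P" "\<forall>P. A P \<noteq> 0 \<longrightarrow> D P = 0"
    have DA: "(\<lambda>P. D P - A P) \<in> Div" "degD (\<lambda>P. D P - A P) = degD D - degD A" using Div_diff[OF D(1) A(1)] by auto
    have eq: "int (ell D) = int (ell (\<lambda>P. D P - A P)) + (degD D - degD (\<lambda>P. D P - A P))"
      using n0[OF D(1,2)] DA(2) by simp
    have le: "D P - A P \<le> D P" for P using A(2)[of P] by simp
    have deg: "degD D - degD (\<lambda>P. D P - A P) = degD A" using DA(2) by simp
    note idx = LL_idx_eq[OF DA(1) D(1) le eq]
    show "has_idx (LL D) (LL (\<lambda>P. D P - A P)) (q ^ nat (degD A)) \<and>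
      (\<forall>a. (\<forall>P. A P \<noteq> 0 \<longrightarrow> a P \<in> OP P) \<longrightarrow> (\<exists>z\<in>LL D. \<forall>P. A P \<noteq> 0 \<longrightarrow> z \<ominus> a P \<in> FI P (A P)))"
    proof (intro conjI allI impI)
      show "has_idx (LL D) (LL (\<lambda>P. D P - A P)) (q ^ nat (degD A))" using idx deg by simp
      fix a assume a: "\<forall>P. A P \<noteq> 0 \<longrightarrow> a P \<in> OP P"
      have "\<exists>z\<in>LL D. \<forall>P. D P - A P \<noteq> D P \<longrightarrow> z \<ominus> a P \<in> FI P (- (D P - A P))"
      proof (rule LL_surj[OF DA(1) D(1) le idx])
        fix P assume P: "P \<in> places F K" "D P - A P \<noteq> D P"
        then have "A P \<noteq> 0" by simp
        then show "a P \<in> FI P (- D P)" using a D(3) FI_0[OF P(1)] by simp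
      qed
      then obtain z where z: "z \<in> LL D" "\<And>P. A P \<noteq> 0 \<Longrightarrow> z \<ominus> a P \<in> FI P (- (D P - A P))" by auto
      have "z \<ominus> a P \<in> FI P (A P)" if "A P \<noteq> 0" for P using z(2)[OF that] D(3) that by simp
      then show "\<exists>z\<in>LL D. \<forall>P. A P \<noteq> 0 \<longrightarrow> z \<ominus> a P \<in> FI P (A P)" using z(1) by blast
    qed
  qed
qed

end

section \<open>Counting locally Eisenstein families\<close>

text \<open>The condition sees only the images under \<open>\<phi>\<close>, and each of the
  \<open>card I\<close> entries of a family of images lifts in \<open>k\<close> ways.\<close>

lemma card_families_fibre:
  fixes \<phi> :: "'b \<Rightarrow> 'c" and R :: "('i \<Rightarrow> 'c) \<Rightarrow> bool"
  assumes "finite L" "finite Y" "finite I" "\<phi> ` L \<subseteq> Y" "\<And>y. y \<in> Y \<Longrightarrow> card {z \<in> L. \<phi> z = y} = k"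
  shows "card {f \<in> PiE I (\<lambda>_. L). R (\<lambda>i\<in>I. \<phi> (f i))} = k ^ card I * card {g \<in> PiE I (\<lambda>_. Y). R g}"
proof -
  let ?G = "{g \<in> PiE I (\<lambda>_. Y). R g}"
  let ?A = "\<lambda>g. PiE I (\<lambda>i. {z \<in> L. \<phi> z = g i})"
  have eq: "{f \<in> PiE I (\<lambda>_. L). R (\<lambda>i\<in>I. \<phi> (f i))} = (\<Union>g\<in>?G. ?A g)"
  proof (intro subset_antisym subsetI)
    fix f assume f: "f \<in> {f \<in> PiE I (\<lambda>_. L). R (\<lambda>i\<in>I. \<phi> (f i))}"
    then have "(\<lambda>i\<in>I. \<phi> (f i)) \<in> ?G" using assms(4) by auto
    moreover have "f \<in> ?A (\<lambda>i\<in>I. \<phi> (f i))" using f by (auto simp: PiE_iff)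
    ultimately show "f \<in> (\<Union>g\<in>?G. ?A g)" by blast
  next
    fix f assume "f \<in> (\<Union>g\<in>?G. ?A g)"
    then obtain g where g: "g \<in> PiE I (\<lambda>_. Y)" "R g" "f \<in> ?A g" by auto
    then have "(\<lambda>i\<in>I. \<phi> (f i)) = g" by (auto simp: PiE_iff fun_eq_iff extensional_def)
    then show "f \<in> {f \<in> PiE I (\<lambda>_. L). R (\<lambda>i\<in>I. \<phi> (f i))}" using g by (auto simp: PiE_iff)
  qed
  have fin: "finite ?G" using finite_PiE[OF assms(3), of "\<lambda>_. Y"] assms(2) by simp
  have dis: "?A g \<inter> ?A g' = {}" if "g \<in> ?G" "g' \<in> ?G" "g \<noteq> g'" for g g'
  proof (rule ccontr)
    assume "?A g \<inter> ?A g' \<noteq> {}"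
    then obtain f where f: "f \<in> ?A g" "f \<in> ?A g'" by blast
    have "g = g'" by (rule PiE_ext[of _ I "\<lambda>_. Y"]) (use that f in \<open>auto simp: PiE_iff\<close>)
    then show False using that(3) by simp
  qed
  have "card (\<Union>g\<in>?G. ?A g) = (\<Sum>g\<in>?G. card (?A g))"
  proof (rule card_UN_disjoint[OF fin])
    show "\<forall>g\<in>?G. finite (?A g)" using assms(1) by (intro ballI finite_PiE[OF assms(3)]) simp
    show "\<forall>g\<in>?G. \<forall>g'\<in>?G. g \<noteq> g' \<longrightarrow> ?A g \<inter> ?A g' = {}" using dis by blast
  qed
  also have "\<dots> = (\<Sum>g\<in>?G. k ^ card I)"
  proof (rule sum.cong[OF refl])
    fix g assume g: "g \<in> ?G"
    have "card (?A g) = (\<Prod>i\<in>I. card {z \<in> L. \<phi> z = g i})" by (rule card_PiE[OF assms(3)])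
    also have "\<dots> = (\<Prod>i\<in>I. k)" using g assms(5) by (intro prod.cong) auto
    finally show "card (?A g) = k ^ card I" by simp
  qed
  finally show ?thesis unfolding eq by simp
qed

text \<open>Transposing g i t turns families of tuples into tuples of families, on which the
  conditions at different \<open>t\<close> concern different components.\<close>

lemma card_families_independent:
  fixes R :: "'t \<Rightarrow> ('i \<Rightarrow> 'c) \<Rightarrow> bool"
  assumes "finite T" "finite I"
  shows "card {g \<in> PiE I (\<lambda>_. PiE T C). \<forall>t\<in>T. R t (\<lambda>i\<in>I. g i t)} =
    (\<Prod>t\<in>T. card {h \<in> PiE I (\<lambda>_. C t). R t h})"
proof -
  let ?G = "{g \<in> PiE I (\<lambda>_. PiE T C). \<forall>t\<in>T. R t (\<lambda>i\<in>I. g i t)}"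
  let ?H = "PiE T (\<lambda>t. {h \<in> PiE I (\<lambda>_. C t). R t h})"
  have "bij_betw (\<lambda>g. \<lambda>t\<in>T. \<lambda>i\<in>I. g i t) ?G ?H"
  proof (rule bij_betwI[where g = "\<lambda>h. \<lambda>i\<in>I. \<lambda>t\<in>T. h t i"])
    show "(\<lambda>g. \<lambda>t\<in>T. \<lambda>i\<in>I. g i t) \<in> ?G \<rightarrow> ?H"
      by (rule funcsetI, rule PiE_I) (auto simp: PiE_iff)
    show "(\<lambda>h. \<lambda>i\<in>I. \<lambda>t\<in>T. h t i) \<in> ?H \<rightarrow> ?G"
    proof
      fix h assume h: "h \<in> ?H"
      have "(\<lambda>i\<in>I. (\<lambda>i\<in>I. \<lambda>t\<in>T. h t i) i t) = h t" if "t \<in> T" for t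
        using h that by (auto simp: PiE_iff fun_eq_iff extensional_def)
      then show "(\<lambda>i\<in>I. \<lambda>t\<in>T. h t i) \<in> ?G" using h by (auto simp: PiE_iff)
    qed
    show "(\<lambda>i\<in>I. \<lambda>t\<in>T. (\<lambda>t\<in>T. \<lambda>i\<in>I. g i t) t i) = g" if "g \<in> ?G" for g
      using that by (fastforce simp: PiE_iff fun_eq_iff extensional_def)
    show "(\<lambda>t\<in>T. \<lambda>i\<in>I. (\<lambda>i\<in>I. \<lambda>t\<in>T. h t i) i t) = h" if "h \<in> ?H" for h
      using that by (fastforce simp: PiE_iff fun_eq_iff extensional_def)
  qed
  then have "card ?G = card ?H" by (rule bij_betw_same_card)
  also have "\<dots> = (\<Prod>t\<in>T. card {h \<in> PiE I (\<lambda>_. C t). R t h})" by (rule card_PiE[OF assms(1)])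
  finally show ?thesis .
qed

lemma card_le_of_finite_subsets:
  assumes "\<And>T. finite T \<Longrightarrow> T \<subseteq> A \<Longrightarrow> card T \<le> n"
  shows "finite A \<and> card A \<le> n"
proof -
  have "finite A"
  proof (rule ccontr)
    assume "infinite A"
    then obtain T where "T \<subseteq> A" "finite T" "card T = Suc n" using infinite_arbitrarily_large by blast
    then show False using assms[of T] by simp
  qed
  then show ?thesis using assms by auto
qed

context function_field_basis
begin

section \<open>The number of places of given degree and the tail of the series\<close>

lemma LL_val: "z \<in> LL D \<Longrightarrow> z \<noteq> \<zero> \<Longrightarrow> P \<in> places F K \<Longrightarrow> 0 \<le> v P z + D P"
  by (auto simp: RR_space_def)

text \<open>To each place Q of degree n a nonzero function vanishing at Q and with poles only at a
  fixed multiple of \<open>P0\<close> is assigned. There are about q^n such functions, and each has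
  boundedly many zeros relative to n. The resulting factor n + c is harmless for
  convergence.\<close>

lemma places_of_degree:
  assumes P0: "P0 \<in> places F K"
  shows "\<exists>c::nat. \<forall>n\<ge>1. finite {P \<in> places F K - {P0}. pdeg P = n} \<and>
    card {P \<in> places F K - {P0}. pdeg P = n} \<le> (n + c) * q ^ (n + c)"
proof -
  obtain \<gamma> where g: "\<gamma> \<ge> 0" "\<And>D. D \<in> Div \<Longrightarrow> degD D - \<gamma> \<le> int (ell D)" using riemann by blast
  define d0 where "d0 = pdeg P0"
  have d0: "d0 \<ge> 1" using residue_idx(2)[OF P0] by (simp add: d0_def)
  define c where "c = nat \<gamma> + d0 + 1"
  have "card T \<le> (n + c) * q ^ (n + c)"
    if n: "n \<ge> 1" and T: "finite T" "T \<subseteq> {P \<in> places F K - {P0}. pdeg P = n}" for n T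
  proof -
    \<comment> \<open>The least multiple with k d0 > n + \<open>\<gamma>\<close>; Riemann's
      inequality then makes L(k P0 - Q) nonzero for every Q of degree n.\<close>
    define k where "k = (n + nat \<gamma>) div d0 + 1"
    have k: "n + nat \<gamma> < k * d0" "k * d0 \<le> n + nat \<gamma> + d0"
    proof -
      have e: "k * d0 = (n + nat \<gamma>) div d0 * d0 + d0" by (simp add: k_def)
      have "(n + nat \<gamma>) mod d0 < d0" using d0 by simp
      then show "n + nat \<gamma> < k * d0" "k * d0 \<le> n + nat \<gamma> + d0"
        using div_mult_mod_eq[of "n + nat \<gamma>" d0] unfolding e by linarith+
    qed
    let ?D = "\<lambda>Q. if Q = P0 then int k else 0"
    have D: "?D \<in> Div" "degD ?D = int (k * d0)" using Div_single[OF P0, of "int k"] by (simp_all add: d0_def)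
    have "\<exists>z. z \<in> LL (\<lambda>P. ?D P - (if P = Q then 1 else 0)) \<and> z \<noteq> \<zero>" if Q: "Q \<in> T" for Q
    proof -
      have QP: "Q \<in> places F K" "pdeg Q = n" using Q T by auto
      have E: "(\<lambda>P. ?D P - (if P = Q then 1 else 0)) \<in> Div" "degD (\<lambda>P. ?D P - (if P = Q then 1 else 0)) = int (k * d0) - int n"
        using Div_diff[OF D(1) Div_single(1)[OF QP(1), of 1]] Div_single(2)[OF QP(1), of 1] D(2) QP(2) by simp_all
      have "0 < ell (\<lambda>P. ?D P - (if P = Q then 1 else 0))" using g(2)[OF E(1)] E(2) k(1) g(1) by linarith
      then show ?thesis using LL_nontrivial[OF E(1)] by blast
    qed
    then obtain z where z: "\<And>Q. Q \<in> T \<Longrightarrow> z Q \<in> LL (\<lambda>P. ?D P - (if P = Q then 1 else 0))" "\<And>Q. Q \<in> T \<Longrightarrow> z Q \<noteq> \<zero>"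
      by metis
    have zD: "z ` T \<subseteq> LL ?D"
    proof -
      have "LL (\<lambda>P. ?D P - (if P = Q then 1 else 0)) \<subseteq> LL ?D" for Q by (rule LL_mono) auto
      then show ?thesis using z(1) by blast
    qed
    have "ell ?D \<le> n + c"
    proof -
      have "int (ell ?D) \<le> int (k * d0) + 1" using ell_eff[OF D(1)] D(2) by simp
      then have "ell ?D \<le> k * d0 + 1" by (metis of_nat_1 of_nat_add of_nat_le_iff)
      then show ?thesis using k(2) unfolding c_def by linarith
    qed
    then have "q ^ ell ?D \<le> q ^ (n + c)" by (simp only: q_pow_le)
    then have zT: "card (z ` T) \<le> q ^ (n + c)" using card_mono[OF LL_finite[OF D(1)] zD] card_LL[OF D(1)] by simp
    \<comment> \<open>A function assigned to all places of \<open>?R\<close> is a nonzero element of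
      L(k P0 - sum of \<open>?R\<close>). That divisor has nonnegative degree, so n times the number
      of these places is at most k d0.\<close>
    have fibre: "card {Q \<in> T. z Q = y} \<le> n + c" if y: "y \<in> z ` T" for y
    proof -
      let ?R = "{Q \<in> T. z Q = y}"
      let ?E = "\<lambda>P. if P \<in> ?R then 1 else 0 :: int"
      have R: "finite ?R" "?R \<subseteq> places F K" using T by auto
      have E: "?E \<in> Div" by (rule DivI[OF R]) auto
      have "degD ?E = (\<Sum>P\<in>?R. ?E P * int (pdeg P))" by (rule degD_superset[OF R(1)]) auto
      also have "\<dots> = (\<Sum>P\<in>?R. int n)" using T by (intro sum.cong) auto
      finally have dE: "degD ?E = int n * int (card ?R)" by simp
      have yn: "y \<noteq> \<zero>" using z(2) y by auto
      have "y \<in> LL (\<lambda>P. ?D P - ?E P)"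
      proof -
        have yF: "y \<in> carrier F" using zD y by (auto simp: RR_space_def)
        have "0 \<le> v P y + (?D P - ?E P)" if P: "P \<in> places F K" for P
        proof (cases "P \<in> ?R")
          case True
          then have "z P = y" "P \<in> T" by auto
          then have "y \<in> LL (\<lambda>Q. ?D Q - (if Q = P then 1 else 0))" using z(1)[of P] by simp
          from LL_val[OF this yn P] have "0 \<le> v P y + (?D P - 1)" by simp
          then show ?thesis using True by simp
        next
          case False
          have "y \<in> LL ?D" using zD y by blast
          from LL_val[OF this yn P] show ?thesis by (simp only: if_not_P[OF False] diff_0_right)
        qed
        then show ?thesis using yF by (auto simp: RR_space_def)
      qed
      from LL_nonzero_deg(1)[OF Div_diff(1)[OF D(1) E] this yn]
      have "int n * int (card ?R) \<le> int (k * d0)" using Div_diff(2)[OF D(1) E] D(2) dE by simp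
      then have "n * card ?R \<le> k * d0" by (simp only: of_nat_mult[symmetric] of_nat_le_iff)
      moreover have "1 * card ?R \<le> n * card ?R" using n by (intro mult_right_mono) auto
      ultimately show ?thesis using k(2) unfolding c_def by linarith
    qed
    have "T = (\<Union>y\<in>z ` T. {Q \<in> T. z Q = y})" by auto
    then have "card T \<le> (\<Sum>y\<in>z ` T. card {Q \<in> T. z Q = y})"
      using card_UN_le[of "z ` T" "\<lambda>y. {Q \<in> T. z Q = y}"] T(1) by simp
    also have "\<dots> \<le> (\<Sum>y\<in>z ` T. n + c)" by (intro sum_mono fibre)
    also have "\<dots> = card (z ` T) * (n + c)" by simp
    also have "\<dots> \<le> q ^ (n + c) * (n + c)" using zT by (rule mult_right_mono) simp
    finally show ?thesis by (simp add: mult.commute)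
  qed
  note main = this
  show ?thesis
  proof (intro exI[of _ c] allI impI)
    fix n :: nat assume n: "1 \<le> n"
    show "finite {P \<in> places F K - {P0}. pdeg P = n} \<and> card {P \<in> places F K - {P0}. pdeg P = n} \<le> (n + c) * q ^ (n + c)"
      by (rule card_le_of_finite_subsets) (rule main[OF n])
  qed
qed

text \<open>The exponent 2 is the least \<open>d\<close> permitted by d > 1. Against roughly n q^n
  places of degree n, the weights q^(-2n) leave a convergent series; with exponent 1 this comparison
  would fail.\<close>

lemma tail_weights:
  assumes P0: "P0 \<in> places F K" and e: "0 < (e::real)"
  shows "\<exists>T0. finite T0 \<and> T0 \<subseteq> places F K - {P0} \<and>
    (\<forall>T. finite T \<longrightarrow> T \<subseteq> places F K - {P0} - T0 \<longrightarrow> (\<Sum>P\<in>T. 1 / real q ^ (2 * pdeg P)) \<le> e)"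
proof -
  obtain c :: nat where c: "\<And>n. n \<ge> 1 \<Longrightarrow> finite {P \<in> places F K - {P0}. pdeg P = n}"
    "\<And>n. n \<ge> 1 \<Longrightarrow> card {P \<in> places F K - {P0}. pdeg P = n} \<le> (n + c) * q ^ (n + c)"
    using places_of_degree[OF P0] by blast
  \<comment> \<open>Majorant for the places of degree n: (n + c) q^(n+c) / q^(2n) is at most (c +
    1)(n + 1) q^c / q^n.\<close>
  define f where "f n = (real c + 1) * real q ^ c * (real (Suc n) * (1 / real q) ^ n)" for n
  have q2: "real q \<ge> 2" using q_ge2 by simp
  have "summable (\<lambda>n. real (Suc n) * (1 / real q) ^ n)"
    using geometric_deriv_sums[of "1 / real q"] q2 by (auto simp: sums_iff)
  then have sf: "summable f" unfolding f_def by (rule summable_mult)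
  have f0: "0 \<le> f n" for n unfolding f_def by simp
  obtain m0 where m0: "\<forall>n\<ge>m0. norm (\<Sum>i. f (i + n)) < e" using suminf_exist_split[OF e sf] by blast
  define m where "m = max 1 m0"
  have m: "suminf (\<lambda>n. f (n + m)) < e" "m \<ge> 1" using m0[rule_format, of m] by (auto simp: m_def)
  \<comment> \<open>All places of degree at most m apart from \<open>P0\<close>; whatever avoids
    them has degree above m and falls into the tail of the majorant.\<close>
  define T0 where "T0 = (\<Union>n\<in>{1..m}. {P \<in> places F K - {P0}. pdeg P = n})"
  have "finite T0" unfolding T0_def using c(1) by auto
  moreover have "T0 \<subseteq> places F K - {P0}" unfolding T0_def by auto
  moreover have "(\<Sum>P\<in>T. 1 / real q ^ (2 * pdeg P)) \<le> e" if T: "finite T" "T \<subseteq> places F K - {P0} - T0" for T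
  proof -
    have big: "m \<le> pdeg P" "1 \<le> pdeg P" if P: "P \<in> T" for P
    proof -
      have PP: "P \<in> places F K - {P0}" "P \<notin> T0" using P T by auto
      show 1: "1 \<le> pdeg P" using residue_idx(2) PP by auto
      then show "m \<le> pdeg P" using PP by (auto simp: T0_def)
    qed
    have loc: "(\<Sum>P | P \<in> T \<and> pdeg P = n. 1 / real q ^ (2 * pdeg P)) \<le> f n" if n: "n \<ge> 1" for n
    proof -
      have "card {P \<in> T. pdeg P = n} \<le> (n + c) * q ^ (n + c)"
        by (rule order_trans[OF card_mono[OF c(1)[OF n]] c(2)[OF n]]) (use T in auto)
      then have "real (card {P \<in> T. pdeg P = n}) \<le> real ((n + c) * q ^ (n + c))" by (simp only: of_nat_le_iff)
      also have "\<dots> \<le> (real c + 1) * real (Suc n) * real q ^ (n + c)"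
      proof -
        have "n + c \<le> (c + 1) * Suc n" by simp
        then have "real (n + c) \<le> (real c + 1) * real (Suc n)"
          by (metis of_nat_1 of_nat_add of_nat_le_iff of_nat_mult)
        then show ?thesis by (simp only: of_nat_mult of_nat_power) (rule mult_right_mono, auto)
      qed
      finally have le: "real (card {P \<in> T. pdeg P = n}) \<le> (real c + 1) * real (Suc n) * real q ^ (n + c)" .
      have "(\<Sum>P | P \<in> T \<and> pdeg P = n. 1 / real q ^ (2 * pdeg P)) = real (card {P \<in> T. pdeg P = n}) * (1 / real q ^ (2 * n))"
        by simp
      also have "\<dots> \<le> ((real c + 1) * real (Suc n) * real q ^ (n + c)) * (1 / real q ^ (2 * n))"
        by (rule mult_right_mono[OF le]) simp
      also have "\<dots> = f n"
        unfolding f_def using q2 by (simp add: power_add power_mult power2_eq_square power_divide field_simps flip: power_mult_distrib)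
      finally show ?thesis .
    qed
    have "(\<Sum>P\<in>T. 1 / real q ^ (2 * pdeg P)) = (\<Sum>n\<in>pdeg ` T. \<Sum>P | P \<in> T \<and> pdeg P = n. 1 / real q ^ (2 * pdeg P))"
      by (rule sum.image_gen[OF T(1)])
    also have "\<dots> \<le> (\<Sum>n\<in>pdeg ` T. f n)" using big loc by (intro sum_mono) auto
    also have "\<dots> = (\<Sum>n\<in>(\<lambda>n. n - m) ` pdeg ` T. f (n + m))"
    proof (rule sum.reindex_cong[symmetric, of "\<lambda>n. n - m"])
      show "inj_on (\<lambda>n. n - m) (pdeg ` T)" by (rule inj_onI) (metis big(1) eq_diff_iff imageE)
    qed (use big in auto)
    also have "\<dots> \<le> suminf (\<lambda>n. f (n + m))"
      by (rule sum_le_suminf) (use T(1) f0 sf summable_iff_shift[of f m] in auto)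
    also have "\<dots> \<le> e" using m(1) by simp
    finally show ?thesis .
  qed
  ultimately show ?thesis by blast
qed

text \<open>The Eisenstein conditions at one place in terms of valuations: \<open>FI Q 1\<close> and
  \<open>FI Q 2\<close> are the maximal ideal of the local ring and its square.
  \<open>place_ideal_square\<close> relates them to ideals of the holomorphy ring.\<close>

definition eis_at :: "nat \<Rightarrow> 'a set \<Rightarrow> (nat \<Rightarrow> 'a) \<Rightarrow> bool"
  where "eis_at d Q f \<longleftrightarrow> (\<forall>i<d. f i \<in> FI Q 1) \<and> f 0 \<notin> FI Q 2 \<and> f d \<notin> FI Q 1"

text \<open>If some family qualifies, its entry at 0 is a nonzero element of L(D - Q), so ell(D - Q)
  + deg Q <= ell D + \<open>\<gamma>\<close> + 1 however large deg Q is. The d lower coefficients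
  all lie in L(D - Q), each saving a factor q^(deg Q) up to a constant. Multiplying instead of
  dividing keeps the bound in the natural numbers.\<close>

lemma eis_at_count_le:
  "\<exists>\<gamma>::nat. \<forall>D Q d. D \<in> Div \<longrightarrow> Q \<in> places F K \<longrightarrow> D Q = 0 \<longrightarrow> d > 0 \<longrightarrow>
    card {f \<in> {..<d + 1} \<rightarrow>\<^sub>E LL D. eis_at d Q f} * q ^ (d * pdeg Q) \<le> q ^ ((d + 1) * ell D + d * \<gamma>)"
proof -
  obtain \<gamma> where g: "\<gamma> \<ge> 0" "\<And>D. D \<in> Div \<Longrightarrow> degD D - \<gamma> \<le> int (ell D)" using riemann by blast
  have "card {f \<in> {..<d + 1} \<rightarrow>\<^sub>E LL D. eis_at d Q f} * q ^ (d * pdeg Q) \<le> q ^ ((d + 1) * ell D + d * nat (\<gamma> + 1))"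
    if D: "D \<in> Div" and Q: "Q \<in> places F K" "D Q = 0" and d: "d > 0" for D Q d
  proof -
    let ?E = "\<lambda>P. D P - (if P = Q then 1 else 0)"
    have E: "?E \<in> Div" "degD ?E = degD D - int (pdeg Q)"
      using Div_diff[OF D Div_single(1)[OF Q(1), of 1]] Div_single(2)[OF Q(1), of 1] by simp_all
    let ?S = "{f \<in> {..<d + 1} \<rightarrow>\<^sub>E LL D. eis_at d Q f}"
    have mem: "f i \<in> LL ?E" if f: "f \<in> ?S" and i: "i < d" for f i
    proof -
      have fL: "f i \<in> LL D" using f i by (auto simp: PiE_iff)
      have fQ: "f i \<in> FI Q 1" using f i by (auto simp: eis_at_def)
      have "f i \<in> FI P (- ?E P)" if "P \<in> places F K" for P
        using fL fQ that Q(2) by (cases "P = Q") (auto simp: LL_FI)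
      then show ?thesis using fL by (auto simp: LL_FI)
    qed
    show ?thesis
    proof (cases "?S = {}")
      case True
      then show ?thesis by (simp only: card.empty)
    next
      case False
      then obtain f where f: "f \<in> ?S" by blast
      have "f 0 \<in> LL ?E" using mem[OF f d] .
      moreover have "f 0 \<noteq> \<zero>" using f by (auto simp: eis_at_def FI_def)
      ultimately have "int (ell ?E) \<le> degD ?E + 1" using LL_nonzero_deg(2)[OF E(1)] by blast
      then have le: "ell ?E + pdeg Q \<le> ell D + nat (\<gamma> + 1)" using g(2)[OF D] E(2) g(1) by linarith
      have "?S \<subseteq> PiE {..<d + 1} (\<lambda>i. if i < d then LL ?E else LL D)"
      proof
        fix f assume f: "f \<in> ?S"
        show "f \<in> PiE {..<d + 1} (\<lambda>i. if i < d then LL ?E else LL D)"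
          by (rule PiE_I) (use mem[OF f] f in \<open>auto dest: PiE_mem PiE_arb\<close>)
      qed
      then have "card ?S \<le> card (PiE {..<d + 1} (\<lambda>i. if i < d then LL ?E else LL D))"
        by (intro card_mono finite_PiE) (use LL_finite E D in auto)
      also have "\<dots> = (\<Prod>i<d + 1. card (if i < d then LL ?E else LL D))" by (rule card_PiE) simp
      also have "\<dots> = (\<Prod>i<d. card (LL ?E)) * card (LL D)" by (simp add: lessThan_Suc)
      also have "\<dots> = q ^ (d * ell ?E + ell D)" using card_LL E D by (simp add: power_add power_mult[symmetric] mult.commute)
      finally have "card ?S * q ^ (d * pdeg Q) \<le> q ^ (d * ell ?E + ell D) * q ^ (d * pdeg Q)" by (rule mult_right_mono) simp
      also have "\<dots> = q ^ (d * (ell ?E + pdeg Q) + ell D)" by (simp add: power_add algebra_simps)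
      also have "\<dots> \<le> q ^ (d * (ell D + nat (\<gamma> + 1)) + ell D)"
        unfolding q_pow_le using le by (intro add_right_mono mult_left_mono) auto
      finally show ?thesis by (simp add: algebra_simps)
    qed
  qed
  then show ?thesis by blast
qed

text \<open>\<open>C\<close> represents the t^2 classes modulo Q^2, with t = q^deg(Q). Of these t
  lie in Q, and exactly one is the zero class. The three factors count the constant coefficient, the
  d - 1 middle ones and the leading one.\<close>

lemma eis_at_local_count:
  assumes Q: "Q \<in> places F K" and C: "finite C" "transversal (FI Q 0) (FI Q 2) C" and d: "d > 0"
  shows "card C = q ^ (2 * pdeg Q)"
    "card {h \<in> {..<d + 1} \<rightarrow>\<^sub>E C. eis_at d Q h} = (q ^ pdeg Q - 1) * q ^ ((d - 1) * pdeg Q) * (q ^ (2 * pdeg Q) - q ^ pdeg Q)"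
proof -
  note A = FI_addsub[OF Q]
  have CF: "C \<subseteq> FI Q 0" using transversalD(1)[OF C(2)] .
  have sub1: "FI Q 1 \<subseteq> FI Q 0" "FI Q 2 \<subseteq> FI Q 1" using FI_mono[of 0 1 Q] FI_mono[of 1 2 Q] by simp_all
  have "has_idx (FI Q 0) (FI Q 2) (card C)" using C by (auto simp: has_idx_def)
  moreover have "has_idx (FI Q 0) (FI Q 2) (q ^ (2 * pdeg Q))" using FI_idx[OF Q, of 0 2] by simp
  ultimately show cC: "card C = q ^ (2 * pdeg Q)" using has_idx_unique[OF _ _ A addsubD(1)[OF A]] by blast
  let ?C1 = "C \<inter> FI Q 1"
  have near: "c \<in> ?C1" if a: "a \<in> FI Q 1" "c \<in> C" "a \<ominus> c \<in> FI Q 2" for a c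
  proof -
    have F: "a \<in> carrier F" "c \<in> carrier F" using a CF by (auto simp: FI_def)
    have "a \<ominus> (a \<ominus> c) \<in> FI Q 1" using addsubD(3)[OF A a(1)] a(3) sub1(2) by blast
    moreover have "a \<ominus> (a \<ominus> c) = c" using F by algebra
    ultimately show ?thesis using a(2) by simp
  qed
  have inc: "incongruent C (FI Q 2)" using transversal_incongruent[OF C(2) A addsubD(1)[OF A]] .
  have "transversal (FI Q 1) (FI Q 2) ?C1"
  proof (rule transversalI[OF A addsubD(1)[OF A]])
    show "\<exists>c\<in>?C1. a \<ominus> c \<in> FI Q 2" if a: "a \<in> FI Q 1" for a
    proof -
      have "a \<in> FI Q 0" using a sub1(1) by blast
      then obtain c where c: "c \<in> C" "a \<ominus> c \<in> FI Q 2" using transversalD(2)[OF C(2)] by blast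
      then show ?thesis using near[OF a] by blast
    qed
    show "incongruent ?C1 (FI Q 2)" using inc by (auto simp: incongruent_def)
  qed auto
  then have "has_idx (FI Q 1) (FI Q 2) (card ?C1)" using C(1) by (auto simp: has_idx_def)
  moreover have "has_idx (FI Q 1) (FI Q 2) (q ^ pdeg Q)" using FI_idx[OF Q, of 1 1] by simp
  ultimately have cC1: "card ?C1 = q ^ pdeg Q" using has_idx_unique[OF _ _ A addsubD(1)[OF A]] by blast
  \<comment> \<open>The zero class has exactly one representative, which need not be zero
    itself.\<close>
  have "\<exists>c0. ?C1 \<inter> FI Q 2 = {c0}"
  proof -
    have "\<zero> \<in> FI Q 0" by (simp add: FI_def)
    then obtain c0 where c0: "c0 \<in> C" "\<zero> \<ominus> c0 \<in> FI Q 2" using transversalD(2)[OF C(2)] by blast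
    have F: "c0 \<in> carrier F" using c0 CF by (auto simp: FI_def)
    have "\<ominus> (\<zero> \<ominus> c0) \<in> FI Q 2" using addsubD(4)[OF A c0(2)] .
    then have c02: "c0 \<in> FI Q 2" using F by (simp add: minus_eq)
    have "c = c0" if "c \<in> C" "c \<in> FI Q 2" for c
      using addsubD(3)[OF A that(2) c02] inc that c0(1) by (auto simp: incongruent_def)
    then show ?thesis using c0(1) c02 sub1(2) by blast
  qed
  then obtain c0 where c0: "?C1 \<inter> FI Q 2 = {c0}" by blast
  have "card (?C1 - FI Q 2) = q ^ pdeg Q - 1"
    using card_Diff_subset_Int[of ?C1 "FI Q 2"] c0 C(1) cC1 by simp
  moreover have "card (C - FI Q 1) = q ^ (2 * pdeg Q) - q ^ pdeg Q"
    using card_Diff_subset_Int[of C "FI Q 1"] C(1) cC cC1 by simp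
  moreover have "{h \<in> {..<d + 1} \<rightarrow>\<^sub>E C. eis_at d Q h} =
      PiE {..<d + 1} (\<lambda>i. if i = 0 then ?C1 - FI Q 2 else if i < d then ?C1 else C - FI Q 1)" (is "?l = PiE _ ?B")
  proof (rule subset_antisym; rule subsetI)
    fix h assume h: "h \<in> ?l"
    show "h \<in> PiE {..<d + 1} ?B"
    proof (rule PiE_I)
      fix i assume i: "i \<in> {..<d + 1}"
      then have "h i \<in> C" using h by (auto dest: PiE_mem)
      moreover have "i = d" if "\<not> i < d" using i that by simp
      ultimately show "h i \<in> ?B i" using h d by (auto simp: eis_at_def)
    qed (use h in \<open>auto dest: PiE_arb\<close>)
  next
    fix h assume h: "h \<in> PiE {..<d + 1} ?B"
    have hB: "h i \<in> ?B i" if "i < d + 1" for i using PiE_mem[OF h, of i] that by simp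
    have "h \<in> {..<d + 1} \<rightarrow>\<^sub>E C"
    proof (rule PiE_I)
      fix i assume "i \<in> {..<d + 1}"
      then show "h i \<in> C" using hB[of i] by (auto split: if_splits)
    qed (use h in \<open>auto dest: PiE_arb\<close>)
    moreover have "h i \<in> FI Q 1" if "i < d" for i using hB[of i] that by (auto split: if_splits)
    moreover have "h 0 \<notin> FI Q 2" "h d \<notin> FI Q 1" using hB[of 0] hB[of d] d by auto
    ultimately show "h \<in> ?l" by (simp add: eis_at_def)
  qed
  moreover have "card (PiE {..<d + 1} ?B) = (\<Prod>i<d + 1. card (?B i))" by (rule card_PiE) simp
  moreover have "(\<Prod>i<d + 1. card (?B i)) = card (?C1 - FI Q 2) * card ?C1 ^ (d - 1) * card (C - FI Q 1)"
  proof -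
    obtain e where e: "d = Suc e" using d by (cases d) auto
    have "(\<Prod>i<d + 1. card (?B i)) = card (?B 0) * (\<Prod>i<d. card (?B (Suc i)))"
      using prod.lessThan_Suc_shift[of "\<lambda>i. card (?B i)" d] by simp
    also have "(\<Prod>i<d. card (?B (Suc i))) = (\<Prod>i<e. card (?B (Suc i))) * card (?B d)"
      unfolding e by simp
    also have "(\<Prod>i<e. card (?B (Suc i))) = (\<Prod>i<e. card ?C1)" using e by (intro prod.cong) auto
    finally show ?thesis using e by (simp add: mult.assoc)
  qed
  ultimately show "card {h \<in> {..<d + 1} \<rightarrow>\<^sub>E C. eis_at d Q h} = (q ^ pdeg Q - 1) * q ^ ((d - 1) * pdeg Q) * (q ^ (2 * pdeg Q) - q ^ pdeg Q)"
    by (simp add: cC1 power_mult[symmetric] mult.commute)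
qed


lemma density_identity:
  fixes t :: real
  assumes "t > 0" "d > 0"
  shows "t ^ (2 * (d + 1)) - (t - 1) * t ^ (d - 1) * (t\<^sup>2 - t) = t ^ (2 * (d + 1)) * (1 - (t - 1)\<^sup>2 / t ^ (d + 2))"
proof -
  obtain e where d: "d = Suc e" using assms(2) by (cases d) auto
  have "t ^ (2 * (d + 1)) = t ^ (d + 2) * t ^ d" by (simp add: power_add[symmetric] mult_2)
  then have "t ^ (2 * (d + 1)) * ((t - 1)\<^sup>2 / t ^ (d + 2)) = (t - 1)\<^sup>2 * t ^ d" using assms(1) by simp
  also have "\<dots> = (t - 1) * t ^ (d - 1) * (t\<^sup>2 - t)" unfolding d by (simp add: power2_eq_square algebra_simps)
  finally show ?thesis by (simp add: right_diff_distrib)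
qed

lemma non_eis_at_count:
  assumes Q: "Q \<in> places F K" and C: "finite C" "transversal (FI Q 0) (FI Q 2) C" and d: "d > 0"
  shows "real (card {h \<in> {..<d + 1} \<rightarrow>\<^sub>E C. \<not> eis_at d Q h}) =
    real q ^ (2 * pdeg Q * (d + 1)) * (1 - (real q ^ pdeg Q - 1)\<^sup>2 / real q ^ ((d + 2) * pdeg Q))"
proof -
  note cnt = eis_at_local_count[OF Q C d]
  let ?U = "{..<d + 1} \<rightarrow>\<^sub>E C"
  have fin: "finite ?U" using C(1) by (intro finite_PiE) auto
  have q1: "1 \<le> q ^ pdeg Q" using q_ge2 by simp
  have q12: "q ^ pdeg Q \<le> q ^ (2 * pdeg Q)" by (simp only: q_pow_le)
  have "{h \<in> ?U. \<not> eis_at d Q h} = ?U - {h \<in> ?U. eis_at d Q h}" by auto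
  then have "card {h \<in> ?U. \<not> eis_at d Q h} = card ?U - card {h \<in> ?U. eis_at d Q h}"
    using fin by (simp add: card_Diff_subset)
  moreover have "card {h \<in> ?U. eis_at d Q h} \<le> card ?U" using fin by (intro card_mono) auto
  ultimately have "real (card {h \<in> ?U. \<not> eis_at d Q h}) = real (card ?U) - real (card {h \<in> ?U. eis_at d Q h})"
    by simp
  moreover have "card ?U = card C ^ (d + 1)" by (simp add: card_PiE)
  then have "card ?U = q ^ (2 * pdeg Q * (d + 1))" by (simp only: cnt(1) power_mult)
  moreover define t where "t = real q ^ pdeg Q"
  have t: "t > 0" unfolding t_def using q_ge2 by simp
  have "real (card {h \<in> ?U. eis_at d Q h}) = (t - 1) * t ^ (d - 1) * (t\<^sup>2 - t)"
    unfolding cnt(2) t_def using q1 q12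
    by (simp add: of_nat_diff power_mult[symmetric] mult.commute)
  ultimately have cnt': "real (card {h \<in> ?U. \<not> eis_at d Q h}) =
      real q ^ (2 * pdeg Q * (d + 1)) - (t - 1) * t ^ (d - 1) * (t\<^sup>2 - t)" by simp
  have e: "t ^ (2 * (d + 1)) = real q ^ (2 * pdeg Q * (d + 1))" "t ^ (d + 2) = real q ^ ((d + 2) * pdeg Q)"
    unfolding t_def power_mult[symmetric] by (simp_all only: mult_ac)
  show ?thesis using cnt' density_identity[OF t d] unfolding e by (simp only: t_def)
qed

text \<open>For D large at \<open>P0\<close>, reduction maps L(D) onto the product over
  \<open>T\<close> of the quotients modulo Q^2, with fibres that are cosets of L(D - A). The
  Eisenstein conditions depend only on these reductions, so the count is an exact product rather
  than an asymptotic one.\<close>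

lemma local_density:
  assumes T: "finite T" "T \<subseteq> places F K" and P0: "P0 \<in> places F K" "P0 \<notin> T" and d: "d > 0"
  shows "\<exists>n0::nat. \<forall>D\<in>Div. (\<forall>P. (if P = P0 then int n0 else 0) \<le> D P) \<longrightarrow> (\<forall>Q\<in>T. D Q = 0) \<longrightarrow>
    real (card {f \<in> {..<d + 1} \<rightarrow>\<^sub>E LL D. \<forall>Q\<in>T. \<not> eis_at d Q f}) =
    real q ^ ((d + 1) * ell D) * (\<Prod>Q\<in>T. 1 - (real q ^ pdeg Q - 1)\<^sup>2 / real q ^ ((d + 2) * pdeg Q))"
proof -
  \<comment> \<open>Order 2 at each place of \<open>T\<close>, since the conditions are decided
    modulo Q^2.\<close>
  define A :: "'a set \<Rightarrow> int" where "A = (\<lambda>P. if P \<in> T then 2 else 0)"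
  have A: "A \<in> Div" "\<And>P. 0 \<le> A P" "A P0 = 0"
    using DivI[OF T, of A] P0(2) by (auto simp: A_def)
  have "degD A = (\<Sum>P\<in>T. A P * int (pdeg P))" by (rule degD_superset[OF T(1)]) (auto simp: A_def)
  also have "\<dots> = int (\<Sum>P\<in>T. 2 * pdeg P)" by (simp add: A_def)
  finally have degA: "nat (degD A) = (\<Sum>P\<in>T. 2 * pdeg P)" by (simp only: nat_int)
  obtain n0 :: nat where n0: "\<forall>D\<in>Div. (\<forall>P. (if P = P0 then int n0 else 0) \<le> D P) \<longrightarrow> (\<forall>P. A P \<noteq> 0 \<longrightarrow> D P = 0) \<longrightarrow>
    has_idx (LL D) (LL (\<lambda>P. D P - A P)) (q ^ nat (degD A)) \<and>
    (\<forall>a. (\<forall>P. A P \<noteq> 0 \<longrightarrow> a P \<in> OP P) \<longrightarrow> (\<exists>z\<in>LL D. \<forall>P. A P \<noteq> 0 \<longrightarrow> z \<ominus> a P \<in> FI P (A P)))"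
    using strong_approximation[OF P0(1) A] by blast
  have "\<forall>Q\<in>T. \<exists>C. finite C \<and> transversal (FI Q 0) (FI Q 2) C"
    using FI_idx[of _ 0 2] T(2) by (auto simp: has_idx_def subset_iff)
  from bchoice[OF this] obtain C where C: "\<forall>Q\<in>T. finite (C Q) \<and> transversal (FI Q 0) (FI Q 2) (C Q)" by blast
  have Cf: "finite (C Q)" and Ct: "transversal (FI Q 0) (FI Q 2) (C Q)" if "Q \<in> T" for Q using C that by auto
  have "\<forall>Q\<in>T. \<exists>r. (\<forall>a\<in>FI Q 0. r a \<in> C Q \<and> a \<ominus> r a \<in> FI Q 2) \<and>
    (\<forall>a\<in>FI Q 0. \<forall>c\<in>FI Q 0. r a = r c \<longleftrightarrow> a \<ominus> c \<in> FI Q 2) \<and> (\<forall>c\<in>C Q. r c = c)"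
    using transversal_rep[OF Ct FI_addsub addsubD(1)[OF FI_addsub]] T(2) by blast
  from bchoice[OF this] obtain r where r: "\<forall>Q\<in>T. (\<forall>a\<in>FI Q 0. r Q a \<in> C Q \<and> a \<ominus> r Q a \<in> FI Q 2) \<and>
    (\<forall>a\<in>FI Q 0. \<forall>c\<in>FI Q 0. r Q a = r Q c \<longleftrightarrow> a \<ominus> c \<in> FI Q 2) \<and> (\<forall>c\<in>C Q. r Q c = c)" by blast
  have r1: "r Q a \<in> C Q" "a \<ominus> r Q a \<in> FI Q 2" if "Q \<in> T" "a \<in> FI Q 0" for Q a using r that by blast+
  have r2: "r Q a = r Q c \<longleftrightarrow> a \<ominus> c \<in> FI Q 2" if "Q \<in> T" "a \<in> FI Q 0" "c \<in> FI Q 0" for Q a c using r that by blast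
  have r3: "r Q c = c" if "Q \<in> T" "c \<in> C Q" for Q c using r that by blast
  have C0: "C Q \<subseteq> FI Q 0" if "Q \<in> T" for Q using transversalD(1)[OF Ct[OF that]] .
  \<comment> \<open>Reduction modulo Q^2 does not change membership in Q or in Q^2, so
    \<open>eis_at\<close> can be tested on representatives.\<close>
  have rmem: "r Q a \<in> FI Q k \<longleftrightarrow> a \<in> FI Q k" if Q: "Q \<in> T" and a: "a \<in> FI Q 0" and k: "k \<le> 2" for Q a k
  proof -
    have QP: "Q \<in> places F K" using Q T by auto
    note AF = addsubD[OF FI_addsub[OF QP, of k]]
    have dk: "a \<ominus> r Q a \<in> FI Q k" using r1(2)[OF Q a] FI_mono[OF k, of Q] by blast
    have F: "a \<in> carrier F" "r Q a \<in> carrier F" using a r1(1)[OF Q a] C0[OF Q] by (auto simp: FI_def)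
    have "a = (a \<ominus> r Q a) \<oplus> r Q a" "r Q a = a \<ominus> (a \<ominus> r Q a)" using F by algebra+
    then show ?thesis using AF(3,5) dk by metis
  qed
  show ?thesis
  proof (intro exI[of _ n0] ballI impI)
    fix D assume D: "D \<in> Div" "\<forall>P. (if P = P0 then int n0 else 0) \<le> D P" "\<forall>Q\<in>T. D Q = 0"
    have DA: "(\<lambda>P. D P - A P) \<in> Div" using Div_diff(1)[OF D(1) A(1)] .
    have D0: "\<forall>P. A P \<noteq> 0 \<longrightarrow> D P = 0" using D(3) by (auto simp: A_def)
    have n: "has_idx (LL D) (LL (\<lambda>P. D P - A P)) (q ^ nat (degD A)) \<and>
      (\<forall>a. (\<forall>P. A P \<noteq> 0 \<longrightarrow> a P \<in> OP P) \<longrightarrow> (\<exists>z\<in>LL D. \<forall>P. A P \<noteq> 0 \<longrightarrow> z \<ominus> a P \<in> FI P (A P)))"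
      using n0 D(1,2) D0 by blast
    note idx = conjunct1[OF n]
    have surj: "\<exists>z\<in>LL D. \<forall>P\<in>T. z \<ominus> a P \<in> FI P 2" if a: "\<And>P. P \<in> T \<Longrightarrow> a P \<in> OP P" for a
    proof -
      have "\<forall>P. A P \<noteq> 0 \<longrightarrow> a P \<in> OP P" using a by (auto simp: A_def)
      then obtain z where z: "z \<in> LL D" "\<forall>P. A P \<noteq> 0 \<longrightarrow> z \<ominus> a P \<in> FI P (A P)" using conjunct2[OF n] by blast
      have "z \<ominus> a P \<in> FI P 2" if "P \<in> T" for P using z(2)[rule_format, of P] that by (simp add: A_def)
      then show ?thesis using z(1) by blast
    qed
    have le: "D P - A P \<le> D P" for P using A(2)[of P] by simp
    have sub: "LL (\<lambda>P. D P - A P) \<subseteq> LL D" by (rule LL_mono[OF le])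
    have cardL: "card (LL D) = q ^ nat (degD A) * card (LL (\<lambda>P. D P - A P))"
      using has_idx_card[OF idx LL_addsub LL_addsub sub LL_finite[OF DA]] by simp
    have L0: "z \<in> FI Q 0" if "z \<in> LL D" "Q \<in> T" for z Q
    proof -
      have "Q \<in> places F K" "D Q = 0" using that T D(3) by auto
      then show ?thesis using that(1) by (auto simp: LL_FI)
    qed
    define \<phi> where "\<phi> z = (\<lambda>Q\<in>T. r Q z)" for z
    \<comment> \<open>Strong approximation provides one preimage \<open>z0\<close> of the prescribed
      representatives; the other preimages differ from it by L(D - A).\<close>
    have fibre: "card {z \<in> LL D. \<phi> z = y} = card (LL (\<lambda>P. D P - A P))" if y: "y \<in> PiE T C" for y
    proof -
      have yC: "y Q \<in> C Q" "y Q \<in> FI Q 0" if "Q \<in> T" for Q using y that C0[OF that] by (auto dest: PiE_mem)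
      obtain z0 where z0: "z0 \<in> LL D" "\<And>Q. Q \<in> T \<Longrightarrow> z0 \<ominus> y Q \<in> FI Q 2"
        using surj[of y] yC(2) FI_0 T(2) by blast
      have z0r: "r Q z0 = y Q" if "Q \<in> T" for Q
        using r2[OF that L0[OF z0(1) that] yC(2)[OF that]] z0(2)[OF that] r3[OF that yC(1)[OF that]] by simp
      have "\<phi> z = y \<longleftrightarrow> z \<ominus> z0 \<in> LL (\<lambda>P. D P - A P)" if z: "z \<in> LL D" for z
      proof -
        have "\<phi> z = y \<longleftrightarrow> (\<forall>Q\<in>T. r Q z = y Q)"
          using y unfolding \<phi>_def by (auto simp: fun_eq_iff restrict_def PiE_iff extensional_def)
        also have "\<dots> \<longleftrightarrow> (\<forall>Q\<in>T. r Q z = r Q z0)" using z0r by simp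
        also have "\<dots> \<longleftrightarrow> (\<forall>Q\<in>T. z \<ominus> z0 \<in> FI Q 2)" using r2 L0[OF z] L0[OF z0(1)] by simp
        also have "\<dots> \<longleftrightarrow> (\<forall>P\<in>places F K. D P - A P \<noteq> D P \<longrightarrow> z \<ominus> z0 \<in> FI P (- (D P - A P)))"
          using D(3) T(2) by (auto simp: A_def)
        finally show ?thesis using LL_diff_mem[OF le z z0(1)] by simp
      qed
      then have eq: "{z \<in> LL D. \<phi> z = y} = {z \<in> LL D. z \<ominus> z0 \<in> LL (\<lambda>P. D P - A P)}" by auto
      have LF: "z \<in> carrier F" if "z \<in> LL D" for z using that by (auto simp: RR_space_def)
      have img: "{z \<in> LL D. z \<ominus> z0 \<in> LL (\<lambda>P. D P - A P)} = (\<lambda>w. w \<oplus> z0) ` LL (\<lambda>P. D P - A P)"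
      proof (rule subset_antisym; rule subsetI)
        fix z assume z: "z \<in> {z \<in> LL D. z \<ominus> z0 \<in> LL (\<lambda>P. D P - A P)}"
        have "z = (z \<ominus> z0) \<oplus> z0" using LF z z0(1) by (simp add: minus_eq a_assoc l_neg)
        then show "z \<in> (\<lambda>w. w \<oplus> z0) ` LL (\<lambda>P. D P - A P)" using z by blast
      next
        fix z assume "z \<in> (\<lambda>w. w \<oplus> z0) ` LL (\<lambda>P. D P - A P)"
        then obtain w where w: "w \<in> LL (\<lambda>P. D P - A P)" "z = w \<oplus> z0" by auto
        have wD: "w \<in> LL D" using w sub by auto
        have "z \<ominus> z0 = w" unfolding w(2) using LF[OF wD] LF[OF z0(1)] by (simp add: minus_eq a_assoc r_neg)
        then show "z \<in> {z \<in> LL D. z \<ominus> z0 \<in> LL (\<lambda>P. D P - A P)}"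
          using w addsubD(5)[OF LL_addsub wD z0(1)] by simp
      qed
      have "inj_on (\<lambda>w. w \<oplus> z0) (LL (\<lambda>P. D P - A P))"
        using LF sub z0(1) by (intro inj_onI) (meson subsetD add.r_cancel)
      then show ?thesis unfolding eq img by (rule card_image)
    qed
    have phiC: "\<phi> ` LL D \<subseteq> PiE T C" unfolding \<phi>_def using r1(1) L0 by auto
    let ?I = "{..<d + 1}"
    let ?R = "\<lambda>g. \<forall>Q\<in>T. \<not> eis_at d Q (\<lambda>i\<in>?I. g i Q)"
    have "{f \<in> ?I \<rightarrow>\<^sub>E LL D. \<forall>Q\<in>T. \<not> eis_at d Q f} = {f \<in> ?I \<rightarrow>\<^sub>E LL D. ?R (\<lambda>i\<in>?I. \<phi> (f i))}"
    proof -
      have "eis_at d Q (\<lambda>i\<in>?I. (\<lambda>i\<in>?I. \<phi> (f i)) i Q) \<longleftrightarrow> eis_at d Q f" if f: "f \<in> ?I \<rightarrow>\<^sub>E LL D" and Q: "Q \<in> T" for f Q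
      proof -
        have m: "r Q (f i) \<in> FI Q k \<longleftrightarrow> f i \<in> FI Q k" if "i < d + 1" "k \<le> 2" for i k
          using rmem[OF Q L0[OF PiE_mem[OF f] Q] that(2), of i] that(1) by simp
        show ?thesis unfolding eis_at_def \<phi>_def using Q m[of _ 1] m[of _ 2] d by auto
      qed
      then show ?thesis by blast
    qed
    then have "card {f \<in> ?I \<rightarrow>\<^sub>E LL D. \<forall>Q\<in>T. \<not> eis_at d Q f} =
        card (LL (\<lambda>P. D P - A P)) ^ (d + 1) * card {g \<in> ?I \<rightarrow>\<^sub>E PiE T C. ?R g}"
      using card_families_fibre[of "LL D" "PiE T C" ?I \<phi> _ ?R, OF LL_finite[OF D(1)] _ _ phiC fibre]
        finite_PiE[OF T(1), of C] Cf by simp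
    also have "card {g \<in> ?I \<rightarrow>\<^sub>E PiE T C. ?R g} = (\<Prod>Q\<in>T. card {h \<in> ?I \<rightarrow>\<^sub>E C Q. \<not> eis_at d Q h})"
      by (rule card_families_independent[OF T(1), of ?I C "\<lambda>Q h. \<not> eis_at d Q h"]) simp
    finally have cnt: "card {f \<in> ?I \<rightarrow>\<^sub>E LL D. \<forall>Q\<in>T. \<not> eis_at d Q f} =
        card (LL (\<lambda>P. D P - A P)) ^ (d + 1) * (\<Prod>Q\<in>T. card {h \<in> ?I \<rightarrow>\<^sub>E C Q. \<not> eis_at d Q h})" .
    let ?x = "\<lambda>Q. 1 - (real q ^ pdeg Q - 1)\<^sup>2 / real q ^ ((d + 2) * pdeg Q)"
    have "real (\<Prod>Q\<in>T. card {h \<in> ?I \<rightarrow>\<^sub>E C Q. \<not> eis_at d Q h}) = (\<Prod>Q\<in>T. real q ^ (2 * pdeg Q * (d + 1)) * ?x Q)"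
      unfolding of_nat_prod using non_eis_at_count[OF _ Cf Ct d] T(2) by (intro prod.cong) auto
    also have "\<dots> = real q ^ ((d + 1) * nat (degD A)) * (\<Prod>Q\<in>T. ?x Q)"
      unfolding degA by (simp add: prod.distrib power_sum power_mult[symmetric] mult.commute sum_distrib_left mult.left_commute)
    finally have pr: "real (\<Prod>Q\<in>T. card {h \<in> ?I \<rightarrow>\<^sub>E C Q. \<not> eis_at d Q h}) = real q ^ ((d + 1) * nat (degD A)) * (\<Prod>Q\<in>T. ?x Q)" .
    have "real q ^ ((d + 1) * ell D) = real (card (LL D)) ^ (d + 1)"
      unfolding card_LL[OF D(1)] by (simp only: of_nat_power power_mult[symmetric] mult.commute[of "d + 1"])
    also have "\<dots> = real q ^ ((d + 1) * nat (degD A)) * real (card (LL (\<lambda>P. D P - A P))) ^ (d + 1)"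
      unfolding cardL by (simp only: of_nat_mult of_nat_power power_mult_distrib power_mult[symmetric] mult.commute[of "d + 1"])
    finally have qD: "real q ^ ((d + 1) * ell D) = real q ^ ((d + 1) * nat (degD A)) * real (card (LL (\<lambda>P. D P - A P))) ^ (d + 1)" .
    show "real (card {f \<in> ?I \<rightarrow>\<^sub>E LL D. \<forall>Q\<in>T. \<not> eis_at d Q f}) = real q ^ ((d + 1) * ell D) * (\<Prod>Q\<in>T. ?x Q)"
      unfolding cnt of_nat_mult of_nat_power pr qD by (simp only: mult_ac)
  qed
qed

end

section \<open>Eisenstein polynomials over the holomorphy ring\<close>

text \<open>\<open>P0\<close> witnesses that \<open>S\<close> is a proper set of places. Allowing
  poles there leaves elements inside the holomorphy ring and gives room for strong
  approximation.\<close>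

locale holomorphy_setting = function_field_basis F K x W for F :: "('a, 'm) ring_scheme" (structure) and K x W +
  fixes S :: "'a set set" and P0 :: "'a set"
  assumes S: "S \<noteq> {}" "S \<subseteq> places F K" and P0: "P0 \<in> places F K" "P0 \<notin> S"
begin

definition H :: "'a set"
  where "H = holomorphy_ring F K S"

abbreviation RH :: "('a, 'm) ring_scheme"
  where "RH \<equiv> F\<lparr>carrier := H\<rparr>"

lemma H_iff: "z \<in> H \<longleftrightarrow> z \<in> carrier F \<and> (\<forall>Q\<in>S. z \<in> FI Q 0)"
proof -
  have "z \<in> H \<longleftrightarrow> (\<forall>Q\<in>S. z \<in> FI Q 0)" using FI_0 S(2) by (auto simp: H_def holomorphy_ring_def)
  then show ?thesis using S(1) by (auto simp: FI_def)
qed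

lemma H_FI: "z \<in> H \<Longrightarrow> Q \<in> S \<Longrightarrow> z \<in> FI Q 0"
  by (simp add: H_iff)

lemma SP: "Q \<in> S \<Longrightarrow> Q \<in> places F K"
  using S(2) by auto

lemma H_subring: "subring H F"
proof -
  have OP: "subring (OP Q) F" if "Q \<in> S" for Q using place_facts(4)[OF SP[OF that]] .
  have "subring (carrier F \<inter> (\<Inter>Q\<in>S. OP Q)) F"
    by (rule subringI) (use subringE[OF OP] in auto)
  moreover have "H = carrier F \<inter> (\<Inter>Q\<in>S. OP Q)" using H_iff FI_0 SP by auto
  ultimately show ?thesis by simp
qed

lemma H_carrier: "z \<in> H \<Longrightarrow> z \<in> carrier F"
  by (simp add: H_iff)

lemma H_ring: "cring RH" "ring RH"
  using subring_is_domain[OF H_subring] by (auto simp: domain_def cring_def)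

lemma LL_H:
  assumes "\<And>Q. Q \<in> S \<Longrightarrow> D Q = 0"
  shows "LL D \<subseteq> H"
proof
  fix z assume z: "z \<in> LL D"
  have "z \<in> FI Q 0" if "Q \<in> S" for Q using z assms[OF that] SP[OF that] by (auto simp: LL_FI)
  then show "z \<in> H" using z by (auto simp: H_iff LL_FI)
qed

text \<open>The approximating element has poles at most at \<open>P0\<close>, hence lies in
  \<open>H\<close>.\<close>

lemma H_approximation:
  assumes A: "A \<in> Div" "\<And>P. 0 \<le> A P" "\<And>P. A P \<noteq> 0 \<Longrightarrow> P \<in> S" and a: "\<And>P. P \<in> S \<Longrightarrow> a P \<in> FI P 0"
  shows "\<exists>z\<in>H. \<forall>P. A P \<noteq> 0 \<longrightarrow> z \<ominus> a P \<in> FI P (A P)"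
proof -
  have AP0: "A P0 = 0" using A(3) P0(2) by blast
  obtain n0 :: nat where n0: "\<forall>D\<in>Div. (\<forall>P. (if P = P0 then int n0 else 0) \<le> D P) \<longrightarrow> (\<forall>P. A P \<noteq> 0 \<longrightarrow> D P = 0) \<longrightarrow>
    has_idx (LL D) (LL (\<lambda>P. D P - A P)) (q ^ nat (degD A)) \<and>
    (\<forall>a. (\<forall>P. A P \<noteq> 0 \<longrightarrow> a P \<in> OP P) \<longrightarrow> (\<exists>z\<in>LL D. \<forall>P. A P \<noteq> 0 \<longrightarrow> z \<ominus> a P \<in> FI P (A P)))"
    using strong_approximation[OF P0(1) A(1,2) AP0] by blast
  let ?D = "\<lambda>P. if P = P0 then int n0 else 0"
  have D: "?D \<in> Div" by (rule Div_single(1)[OF P0(1)])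
  have D0: "\<forall>P. A P \<noteq> 0 \<longrightarrow> ?D P = 0" using AP0 by auto
  have aO: "\<forall>P. A P \<noteq> 0 \<longrightarrow> a P \<in> OP P" using a A(3) FI_0 SP by blast
  have Dle: "\<forall>P. (if P = P0 then int n0 else 0) \<le> ?D P" by simp
  have "\<forall>a. (\<forall>P. A P \<noteq> 0 \<longrightarrow> a P \<in> OP P) \<longrightarrow> (\<exists>z\<in>LL ?D. \<forall>P. A P \<noteq> 0 \<longrightarrow> z \<ominus> a P \<in> FI P (A P))"
    by (rule conjunct2[OF n0[THEN bspec[OF _ D], THEN mp, OF Dle, THEN mp, OF D0]])
  from mp[OF spec[OF this] aO] have "\<exists>z\<in>LL ?D. \<forall>P. A P \<noteq> 0 \<longrightarrow> z \<ominus> a P \<in> FI P (A P)" .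
  moreover have "LL ?D \<subseteq> H" by (rule LL_H) (use P0(2) in auto)
  ultimately show ?thesis by blast
qed

section \<open>Prime ideals of the holomorphy ring\<close>

lemma RH_minus: "a \<in> H \<Longrightarrow> \<ominus>\<^bsub>RH\<^esub> a = \<ominus> a"
proof -
  assume a: "a \<in> H"
  interpret R: cring RH by (rule H_ring(1))
  have "\<ominus> a \<in> H" using subringE(5)[OF H_subring a] .
  then show ?thesis using a H_carrier[OF a] by (intro R.minus_equality) (auto simp: l_neg)
qed

lemma place_primeideal:
  assumes Q: "Q \<in> S"
  shows "primeideal (Q \<inter> H) RH"
proof -
  interpret R: cring RH by (rule H_ring(1))
  note PF = place_facts[OF SP[OF Q]] and HS = subringE[OF H_subring]
  have HQ: "H \<subseteq> OP Q" using H_FI[OF _ Q] FI_0[OF SP[OF Q]] by auto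
  have id: "ideal (Q \<inter> H) RH"
  proof (rule idealI)
    have "R.addsub (Q \<inter> H)"
      by (rule R.addsubI) (use addsubD[OF PF(1)] addsubD[OF addsub_subring[OF H_subring]] RH_minus in auto)
    then show "subgroup (Q \<inter> H) (add_monoid RH)" by (simp only: R.addsub_subgroup)
    show "z \<otimes>\<^bsub>RH\<^esub> a \<in> Q \<inter> H" if "a \<in> Q \<inter> H" "z \<in> carrier RH" for a z
      using that PF(3)[of z a] HS(6)[of z a] HQ by auto
    show "a \<otimes>\<^bsub>RH\<^esub> z \<in> Q \<inter> H" if "a \<in> Q \<inter> H" "z \<in> carrier RH" for a z
    proof -
      have "a \<otimes> z = z \<otimes> a" using that H_carrier by (auto intro: m_comm)
      then show ?thesis using that PF(3)[of z a] HS(6)[of z a] HQ by auto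
    qed
  qed (rule H_ring(2))
  show ?thesis
  proof (rule primeidealI[OF id H_ring(1)])
    show "carrier RH \<noteq> Q \<inter> H" using one_notin_place[OF SP[OF Q]] HS(3) by auto
    fix a c assume ac: "a \<in> carrier RH" "c \<in> carrier RH" "a \<otimes>\<^bsub>RH\<^esub> c \<in> Q \<inter> H"
    have H: "a \<in> H" "c \<in> H" "a \<otimes> c \<in> Q" using ac by auto
    show "a \<in> Q \<inter> H \<or> c \<in> Q \<inter> H"
    proof (rule ccontr)
      assume "\<not> ?thesis"
      then have "a \<notin> Q" "c \<notin> Q" using H by auto
      then have "a \<noteq> \<zero>" "c \<noteq> \<zero>" using addsubD(2)[OF PF(1)] by auto
      moreover have F: "a \<in> carrier F" "c \<in> carrier F" using H H_carrier by auto
      moreover have "v Q a \<le> 0" "v Q c \<le> 0"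
        using v_OP(2)[OF SP[OF Q]] F calculation \<open>a \<notin> Q\<close> \<open>c \<notin> Q\<close> by (meson not_le int_one_le_iff_zero_less)+
      ultimately show False using H(3) v_OP(2)[OF SP[OF Q], of "a \<otimes> c"] v_mult[OF SP[OF Q], of a c] by simp
    qed
  qed
qed

lemma H_divide:
  assumes "a \<in> H" "a \<noteq> \<zero>" "c \<in> H" "\<And>Q. Q \<in> S \<Longrightarrow> 0 < v Q a \<Longrightarrow> c \<in> FI Q (v Q a)"
  shows "inv a \<otimes> c \<in> H"
proof -
  have F: "a \<in> carrier F" "c \<in> carrier F" using assms H_carrier by auto
  have "inv a \<otimes> c \<in> FI Q 0" if Q: "Q \<in> S" for Q
  proof -
    have "c \<in> FI Q (v Q a)"
    proof (cases "0 < v Q a")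
      case False
      then have "v Q a = 0" using H_FI[OF assms(1) Q] assms(2) by (auto simp: FI_def)
      then show ?thesis using H_FI[OF assms(3) Q] by simp
    qed (use assms(4)[OF Q] in blast)
    moreover have "inv a \<in> FI Q (- v Q a)" using v_inv[OF SP[OF Q] F(1) assms(2)] F assms(2) by (auto simp: FI_def)
    ultimately show ?thesis using FI_mult[OF SP[OF Q], of "inv a" "- v Q a" c "v Q a"] by simp
  qed
  then show ?thesis using F assms(2) by (auto simp: H_iff)
qed

lemma FI_pow:
  assumes "Q \<in> places F K" "a \<in> FI Q 1"
  shows "a [^] (n::nat) \<in> FI Q (int n)"
proof (induction n)
  case 0
  then show ?case using v_one[OF assms(1)] by (simp add: FI_def)
next
  case (Suc n)
  from FI_mult[OF assms(1) Suc assms(2)] show ?case by (simp add: add.commute)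
qed

text \<open>The nonzero element \<open>a\<close> has only finitely many zeros in \<open>S\<close>.
  Primality of \<open>p\<close> shows that it contains Q \<inter> H for one of them, and finiteness
  of the residue field makes this ideal large enough to equal \<open>p\<close>.\<close>

lemma nonzero_primeideal:
  assumes p: "primeideal p RH" and a: "a \<in> p" "a \<noteq> \<zero>"
  shows "\<exists>Q\<in>S. p = Q \<inter> H"
proof -
  interpret p: primeideal p RH by (rule p)
  note HS = subringE[OF H_subring]
  have pH: "p \<subseteq> H" using p.a_subset by simp
  have aH: "a \<in> H" "a \<in> carrier F" using a pH H_carrier by auto
  have one: "\<one> \<notin> p" using p.one_imp_carrier p.I_notcarr by auto
  have prime: "u \<in> p \<or> w \<in> p" if "u \<in> H" "w \<in> H" "u \<otimes> w \<in> p" for u w using p.I_prime[of u w] that by simp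
  have powp: "u \<in> p" if "u \<in> H" "u [^] (n::nat) \<in> p" for u n
    using that(2)
  proof (induction n)
    case 0
    then show ?case using one by simp
  next
    case (Suc n)
    have "u [^] n \<in> H" using that(1) HS by (induction n) auto
    then show ?case using prime[of "u [^] n" u] Suc that(1) by auto
  qed
  let ?Z = "{Q \<in> S. 0 < v Q a}"
  have fin: "finite ?Z" by (rule finite_subset[OF _ finite_zeros[OF aH(2) a(2)]]) (use SP in auto)
  have "\<exists>Q\<in>?Z. Q \<inter> H \<subseteq> p"
  proof (rule ccontr)
    \<comment> \<open>Then every zero Q of \<open>a\<close> in \<open>S\<close> has some u in Q
      \<inter> H outside \<open>p\<close>. The product of the powers u^(v_Q(a)) stays outside the
      prime ideal, although \<open>a\<close> divides it in \<open>H\<close>.\<close>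
    assume no: "\<not> ?thesis"
    have "\<exists>c\<in>H. c \<notin> p \<and> (\<forall>Q\<in>Z. c \<in> FI Q (v Q a))" if "finite Z" "Z \<subseteq> ?Z" for Z
      using that
    proof (induction Z)
      case empty
      show ?case using one HS(3) by auto
    next
      case (insert Q Z)
      then obtain c where c: "c \<in> H" "c \<notin> p" "\<And>Q. Q \<in> Z \<Longrightarrow> c \<in> FI Q (v Q a)" by auto
      have Q: "Q \<in> S" "0 < v Q a" using insert.prems by auto
      obtain u where u: "u \<in> Q" "u \<in> H" "u \<notin> p" using no insert.prems by blast
      define n where "n = nat (v Q a)"
      have uQ: "u [^] n \<in> FI Q (v Q a)"
        using FI_pow[OF SP[OF Q(1)], of u n] u(1) FI_1[OF SP[OF Q(1)]] Q(2) by (simp add: n_def)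
      have unH: "u [^] n \<in> H" using u(2) HS by (induction n) auto
      have "c \<otimes> u [^] n \<in> FI R (v R a)" if "R \<in> insert Q Z" for R
      proof (cases "R = Q")
        case True
        then show ?thesis using FI_mult[OF SP[OF Q(1)] H_FI[OF c(1) Q(1)] uQ] by simp
      next
        case False
        then have R: "R \<in> Z" "R \<in> S" using that insert.prems by auto
        then show ?thesis using FI_mult[OF SP[OF R(2)] c(3)[OF R(1)] H_FI[OF unH R(2)]] by simp
      qed
      moreover have "c \<otimes> u [^] n \<notin> p" using prime[OF c(1) unH] c(2) powp[OF u(2)] u(3) by blast
      moreover have "c \<otimes> u [^] n \<in> H" using HS(6)[OF c(1) unH] .
      ultimately show ?case by blast
    qed
    from this[OF fin] obtain c where c: "c \<in> H" "c \<notin> p" "\<And>Q. Q \<in> ?Z \<Longrightarrow> c \<in> FI Q (v Q a)" by auto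
    have "inv a \<otimes> c \<in> H" by (rule H_divide[OF aH(1) a(2) c(1)]) (use c(3) in auto)
    then have "a \<otimes>\<^bsub>RH\<^esub> (inv a \<otimes> c) \<in> p" using p.I_r_closed[OF a(1)] by simp
    moreover have "a \<otimes> (inv a \<otimes> c) = c" using aH a(2) H_carrier[OF c(1)] by simp
    ultimately show False using c(2) by simp
  qed
  then obtain Q where Q: "Q \<in> S" "Q \<inter> H \<subseteq> p" by auto
  have "p \<subseteq> Q \<inter> H"
  proof
    fix u assume u: "u \<in> p"
    have uH: "u \<in> H" using u pH by auto
    have uF: "u \<in> carrier F" using uH H_carrier by auto
    have uO: "u \<in> OP Q" using H_FI[OF uH Q(1)] FI_0[OF SP[OF Q(1)]] by simp
    show "u \<in> Q \<inter> H"
    proof (rule ccontr)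
      assume "u \<notin> Q \<inter> H"
      then have uQ: "u \<notin> Q" using uH by auto
      \<comment> \<open>For u in \<open>p\<close> outside Q, some power u^M is 1 modulo Q. Then u^M
        - 1 lies in Q \<inter> H and so in \<open>p\<close>, together with u^M, which puts one into
        \<open>p\<close>.\<close>
      from residue_exponent[OF SP[OF Q(1)]] obtain M :: nat where M: "M \<ge> 1"
        "\<forall>k::nat. k \<ge> 1 \<longrightarrow> (\<forall>y\<in>OP Q. y [^] (M * k) \<in> Q \<or> y [^] (M * k) \<ominus> \<one> \<in> Q)"
        by (elim exE conjE)
      have or: "u [^] M \<in> Q \<or> u [^] M \<ominus> \<one> \<in> Q" using M(2)[rule_format, of 1 u] uO by simp
      have "u \<noteq> \<zero>" using uQ addsubD(2)[OF place_facts(1)[OF SP[OF Q(1)]]] by auto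
      then have "v Q (u [^] M) = 0"
        using v_pow[OF SP[OF Q(1)] uF, of M] v_OP[OF SP[OF Q(1)] uF] uO uQ by simp
      then have "u [^] M \<notin> Q" using v_OP(2)[OF SP[OF Q(1)], of "u [^] M"] uF \<open>u \<noteq> \<zero>\<close> by simp
      then have m1: "u [^] M \<ominus> \<one> \<in> Q" using or by simp
      have uMH: "u [^] k \<in> H" for k :: nat using uH HS by (induction k) auto
      have uMp: "u [^] M \<in> p"
      proof -
        obtain k where k: "M = Suc k" using M(1) by (cases M) auto
        have "u [^] k \<otimes>\<^bsub>RH\<^esub> u \<in> p" using p.I_l_closed[OF u, of "u [^] k"] uMH by simp
        then show ?thesis unfolding k by simp
      qed
      have "u [^] M \<ominus> \<one> \<in> H" using addsubD(3)[OF addsub_subring[OF H_subring] uMH HS(3)] .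
      then have "u [^] M \<ominus> \<one> \<in> p" using m1 Q(2) by blast
      moreover have "\<ominus> (u [^] M) \<in> p"
      proof -
        have "(\<ominus> \<one>) \<otimes>\<^bsub>RH\<^esub> u [^] M \<in> p" using p.I_l_closed[OF uMp, of "\<ominus> \<one>"] HS(3,5) by simp
        then show ?thesis using uF by (simp add: l_minus)
      qed
      ultimately have "(u [^] M \<ominus> \<one>) \<oplus>\<^bsub>RH\<^esub> \<ominus> (u [^] M) \<in> p" by (rule additive_subgroup.a_closed[OF ideal.axioms(1)[OF p.is_ideal]])
      moreover have "(u [^] M \<ominus> \<one>) \<oplus> \<ominus> (u [^] M) = \<ominus> \<one>"
      proof -
        have "u [^] M \<in> carrier F" using uF by simp
        then show ?thesis by algebra
      qed
      ultimately have "\<ominus> \<one> \<in> p" by simp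
      then have "(\<ominus> \<one>) \<otimes>\<^bsub>RH\<^esub> (\<ominus> \<one>) \<in> p" using p.I_l_closed[of "\<ominus> \<one>" "\<ominus> \<one>"] HS(3,5) by simp
      moreover have "(\<ominus> \<one>) \<otimes> (\<ominus> \<one>) = \<one>" by algebra
      ultimately show False using one by simp
    qed
  qed
  then show ?thesis using Q by blast
qed

text \<open>The inclusion from right to left needs work, since Q \<inter> H need not be principal.
  Take t in \<open>H\<close> of valuation 1 at Q, and c in \<open>H\<close> that is 1 modulo Q and
  divisible by t^2 away from Q. Then z = cz + (1 - c)z, where cz = t (ht) with h in
  \<open>H\<close>, and (1 - c)z is a product of two elements of Q \<inter> H.\<close>

lemma place_ideal_square:
  assumes Q: "Q \<in> S"
  shows "(Q \<inter> H) \<cdot>\<^bsub>RH\<^esub> (Q \<inter> H) = FI Q 2 \<inter> H"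
proof (rule subset_antisym; rule subsetI)
  note HS = subringE[OF H_subring] and QP = SP[OF Q]
  have Q1: "FI Q 1 = Q" by (rule FI_1[OF QP])
  fix z
  show "z \<in> FI Q 2 \<inter> H" if "z \<in> (Q \<inter> H) \<cdot>\<^bsub>RH\<^esub> (Q \<inter> H)"
    using that
  proof (induction rule: ideal_prod.induct)
    case (prod i j)
    then have "i \<otimes> j \<in> FI Q (1 + 1)" using FI_mult[OF QP, of i 1 j 1] Q1 by auto
    then show ?case using prod HS(6)[of i j] by auto
  next
    case (sum s t)
    then show ?case using addsubD(5)[OF FI_addsub[OF QP]] HS(7)[of s t] by auto
  qed
  assume z: "z \<in> FI Q 2 \<inter> H"
  then have zF: "z \<in> carrier F" by (auto simp: FI_def)
  have zQ: "z \<in> Q" using z FI_mono[of 1 2 Q] Q1 by auto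
  obtain s where s: "s \<in> carrier F" "s \<noteq> \<zero>" "v Q s = 1" using v_value[OF QP] by blast
  let ?A = "\<lambda>P. if P = Q then 2 else 0 :: int"
  obtain t where t: "t \<in> H" "t \<ominus> s \<in> FI Q 2"
  proof -
    have "\<exists>z\<in>H. \<forall>P. ?A P \<noteq> 0 \<longrightarrow> z \<ominus> (if P = Q then s else \<zero>) \<in> FI P (?A P)"
    proof (rule H_approximation)
      show "?A \<in> Div" by (rule Div_single(1)[OF QP])
      show "(if P = Q then s else \<zero>) \<in> FI P 0" if "P \<in> S" for P using s by (auto simp: FI_def)
    qed (use Q in \<open>auto split: if_splits\<close>)
    then obtain z where z: "z \<in> H" "\<forall>P. ?A P \<noteq> 0 \<longrightarrow> z \<ominus> (if P = Q then s else \<zero>) \<in> FI P (?A P)" by blast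
    have "z \<ominus> s \<in> FI Q 2" using z(2)[rule_format, of Q] by simp
    then show thesis using that z(1) by blast
  qed
  have tF: "t \<in> carrier F" using H_carrier[OF t(1)] .
  have s1: "s \<in> FI Q 1" "s \<notin> FI Q 2" using s by (auto simp: FI_def)
  have "t = (t \<ominus> s) \<oplus> s" using tF s(1) by algebra
  moreover have ts1: "t \<ominus> s \<in> FI Q 1" using t(2) FI_mono[of 1 2 Q] by auto
  ultimately have tQ: "t \<in> FI Q 1" using addsubD(5)[OF FI_addsub[OF QP] _ s1(1)] by metis
  have "s = t \<ominus> (t \<ominus> s)" using tF s(1) by algebra
  then have t2: "t \<notin> FI Q 2" using addsubD(3)[OF FI_addsub[OF QP] _ t(2)] s1(2) by metis
  have t0: "t \<noteq> \<zero>" and vt: "v Q t = 1" using tQ t2 tF by (auto simp: FI_def)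
  let ?a = "t \<otimes> t"
  have a: "?a \<in> H" "?a \<noteq> \<zero>" "?a \<in> carrier F" using HS(6)[OF t(1) t(1)] tF t0 by auto
  have va: "v Q ?a = 2" using v_mult[OF QP tF t0 tF t0] vt by simp
  let ?Z = "{P \<in> S. P \<noteq> Q \<and> 0 < v P ?a}"
  have finZ: "finite ?Z" by (rule finite_subset[OF _ finite_zeros[OF a(3,2)]]) (use SP in auto)
  \<comment> \<open>At Q only the congruence to one is prescribed; at the other zeros of t^2 in
    \<open>S\<close> the element c must vanish to the same order. The factor z of order 2 takes care
    of the division at Q.\<close>
  let ?B = "\<lambda>P. if P = Q then 1 else if P \<in> ?Z then v P ?a else 0"
  obtain c where c: "c \<in> H" "c \<ominus> \<one> \<in> FI Q 1" "\<And>P. P \<in> ?Z \<Longrightarrow> c \<in> FI P (v P ?a)"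
  proof -
    have "\<exists>z\<in>H. \<forall>P. ?B P \<noteq> 0 \<longrightarrow> z \<ominus> (if P = Q then \<one> else \<zero>) \<in> FI P (?B P)"
    proof (rule H_approximation)
      show "?B \<in> Div" by (rule DivI[of "insert Q ?Z"]) (use finZ QP SP in auto)
      show "(if P = Q then \<one> else \<zero>) \<in> FI P 0" if "P \<in> S" for P using v_one[OF SP[OF that]] by (auto simp: FI_def)
    qed (use Q in \<open>auto split: if_splits\<close>)
    then obtain c where c: "c \<in> H" "\<forall>P. ?B P \<noteq> 0 \<longrightarrow> c \<ominus> (if P = Q then \<one> else \<zero>) \<in> FI P (?B P)" by blast
    have "c \<in> FI P (v P ?a)" if "P \<in> ?Z" for P
      using c(2)[rule_format, of P] that H_carrier[OF c(1)] by (auto simp: minus_eq)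
    moreover have "c \<ominus> \<one> \<in> FI Q 1" using c(2)[rule_format, of Q] by simp
    ultimately show thesis using that c(1) by blast
  qed
  have cF: "c \<in> carrier F" using H_carrier[OF c(1)] .
  have zH: "z \<in> H" using z by simp
  have cz: "c \<otimes> z \<in> H" using HS(6)[OF c(1) zH] .
  define h where "h = inv ?a \<otimes> (c \<otimes> z)"
  have h: "h \<in> H"
    unfolding h_def
  proof (rule H_divide[OF a(1,2) cz])
    fix P assume P: "P \<in> S" "0 < v P ?a"
    show "c \<otimes> z \<in> FI P (v P ?a)"
    proof (cases "P = Q")
      case True
      then show ?thesis using FI_mult[OF QP H_FI[OF c(1) Q], of z 2] z va by simp
    next
      case False
      then have "P \<in> ?Z" using P by simp
      from FI_mult[OF SP[OF P(1)] c(3)[OF this] H_FI[OF zH P(1)]] show ?thesis by simp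
    qed
  qed
  have tQH: "t \<in> Q \<inter> H" using tQ Q1 t(1) by auto
  have hF: "h \<in> carrier F" using H_carrier[OF h] .
  have "h \<otimes> t \<in> Q \<inter> H"
  proof -
    have "h \<in> OP Q" using H_FI[OF h Q] FI_0[OF QP] by simp
    then show ?thesis using place_facts(3)[OF QP, of h t] tQH HS(6)[OF h t(1)] by auto
  qed
  from ideal_prod.prod[OF tQH this, of RH] have 1: "t \<otimes> (h \<otimes> t) \<in> (Q \<inter> H) \<cdot>\<^bsub>RH\<^esub> (Q \<inter> H)" by simp
  have "t \<otimes> (h \<otimes> t) = ?a \<otimes> h" using tF hF by (simp add: m_ac)
  also have "\<dots> = c \<otimes> z" unfolding h_def using a cF zF by simp
  finally have 2: "c \<otimes> z \<in> (Q \<inter> H) \<cdot>\<^bsub>RH\<^esub> (Q \<inter> H)" using 1 by simp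
  have "\<one> \<ominus> c \<in> Q \<inter> H"
    using diff_swap[OF FI_addsub[OF QP] cF one_closed c(2)] Q1 addsubD(3)[OF addsub_subring[OF H_subring] HS(3) c(1)] by auto
  from ideal_prod.prod[OF this, of z "Q \<inter> H" RH] have 3: "(\<one> \<ominus> c) \<otimes> z \<in> (Q \<inter> H) \<cdot>\<^bsub>RH\<^esub> (Q \<inter> H)" using zQ zH by simp
  have "c \<otimes> z \<oplus> (\<one> \<ominus> c) \<otimes> z = z" using cF zF by algebra
  then show "z \<in> (Q \<inter> H) \<cdot>\<^bsub>RH\<^esub> (Q \<inter> H)" using ideal_prod.sum[OF 2 3] by simp
qed

text \<open>The zero ideal never qualifies: the constant coefficient lies in \<open>p\<close> but
  outside its square, so it is a nonzero element of \<open>p\<close>. Hence \<open>p\<close> comes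
  from a place of \<open>S\<close>.\<close>

lemma eisenstein_criterion_iff:
  assumes f: "\<And>i. i \<le> d \<Longrightarrow> f i \<in> H" and d: "d > 0"
  shows "(\<exists>p. primeideal p RH \<and> (\<forall>i<d. f i \<in> p) \<and> f 0 \<notin> p \<cdot>\<^bsub>RH\<^esub> p \<and> f d \<notin> p) \<longleftrightarrow> (\<exists>Q\<in>S. eis_at d Q f)"
proof
  assume "\<exists>p. primeideal p RH \<and> (\<forall>i<d. f i \<in> p) \<and> f 0 \<notin> p \<cdot>\<^bsub>RH\<^esub> p \<and> f d \<notin> p"
  then obtain p where p: "primeideal p RH" "\<forall>i<d. f i \<in> p" "f 0 \<notin> p \<cdot>\<^bsub>RH\<^esub> p" "f d \<notin> p" by blast
  interpret p: primeideal p RH by (rule p(1))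
  have "\<zero> \<in> p" using additive_subgroup.zero_closed[OF ideal.axioms(1)[OF p.is_ideal]] by simp
  from ideal_prod.prod[OF this this, of RH] have "\<zero> \<in> p \<cdot>\<^bsub>RH\<^esub> p" by simp
  then have "f 0 \<noteq> \<zero>" using p(3) by metis
  then obtain Q where Q: "Q \<in> S" "p = Q \<inter> H" using nonzero_primeideal[OF p(1)] p(2) d by blast
  have "eis_at d Q f"
    unfolding eis_at_def using p f d Q place_ideal_square[OF Q(1)] FI_1[OF SP[OF Q(1)]] by auto
  then show "\<exists>Q\<in>S. eis_at d Q f" using Q(1) by blast
next
  assume "\<exists>Q\<in>S. eis_at d Q f"
  then obtain Q where Q: "Q \<in> S" "eis_at d Q f" by blast
  show "\<exists>p. primeideal p RH \<and> (\<forall>i<d. f i \<in> p) \<and> f 0 \<notin> p \<cdot>\<^bsub>RH\<^esub> p \<and> f d \<notin> p"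
    using place_primeideal[OF Q(1)] Q(2) f place_ideal_square[OF Q(1)] FI_1[OF SP[OF Q(1)]]
    unfolding eis_at_def by (intro exI[of _ "Q \<inter> H"]) auto
qed

text \<open>The leading entry lies outside \<open>FI Q 1\<close>, so it is nonzero and the
  polynomial with these coefficients has degree exactly d; no separate degree condition on tuples
  remains.\<close>

lemma eisenstein_tuples_iff:
  assumes d: "d > 0"
  shows "eisenstein_tuples RH d = {f \<in> {..<d + 1} \<rightarrow>\<^sub>E H. \<exists>Q\<in>S. eis_at d Q f}"
proof (rule subset_antisym; rule subsetI)
  have eis_restrict: "eis_at d Q (restrict g {..<d + 1}) \<longleftrightarrow> eis_at d Q g" for Q g by (simp add: eis_at_def)
  fix f
  show "f \<in> {f \<in> {..<d + 1} \<rightarrow>\<^sub>E H. \<exists>Q\<in>S. eis_at d Q f}" if "f \<in> eisenstein_tuples RH d"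
  proof -
    obtain g where g: "g \<in> carrier (UP RH)" "deg RH g = d" "eisenstein RH g" "f = restrict (up_ring.coeff (UP RH) g) {..<d + 1}"
      using \<open>f \<in> eisenstein_tuples RH d\<close> by (auto simp: eisenstein_tuples_def)
    have up: "g \<in> up RH" using g(1) by (simp add: UP_def)
    have co: "up_ring.coeff (UP RH) g = g" using up by (simp add: UP_def fun_eq_iff)
    have gH: "g i \<in> H" for i using up by (auto simp: up_def)
    have "\<exists>Q\<in>S. eis_at d Q g"
      using eisenstein_criterion_iff[of d g] gH d g(2,3) unfolding eisenstein_def co by auto
    then show ?thesis using eis_restrict gH unfolding g(4) co by (auto simp: restrict_PiE_iff)
  qed
  show "f \<in> eisenstein_tuples RH d" if "f \<in> {f \<in> {..<d + 1} \<rightarrow>\<^sub>E H. \<exists>Q\<in>S. eis_at d Q f}"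
  proof -
    have fP: "f \<in> {..<d + 1} \<rightarrow>\<^sub>E H" and ex: "\<exists>Q\<in>S. eis_at d Q f" using that by auto
    \<comment> \<open>A tuple is \<open>undefined\<close> beyond index d, whereas a coefficient
      sequence must be zero there.\<close>
    define g where "g = (\<lambda>n. if n \<le> d then f n else \<zero>)"
    have gH: "g i \<in> H" for i using PiE_mem[OF fP, of i] subringE(2)[OF H_subring] by (auto simp: g_def)
    have bd: "bound \<zero> d g" by (rule bound.intro) (simp add: g_def)
    have up: "g \<in> up RH" using gH bd by (auto simp: up_def)
    have co: "up_ring.coeff (UP RH) g = g" using up by (simp add: UP_def fun_eq_iff)
    have eg: "eis_at d Q g \<longleftrightarrow> eis_at d Q f" for Q by (simp add: eis_at_def g_def)
    obtain Q where Q: "Q \<in> S" "eis_at d Q g" using ex eg by blast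
    have gd: "g d \<noteq> \<zero>" using Q(2) by (auto simp: eis_at_def FI_def)
    have deg: "deg RH g = d"
      unfolding deg_def co
    proof (rule Least_equality)
      show "bound \<zero>\<^bsub>RH\<^esub> d g" using bd by simp
      show "d \<le> n" if "bound \<zero>\<^bsub>RH\<^esub> n g" for n
      proof (rule ccontr)
        assume "\<not> d \<le> n"
        then have "g d = \<zero>" using bound.bound[OF that, of d] by simp
        then show False using gd by simp
      qed
    qed
    have "eisenstein RH g"
      using eisenstein_criterion_iff[of d g] gH d Q unfolding eisenstein_def co deg by auto
    moreover have "f = restrict (up_ring.coeff (UP RH) g) {..<d + 1}"
      unfolding co using fP by (auto simp: fun_eq_iff g_def PiE_iff extensional_def)
    moreover have "g \<in> carrier (UP RH)" using up by (simp add: UP_def)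
    ultimately show ?thesis unfolding eisenstein_tuples_def using deg by blast
  qed
qed

end

section \<open>The density\<close>

text \<open>Finite partial products decrease as the index set grows and are bounded below by 0, so
  they converge to their infimum. The two further conclusions are the form of convergence used in
  \<open>density_estimate\<close>.\<close>

lemma infprod_of_decreasing:
  fixes f :: "'b \<Rightarrow> real"
  assumes f: "\<And>a. a \<in> A \<Longrightarrow> 0 \<le> f a \<and> f a \<le> 1"
  shows "\<exists>L. has_infprod f A L \<and> (\<forall>T. finite T \<longrightarrow> T \<subseteq> A \<longrightarrow> L \<le> prod f T) \<and>
    (\<forall>e>0. \<exists>T0. finite T0 \<and> T0 \<subseteq> A \<and> (\<forall>T. finite T \<longrightarrow> T0 \<subseteq> T \<longrightarrow> T \<subseteq> A \<longrightarrow> prod f T < L + e))"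
proof -
  have mono: "prod f T \<le> prod f T0" if T: "finite T" "T0 \<subseteq> T" "T \<subseteq> A" for T T0
  proof -
    have "prod f T = prod f (T - T0) * prod f T0" by (rule prod.subset_diff[OF T(2,1)])
    also have "\<dots> \<le> 1 * prod f T0"
      using f T by (intro mult_right_mono prod_le_1 prod_nonneg) auto
    finally show ?thesis by simp
  qed
  define L where "L = Inf (prod f ` {T. finite T \<and> T \<subseteq> A})"
  have bdd: "bdd_below (prod f ` {T. finite T \<and> T \<subseteq> A})"
    by (rule bdd_belowI[of _ 0]) (use f in \<open>auto intro!: prod_nonneg\<close>)
  have low: "L \<le> prod f T" if "finite T" "T \<subseteq> A" for T
    unfolding L_def by (rule cInf_lower[OF _ bdd]) (use that in auto)
  have up: "\<exists>T0. finite T0 \<and> T0 \<subseteq> A \<and> (\<forall>T. finite T \<longrightarrow> T0 \<subseteq> T \<longrightarrow> T \<subseteq> A \<longrightarrow> prod f T < L + e)" if e: "e > 0" for e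
  proof -
    have "prod f ` {T. finite T \<and> T \<subseteq> A} \<noteq> {}" by blast
    from cInf_lessD[OF this, of "L + e"] e obtain T0 where T0: "finite T0" "T0 \<subseteq> A" "prod f T0 < L + e"
      unfolding L_def by auto
    then show ?thesis using mono by (intro exI[of _ T0]) (auto intro: le_less_trans)
  qed
  have "has_infprod f A L"
    unfolding has_infprod_def
  proof (rule tendstoI)
    fix e :: real assume "e > 0"
    from up[OF this] obtain T0 where T0: "finite T0" "T0 \<subseteq> A" "\<forall>T. finite T \<longrightarrow> T0 \<subseteq> T \<longrightarrow> T \<subseteq> A \<longrightarrow> prod f T < L + e" by blast
    show "\<forall>\<^sub>F T in finite_subsets_at_top A. dist (prod f T) L < e"
      unfolding eventually_finite_subsets_at_top
    proof (intro exI[of _ T0] conjI allI impI T0(1,2))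
      fix T assume T: "finite T \<and> T0 \<subseteq> T \<and> T \<subseteq> A"
      then have "prod f T < L + e" "L \<le> prod f T" using T0(3) low by auto
      then show "dist (prod f T) L < e" by (simp add: dist_real_def)
    qed
  qed
  then show ?thesis using low up by blast
qed

lemma eventually_tails:
  assumes "d0 \<in> A" "\<And>d. d \<in> A \<Longrightarrow> d0 \<le> d \<Longrightarrow> R d"
  shows "eventually R (tails A)"
  unfolding tails_def
  by (rule eventually_INF1[OF assms(1)]) (use assms(2) in \<open>auto simp: eventually_principal\<close>)

text \<open>Directedness makes the tails a filter base of nonempty sets. A proper filter is needed
  to read off Limsup and Liminf from a limit.\<close>

lemma tails_not_bot:
  assumes "A \<noteq> {}" "\<And>a c. a \<in> A \<Longrightarrow> c \<in> A \<Longrightarrow> \<exists>e\<in>A. a \<le> e \<and> c \<le> e"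
  shows "tails A \<noteq> bot"
proof
  assume "tails A = bot"
  then have "eventually (\<lambda>_. False) (tails A)" by simp
  then have "\<exists>a\<in>A. eventually (\<lambda>_. False) (principal {e \<in> A. a \<le> e})"
    unfolding tails_def
  proof (subst (asm) eventually_INF_base)
    show "\<exists>e\<in>A. principal {e' \<in> A. e \<le> e'} \<le> inf (principal {e' \<in> A. a \<le> e'}) (principal {e' \<in> A. c \<le> e'})"
      if "a \<in> A" "c \<in> A" for a c
    proof -
      obtain e where "e \<in> A" "a \<le> e" "c \<le> e" using assms(2)[OF \<open>a \<in> A\<close> \<open>c \<in> A\<close>] by blast
      then show ?thesis by (intro bexI[of _ e]) (auto intro: order_trans)
    qed
  qed (use assms(1) in auto)
  then show False by (auto simp: eventually_principal)
qed

section \<open>The squeeze and the limit along the effective divisors\<close>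

context holomorphy_setting
begin

definition fac :: "nat \<Rightarrow> 'a set \<Rightarrow> real"
  where "fac d Q = 1 - (real q ^ pdeg Q - 1)\<^sup>2 / real q ^ ((d + 2) * pdeg Q)"

lemma fac_bounds: "0 \<le> fac d Q \<and> fac d Q \<le> 1"
proof -
  define t where "t = real q ^ pdeg Q"
  have t: "1 \<le> t" unfolding t_def using q_ge2 by (intro one_le_power) auto
  have "(t - 1)\<^sup>2 \<le> t\<^sup>2" using t by (intro power_mono) auto
  also have "t\<^sup>2 \<le> t ^ (d + 2)" using t by (intro power_increasing) auto
  finally have "(t - 1)\<^sup>2 / t ^ (d + 2) \<le> 1" using t by (simp add: divide_le_eq)
  moreover have "0 \<le> (t - 1)\<^sup>2 / t ^ (d + 2)" using t by simp
  moreover have "t ^ (d + 2) = real q ^ ((d + 2) * pdeg Q)"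
    unfolding t_def power_mult[symmetric] by (simp only: mult.commute)
  ultimately show ?thesis unfolding fac_def t_def by simp
qed

abbreviation Eff :: "('a set \<Rightarrow> int) set"
  where "Eff \<equiv> eff_divisors F K S"

lemma EffD:
  assumes "D \<in> Eff"
  shows "D \<in> Div" "\<And>P. 0 \<le> D P" "\<And>Q. Q \<in> S \<Longrightarrow> D Q = 0"
  using assms by (auto simp: eff_divisors_def)

text \<open>For D large at \<open>P0\<close>, tuples that are Eisenstein at some place of a finite
  set \<open>T\<close> have proportion exactly 1 minus the partial product and give the lower bound.
  The upper bound adds the tuples that are Eisenstein at a place of \<open>S\<close> outside
  \<open>T\<close>, bounded by a tail sum independently of D. Each of the two errors is kept below
  e/2.\<close>

lemma density_estimate:
  assumes d: "d > 1"
    and low: "\<And>T. finite T \<Longrightarrow> T \<subseteq> S \<Longrightarrow> L \<le> prod (fac d) T"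
    and up: "\<And>e. e > 0 \<Longrightarrow> \<exists>T0. finite T0 \<and> T0 \<subseteq> S \<and> (\<forall>T. finite T \<longrightarrow> T0 \<subseteq> T \<longrightarrow> T \<subseteq> S \<longrightarrow> prod (fac d) T < L + e)"
    and e: "e > 0"
  shows "\<exists>D0\<in>Eff. \<forall>D\<in>Eff. D0 \<le> D \<longrightarrow> \<bar>density_quotient F K (d + 1) (eisenstein_tuples RH d) D - (1 - L)\<bar> < e"
proof -
  obtain \<gamma> :: nat where \<gamma>: "\<forall>D Q d. D \<in> Div \<longrightarrow> Q \<in> places F K \<longrightarrow> D Q = 0 \<longrightarrow> d > 0 \<longrightarrow>
    card {f \<in> {..<d + 1} \<rightarrow>\<^sub>E LL D. eis_at d Q f} * q ^ (d * pdeg Q) \<le> q ^ ((d + 1) * ell D + d * \<gamma>)"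
    using eis_at_count_le by blast
  have q0: "0 < real q" using q_ge2 by simp
  \<comment> \<open>The constant lost in \<open>eis_at_count_le\<close>. It depends on neither D nor
    Q, hence the tail can be chosen before D.\<close>
  define c where "c = real q ^ (d * \<gamma>)"
  have c: "c > 0" using q0 by (simp add: c_def)
  obtain T1 where T1: "finite T1" "T1 \<subseteq> places F K - {P0}"
    "\<And>T. finite T \<Longrightarrow> T \<subseteq> places F K - {P0} - T1 \<Longrightarrow> (\<Sum>P\<in>T. 1 / real q ^ (2 * pdeg P)) \<le> e / (2 * c)"
    using tail_weights[OF P0(1), of "e / (2 * c)"] e c by auto
  obtain T0 where T0: "finite T0" "T0 \<subseteq> S" "\<And>T. finite T \<Longrightarrow> T0 \<subseteq> T \<Longrightarrow> T \<subseteq> S \<Longrightarrow> prod (fac d) T < L + e / 2"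
    using up[of "e / 2"] e by auto
  \<comment> \<open>\<open>T0\<close> brings the partial product within e/2 of \<open>L\<close>;
    adding the places of \<open>T1\<close> in \<open>S\<close> ensures that every remaining place of
    \<open>S\<close> lies in the small tail.\<close>
  define T where "T = T0 \<union> (T1 \<inter> S)"
  have T: "finite T" "T \<subseteq> S" "T \<subseteq> places F K" "P0 \<notin> T" using T0 T1 S(2) P0(2) by (auto simp: T_def)
  have pT: "L \<le> prod (fac d) T" "prod (fac d) T < L + e / 2" using low[OF T(1,2)] T0(3)[OF T(1) _ T(2)] by (auto simp: T_def)
  have d0: "d > 0" using d by simp
  obtain n0 :: nat where n0: "\<forall>D\<in>Div. (\<forall>P. (if P = P0 then int n0 else 0) \<le> D P) \<longrightarrow> (\<forall>Q\<in>T. D Q = 0) \<longrightarrow>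
    real (card {f \<in> {..<d + 1} \<rightarrow>\<^sub>E LL D. \<forall>Q\<in>T. \<not> eis_at d Q f}) =
    real q ^ ((d + 1) * ell D) * (\<Prod>Q\<in>T. 1 - (real q ^ pdeg Q - 1)\<^sup>2 / real q ^ ((d + 2) * pdeg Q))"
    using local_density[OF T(1,3) P0(1) T(4) d0] by blast
  let ?D0 = "\<lambda>P. if P = P0 then int n0 else 0"
  have "?D0 \<in> Eff" using Div_single(1)[OF P0(1)] P0(2) by (auto simp: eff_divisors_def)
  moreover have "\<bar>density_quotient F K (d + 1) (eisenstein_tuples RH d) D - (1 - L)\<bar> < e" if D: "D \<in> Eff" "?D0 \<le> D" for D
  proof -
    note DE = EffD[OF D(1)]
    define N where "N = real q ^ ((d + 1) * ell D)"
    have N: "N > 0" using q0 by (simp add: N_def)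
    let ?U = "{..<d + 1} \<rightarrow>\<^sub>E LL D"
    let ?G = "{f \<in> ?U. \<forall>Q\<in>T. \<not> eis_at d Q f}"
    let ?E = "{f \<in> ?U. \<exists>Q\<in>S. eis_at d Q f}"
    have finU: "finite ?U" using LL_finite[OF DE(1)] by (intro finite_PiE) auto
    have "card ?U = card (LL D) ^ (d + 1)" by (simp add: card_PiE)
    then have cardU: "real (card ?U) = N"
      unfolding N_def card_LL[OF DE(1)] by (simp only: of_nat_power power_mult[symmetric] mult.commute)
    have cardG: "real (card ?G) = N * prod (fac d) T"
    proof -
      have "\<forall>P. (if P = P0 then int n0 else 0) \<le> D P" using D(2) by (simp add: le_fun_def)
      moreover have "\<forall>Q\<in>T. D Q = 0" using DE(3) T(2) by auto
      ultimately show ?thesis using n0 DE(1) unfolding fac_def N_def by blast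
    qed
    have EU: "eisenstein_tuples RH d \<inter> ?U = ?E"
    proof -
      have "?U \<subseteq> {..<d + 1} \<rightarrow>\<^sub>E H" by (rule PiE_mono) (rule LL_H[OF DE(3)])
      then show ?thesis unfolding eisenstein_tuples_iff[OF d0] by blast
    qed
    have dq: "density_quotient F K (d + 1) (eisenstein_tuples RH d) D = real (card ?E) / N"
      unfolding density_quotient_def EU N_def by simp
    have "card (?U - ?G) = card ?U - card ?G" by (rule card_Diff_subset) (use finU in auto)
    moreover have "card ?G \<le> card ?U" by (rule card_mono[OF finU]) auto
    ultimately have UG: "real (card (?U - ?G)) = N * (1 - prod (fac d) T)"
      using cardU cardG by (simp add: of_nat_diff right_diff_distrib)
    have "card (?U - ?G) \<le> card ?E" by (rule card_mono) (use finU T(2) in auto)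
    then have lo: "N * (1 - prod (fac d) T) \<le> real (card ?E)" unfolding UG[symmetric] by simp
    \<comment> \<open>\<open>S\<close> may be infinite, but only finitely many tuples occur. One
      chosen place per tuple gives a finite set \<open>V\<close>, so the union bound is a finite
      sum.\<close>
    define ch where "ch f = (SOME Q. Q \<in> S \<and> eis_at d Q f)" for f
    have ch: "ch f \<in> S" "eis_at d (ch f) f" if "f \<in> ?E" for f
    proof -
      have "\<exists>Q. Q \<in> S \<and> eis_at d Q f" using that by blast
      from someI_ex[OF this] show "ch f \<in> S" "eis_at d (ch f) f" unfolding ch_def by blast+
    qed
    define V where "V = ch ` ?E - T"
    have finV: "finite V" unfolding V_def using finU by simp
    have VS: "V \<subseteq> S" unfolding V_def using ch(1) by blast
    have Vt: "V \<subseteq> places F K - {P0} - T1" using VS S(2) P0(2) unfolding V_def T_def by blast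
    have "?E \<subseteq> (?U - ?G) \<union> (\<Union>Q\<in>V. {f \<in> ?U. eis_at d Q f})"
    proof
      fix f assume f: "f \<in> ?E"
      show "f \<in> (?U - ?G) \<union> (\<Union>Q\<in>V. {f \<in> ?U. eis_at d Q f})"
      proof (cases "ch f \<in> T")
        case True
        then show ?thesis using f ch(2)[OF f] by blast
      next
        case False
        then have "ch f \<in> V" using f by (auto simp: V_def)
        then show ?thesis using f ch(2)[OF f] by blast
      qed
    qed
    then have "card ?E \<le> card ((?U - ?G) \<union> (\<Union>Q\<in>V. {f \<in> ?U. eis_at d Q f}))"
      by (rule card_mono[rotated]) (use finU finV in auto)
    also have "\<dots> \<le> card (?U - ?G) + card (\<Union>Q\<in>V. {f \<in> ?U. eis_at d Q f})" by (rule card_Un_le)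
    also have "\<dots> \<le> card (?U - ?G) + (\<Sum>Q\<in>V. card {f \<in> ?U. eis_at d Q f})"
      by (intro add_left_mono card_UN_le finV)
    finally have "real (card ?E) \<le> real (card (?U - ?G) + (\<Sum>Q\<in>V. card {f \<in> ?U. eis_at d Q f}))" by (simp only: of_nat_le_iff)
    then have hi: "real (card ?E) \<le> N * (1 - prod (fac d) T) + (\<Sum>Q\<in>V. real (card {f \<in> ?U. eis_at d Q f}))"
      by (simp only: of_nat_add of_nat_sum UG)
    have each: "real (card {f \<in> ?U. eis_at d Q f}) \<le> N * c * (1 / real q ^ (2 * pdeg Q))" if Q: "Q \<in> V" for Q
    proof -
      have QS: "Q \<in> places F K" "D Q = 0" using Q VS SP DE(3) by auto
      have "card {f \<in> ?U. eis_at d Q f} * q ^ (d * pdeg Q) \<le> q ^ ((d + 1) * ell D + d * \<gamma>)"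
        using \<gamma> DE(1) QS d0 by blast
      then have "real (card {f \<in> ?U. eis_at d Q f} * q ^ (d * pdeg Q)) \<le> real (q ^ ((d + 1) * ell D + d * \<gamma>))"
        by (simp only: of_nat_le_iff)
      then have "real (card {f \<in> ?U. eis_at d Q f}) * real q ^ (d * pdeg Q) \<le> N * c"
        by (simp only: of_nat_mult of_nat_power power_add N_def c_def)
      \<comment> \<open>Here d > 1 enters: the saving q^(d deg Q) is at least the weight q^(2 deg Q)
        of the summable tail.\<close>
      moreover have "real q ^ (2 * pdeg Q) \<le> real q ^ (d * pdeg Q)"
        using q_ge2 d by (intro power_increasing mult_right_mono) auto
      then have "real (card {f \<in> ?U. eis_at d Q f}) * real q ^ (2 * pdeg Q) \<le> real (card {f \<in> ?U. eis_at d Q f}) * real q ^ (d * pdeg Q)"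
        by (rule mult_left_mono) simp
      ultimately have "real (card {f \<in> ?U. eis_at d Q f}) * real q ^ (2 * pdeg Q) \<le> N * c" by linarith
      then show ?thesis using q0 by (simp add: le_divide_eq)
    qed
    have "(\<Sum>Q\<in>V. real (card {f \<in> ?U. eis_at d Q f})) \<le> (\<Sum>Q\<in>V. N * c * (1 / real q ^ (2 * pdeg Q)))"
      by (rule sum_mono[OF each])
    also have "\<dots> = N * c * (\<Sum>Q\<in>V. 1 / real q ^ (2 * pdeg Q))" by (rule sum_distrib_left[symmetric])
    also have "\<dots> \<le> N * c * (e / (2 * c))" using T1(3)[OF finV Vt] N c by (intro mult_left_mono) auto
    also have "\<dots> = N * (e / 2)" using c by simp
    finally have "real (card ?E) \<le> N * (1 - prod (fac d) T) + N * (e / 2)" using hi by linarith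
    then have hi': "real (card ?E) \<le> N * (1 - prod (fac d) T + e / 2)" by (simp only: distrib_left)
    have "1 - prod (fac d) T \<le> real (card ?E) / N" using lo N by (simp add: le_divide_eq mult.commute)
    moreover have "real (card ?E) / N \<le> 1 - prod (fac d) T + e / 2" using hi' N by (simp add: divide_le_eq mult.commute)
    ultimately show ?thesis unfolding dq using pT e by linarith
  qed
  ultimately show ?thesis by blast
qed

lemma density_eisenstein:
  assumes d: "d > 1"
  shows "\<exists>L. has_infprod (fac d) S L \<and> has_density F K S (d + 1) (eisenstein_tuples RH d) (1 - L)"
proof -
  obtain L where L: "has_infprod (fac d) S L" "\<And>T. finite T \<Longrightarrow> T \<subseteq> S \<Longrightarrow> L \<le> prod (fac d) T"
    "\<And>e. e > 0 \<Longrightarrow> \<exists>T0. finite T0 \<and> T0 \<subseteq> S \<and> (\<forall>T. finite T \<longrightarrow> T0 \<subseteq> T \<longrightarrow> T \<subseteq> S \<longrightarrow> prod (fac d) T < L + e)"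
    using infprod_of_decreasing[of S "fac d"] fac_bounds by blast
  let ?f = "density_quotient F K (d + 1) (eisenstein_tuples RH d)"
  have "(?f \<longlongrightarrow> 1 - L) (tails Eff)"
  proof (rule tendstoI)
    fix e :: real assume "e > 0"
    from density_estimate[OF d L(2,3) this] obtain D0 where D0: "D0 \<in> Eff"
      "\<forall>D\<in>Eff. D0 \<le> D \<longrightarrow> \<bar>?f D - (1 - L)\<bar> < e" by blast
    show "\<forall>\<^sub>F D in tails Eff. dist (?f D) (1 - L) < e"
      by (rule eventually_tails[OF D0(1)]) (use D0(2) in \<open>simp add: dist_real_def\<close>)
  qed
  then have lim: "((\<lambda>D. ereal (?f D)) \<longlongrightarrow> ereal (1 - L)) (tails Eff)" by (rule tendsto_ereal)
  have nb: "tails Eff \<noteq> bot"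
  proof (rule tails_not_bot)
    have "(\<lambda>P. 0) \<in> Eff" using Div_zero(1) by (simp add: eff_divisors_def)
    then show "Eff \<noteq> {}" by blast
    fix D E assume DE: "D \<in> Eff" "E \<in> Eff"
    note D = EffD[OF DE(1)] and E = EffD[OF DE(2)]
    have "(\<lambda>P. D P + E P) \<in> Eff"
      using Div_add(1)[OF D(1) E(1)] D(2,3) E(2,3) by (auto simp: eff_divisors_def)
    then show "\<exists>G\<in>Eff. D \<le> G \<and> E \<le> G" using D(2) E(2) by (intro bexI[of _ "\<lambda>P. D P + E P"]) (auto simp: le_fun_def)
  qed
  have "has_density F K S (d + 1) (eisenstein_tuples RH d) (1 - L)"
    unfolding has_density_def upper_density_def lower_density_def
    using lim_imp_Limsup[OF nb lim] lim_imp_Liminf[OF nb lim] by simp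
  then show ?thesis using L(1) by blast
qed

end

theorem theorem3p2:
  fixes F :: "('a, 'm) ring_scheme" and K :: "'a set" and S :: "'a set set" and q d :: nat
  assumes "primepow q"
    and "function_field F K" and "full_constant_field F K" and "card K = q"
    and "S \<noteq> {}" and "S \<subset> places F K"
    and "d > 1"
  shows "\<exists>L. has_infprod
            (\<lambda>Q. 1 - (real q ^ place_degree F K Q - 1)\<^sup>2 / real q ^ ((d + 2) * place_degree F K Q))
            S L \<and>
          has_density F K S (d + 1)
            (eisenstein_tuples (F\<lparr>carrier := holomorphy_ring F K S\<rparr>) d) (1 - L)"
proof -
  have F: "field F" and K: "subfield K F" using assms(2) by (auto simp: function_field_def)
  interpret field F by (rule F)
  \<comment> \<open>An infinite set has \<open>card\<close> zero, which is not a prime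
    power.\<close>
  have finK: "finite K" using assms(1,4) primepow_gt_0_nat[of q] by (metis card.infinite less_irrefl)
  obtain x where x: "x \<in> carrier F" "transcendental K x"
    "finite_dimension (generate_field F (insert x K)) (carrier F)"
    using assms(2) by (auto simp: function_field_def)
  have alg: "z \<in> K" if "z \<in> carrier F" "algebraic K z" for z
    using assms(3) that by (simp add: full_constant_field_def over_def)
  obtain W where W: "function_field_basis F K x W" using function_field_basis_exists[OF K finK alg x] by blast
  \<comment> \<open>\<open>S\<close> being a proper subset supplies the place at which poles are
    allowed.\<close>
  obtain P0 where P0: "P0 \<in> places F K" "P0 \<notin> S" using assms(6) by blast
  interpret holomorphy_setting F K x W S P0
    by (intro holomorphy_setting.intro W holomorphy_setting_axioms.intro) (use assms(5,6) P0 in auto)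
  show ?thesis using density_eisenstein[OF assms(7)] assms(4) unfolding fac_def H_def by simp
qed

end
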